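(* For every $\mathbb{S}^{1}$-torsor $\rho:(P,\sigma)\rightarrow(C,\tau)$ over a real algebraic variety $(C,\tau)$ there exists a pair $(\mathcal{L},h)$ consisting of an invertible $\mathcal{O}_{C}$-submodule $\mathcal{L}\subset\mathcal{K}_{C}$ and a nonzero real rational function $h$ on $(C,\tau)$ such that $\rho_{*}\mathcal{O}_{P}=\bigoplus_{m\in\mathbb{Z}}\mathcal{L}^{\otimes m}$ and $\mathcal{L}\otimes\tau^{*}\mathcal{L}=h^{-1}\mathcal{O}_{C}$ as $\mathcal{O}_{C}$-submodules of $\mathcal{K}_{C}$. Furthermore, two such pairs $(\mathcal{L}_{1},h_{1})$ and $(\mathcal{L}_{2},h_{2})$ determine isomorphic $\mathbb{S}^{1}$-torsors if and only if there exists a rational function $f\in\Gamma(C,\mathcal{K}_{C}^{*})$ such that $\mathcal{L}_{1}^{\vee}\otimes\mathcal{L}_{2}=f^{-1}\mathcal{O}_{C}$ and $h_{2}=(f\,\tau^{*}f)\,h_{1}$.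
   Context: A real algebraic variety is viewed as a pair $(V,\sigma)$, with $V$ a (quasi-projective, integral) complex variety and $\sigma$ a real structure, i.e. an involution of $V$ as an $\mathbb{R}$-scheme lifting complex conjugation. Real morphisms commute with the real structures; a real rational function on $(C,\tau)$ is a rational function $h$ with $\tau^*h=h$. $\mathcal{K}_C$ is the sheaf of rational functions of $C$. Tensor products, duals and pull-backs $\tau^*\mathcal{L}$ of invertible submodules of $\mathcal{K}_C$ are viewed as submodules of $\mathcal{K}_C$ (via products and via $\tau^*$ on rational functions); for $m<0$, $\mathcal{L}^{\otimes m}=(\mathcal{L}^\vee)^{\otimes(-m)}$. The circle $\mathbb{S}^1$ is the real algebraic group $(\mathbb{G}_{m,\mathbb{C}},\sigma_0)$, with $\mathbb{G}_{m,\mathbb{C}}=\mathrm{Spec}(\mathbb{C}[t^{\pm1}])$ and $\sigma_0$ the composition of $t\mapsto t^{-1}$ with complex conjugation. An $\mathbb{S}^1$-action on $(V,\sigma)$ is an action $\mu:\mathbb{G}_{m,\mathbb{C}}\times V\to V$ with $\sigma\circ\mu=\mu\circ(\sigma_0\times\sigma)$. An $\mathbb{S}^1$-torsor over $(C,\tau)$ is a real variety $\rho:(P,\sigma)\to(C,\tau)$ with an $\mathbb{S}^1$-action for which $\rho:P\to C$ is a $\mathbb{G}_{m,\mathbb{C}}$-torsor, i.e. $\mathbb{G}_{m,\mathbb{C}}$ acts by $C$-automorphisms and $P$ is Zariski locally over $C$ equivariantly isomorphic to $C\times\mathbb{G}_{m,\mathbb{C}}$ with action by translations on the second factor. Isomorphisms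 of $\mathbb{S}^1$-torsors are $\mathbb{S}^1$-equivariant real isomorphisms over $(C,\tau)$. The algebra $\rho_*\mathcal{O}_P$ is $\mathbb{Z}$-graded by the weights of semi-invariants, and the equality $\rho_{*}\mathcal{O}_{P}=\bigoplus_{m\in\mathbb{Z}}\mathcal{L}^{\otimes m}$ is understood as an identification of $\mathbb{Z}$-graded $\mathcal{O}_C$-algebras. The $\mathbb{S}^1$-torsor determined by a pair $(\mathcal{L},h)$ with $\tau^*h=h$ and $\mathcal{L}\otimes\tau^*\mathcal{L}=h^{-1}\mathcal{O}_C$ is $P=\mathrm{Spec}_C(\bigoplus_{m\in\mathbb{Z}}\mathcal{L}^{\otimes m})$, with $\mathbb{G}_{m,\mathbb{C}}$-action given by the grading (degree $m$ sections have weight $m$) and real structure $\sigma$ lifting $\tau$ which sends a section $g$ of degree $m$ to the section $\sigma^*(g)=h^m\tau^*g$ of degree $-m$. *)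

theory Defs
  imports
    "HOL-Analysis.Analysis"
    "HOL-Computational_Algebra.Polynomial"
    "HOL-Algebra.QuotRing"
    "HOL-Algebra.Generated_Groups"
begin

text \<open>
  Varieties are taken in the classical sense: a reduced complex variety is the set of its closed
  points with the Zariski topology and the sheaf of complex-valued regular functions. A regular
  function on an open set \<open>U\<close> is a function that is \<open>undefined\<close> outside \<open>U\<close>, so
  that equality of regular functions is equality of HOL functions. Maps between varieties are only
  considered on closed points of the source.
\<close>

record 'a fspace =
  zariski :: "'a topology"
  reg :: "'a set \<Rightarrow> ('a \<Rightarrow> complex) set"

abbreviation points :: "('a, 'm) fspace_scheme \<Rightarrow> 'a set" where
  "points X \<equiv> topspace (zariski X)"

definition nopen :: "('a, 'm) fspace_scheme \<Rightarrow> 'a set \<Rightarrow> bool" where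
  "nopen X U \<longleftrightarrow> openin (zariski X) U \<and> U \<noteq> {}"

definition preim :: "('a, 'm) fspace_scheme \<Rightarrow> ('a \<Rightarrow> 'b) \<Rightarrow> 'b set \<Rightarrow> 'a set" where
  "preim X \<phi> V = {x \<in> points X. \<phi> x \<in> V}"

definition fmorphism ::
  "('a, 'm) fspace_scheme \<Rightarrow> ('b, 'n) fspace_scheme \<Rightarrow> ('a \<Rightarrow> 'b) \<Rightarrow> bool" where
  "fmorphism X Y \<phi> \<longleftrightarrow>
     continuous_map (zariski X) (zariski Y) \<phi> \<and>
     (\<forall>V f. openin (zariski Y) V \<and> f \<in> reg Y V \<longrightarrow>
        (\<lambda>x\<in>preim X \<phi> V. f (\<phi> x)) \<in> reg X (preim X \<phi> V))"

definition fiso ::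
  "('a, 'm) fspace_scheme \<Rightarrow> ('b, 'n) fspace_scheme \<Rightarrow> ('a \<Rightarrow> 'b) \<Rightarrow> bool" where
  "fiso X Y \<phi> \<longleftrightarrow>
     bij_betw \<phi> (points X) (points Y) \<and> fmorphism X Y \<phi> \<and>
     fmorphism Y X (inv_into (points X) \<phi>)"

text \<open>The space whose topology is generated by the domains of a family \<open>Q\<close> of functions
  (given as pairs of a domain and a function) and whose regular functions are those that locally
  agree with a member of \<open>Q\<close>.\<close>

definition generated_space :: "('a set \<times> ('a \<Rightarrow> complex)) set \<Rightarrow> 'a fspace" where
  "generated_space Q =
     (let T = topology_generated_by (fst ` Q)
      in \<lparr>zariski = T,
          reg = (\<lambda>U. {f \<in> extensional U. \<forall>x\<in>U. \<exists>(D, g)\<in>Q. \<exists>W.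
                   openin T W \<and> x \<in> W \<and> W \<subseteq> U \<inter> D \<and> (\<forall>y\<in>W. f y = g y)})\<rparr>)"

text \<open>For a locally closed \<open>S\<close> this is the reduced induced structure; for an open \<open>S\<close> it is
  the open subvariety.\<close>

definition subvariety :: "('a, 'm) fspace_scheme \<Rightarrow> 'a set \<Rightarrow> 'a fspace" where
  "subvariety X S =
     \<lparr>zariski = subtopology (zariski X) S,
      reg = (\<lambda>U. {f \<in> extensional U. \<forall>x\<in>U. \<exists>V g.
               openin (zariski X) V \<and> g \<in> reg X V \<and> x \<in> V \<and>
               (\<forall>y\<in>V \<inter> S. y \<in> U \<and> f y = g y)})\<rparr>"

text \<open>The product of varieties. Its topology is finer than the product topology.\<close>

definition prod_space ::
  "('a, 'm) fspace_scheme \<Rightarrow> ('b, 'n) fspace_scheme \<Rightarrow> ('a \<times> 'b) fspace" where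
  "prod_space X Y =
     (let bilin = (\<lambda>U V. {F. \<exists>(k::nat) f g. (\<forall>i<k. f i \<in> reg X U \<and> g i \<in> reg Y V) \<and>
                              F = (\<lambda>(x, y). \<Sum>i<k. f i x * g i y)})
      in generated_space
           {({p \<in> U \<times> V. G p \<noteq> 0}, \<lambda>p. F p / G p) | U V F G.
              openin (zariski X) U \<and> openin (zariski Y) V \<and> F \<in> bilin U V \<and> G \<in> bilin U V})"

text \<open>The variables are \<open>x 0, \<dots>, x n\<close>; polynomials are identified with polynomial functions.\<close>

definition hom_poly :: "nat \<Rightarrow> nat \<Rightarrow> ((nat \<Rightarrow> complex) \<Rightarrow> complex) \<Rightarrow> bool" where
  "hom_poly n d p \<longleftrightarrow>
     (\<exists>(A :: (nat \<Rightarrow> nat) set) c. finite A \<and> (\<forall>\<alpha>\<in>A. (\<Sum>i\<le>n. \<alpha> i) = d) \<and>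
        p = (\<lambda>x. \<Sum>\<alpha>\<in>A. c \<alpha> * (\<Prod>i\<le>n. x i ^ \<alpha> i)))"

definition hvectors :: "nat \<Rightarrow> (nat \<Rightarrow> complex) set" where
  "hvectors n = {x. (\<forall>i>n. x i = 0) \<and> (\<exists>i. x i \<noteq> 0)}"

definition line :: "(nat \<Rightarrow> complex) \<Rightarrow> (nat \<Rightarrow> complex) set" where
  "line x = {(\<lambda>i. c * x i) | c. c \<noteq> 0}"

text \<open>The value \<open>a / b\<close> at a point does not depend on the representative chosen by
  \<open>SOME\<close>, as \<open>a\<close> and \<open>b\<close> are homogeneous of the same degree.\<close>

definition projective_space :: "nat \<Rightarrow> (nat \<Rightarrow> complex) set fspace" where
  "projective_space n = generated_space
     {(line ` {x \<in> hvectors n. b x \<noteq> 0}, \<lambda>q. let x = (SOME x. x \<in> q) in a x / b x) | a b d.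
        hom_poly n d a \<and> hom_poly n d b}"

definition irreducible_space :: "'a topology \<Rightarrow> bool" where
  "irreducible_space T \<longleftrightarrow>
     topspace T \<noteq> {} \<and>
     (\<forall>U V. openin T U \<and> openin T V \<and> U \<noteq> {} \<and> V \<noteq> {} \<longrightarrow> U \<inter> V \<noteq> {})"

definition variety :: "('a, 'm) fspace_scheme \<Rightarrow> bool" where
  "variety X \<longleftrightarrow>
     irreducible_space (zariski X) \<and>
     (\<forall>U. openin (zariski X) U \<longrightarrow> reg X U \<subseteq> extensional U) \<and>
     (\<exists>n A B \<phi>. openin (zariski (projective_space n)) A \<and>
        closedin (zariski (projective_space n)) B \<and>
        fiso X (subvariety (projective_space n) (A \<inter> B)) \<phi>)"

record 'a real_space = "'a fspace" +
  rconj :: "'a \<Rightarrow> 'a"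

text \<open>An involution lifting complex conjugation acts on regular functions by
  \<open>f \<mapsto> cnj \<circ> f \<circ> \<sigma>\<close>: on residue fields at closed points it induces complex conjugation.\<close>

definition real_variety :: "('a, 'm) real_space_scheme \<Rightarrow> bool" where
  "real_variety X \<longleftrightarrow>
     variety X \<and>
     continuous_map (zariski X) (zariski X) (rconj X) \<and>
     (\<forall>x\<in>points X. rconj X (rconj X x) = x) \<and>
     (\<forall>U f. openin (zariski X) U \<and> f \<in> reg X U \<longrightarrow>
        (\<lambda>x\<in>preim X (rconj X) U. cnj (f (rconj X x))) \<in> reg X (preim X (rconj X) U))"

definition real_morphism ::
  "('a, 'm) real_space_scheme \<Rightarrow> ('b, 'n) real_space_scheme \<Rightarrow> ('a \<Rightarrow> 'b) \<Rightarrow> bool" where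
  "real_morphism X Y \<phi> \<longleftrightarrow>
     fmorphism X Y \<phi> \<and> (\<forall>x\<in>points X. \<phi> (rconj X x) = rconj Y (\<phi> x))"

text \<open>The closed points of \<open>Spec \<complex>[t, 1/t]\<close>; a fraction of Laurent polynomials is a fraction of
  polynomials.\<close>

definition Gm :: "complex fspace" where
  "Gm = generated_space {({z. z \<noteq> 0 \<and> poly q z \<noteq> 0}, \<lambda>z. poly p z / poly q z) | p q. True}"

definition circle :: "complex real_space" where
  "circle = \<lparr>zariski = zariski Gm, reg = reg Gm, rconj = (\<lambda>z. 1 / cnj z)\<rparr>"

record ('b, 'a) torsor = "'b real_space" +
  base :: "'b \<Rightarrow> 'a"
  act :: "complex \<Rightarrow> 'b \<Rightarrow> 'b"

definition S1_torsor :: "('a, 'm) real_space_scheme \<Rightarrow> ('b, 'a, 'n) torsor_scheme \<Rightarrow> bool" where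
  "S1_torsor C P \<longleftrightarrow>
     real_variety P \<and> real_morphism P C (base P) \<and>
     fmorphism (prod_space circle P) P (\<lambda>(z, p). act P z p) \<and>
     (\<forall>p\<in>points P. act P 1 p = p) \<and>
     (\<forall>z\<in>points circle. \<forall>w\<in>points circle. \<forall>p\<in>points P. act P (z * w) p = act P z (act P w p)) \<and>
     (\<forall>z\<in>points circle. \<forall>p\<in>points P. rconj P (act P z p) = act P (rconj circle z) (rconj P p)) \<and>
     (\<forall>z\<in>points circle. \<forall>p\<in>points P. base P (act P z p) = base P p) \<and>
     (\<forall>c\<in>points C. \<exists>U \<phi>. openin (zariski C) U \<and> c \<in> U \<and>
        fiso (subvariety P (preim P (base P) U)) (prod_space (subvariety C U) Gm) \<phi> \<and>
        (\<forall>p\<in>preim P (base P) U. fst (\<phi> p) = base P p \<and>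
           (\<forall>z\<in>points Gm. \<phi> (act P z p) = (base P p, z * snd (\<phi> p)))))"

definition torsor_isomorphic ::
  "('b, 'a, 'n) torsor_scheme \<Rightarrow> ('c, 'a, 'k) torsor_scheme \<Rightarrow> bool" where
  "torsor_isomorphic P Q \<longleftrightarrow>
     (\<exists>\<phi>. fiso P Q \<phi> \<and> real_morphism P Q \<phi> \<and>
        (\<forall>p\<in>points P. base Q (\<phi> p) = base P p) \<and>
        (\<forall>z\<in>points circle. \<forall>p\<in>points P. \<phi> (act P z p) = act Q z (\<phi> p)))"

text \<open>A rational function is the class of all pairs of a nonempty open set and a regular function
  on it representing it.\<close>

type_synonym 'a ratfun = "('a set \<times> ('a \<Rightarrow> complex)) set"

definition germ :: "('a, 'm) fspace_scheme \<Rightarrow> 'a set \<Rightarrow> ('a \<Rightarrow> complex) \<Rightarrow> 'a ratfun" where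
  "germ C U f = {(V, g). nopen C V \<and> g \<in> reg C V \<and> (\<forall>x\<in>U \<inter> V. f x = g x)}"

definition const_rat :: "('a, 'm) fspace_scheme \<Rightarrow> complex \<Rightarrow> 'a ratfun" where
  "const_rat C z = germ C (points C) (\<lambda>x\<in>points C. z)"

definition ratfuns :: "('a, 'm) fspace_scheme \<Rightarrow> 'a ratfun ring" where
  "ratfuns C =
     \<lparr>carrier = {germ C U f | U f. nopen C U \<and> f \<in> reg C U},
      mult = (\<lambda>k l. \<Union>(U, f)\<in>k. \<Union>(V, g)\<in>l. germ C (U \<inter> V) (\<lambda>x\<in>U \<inter> V. f x * g x)),
      one = const_rat C 1,
      zero = const_rat C 0,
      add = (\<lambda>k l. \<Union>(U, f)\<in>k. \<Union>(V, g)\<in>l. germ C (U \<inter> V) (\<lambda>x\<in>U \<inter> V. f x + g x))\<rparr>"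

definition rat_conj :: "('a, 'm) real_space_scheme \<Rightarrow> 'a ratfun \<Rightarrow> 'a ratfun" where
  "rat_conj C k =
     (\<Union>(U, f)\<in>k. germ C (preim C (rconj C) U) (\<lambda>x\<in>preim C (rconj C) U. cnj (f (rconj C x))))"

text \<open>On an irreducible space the sheaf of rational functions is constant, so a submodule is given
  by its sections over the nonempty open sets, as subsets of the function field. Values at other
  sets carry no information.\<close>

type_synonym 'a submod = "'a set \<Rightarrow> 'a ratfun set"

definition structure_sheaf :: "('a, 'm) fspace_scheme \<Rightarrow> 'a submod" where
  "structure_sheaf C U = germ C U ` reg C U"

definition principal_submod :: "('a, 'm) fspace_scheme \<Rightarrow> 'a ratfun \<Rightarrow> 'a submod" where
  "principal_submod C k U = (\<lambda>s. k \<otimes>\<^bsub>ratfuns C\<^esub> s) ` structure_sheaf C U"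

definition submod_eq :: "('a, 'm) fspace_scheme \<Rightarrow> 'a submod \<Rightarrow> 'a submod \<Rightarrow> bool" where
  "submod_eq C L M \<longleftrightarrow> (\<forall>U. nopen C U \<longrightarrow> L U = M U)"

definition is_submod :: "('a, 'm) fspace_scheme \<Rightarrow> 'a submod \<Rightarrow> bool" where
  "is_submod C L \<longleftrightarrow>
     (\<forall>U. nopen C U \<longrightarrow> subgroup (L U) (add_monoid (ratfuns C)) \<and>
        (\<forall>s\<in>structure_sheaf C U. \<forall>g\<in>L U. s \<otimes>\<^bsub>ratfuns C\<^esub> g \<in> L U)) \<and>
     (\<forall>U V. nopen C U \<and> nopen C V \<and> V \<subseteq> U \<longrightarrow> L U \<subseteq> L V) \<and>
     (\<forall>\<U> k. \<U> \<noteq> {} \<and> (\<forall>U\<in>\<U>. nopen C U \<and> k \<in> L U) \<longrightarrow> k \<in> L (\<Union>\<U>))"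

text \<open>A local isomorphism from the structure sheaf is multiplication by the image of 1.\<close>

definition invertible_submod :: "('a, 'm) fspace_scheme \<Rightarrow> 'a submod \<Rightarrow> bool" where
  "invertible_submod C L \<longleftrightarrow>
     is_submod C L \<and>
     (\<forall>c\<in>points C. \<exists>U g. openin (zariski C) U \<and> c \<in> U \<and>
        g \<in> carrier (ratfuns C) - {\<zero>\<^bsub>ratfuns C\<^esub>} \<and>
        (\<forall>V. nopen C V \<and> V \<subseteq> U \<longrightarrow> L V = principal_submod C g V))"

text \<open>Locally, sections of the tensor product are finite sums of products of sections.\<close>

definition tensor_submod :: "('a, 'm) fspace_scheme \<Rightarrow> 'a submod \<Rightarrow> 'a submod \<Rightarrow> 'a submod" where
  "tensor_submod C L M U =
     {k \<in> carrier (ratfuns C). \<forall>c\<in>U. \<exists>V. openin (zariski C) V \<and> c \<in> V \<and> V \<subseteq> U \<and>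
        k \<in> generate (add_monoid (ratfuns C)) {x \<otimes>\<^bsub>ratfuns C\<^esub> y | x y. x \<in> L V \<and> y \<in> M V}}"

text \<open>A homomorphism to the structure sheaf is multiplication by a rational function.\<close>

definition dual_submod :: "('a, 'm) fspace_scheme \<Rightarrow> 'a submod \<Rightarrow> 'a submod" where
  "dual_submod C L U =
     {k \<in> carrier (ratfuns C). \<forall>V. nopen C V \<and> V \<subseteq> U \<longrightarrow>
        (\<forall>g\<in>L V. k \<otimes>\<^bsub>ratfuns C\<^esub> g \<in> structure_sheaf C V)}"

definition tensor_pow :: "('a, 'm) fspace_scheme \<Rightarrow> 'a submod \<Rightarrow> int \<Rightarrow> 'a submod" where
  "tensor_pow C L m =
     (if m \<ge> 0 then (tensor_submod C L ^^ nat m) (structure_sheaf C)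
      else (tensor_submod C (dual_submod C L) ^^ nat (- m)) (structure_sheaf C))"

definition pullback_conj :: "('a, 'm) real_space_scheme \<Rightarrow> 'a submod \<Rightarrow> 'a submod" where
  "pullback_conj C L U = rat_conj C ` L (rconj C ` U)"

definition torsor_pair :: "('a, 'm) real_space_scheme \<Rightarrow> 'a submod \<Rightarrow> 'a ratfun \<Rightarrow> bool" where
  "torsor_pair C L h \<longleftrightarrow>
     invertible_submod C L \<and>
     h \<in> carrier (ratfuns C) - {\<zero>\<^bsub>ratfuns C\<^esub>} \<and> rat_conj C h = h \<and>
     submod_eq C (tensor_submod C L (pullback_conj C L)) (principal_submod C (inv\<^bsub>ratfuns C\<^esub> h))"

definition homog :: "('a, 'm) fspace_scheme \<Rightarrow> int \<Rightarrow> 'a ratfun \<Rightarrow> int \<Rightarrow> 'a ratfun" where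
  "homog C m k = (\<lambda>i. if i = m then k else \<zero>\<^bsub>ratfuns C\<^esub>)"

text \<open>Finitely supported families with \<open>m\<close>-th entry in \<open>A m\<close>, multiplied as Laurent
  polynomials over the function field.\<close>

definition graded_ring ::
  "('a, 'm) fspace_scheme \<Rightarrow> (int \<Rightarrow> 'a ratfun set) \<Rightarrow> (int \<Rightarrow> 'a ratfun) ring" where
  "graded_ring C A =
     \<lparr>carrier = {a. finite {m. a m \<noteq> \<zero>\<^bsub>ratfuns C\<^esub>} \<and> (\<forall>m. a m \<in> A m)},
      mult = (\<lambda>a b m. \<Oplus>\<^bsub>ratfuns C\<^esub>i\<in>{i. a i \<noteq> \<zero>\<^bsub>ratfuns C\<^esub>}. a i \<otimes>\<^bsub>ratfuns C\<^esub> b (m - i)),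
      one = homog C 0 \<one>\<^bsub>ratfuns C\<^esub>,
      zero = (\<lambda>m. \<zero>\<^bsub>ratfuns C\<^esub>),
      add = (\<lambda>a b m. a m \<oplus>\<^bsub>ratfuns C\<^esub> b m)\<rparr>"

text \<open>Sections over a nonempty open set, and the stalk at a point, of the direct sum of the tensor
  powers of \<open>L\<close>. Varieties being noetherian spaces, sections over an open set commute with direct
  sums.\<close>

definition power_alg ::
  "('a, 'm) fspace_scheme \<Rightarrow> 'a submod \<Rightarrow> 'a set \<Rightarrow> (int \<Rightarrow> 'a ratfun) ring" where
  "power_alg C L U = graded_ring C (\<lambda>m. tensor_pow C L m U)"

definition power_stalk ::
  "('a, 'm) fspace_scheme \<Rightarrow> 'a submod \<Rightarrow> 'a \<Rightarrow> (int \<Rightarrow> 'a ratfun) ring" where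
  "power_stalk C L c =
     graded_ring C (\<lambda>m. \<Union>U\<in>{U. openin (zariski C) U \<and> c \<in> U}. tensor_pow C L m U)"

definition reg_ring :: "('a, 'm) fspace_scheme \<Rightarrow> 'a set \<Rightarrow> ('a \<Rightarrow> complex) ring" where
  "reg_ring P W =
     \<lparr>carrier = reg P W, mult = (\<lambda>f g. \<lambda>x\<in>W. f x * g x), one = (\<lambda>x\<in>W. 1),
      zero = (\<lambda>x\<in>W. 0), add = (\<lambda>f g. \<lambda>x\<in>W. f x + g x)\<rparr>"

definition semi_invariant ::
  "('b, 'a, 'n) torsor_scheme \<Rightarrow> 'b set \<Rightarrow> int \<Rightarrow> ('b \<Rightarrow> complex) \<Rightarrow> bool" where
  "semi_invariant P W m F \<longleftrightarrow>
     (\<forall>z\<in>points circle. \<forall>p\<in>W. F (act P z p) = z powi m * F p)"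

text \<open>The direct image of the structure sheaf of \<open>P\<close> is isomorphic to the direct sum of the tensor
  powers of \<open>L\<close>, as a sheaf of graded algebras over the structure sheaf of \<open>C\<close>. Restriction maps
  between sections of submodules of the sheaf of rational functions are inclusions.\<close>

definition direct_image_is_power_alg ::
  "('a, 'm) fspace_scheme \<Rightarrow> ('b, 'a, 'n) torsor_scheme \<Rightarrow> 'a submod \<Rightarrow> bool" where
  "direct_image_is_power_alg C P L \<longleftrightarrow>
     (\<exists>\<Phi>. \<forall>U. nopen C U \<longrightarrow> (let W = preim P (base P) U in
        \<Phi> U \<in> ring_iso (reg_ring P W) (power_alg C L U) \<and>
        (\<forall>f\<in>reg C U. \<Phi> U (\<lambda>p\<in>W. f (base P p)) = homog C 0 (germ C U f)) \<and>
        (\<forall>m. \<forall>F\<in>reg P W. semi_invariant P W m F \<longleftrightarrow> (\<exists>k. \<Phi> U F = homog C m k)) \<and>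
        (\<forall>V. nopen C V \<and> V \<subseteq> U \<longrightarrow>
           (\<forall>F\<in>reg P W. \<Phi> V (restrict F (preim P (base P) V)) = \<Phi> U F))))"

definition complex_ring :: "complex ring" where
  "complex_ring = \<lparr>carrier = UNIV, mult = (*), one = 1, zero = 0, add = (+)\<rparr>"

text \<open>The closed points of the relative spectrum over a closed point \<open>c\<close> are the homomorphisms from
  the stalk at \<open>c\<close> to the complex numbers that restrict in degree 0 to evaluation at \<open>c\<close>.\<close>

definition spec_points ::
  "('a, 'm) fspace_scheme \<Rightarrow> 'a submod \<Rightarrow> ('a \<times> ((int \<Rightarrow> 'a ratfun) \<Rightarrow> complex)) set" where
  "spec_points C L =
     {(c, \<psi>). c \<in> points C \<and> \<psi> \<in> extensional (carrier (power_stalk C L c)) \<and>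
        \<psi> \<in> ring_hom (power_stalk C L c) complex_ring \<and>
        (\<forall>U f. openin (zariski C) U \<and> c \<in> U \<and> f \<in> reg C U \<longrightarrow> \<psi> (homog C 0 (germ C U f)) = f c)}"

definition spec_space ::
  "('a, 'm) fspace_scheme \<Rightarrow> 'a submod \<Rightarrow> ('a \<times> ((int \<Rightarrow> 'a ratfun) \<Rightarrow> complex)) fspace" where
  "spec_space C L = generated_space
     {({(c, \<psi>) \<in> spec_points C L. c \<in> U \<and> \<psi> b \<noteq> 0}, \<lambda>(c, \<psi>). \<psi> a / \<psi> b) | U a b.
        nopen C U \<and> a \<in> carrier (power_alg C L U) \<and> b \<in> carrier (power_alg C L U)}"

text \<open>The action and the real structure are the maps on points dual to the prescribed maps on
  sections. A section of degree \<open>m\<close> is multiplied by the \<open>m\<close>-th power of \<open>z\<close> under the action of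
  \<open>z\<close>. For the real structure, the value of a section \<open>a\<close> at the conjugate point is the complex
  conjugate of the value of the section with component
  \<open>h\<^sup>-\<^sup>m \<tau>\<^sup>*(a (- m))\<close> in degree \<open>m\<close>.\<close>

definition pair_torsor ::
  "('a, 'm) real_space_scheme \<Rightarrow> 'a submod \<Rightarrow> 'a ratfun \<Rightarrow>
     ('a \<times> ((int \<Rightarrow> 'a ratfun) \<Rightarrow> complex), 'a) torsor" where
  "pair_torsor C L h =
     \<lparr>zariski = zariski (spec_space C L),
      reg = reg (spec_space C L),
      rconj = (\<lambda>(c, \<psi>). (rconj C c,
        \<lambda>a\<in>carrier (power_stalk C L (rconj C c)).
          cnj (\<psi> (\<lambda>m. h [^]\<^bsub>ratfuns C\<^esub> (- m) \<otimes>\<^bsub>ratfuns C\<^esub> rat_conj C (a (- m)))))),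
      base = fst,
      act = (\<lambda>z (c, \<psi>). (c,
        \<lambda>a\<in>carrier (power_stalk C L c).
          \<psi> (\<lambda>m. const_rat C (z powi m) \<otimes>\<^bsub>ratfuns C\<^esub> a m)))\<rparr>"

end

theory Submission
  imports Defs "HOL-Computational_Algebra.Fundamental_Theorem_Algebra"
begin

text \<open>
  On an irreducible variety an invertible submodule of the sheaf of rational functions is the same
  as a Cartier divisor, here a choice of a local generator at every point which is locally constant
  up to units of the stalks; tensor products, duals and pull-backs become pointwise products,
  inverses and conjugates. A point over \<open>c\<close> of the relative spectrum of \<open>\<Oplus>\<^sub>m L\<^sup>m\<close> is given by the
  value \<open>z \<noteq> 0\<close> of the generator at \<open>c\<close>. In these coordinates a torsor isomorphism over \<open>C\<close> is
  multiplication of \<open>z\<close> by a unit \<open>w\<close>, the real structure is \<open>z \<mapsto> cnj (e / z)\<close> with \<open>e\<close> the value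
  of \<open>h \<otimes> \<tau>\<^sup>*L \<otimes> L\<close>, and both conditions on \<open>f\<close> say that \<open>w\<close> comes from \<open>f\<close> and is compatible
  with the two real structures.

  For a torsor \<open>P\<close>, a function on \<open>\<rho>\<^sup>-\<^sup>1 U\<close> is a Laurent polynomial in the group variable along every
  orbit. Its degree is bounded over one nonempty open set, a discrete Fourier transform expresses
  the coefficients by translates of the function, and irreducibility spreads the identity over
  \<open>\<rho>\<^sup>-\<^sup>1 U\<close>; so the function is a finite sum of semi-invariants. Local trivializations are units \<open>u\<close> of
  weight 1. Fixing one of them, \<open>u\<^sub>0\<close>, the quotients \<open>u / u\<^sub>0\<close> descend to the divisor of \<open>L\<close>, and
  \<open>u\<^sub>0 \<cdot> \<sigma>\<^sup>*u\<^sub>0\<close> descends to \<open>h\<close>.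
\<close>

text \<open>No finite cover of \<open>C\<close> is ever fixed: attaching a generator to every point
  turns each condition into one about units of single stalks, so covers never have to be refined.

  Regular functions on \<open>over U\<close> are only locally fractions, so nothing bounds their
  degree along orbits a priori. Near one point (1, p) of the product of the group with
  \<open>P\<close>, however, the translated function is a single quotient of finite sums of products
  of a function of the group variable and a function on \<open>P\<close>. Freezing the second factor
  leaves combinations of the same finitely many rational functions, whence a bound \<open>N\<close>
  for all nearby p. The exponents from -N to N are pairwise incongruent modulo 2N + 1, so averaging
  over the roots of unity of that order isolates each coefficient; the averages are regular on all
  of \<open>over U\<close>, even where no bound is known yet.

  Embedding \<open>L\<close> into the function field amounts to choosing a rational section of
  \<open>P\<close>; any chart gives one, since nonempty open sets meet. The function
  \<open>h\<close> is real because the product of \<open>u0\<close> with its conjugate is unchanged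
  when p and \<sigma> p are exchanged and the value is conjugated.\<close>

lemma ex3I: "P x y z \<Longrightarrow> \<exists>x y z. P x y z"
  by blast

section \<open>Spaces with functions\<close>

text \<open>The interface between geometry and sheaf theory: a sheaf of complex-valued functions,
  closed under the ring operations, in which nowhere vanishing functions are units and zero sets are
  closed. It holds for suitable generated spaces and passes to induced structures and along
  isomorphisms, hence from projective space to every variety.\<close>

locale fun_space =
  fixes X :: "('a, 'm) fspace_scheme"
  assumes reg_ext: "\<And>U f. openin (zariski X) U \<Longrightarrow> f \<in> reg X U \<Longrightarrow> f \<in> extensional U"
    and reg_restrict: "\<And>U V f. openin (zariski X) U \<Longrightarrow> openin (zariski X) V \<Longrightarrow> V \<subseteq> U \<Longrightarrow>
        f \<in> reg X U \<Longrightarrow> restrict f V \<in> reg X V"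
    and reg_glue: "\<And>U f. openin (zariski X) U \<Longrightarrow> f \<in> extensional U \<Longrightarrow>
        (\<And>x. x \<in> U \<Longrightarrow> \<exists>V. openin (zariski X) V \<and> x \<in> V \<and> V \<subseteq> U \<and> restrict f V \<in> reg X V) \<Longrightarrow>
        f \<in> reg X U"
    and reg_const: "\<And>U z. openin (zariski X) U \<Longrightarrow> (\<lambda>x\<in>U. z) \<in> reg X U"
    and reg_add: "\<And>U f g. openin (zariski X) U \<Longrightarrow> f \<in> reg X U \<Longrightarrow> g \<in> reg X U \<Longrightarrow>
        (\<lambda>x\<in>U. f x + g x) \<in> reg X U"
    and reg_mult: "\<And>U f g. openin (zariski X) U \<Longrightarrow> f \<in> reg X U \<Longrightarrow> g \<in> reg X U \<Longrightarrow>
        (\<lambda>x\<in>U. f x * g x) \<in> reg X U"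
    and reg_inverse: "\<And>U f. openin (zariski X) U \<Longrightarrow> f \<in> reg X U \<Longrightarrow> (\<And>x. x \<in> U \<Longrightarrow> f x \<noteq> 0) \<Longrightarrow>
        (\<lambda>x\<in>U. inverse (f x)) \<in> reg X U"
    and open_nonzero: "\<And>U f. openin (zariski X) U \<Longrightarrow> f \<in> reg X U \<Longrightarrow>
        openin (zariski X) {x \<in> U. f x \<noteq> 0}"
begin

lemma reg_eqI:
  assumes "openin (zariski X) U" "f \<in> reg X U" "g \<in> reg X U" "\<And>x. x \<in> U \<Longrightarrow> f x = g x"
  shows "f = g"
  using assms extensionalityI reg_ext by metis

lemma reg_cong:
  assumes "openin (zariski X) U" "f \<in> reg X U" "\<And>x. x \<in> U \<Longrightarrow> f x = g x"
  shows "restrict g U \<in> reg X U"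
proof -
  have "f = restrict g U"
    using assms reg_ext[OF assms(1,2)] by (auto simp: extensional_def)
  then show ?thesis using assms by simp
qed

lemma reg_localI:
  assumes U: "openin (zariski X) U"
    and loc: "\<And>x. x \<in> U \<Longrightarrow> \<exists>V g. openin (zariski X) V \<and> x \<in> V \<and> g \<in> reg X V \<and> (\<forall>y\<in>U \<inter> V. f y = g y)"
  shows "restrict f U \<in> reg X U"
proof (rule reg_glue[OF U])
  fix x assume x: "x \<in> U"
  then obtain V g where V: "openin (zariski X) V" "x \<in> V" "g \<in> reg X V" "\<forall>y\<in>U \<inter> V. f y = g y"
    using loc by blast
  have o: "openin (zariski X) (U \<inter> V)" using U V by auto
  have "restrict g (U \<inter> V) \<in> reg X (U \<inter> V)" using reg_restrict[OF V(1) o _ V(3)] by auto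
  from reg_cong[OF o this, of "restrict f U"] V
  show "\<exists>V. openin (zariski X) V \<and> x \<in> V \<and> V \<subseteq> U \<and> restrict (restrict f U) V \<in> reg X V"
    using o x by (intro exI[of _ "U \<inter> V"]) auto
qed auto

lemma reg_sum:
  assumes "openin (zariski X) U" "finite A" "\<And>i. i \<in> A \<Longrightarrow> (\<lambda>x\<in>U. f i x) \<in> reg X U"
  shows "(\<lambda>x\<in>U. \<Sum>i\<in>A. f i x) \<in> reg X U"
  using assms(2,3)
proof (induction A)
  case empty
  then show ?case using reg_const[OF assms(1), of 0] by (simp only: sum.empty)
next
  case (insert i A)
  then have "(\<lambda>x\<in>U. (\<lambda>x\<in>U. f i x) x + (\<lambda>x\<in>U. \<Sum>i\<in>A. f i x) x) \<in> reg X U"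
    by (intro reg_add[OF assms(1)]) blast+
  then show ?case by (rule reg_cong[OF assms(1)]) (use insert in auto)
qed

lemma reg_power:
  assumes "openin (zariski X) U" "f \<in> reg X U"
  shows "(\<lambda>x\<in>U. f x ^ n) \<in> reg X U"
proof (induction n)
  case 0
  then show ?case using reg_const[OF assms(1), of 1] by (simp only: power_0)
next
  case (Suc n)
  then have "(\<lambda>x\<in>U. f x * (\<lambda>x\<in>U. f x ^ n) x) \<in> reg X U"
    by (intro reg_mult assms) auto
  then show ?case by (rule reg_cong[OF assms(1)]) auto
qed

lemma reg_powi:
  assumes "openin (zariski X) U" "f \<in> reg X U" "\<And>x. x \<in> U \<Longrightarrow> f x \<noteq> 0"
  shows "(\<lambda>x\<in>U. f x powi n) \<in> reg X U"
proof (cases "n \<ge> 0")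
  case True
  then show ?thesis using reg_power[OF assms(1,2), of "nat n"] by (simp add: power_int_def)
next
  case False
  have "(\<lambda>x\<in>U. (\<lambda>x\<in>U. inverse (f x)) x ^ nat (-n)) \<in> reg X U"
    using reg_power[OF assms(1) reg_inverse[OF assms]] by blast
  then show ?thesis
    by (rule reg_cong[OF assms(1)]) (use False in \<open>auto simp: power_int_def\<close>)
qed

lemma reg_cmult:
  assumes "openin (zariski X) U" "f \<in> reg X U"
  shows "(\<lambda>x\<in>U. z * f x) \<in> reg X U"
  by (rule reg_cong[OF assms(1) reg_mult[OF assms(1) reg_const[OF assms(1), of z] assms(2)]]) auto

end

section \<open>Spaces generated by a family of functions\<close>

lemma points_generated: "points (generated_space Q) = \<Union> (fst ` Q)"
  by (simp add: generated_space_def Let_def)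

lemma open_generated: "(D, g) \<in> Q \<Longrightarrow> openin (zariski (generated_space Q)) D"
  by (force simp: generated_space_def Let_def intro: topology_generated_by_Basis)

lemma reg_generated:
  "f \<in> reg (generated_space Q) U \<longleftrightarrow> f \<in> extensional U \<and>
     (\<forall>x\<in>U. \<exists>D g W. (D, g) \<in> Q \<and> openin (zariski (generated_space Q)) W \<and> x \<in> W \<and> W \<subseteq> U \<inter> D \<and>
        (\<forall>y\<in>W. f y = g y))"
proof -
  have "(\<exists>(D, g)\<in>Q. \<exists>W. R D g W) \<longleftrightarrow> (\<exists>D g W. (D, g) \<in> Q \<and> R D g W)"
    for R :: "'a set \<Rightarrow> ('a \<Rightarrow> complex) \<Rightarrow> 'a set \<Rightarrow> bool" by auto
  then show ?thesis unfolding generated_space_def Let_def by simp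
qed

text \<open>Regularity is local, so it is enough that sums, products and inverses of generators are
  again generators after shrinking around a given point. The clause on inverses also makes
  nonvanishing loci open: around a point where \<open>g\<close> is nonzero it supplies a subbasic
  set \<open>E\<close> on which \<open>g\<close> has no zero.\<close>

lemma fun_space_generated:
  assumes const: "\<And>x z. x \<in> \<Union>(fst ` Q) \<Longrightarrow> \<exists>(E, k)\<in>Q. x \<in> E \<and> (\<forall>y\<in>E. k y = z)"
    and add: "\<And>D g D' g' x. (D, g) \<in> Q \<Longrightarrow> (D', g') \<in> Q \<Longrightarrow> x \<in> D \<inter> D' \<Longrightarrow>
       \<exists>(E, k)\<in>Q. x \<in> E \<and> E \<subseteq> D \<inter> D' \<and> (\<forall>y\<in>E. k y = g y + g' y)"
    and mult: "\<And>D g D' g' x. (D, g) \<in> Q \<Longrightarrow> (D', g') \<in> Q \<Longrightarrow> x \<in> D \<inter> D' \<Longrightarrow>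
       \<exists>(E, k)\<in>Q. x \<in> E \<and> E \<subseteq> D \<inter> D' \<and> (\<forall>y\<in>E. k y = g y * g' y)"
    and inv: "\<And>D g x. (D, g) \<in> Q \<Longrightarrow> x \<in> D \<Longrightarrow> g x \<noteq> 0 \<Longrightarrow>
       \<exists>(E, k)\<in>Q. x \<in> E \<and> E \<subseteq> D \<and> (\<forall>y\<in>E. g y \<noteq> 0 \<and> k y = inverse (g y))"
  shows "fun_space (generated_space Q)"
proof
  let ?T = "zariski (generated_space Q)"
  have locD: "\<exists>D g W. (D, g) \<in> Q \<and> openin ?T W \<and> x \<in> W \<and> W \<subseteq> U \<inter> D \<and> (\<forall>y\<in>W. f y = g y)"
    if "f \<in> reg (generated_space Q) U" "x \<in> U" for f U x
    using that unfolding reg_generated by simp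
  have locI: "f \<in> reg (generated_space Q) U"
    if "f \<in> extensional U"
       "\<And>x. x \<in> U \<Longrightarrow> \<exists>D g W. (D, g) \<in> Q \<and> openin ?T W \<and> x \<in> W \<and> W \<subseteq> U \<inter> D \<and> (\<forall>y\<in>W. f y = g y)" for f U
    using that unfolding reg_generated by simp
  show "f \<in> extensional U" if "f \<in> reg (generated_space Q) U" for f U
    using that by (simp add: reg_generated)
  show "restrict f V \<in> reg (generated_space Q) V"
    if o: "openin ?T U" "openin ?T V" "V \<subseteq> U" and f: "f \<in> reg (generated_space Q) U" for f U V
  proof (rule locI)
    fix x assume x: "x \<in> V"
    obtain D g W where "(D, g) \<in> Q" "openin ?T W" "x \<in> W" "W \<subseteq> U \<inter> D" "\<forall>y\<in>W. f y = g y"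
      using locD[OF f] x o by blast
    then show "\<exists>D g W. (D, g) \<in> Q \<and> openin ?T W \<and> x \<in> W \<and> W \<subseteq> V \<inter> D \<and> (\<forall>y\<in>W. restrict f V y = g y)"
      using o x by (intro ex3I[of _ D g "W \<inter> V"]) auto
  qed auto
  show "f \<in> reg (generated_space Q) U"
    if o: "openin ?T U" and e: "f \<in> extensional U"
     and l: "\<And>x. x \<in> U \<Longrightarrow> \<exists>V. openin ?T V \<and> x \<in> V \<and> V \<subseteq> U \<and> restrict f V \<in> reg (generated_space Q) V" for f U
  proof (rule locI[OF e])
    fix x assume x: "x \<in> U"
    obtain V where V: "openin ?T V" "x \<in> V" "V \<subseteq> U" "restrict f V \<in> reg (generated_space Q) V"
      using l[OF x] by blast
    obtain D g W where W: "(D, g) \<in> Q" "openin ?T W" "x \<in> W" "W \<subseteq> V \<inter> D" "\<forall>y\<in>W. restrict f V y = g y"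
      using locD[OF V(4,2)] by blast
    have "f y = g y" if "y \<in> W" for y
      using bspec[OF W(5) that] subsetD[OF W(4) that] by simp
    with W show "\<exists>D g W. (D, g) \<in> Q \<and> openin ?T W \<and> x \<in> W \<and> W \<subseteq> U \<inter> D \<and> (\<forall>y\<in>W. f y = g y)"
      using V by (intro ex3I[of _ D g W]) auto
  qed
  show "(\<lambda>x\<in>U. z) \<in> reg (generated_space Q) U" if o: "openin ?T U" for U z
  proof (rule locI)
    fix x assume x: "x \<in> U"
    have "x \<in> \<Union>(fst ` Q)" using openin_subset[OF o] x points_generated[of Q] by auto
    then obtain E k where E: "(E, k) \<in> Q" "x \<in> E" "\<forall>y\<in>E. k y = z" using const[of x z] by fast
    then show "\<exists>D g W. (D, g) \<in> Q \<and> openin ?T W \<and> x \<in> W \<and> W \<subseteq> U \<inter> D \<and> (\<forall>y\<in>W. (\<lambda>x\<in>U. z) y = g y)"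
      using x o open_generated[OF E(1)] by (intro ex3I[of _ E k "U \<inter> E"]) auto
  qed auto
  have bin: "(\<lambda>x\<in>U. op (f x) (g x)) \<in> reg (generated_space Q) U"
    if o: "openin ?T U" and fg: "f \<in> reg (generated_space Q) U" "g \<in> reg (generated_space Q) U"
    and op: "\<And>D g D' g' x. (D, g) \<in> Q \<Longrightarrow> (D', g') \<in> Q \<Longrightarrow> x \<in> D \<inter> D' \<Longrightarrow>
       \<exists>(E, k)\<in>Q. x \<in> E \<and> E \<subseteq> D \<inter> D' \<and> (\<forall>y\<in>E. k y = op (g y) (g' y))"
    for f g U and op :: "complex \<Rightarrow> complex \<Rightarrow> complex"
  proof (rule locI)
    fix x assume x: "x \<in> U"
    obtain D1 g1 W1 where 1: "(D1, g1) \<in> Q" "openin ?T W1" "x \<in> W1" "W1 \<subseteq> U \<inter> D1" "\<forall>y\<in>W1. f y = g1 y"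
      using locD[OF fg(1) x] by blast
    obtain D2 g2 W2 where 2: "(D2, g2) \<in> Q" "openin ?T W2" "x \<in> W2" "W2 \<subseteq> U \<inter> D2" "\<forall>y\<in>W2. g y = g2 y"
      using locD[OF fg(2) x] by blast
    obtain E k where E: "(E, k) \<in> Q" "x \<in> E" "E \<subseteq> D1 \<inter> D2" "\<forall>y\<in>E. k y = op (g1 y) (g2 y)"
      using op[OF 1(1) 2(1), of x] 1 2 by fast
    then show "\<exists>D g' W. (D, g') \<in> Q \<and> openin ?T W \<and> x \<in> W \<and> W \<subseteq> U \<inter> D \<and> (\<forall>y\<in>W. (\<lambda>x\<in>U. op (f x) (g x)) y = g' y)"
      using x o 1 2 open_generated[OF E(1)] by (intro ex3I[of _ E k "W1 \<inter> W2 \<inter> E"]) auto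
  qed auto
  show "(\<lambda>x\<in>U. f x + g x) \<in> reg (generated_space Q) U"
    if "openin ?T U" "f \<in> reg (generated_space Q) U" "g \<in> reg (generated_space Q) U" for U f g
    using bin[OF that, of "(+)"] add by blast
  show "(\<lambda>x\<in>U. f x * g x) \<in> reg (generated_space Q) U"
    if "openin ?T U" "f \<in> reg (generated_space Q) U" "g \<in> reg (generated_space Q) U" for U f g
    using bin[OF that, of "(*)"] mult by blast
  have invloc: "\<exists>E k W. (E, k) \<in> Q \<and> openin ?T W \<and> x \<in> W \<and> W \<subseteq> U \<inter> E \<and> (\<forall>y\<in>W. f y \<noteq> 0 \<and> inverse (f y) = k y)"
    if f: "f \<in> reg (generated_space Q) U" and x: "x \<in> U" "f x \<noteq> 0" for x f U
  proof -
    obtain D g W where 1: "(D, g) \<in> Q" "openin ?T W" "x \<in> W" "W \<subseteq> U \<inter> D" "\<forall>y\<in>W. f y = g y"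
      using locD[OF f x(1)] by blast
    obtain E k where E: "(E, k) \<in> Q" "x \<in> E" "E \<subseteq> D" "\<forall>y\<in>E. g y \<noteq> 0 \<and> k y = inverse (g y)"
      using inv[OF 1(1), of x] 1 x by (smt (verit) IntD2 case_prodE subsetD)
    then show ?thesis
      using x 1 open_generated[OF E(1)] by (intro ex3I[of _ E k "W \<inter> E"]) auto
  qed
  show "(\<lambda>x\<in>U. inverse (f x)) \<in> reg (generated_space Q) U"
    if o: "openin ?T U" and f: "f \<in> reg (generated_space Q) U" and nz: "\<And>x. x \<in> U \<Longrightarrow> f x \<noteq> 0" for U f
  proof (rule locI)
    fix x assume x: "x \<in> U"
    obtain E k W where "(E, k) \<in> Q" "openin ?T W" "x \<in> W" "W \<subseteq> U \<inter> E" "\<forall>y\<in>W. f y \<noteq> 0 \<and> inverse (f y) = k y"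
      using invloc[OF f x nz[OF x]] by blast
    then show "\<exists>D g W. (D, g) \<in> Q \<and> openin ?T W \<and> x \<in> W \<and> W \<subseteq> U \<inter> D \<and> (\<forall>y\<in>W. (\<lambda>x\<in>U. inverse (f x)) y = g y)"
      by (intro ex3I[of _ E k W]) auto
  qed auto
  show "openin ?T {x \<in> U. f x \<noteq> 0}" if o: "openin ?T U" and f: "f \<in> reg (generated_space Q) U" for U f
  proof (subst openin_subopen, safe)
    fix x assume x: "x \<in> U" "f x \<noteq> 0"
    obtain E k W where "(E, k) \<in> Q" "openin ?T W" "x \<in> W" "W \<subseteq> U \<inter> E" "\<forall>y\<in>W. f y \<noteq> 0 \<and> inverse (f y) = k y"
      using invloc[OF f x] by blast
    then show "\<exists>T. openin ?T T \<and> x \<in> T \<and> T \<subseteq> {x \<in> U. f x \<noteq> 0}"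
      by (intro exI[of _ W]) auto
  qed
qed

section \<open>Induced structures on subsets\<close>

lemma points_subvariety [simp]: "points (subvariety X S) = points X \<inter> S"
  by (simp add: subvariety_def)

lemma zariski_subvariety [simp]: "zariski (subvariety X S) = subtopology (zariski X) S"
  by (simp add: subvariety_def)

lemma reg_subvariety:
  "f \<in> reg (subvariety X S) U \<longleftrightarrow> f \<in> extensional U \<and> (\<forall>x\<in>U. \<exists>V g.
     openin (zariski X) V \<and> g \<in> reg X V \<and> x \<in> V \<and> (\<forall>y\<in>V \<inter> S. y \<in> U \<and> f y = g y))"
  by (simp add: subvariety_def)

text \<open>Functions on \<open>S\<close> extend locally to \<open>X\<close>, and all operations are
  carried out on such extensions.\<close>

lemma fun_space_subvariety:
  assumes "fun_space X"
  shows "fun_space (subvariety X S)"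
proof -
  interpret fun_space X by fact
  let ?Y = "subvariety X S"
  have locD: "\<exists>V g. openin (zariski X) V \<and> g \<in> reg X V \<and> x \<in> V \<and> (\<forall>y\<in>V \<inter> S. y \<in> U \<and> f y = g y)"
    if "f \<in> reg ?Y U" "x \<in> U" for f U x
    using that unfolding reg_subvariety by blast
  have bin: "(\<lambda>x\<in>U. op (f x) (g x)) \<in> reg ?Y U"
    if fg: "f \<in> reg ?Y U" "g \<in> reg ?Y U"
    and op: "\<And>V f g. openin (zariski X) V \<Longrightarrow> f \<in> reg X V \<Longrightarrow> g \<in> reg X V \<Longrightarrow> (\<lambda>x\<in>V. op (f x) (g x)) \<in> reg X V"
    for f g U and op :: "complex \<Rightarrow> complex \<Rightarrow> complex"
    unfolding reg_subvariety
  proof (intro conjI ballI)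
    fix x assume x: "x \<in> U"
    obtain V1 g1 where 1: "openin (zariski X) V1" "g1 \<in> reg X V1" "x \<in> V1" "\<forall>y\<in>V1 \<inter> S. y \<in> U \<and> f y = g1 y"
      using locD[OF fg(1) x] by blast
    obtain V2 g2 where 2: "openin (zariski X) V2" "g2 \<in> reg X V2" "x \<in> V2" "\<forall>y\<in>V2 \<inter> S. y \<in> U \<and> g y = g2 y"
      using locD[OF fg(2) x] by blast
    let ?V = "V1 \<inter> V2"
    have o: "openin (zariski X) ?V" using 1 2 by auto
    have "restrict g1 ?V \<in> reg X ?V" "restrict g2 ?V \<in> reg X ?V"
      using 1 2 o by (auto intro: reg_restrict[where U=V1] reg_restrict[where U=V2])
    from op[OF o this] show "\<exists>V h. openin (zariski X) V \<and> h \<in> reg X V \<and> x \<in> V \<and>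
       (\<forall>y\<in>V \<inter> S. y \<in> U \<and> (\<lambda>x\<in>U. op (f x) (g x)) y = h y)"
      using 1 2 o by (intro exI[of _ ?V] exI[of _ "\<lambda>x\<in>?V. op (restrict g1 ?V x) (restrict g2 ?V x)"]) auto
  qed auto
  show ?thesis
  proof
    show "f \<in> extensional U" if "f \<in> reg ?Y U" for f U using that by (simp add: reg_subvariety)
    show "restrict f V \<in> reg ?Y V"
      if o: "openin (zariski ?Y) U" "openin (zariski ?Y) V" "V \<subseteq> U" and f: "f \<in> reg ?Y U" for f U V
      unfolding reg_subvariety
    proof (intro conjI ballI)
      fix x assume x: "x \<in> V"
      then have "x \<in> U" using o by auto
      then obtain V1 g1 where 1: "openin (zariski X) V1" "g1 \<in> reg X V1" "x \<in> V1" "\<forall>y\<in>V1 \<inter> S. y \<in> U \<and> f y = g1 y"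
        using locD[OF f] by blast
      obtain V' where V': "openin (zariski X) V'" "V = V' \<inter> S" using o by (auto simp: openin_subtopology)
      have o: "openin (zariski X) (V1 \<inter> V')" using 1 V' by auto
      have "restrict g1 (V1 \<inter> V') \<in> reg X (V1 \<inter> V')" using reg_restrict[OF 1(1) o _ 1(2)] by auto
      then show "\<exists>W g. openin (zariski X) W \<and> g \<in> reg X W \<and> x \<in> W \<and> (\<forall>y\<in>W \<inter> S. y \<in> V \<and> restrict f V y = g y)"
        using o V' x 1 by (intro exI[of _ "V1 \<inter> V'"] exI[of _ "restrict g1 (V1 \<inter> V')"]) auto
    qed auto
    show "f \<in> reg ?Y U"
      if o: "openin (zariski ?Y) U" and e: "f \<in> extensional U"
      and l: "\<And>x. x \<in> U \<Longrightarrow> \<exists>V. openin (zariski ?Y) V \<and> x \<in> V \<and> V \<subseteq> U \<and> restrict f V \<in> reg ?Y V" for f U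
      unfolding reg_subvariety
    proof (intro conjI ballI e)
      fix x assume x: "x \<in> U"
      obtain V where V: "openin (zariski ?Y) V" "x \<in> V" "V \<subseteq> U" "restrict f V \<in> reg ?Y V" using l[OF x] by blast
      obtain V1 g1 where 1: "openin (zariski X) V1" "g1 \<in> reg X V1" "x \<in> V1" "\<forall>y\<in>V1 \<inter> S. y \<in> V \<and> restrict f V y = g1 y"
        using locD[OF V(4,2)] by blast
      have "y \<in> U \<and> f y = g1 y" if "y \<in> V1 \<inter> S" for y
        using bspec[OF 1(4) that] V(3) by auto
      with 1 show "\<exists>V g. openin (zariski X) V \<and> g \<in> reg X V \<and> x \<in> V \<and> (\<forall>y\<in>V \<inter> S. y \<in> U \<and> f y = g y)"
        by blast
    qed
    show "(\<lambda>x\<in>U. z) \<in> reg ?Y U" if o: "openin (zariski ?Y) U" for U z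
      unfolding reg_subvariety
    proof (intro conjI ballI)
      fix x assume x: "x \<in> U"
      obtain V' where V': "openin (zariski X) V'" "U = V' \<inter> S" using o by (auto simp: openin_subtopology)
      show "\<exists>V g. openin (zariski X) V \<and> g \<in> reg X V \<and> x \<in> V \<and> (\<forall>y\<in>V \<inter> S. y \<in> U \<and> (\<lambda>x\<in>U. z) y = g y)"
        using V' x reg_const[OF V'(1), of z] by (intro exI[of _ V'] exI[of _ "\<lambda>x\<in>V'. z"]) auto
    qed auto
    show "(\<lambda>x\<in>U. f x + g x) \<in> reg ?Y U" if "f \<in> reg ?Y U" "g \<in> reg ?Y U" for U f g
      using bin[OF that, of "(+)"] reg_add by blast
    show "(\<lambda>x\<in>U. f x * g x) \<in> reg ?Y U" if "f \<in> reg ?Y U" "g \<in> reg ?Y U" for U f g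
      using bin[OF that, of "(*)"] reg_mult by blast
    \<comment> \<open>An extension of a function without zeros may still vanish off
      \<open>S\<close>; restricting it to its nonvanishing locus keeps the given point and makes the
      extension invertible.\<close>
    have nz: "\<exists>V g. openin (zariski X) V \<and> g \<in> reg X V \<and> x \<in> V \<and> (\<forall>y\<in>V. g y \<noteq> 0) \<and> (\<forall>y\<in>V \<inter> S. y \<in> U \<and> f y = g y)"
      if f: "f \<in> reg ?Y U" and x: "x \<in> U" "f x \<noteq> 0" and o: "openin (zariski ?Y) U" for f U x
    proof -
      obtain V1 g1 where 1: "openin (zariski X) V1" "g1 \<in> reg X V1" "x \<in> V1" "\<forall>y\<in>V1 \<inter> S. y \<in> U \<and> f y = g1 y"
        using locD[OF f x(1)] by blast
      let ?V = "{y \<in> V1. g1 y \<noteq> 0}"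
      have xS: "x \<in> S" using o x by (auto simp: openin_subtopology)
      have o: "openin (zariski X) ?V" using open_nonzero 1 by blast
      have "restrict g1 ?V \<in> reg X ?V" using reg_restrict[OF 1(1) o _ 1(2)] by auto
      then show ?thesis using 1 x xS o by (intro exI[of _ ?V] exI[of _ "restrict g1 ?V"]) auto
    qed
    show "(\<lambda>x\<in>U. inverse (f x)) \<in> reg ?Y U"
      if o: "openin (zariski ?Y) U" and f: "f \<in> reg ?Y U" and z: "\<And>x. x \<in> U \<Longrightarrow> f x \<noteq> 0" for U f
      unfolding reg_subvariety
    proof (intro conjI ballI)
      fix x assume x: "x \<in> U"
      obtain V g where V: "openin (zariski X) V" "g \<in> reg X V" "x \<in> V" "\<forall>y\<in>V. g y \<noteq> 0" "\<forall>y\<in>V \<inter> S. y \<in> U \<and> f y = g y"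
        using nz[OF f x z[OF x] o] by blast
      show "\<exists>V g. openin (zariski X) V \<and> g \<in> reg X V \<and> x \<in> V \<and> (\<forall>y\<in>V \<inter> S. y \<in> U \<and> (\<lambda>x\<in>U. inverse (f x)) y = g y)"
        using V reg_inverse[OF V(1,2)] by (intro exI[of _ V] exI[of _ "\<lambda>x\<in>V. inverse (g x)"]) auto
    qed auto
    show "openin (zariski ?Y) {x \<in> U. f x \<noteq> 0}" if o: "openin (zariski ?Y) U" and f: "f \<in> reg ?Y U" for U f
    proof (subst openin_subopen, safe)
      fix x assume x: "x \<in> U" "f x \<noteq> 0"
      obtain V g where V: "openin (zariski X) V" "g \<in> reg X V" "x \<in> V" "\<forall>y\<in>V. g y \<noteq> 0" "\<forall>y\<in>V \<inter> S. y \<in> U \<and> f y = g y"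
        using nz[OF f x o] by blast
      have "x \<in> S" using o x by (auto simp: openin_subtopology)
      then show "\<exists>T. openin (zariski ?Y) T \<and> x \<in> T \<and> T \<subseteq> {x \<in> U. f x \<noteq> 0}"
        using V by (intro exI[of _ "V \<inter> S"]) (auto simp: openin_subtopology)
    qed
  qed
qed

lemma reg_open_subvariety:
  assumes "fun_space X" "openin (zariski X) S" "openin (zariski X) U" "U \<subseteq> S"
  shows "reg (subvariety X S) U = reg X U"
proof -
  interpret fun_space X by fact
  show ?thesis
  proof (intro equalityI subsetI)
    fix f assume f: "f \<in> reg (subvariety X S) U"
    have "restrict f U \<in> reg X U"
    proof (rule reg_localI[OF assms(3)])
      fix x assume "x \<in> U"
      then show "\<exists>V g. openin (zariski X) V \<and> x \<in> V \<and> g \<in> reg X V \<and> (\<forall>y\<in>U \<inter> V. f y = g y)"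
        using f assms(4) unfolding reg_subvariety by blast
    qed
    moreover have "f \<in> extensional U" using f by (simp add: reg_subvariety)
    ultimately show "f \<in> reg X U" by (simp add: extensional_restrict)
  next
    fix f assume "f \<in> reg X U"
    then show "f \<in> reg (subvariety X S) U"
      unfolding reg_subvariety using assms(3) reg_ext by blast
  qed
qed

lemma openin_subvariety:
  "openin (zariski X) S \<Longrightarrow> openin (zariski (subvariety X S)) U \<longleftrightarrow> openin (zariski X) U \<and> U \<subseteq> S"
  by (simp add: openin_open_subtopology)

section \<open>Morphisms of spaces with functions\<close>

lemma preim_iff [simp]: "x \<in> preim X \<phi> V \<longleftrightarrow> x \<in> points X \<and> \<phi> x \<in> V"
  by (simp add: preim_def)

lemma fmorphism_open: "fmorphism X Y \<phi> \<Longrightarrow> openin (zariski Y) V \<Longrightarrow> openin (zariski X) (preim X \<phi> V)"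
  by (simp add: fmorphism_def continuous_map_def preim_def)

lemma fmorphism_reg:
  "fmorphism X Y \<phi> \<Longrightarrow> openin (zariski Y) V \<Longrightarrow> f \<in> reg Y V \<Longrightarrow> (\<lambda>x\<in>preim X \<phi> V. f (\<phi> x)) \<in> reg X (preim X \<phi> V)"
  by (simp add: fmorphism_def)

lemma fmorphism_points: "fmorphism X Y \<phi> \<Longrightarrow> x \<in> points X \<Longrightarrow> \<phi> x \<in> points Y"
  by (auto simp: fmorphism_def continuous_map_def)

lemma fmorphism_comp:
  assumes f: "fmorphism X Y \<phi>" and g: "fmorphism Y Z \<psi>"
  shows "fmorphism X Z (\<lambda>x. \<psi> (\<phi> x))"
proof -
  have "continuous_map (zariski X) (zariski Z) (\<lambda>x. \<psi> (\<phi> x))"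
    using continuous_map_compose[of "zariski X" "zariski Y" \<phi> "zariski Z" \<psi>] f g
    by (simp add: fmorphism_def comp_def)
  moreover have "(\<lambda>x\<in>preim X (\<lambda>x. \<psi> (\<phi> x)) V. h (\<psi> (\<phi> x))) \<in> reg X (preim X (\<lambda>x. \<psi> (\<phi> x)) V)"
    if "openin (zariski Z) V" "h \<in> reg Z V" for V h
  proof -
    have eq: "preim X (\<lambda>x. \<psi> (\<phi> x)) V = preim X \<phi> (preim Y \<psi> V)"
      using fmorphism_points[OF f] by auto
    have "(\<lambda>x\<in>preim X \<phi> (preim Y \<psi> V). (\<lambda>y\<in>preim Y \<psi> V. h (\<psi> y)) (\<phi> x)) \<in> reg X (preim X \<phi> (preim Y \<psi> V))"
      using fmorphism_reg[OF f fmorphism_open[OF g that(1)] fmorphism_reg[OF g that]] .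
    moreover have "(\<lambda>x\<in>preim X \<phi> (preim Y \<psi> V). (\<lambda>y\<in>preim Y \<psi> V. h (\<psi> y)) (\<phi> x)) =
      (\<lambda>x\<in>preim X \<phi> (preim Y \<psi> V). h (\<psi> (\<phi> x)))" by (rule restrict_ext) auto
    ultimately show ?thesis unfolding eq by simp
  qed
  ultimately show ?thesis by (simp add: fmorphism_def)
qed

lemma fmorphism_cong:
  assumes "fmorphism X Y \<phi>" "\<And>x. x \<in> points X \<Longrightarrow> \<phi> x = \<psi> x"
  shows "fmorphism X Y \<psi>"
proof -
  have "preim X \<phi> V = preim X \<psi> V" for V using assms(2) by auto
  moreover have "(\<lambda>x\<in>preim X \<psi> V. f (\<phi> x)) = (\<lambda>x\<in>preim X \<psi> V. f (\<psi> x))" for V and f :: "_ \<Rightarrow> complex"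
    by (rule restrict_ext) (use assms(2) in auto)
  moreover have "continuous_map (zariski X) (zariski Y) \<psi>"
    using assms continuous_map_eq unfolding fmorphism_def by blast
  ultimately show ?thesis using assms(1) by (simp add: fmorphism_def)
qed

lemma fmorphism_generatedI:
  assumes "fun_space X"
    and pts: "\<And>x. x \<in> points X \<Longrightarrow> \<phi> x \<in> \<Union>(fst ` Q)"
    and o: "\<And>D g. (D, g) \<in> Q \<Longrightarrow> openin (zariski X) (preim X \<phi> D)"
    and r: "\<And>D g. (D, g) \<in> Q \<Longrightarrow> (\<lambda>x\<in>preim X \<phi> D. g (\<phi> x)) \<in> reg X (preim X \<phi> D)"
  shows "fmorphism X (generated_space Q) \<phi>"
proof -
  interpret fun_space X by fact
  have cm: "continuous_map (zariski X) (zariski (generated_space Q)) \<phi>"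
    unfolding generated_space_def Let_def fspace.select_convs
  proof (rule continuous_on_generated_topo)
    fix U assume "U \<in> fst ` Q"
    then obtain g where "(U, g) \<in> Q" by auto
    from o[OF this] show "openin (zariski X) (\<phi> -` U \<inter> points X)"
      by (simp add: preim_def vimage_def Int_def conj_commute)
  qed (use pts in auto)
  have "(\<lambda>x\<in>preim X \<phi> V. f (\<phi> x)) \<in> reg X (preim X \<phi> V)"
    if V: "openin (zariski (generated_space Q)) V" and f: "f \<in> reg (generated_space Q) V" for V f
  proof (rule reg_localI)
    show "openin (zariski X) (preim X \<phi> V)" using cm V by (simp add: continuous_map_def preim_def)
    fix x assume x: "x \<in> preim X \<phi> V"
    then obtain D g W where W: "(D, g) \<in> Q" "openin (zariski (generated_space Q)) W" "\<phi> x \<in> W" "W \<subseteq> V \<inter> D" "\<forall>y\<in>W. f y = g y"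
      using f unfolding reg_generated preim_iff by (metis (no_types))
    have oW: "openin (zariski X) (preim X \<phi> W)" using cm W by (simp add: continuous_map_def preim_def)
    have sub: "preim X \<phi> W \<subseteq> preim X \<phi> D" using W by auto
    have "restrict (\<lambda>x\<in>preim X \<phi> D. g (\<phi> x)) (preim X \<phi> W) \<in> reg X (preim X \<phi> W)"
      using reg_restrict[OF o[OF W(1)] oW sub r[OF W(1)]] .
    then show "\<exists>T h. openin (zariski X) T \<and> x \<in> T \<and> h \<in> reg X T \<and> (\<forall>y\<in>preim X \<phi> V \<inter> T. f (\<phi> y) = h y)"
      using oW x W by (intro exI[of _ "preim X \<phi> W"] exI[of _ "restrict (\<lambda>x\<in>preim X \<phi> D. g (\<phi> x)) (preim X \<phi> W)"]) auto
  qed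
  then show ?thesis using cm by (simp add: fmorphism_def)
qed

text \<open>Transport of structure. An isomorphism sees a function on \<open>U\<close> only through
  its values on \<open>U\<close>; that members of \<open>reg X U\<close> are undefined elsewhere is
  therefore a separate assumption.\<close>

lemma fun_space_fiso:
  assumes iso: "fiso X Y \<phi>" and Y: "fun_space Y"
    and ext: "\<And>U. openin (zariski X) U \<Longrightarrow> reg X U \<subseteq> extensional U"
  shows "fun_space X"
proof -
  interpret Y: fun_space Y by fact
  define \<psi> where "\<psi> = inv_into (points X) \<phi>"
  have bij: "bij_betw \<phi> (points X) (points Y)" and m1: "fmorphism X Y \<phi>" and m2: "fmorphism Y X \<psi>"
    using iso by (auto simp: fiso_def \<psi>_def)
  have \<psi>\<phi>: "\<psi> (\<phi> x) = x" if "x \<in> points X" for x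
    using bij that by (simp add: \<psi>_def bij_betw_def)
  have \<phi>\<psi>: "\<phi> (\<psi> y) = y" if "y \<in> points Y" for y
    using bij that by (simp add: \<psi>_def bij_betw_def f_inv_into_f)
  let ?i = "\<lambda>U. preim Y \<psi> U"
  have io: "openin (zariski Y) (?i U)" if "openin (zariski X) U" for U using fmorphism_open[OF m2 that] .
  have pre: "preim X \<phi> (?i U) = U" if "openin (zariski X) U" for U
    using openin_subset[OF that] \<psi>\<phi> fmorphism_points[OF m1] by auto
  have mem: "\<phi> x \<in> ?i U" if "openin (zariski X) U" "x \<in> U" for U x
    using openin_subset[OF that(1)] that \<psi>\<phi> fmorphism_points[OF m1] by auto
  have to: "(\<lambda>y\<in>?i U. f (\<psi> y)) \<in> reg Y (?i U)" if "openin (zariski X) U" "f \<in> reg X U" for f U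
    using fmorphism_reg[OF m2 that] .
  have from': "restrict f U \<in> reg X U"
    if U: "openin (zariski X) U" and g: "g \<in> reg Y (?i U)" "\<And>y. y \<in> ?i U \<Longrightarrow> g y = f (\<psi> y)" for f U g
  proof -
    have 1: "(\<lambda>x\<in>U. g (\<phi> x)) \<in> reg X U" using fmorphism_reg[OF m1 io[OF U] g(1)] pre[OF U] by simp
    have "(\<lambda>x\<in>U. g (\<phi> x)) = restrict f U"
      by (rule restrict_ext) (use g(2)[OF mem[OF U]] openin_subset[OF U] \<psi>\<phi> in auto)
    with 1 show ?thesis by simp
  qed
  show ?thesis
  proof
    show e: "f \<in> extensional U" if "openin (zariski X) U" "f \<in> reg X U" for f U using ext that by blast
    show rs: "restrict f V \<in> reg X V" if o: "openin (zariski X) U" "openin (zariski X) V" "V \<subseteq> U" and f: "f \<in> reg X U" for f U V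
    proof (rule from'[OF o(2)])
      have s: "?i V \<subseteq> ?i U" using o by auto
      show "restrict (\<lambda>y\<in>?i U. f (\<psi> y)) (?i V) \<in> reg Y (?i V)"
        using Y.reg_restrict[OF io[OF o(1)] io[OF o(2)] s to[OF o(1) f]] .
      show "restrict (\<lambda>y\<in>?i U. f (\<psi> y)) (?i V) y = f (\<psi> y)" if "y \<in> ?i V" for y using that s by auto
    qed
    show "f \<in> reg X U"
      if o: "openin (zariski X) U" and e: "f \<in> extensional U"
      and l: "\<And>x. x \<in> U \<Longrightarrow> \<exists>V. openin (zariski X) V \<and> x \<in> V \<and> V \<subseteq> U \<and> restrict f V \<in> reg X V" for f U
    proof -
      have "(\<lambda>y\<in>?i U. f (\<psi> y)) \<in> reg Y (?i U)"
      proof (rule Y.reg_localI[OF io[OF o]])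
        fix y assume y: "y \<in> ?i U"
        then obtain V where V: "openin (zariski X) V" "\<psi> y \<in> V" "V \<subseteq> U" "restrict f V \<in> reg X V" using l by auto
        show "\<exists>V g. openin (zariski Y) V \<and> y \<in> V \<and> g \<in> reg Y V \<and> (\<forall>y\<in>?i U \<inter> V. f (\<psi> y) = g y)"
          using to[OF V(1,4)] V io[OF V(1)] y by (intro exI[of _ "?i V"] exI[of _ "\<lambda>y\<in>?i V. restrict f V (\<psi> y)"]) auto
      qed
      from from'[OF o this, of f] show ?thesis using e by (simp add: extensional_restrict)
    qed
    show "(\<lambda>x\<in>U. z) \<in> reg X U" if o: "openin (zariski X) U" for U z
      using from'[OF o Y.reg_const[OF io[OF o]]] by simp
    show "(\<lambda>x\<in>U. f x + g x) \<in> reg X U" if o: "openin (zariski X) U" and "f \<in> reg X U" "g \<in> reg X U" for U f g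
      by (rule from'[OF o Y.reg_add[OF io[OF o] to[OF o that(2)] to[OF o that(3)]]]) auto
    show "(\<lambda>x\<in>U. f x * g x) \<in> reg X U" if o: "openin (zariski X) U" and "f \<in> reg X U" "g \<in> reg X U" for U f g
      by (rule from'[OF o Y.reg_mult[OF io[OF o] to[OF o that(2)] to[OF o that(3)]]]) auto
    show "(\<lambda>x\<in>U. inverse (f x)) \<in> reg X U" if o: "openin (zariski X) U" and "f \<in> reg X U" "\<And>x. x \<in> U \<Longrightarrow> f x \<noteq> 0" for U f
      by (rule from'[OF o Y.reg_inverse[OF io[OF o] to[OF o that(2)]]]) (use that in auto)
    show "openin (zariski X) {x \<in> U. f x \<noteq> 0}" if o: "openin (zariski X) U" and "f \<in> reg X U" for U f
    proof -
      have "openin (zariski X) (preim X \<phi> {y \<in> ?i U. (\<lambda>y\<in>?i U. f (\<psi> y)) y \<noteq> 0})"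
        by (rule fmorphism_open[OF m1 Y.open_nonzero[OF io[OF o] to[OF that]]])
      also have "preim X \<phi> {y \<in> ?i U. (\<lambda>y\<in>?i U. f (\<psi> y)) y \<noteq> 0} = {x \<in> U. f x \<noteq> 0}"
        using openin_subset[OF o] \<psi>\<phi> fmorphism_points[OF m1] by fastforce
      finally show ?thesis .
    qed
  qed
qed

section \<open>Projective varieties\<close>

lemma hom_poly_zero: "hom_poly n d (\<lambda>x. 0)"
  unfolding hom_poly_def by (rule exI[of _ "{}"]) auto

lemma hom_poly_const: "hom_poly n 0 (\<lambda>x. z)"
  unfolding hom_poly_def by (rule exI[of _ "{\<lambda>_. 0}"], rule exI[of _ "\<lambda>_. z"]) auto

lemma hom_poly_add:
  assumes "hom_poly n d p" "hom_poly n d q"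
  shows "hom_poly n d (\<lambda>x. p x + q x)"
proof -
  let ?M = "\<lambda>x \<alpha>. \<Prod>i\<le>n. x i ^ \<alpha> i :: complex"
  obtain A c where A: "finite A" "\<forall>\<alpha>\<in>A. (\<Sum>i\<le>n. \<alpha> i) = d" "p = (\<lambda>x. \<Sum>\<alpha>\<in>A. c \<alpha> * ?M x \<alpha>)"
    using assms(1) unfolding hom_poly_def by blast
  obtain B c' where B: "finite B" "\<forall>\<alpha>\<in>B. (\<Sum>i\<le>n. \<alpha> i) = d" "q = (\<lambda>x. \<Sum>\<alpha>\<in>B. c' \<alpha> * ?M x \<alpha>)"
    using assms(2) unfolding hom_poly_def by blast
  have ext: "(\<Sum>\<alpha>\<in>A \<union> B. (if \<alpha> \<in> E then e \<alpha> else 0) * ?M x \<alpha>) = (\<Sum>\<alpha>\<in>E. e \<alpha> * ?M x \<alpha>)"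
    if "E \<subseteq> A \<union> B" for E e x
    using that A(1) B(1) by (intro sum.mono_neutral_cong_right) auto
  have "(\<lambda>x. p x + q x) = (\<lambda>x. \<Sum>\<alpha>\<in>A \<union> B. ((if \<alpha> \<in> A then c \<alpha> else 0) + (if \<alpha> \<in> B then c' \<alpha> else 0)) * ?M x \<alpha>)"
    unfolding A(3) B(3) distrib_right sum.distrib by (subst (1 2) ext) auto
  then show ?thesis unfolding hom_poly_def
    using A B
    by (intro exI[of _ "A \<union> B"] exI[of _ "\<lambda>\<alpha>. (if \<alpha> \<in> A then c \<alpha> else 0) + (if \<alpha> \<in> B then c' \<alpha> else 0)"]) auto
qed

text \<open>Multiplication by a single monomial translates the exponents injectively, so no like
  terms have to be collected. The general product is then a sum of such translates.\<close>

lemma hom_poly_mult_monom: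
  assumes "hom_poly n d p" "(\<Sum>i\<le>n. \<beta> i) = e"
  shows "hom_poly n (d + e) (\<lambda>x. p x * (z * (\<Prod>i\<le>n. x i ^ \<beta> i)))"
proof -
  let ?M = "\<lambda>x \<alpha>. \<Prod>i\<le>n. x i ^ \<alpha> i :: complex"
  obtain A c where A: "finite A" "\<forall>\<alpha>\<in>A. (\<Sum>i\<le>n. \<alpha> i) = d" "p = (\<lambda>x. \<Sum>\<alpha>\<in>A. c \<alpha> * ?M x \<alpha>)"
    using assms(1) unfolding hom_poly_def by blast
  let ?s = "\<lambda>\<alpha> i. \<alpha> i + \<beta> i"
  have inj: "inj_on ?s A" by (auto simp: inj_on_def fun_eq_iff)
  have "(\<lambda>x. p x * (z * ?M x \<beta>)) = (\<lambda>x. \<Sum>\<gamma>\<in>?s ` A. (c (\<lambda>i. \<gamma> i - \<beta> i) * z) * ?M x \<gamma>)"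
    unfolding A(3) sum.reindex[OF inj] sum_distrib_right
    by (intro ext sum.cong) (auto simp: power_add prod.distrib)
  then show ?thesis unfolding hom_poly_def
    using A assms(2)
    by (intro exI[of _ "?s ` A"] exI[of _ "\<lambda>\<gamma>. c (\<lambda>i. \<gamma> i - \<beta> i) * z"]) (auto simp: sum.distrib)
qed

lemma hom_poly_mult:
  assumes p: "hom_poly n d p" and q: "hom_poly n e q"
  shows "hom_poly n (d + e) (\<lambda>x. p x * q x)"
proof -
  obtain B c where B: "finite B" "\<forall>\<alpha>\<in>B. (\<Sum>i\<le>n. \<alpha> i) = e"
    and q': "q = (\<lambda>x. \<Sum>\<alpha>\<in>B. c \<alpha> * (\<Prod>i\<le>n. x i ^ \<alpha> i))"
    using q unfolding hom_poly_def by blast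
  from B show ?thesis unfolding q'
  proof (induction B)
    case empty
    then show ?case by (simp add: hom_poly_zero)
  next
    case (insert \<beta> B)
    then show ?case
      using hom_poly_add[OF hom_poly_mult_monom[OF p, of \<beta> e "c \<beta>"], of "\<lambda>x. p x * (\<Sum>\<alpha>\<in>B. c \<alpha> * (\<Prod>i\<le>n. x i ^ \<alpha> i))"]
      by (simp add: distrib_left)
  qed
qed

lemma hom_poly_scale:
  assumes "hom_poly n d p"
  shows "p (\<lambda>i. c * x i) = c ^ d * p x"
proof -
  obtain A e where A: "finite A" "\<forall>\<alpha>\<in>A. (\<Sum>i\<le>n. \<alpha> i) = d" "p = (\<lambda>x. \<Sum>\<alpha>\<in>A. e \<alpha> * (\<Prod>i\<le>n. x i ^ \<alpha> i))"
    using assms unfolding hom_poly_def by blast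
  show ?thesis unfolding A(3) sum_distrib_left
  proof (rule sum.cong)
    fix \<alpha> assume "\<alpha> \<in> A"
    then have "(\<Prod>i\<le>n. (c * x i) ^ \<alpha> i) = c ^ d * (\<Prod>i\<le>n. x i ^ \<alpha> i)"
      using A(2) by (auto simp: power_mult_distrib prod.distrib power_sum)
    then show "e \<alpha> * (\<Prod>i\<le>n. (c * x i) ^ \<alpha> i) = c ^ d * (e \<alpha> * (\<Prod>i\<le>n. x i ^ \<alpha> i))" by simp
  qed auto
qed

lemma line_self: "x \<in> line x"
  unfolding line_def by (rule CollectI, rule exI[of _ 1]) auto

lemma line_scale:
  assumes "c \<noteq> 0"
  shows "line (\<lambda>i. c * x i) = line x"
proof (intro equalityI subsetI)
  fix y assume "y \<in> line (\<lambda>i. c * x i)"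
  then obtain a where a: "y = (\<lambda>i. a * (c * x i))" "a \<noteq> 0" unfolding line_def by auto
  show "y \<in> line x" unfolding line_def
    by (rule CollectI, rule exI[of _ "a * c"]) (use a assms in auto)
next
  fix y assume "y \<in> line x"
  then obtain a where a: "y = (\<lambda>i. a * x i)" "a \<noteq> 0" unfolding line_def by auto
  show "y \<in> line (\<lambda>i. c * x i)" unfolding line_def
    by (rule CollectI, rule exI[of _ "a / c"]) (use a assms in auto)
qed

lemma line_rep:
  assumes "q \<in> line ` hvectors n"
  shows "(SOME x. x \<in> q) \<in> hvectors n" "line (SOME x. x \<in> q) = q"
proof -
  obtain x where x: "x \<in> hvectors n" "q = line x" using assms by blast
  have "x \<in> q" unfolding x by (rule line_self)
  then have "(SOME x. x \<in> q) \<in> q" using someI[of "\<lambda>y. y \<in> q" x] by blast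
  then obtain c where c: "c \<noteq> 0" "(SOME x. x \<in> q) = (\<lambda>i. c * x i)" unfolding x line_def by auto
  show "(SOME x. x \<in> q) \<in> hvectors n" using x(1) c(1) unfolding c(2) hvectors_def by auto
  show "line (SOME x. x \<in> q) = q" by (simp only: c(2) line_scale[OF c(1)] x(2)[symmetric])
qed

text \<open>A homogeneous polynomial is scaled by a nonzero factor when the representative changes,
  so its nonvanishing can be tested on the vector chosen by \<open>SOME\<close>. Domain and function
  of a generator are thereby expressed through the same vector.\<close>

lemma line_domain:
  assumes "hom_poly n d b"
  shows "line ` {x \<in> hvectors n. b x \<noteq> 0} = {q \<in> line ` hvectors n. b (SOME x. x \<in> q) \<noteq> 0}"
proof (intro equalityI subsetI)
  fix q assume "q \<in> line ` {x \<in> hvectors n. b x \<noteq> 0}"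
  then obtain x where x: "x \<in> hvectors n" "b x \<noteq> 0" "q = line x" by blast
  have q: "q \<in> line ` hvectors n" using x by blast
  have "x \<in> line (SOME x. x \<in> q)" using line_rep(2)[OF q] x(3) line_self[of x] by simp
  then obtain c where c: "x = (\<lambda>i. c * (SOME x. x \<in> q) i)" unfolding line_def by auto
  have "b x = c ^ d * b (SOME x. x \<in> q)" by (subst c) (rule hom_poly_scale[OF assms])
  then have "b (SOME x. x \<in> q) \<noteq> 0" using x(2) by auto
  with q show "q \<in> {q \<in> line ` hvectors n. b (SOME x. x \<in> q) \<noteq> 0}" by blast
next
  fix q assume "q \<in> {q \<in> line ` hvectors n. b (SOME x. x \<in> q) \<noteq> 0}"
  then have q: "q \<in> line ` hvectors n" "b (SOME x. x \<in> q) \<noteq> 0" by auto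
  show "q \<in> line ` {x \<in> hvectors n. b x \<noteq> 0}"
    using line_rep[OF q(1)] q(2) by (intro image_eqI[of _ _ "SOME x. x \<in> q"]) auto
qed

lemma fun_space_projective_space: "fun_space (projective_space n)"
proof -
  define L where "L = line ` hvectors n"
  define r :: "(nat \<Rightarrow> complex) set \<Rightarrow> nat \<Rightarrow> complex" where "r = (\<lambda>q. SOME x. x \<in> q)"
  define D where "D = (\<lambda>b :: (nat \<Rightarrow> complex) \<Rightarrow> complex. {q \<in> L. b (r q) \<noteq> 0})"
  define Q where "Q = {(D b, \<lambda>q. a (r q) / b (r q)) | a b d. hom_poly n d a \<and> hom_poly n d b}"
  have dom: "line ` {x \<in> hvectors n. b x \<noteq> 0} = D b" if "hom_poly n d b" for b d
    unfolding line_domain[OF that] D_def L_def r_def ..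
  have eq: "projective_space n = generated_space Q"
    unfolding projective_space_def Q_def Let_def r_def[symmetric]
    apply (rule arg_cong[of _ _ generated_space], rule Collect_cong, intro ex_cong1)
    subgoal for u a b d using dom[of d b] by (auto simp: r_def)
    done
  have QE: thesis if "(E, g) \<in> Q" "\<And>a b d. E = D b \<Longrightarrow> g = (\<lambda>q. a (r q) / b (r q)) \<Longrightarrow> hom_poly n d a \<Longrightarrow> hom_poly n d b \<Longrightarrow> thesis" for E g thesis
    using that(1) unfolding Q_def by (elim CollectE exE conjE) (simp add: that(2))
  have QI: "(D b, \<lambda>q. a (r q) / b (r q)) \<in> Q" if "hom_poly n d a" "hom_poly n d b" for a b d
    unfolding Q_def by (rule CollectI, rule exI[of _ a], rule exI[of _ b], rule exI[of _ d]) (simp add: that)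
  have LQ: "x \<in> L" if "x \<in> \<Union> (fst ` Q)" for x
    using that unfolding Q_def D_def by auto
  show ?thesis unfolding eq
  proof (rule fun_space_generated)
    fix x z assume "x \<in> \<Union> (fst ` Q)"
    then have "x \<in> D (\<lambda>_. 1)" using LQ by (simp add: D_def)
    then show "\<exists>(E, k)\<in>Q. x \<in> E \<and> (\<forall>y\<in>E. k y = z)"
      using QI[OF hom_poly_const[of n z] hom_poly_const[of n 1]] by fastforce
  next
    fix E g E' g' x assume 1: "(E, g) \<in> Q" and 2: "(E', g') \<in> Q" and x: "x \<in> E \<inter> E'"
    obtain a b d where a: "E = D b" "g = (\<lambda>q. a (r q) / b (r q))" "hom_poly n d a" "hom_poly n d b" using QE[OF 1] .
    obtain a' b' d' where b: "E' = D b'" "g' = (\<lambda>q. a' (r q) / b' (r q))" "hom_poly n d' a'" "hom_poly n d' b'" using QE[OF 2] .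
    have h: "hom_poly n (d + d') (\<lambda>x. a x * b' x + b x * a' x)" "hom_poly n (d + d') (\<lambda>x. b x * b' x)"
        "hom_poly n (d + d') (\<lambda>x. a x * a' x)"
      using a b by (intro hom_poly_add hom_poly_mult; simp)+
    have DD: "D (\<lambda>x. b x * b' x) = E \<inter> E'" by (auto simp: D_def a b)
    show "\<exists>(E1, k)\<in>Q. x \<in> E1 \<and> E1 \<subseteq> E \<inter> E' \<and> (\<forall>y\<in>E1. k y = g y + g' y)"
      by (rule bexI[OF _ QI[OF h(1,2)]]) (use x in \<open>auto simp: DD\<close>, auto simp: a b D_def field_simps)
    show "\<exists>(E1, k)\<in>Q. x \<in> E1 \<and> E1 \<subseteq> E \<inter> E' \<and> (\<forall>y\<in>E1. k y = g y * g' y)"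
      by (rule bexI[OF _ QI[OF h(3,2)]]) (use x in \<open>auto simp: DD\<close>, auto simp: a b D_def field_simps)
  next
    fix E g x assume 1: "(E, g) \<in> Q" and x: "x \<in> E" "g x \<noteq> 0"
    obtain a b d where a: "E = D b" "g = (\<lambda>q. a (r q) / b (r q))" "hom_poly n d a" "hom_poly n d b" using QE[OF 1] .
    \<comment> \<open>The inverse of a / b is written as (b b) / (a b) rather than b / a: the
      denominator must vanish wherever \<open>b\<close> does, since the new domain has to lie inside
      the old one.\<close>
    have h: "hom_poly n (d + d) (\<lambda>x. b x * b x)" "hom_poly n (d + d) (\<lambda>x. a x * b x)"
      using a by (intro hom_poly_add hom_poly_mult; simp)+
    show "\<exists>(E1, k)\<in>Q. x \<in> E1 \<and> E1 \<subseteq> E \<and> (\<forall>y\<in>E1. g y \<noteq> 0 \<and> k y = inverse (g y))"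
      by (rule bexI[OF _ QI[OF h]]) (use x in \<open>auto simp: a D_def field_simps\<close>)
  qed
qed

lemma variety_fun_space: "variety X \<Longrightarrow> fun_space X"
  unfolding variety_def
  using fun_space_fiso[OF _ fun_space_subvariety[OF fun_space_projective_space]] by metis

section \<open>Products and the multiplicative group\<close>

definition bilin :: "('a, 'm) fspace_scheme \<Rightarrow> ('b, 'n) fspace_scheme \<Rightarrow> 'a set \<Rightarrow> 'b set \<Rightarrow> ('a \<times> 'b \<Rightarrow> complex) set" where
  "bilin X Y U V = {F. \<exists>(k::nat) f g. (\<forall>i<k. f i \<in> reg X U \<and> g i \<in> reg Y V) \<and>
                              F = (\<lambda>(x, y). \<Sum>i<k. f i x * g i y)}"

definition prod_gens :: "('a, 'm) fspace_scheme \<Rightarrow> ('b, 'n) fspace_scheme \<Rightarrow> (('a \<times> 'b) set \<times> ('a \<times> 'b \<Rightarrow> complex)) set" where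
  "prod_gens X Y = {({p \<in> U \<times> V. G p \<noteq> 0}, \<lambda>p. F p / G p) | U V F G.
              openin (zariski X) U \<and> openin (zariski Y) V \<and> F \<in> bilin X Y U V \<and> G \<in> bilin X Y U V}"

lemma prod_space_eq: "prod_space X Y = generated_space (prod_gens X Y)"
  unfolding prod_space_def prod_gens_def bilin_def Let_def by simp

lemma prod_gensE:
  assumes "(D, h) \<in> prod_gens X Y"
  obtains U V F G where "D = {p \<in> U \<times> V. G p \<noteq> 0}" "h = (\<lambda>p. F p / G p)"
     "openin (zariski X) U" "openin (zariski Y) V" "F \<in> bilin X Y U V" "G \<in> bilin X Y U V"
  using assms unfolding prod_gens_def by blast

lemma prod_gensI:
  assumes "openin (zariski X) U" "openin (zariski Y) V" "F \<in> bilin X Y U V" "G \<in> bilin X Y U V"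
  shows "({p \<in> U \<times> V. G p \<noteq> 0}, \<lambda>p. F p / G p) \<in> prod_gens X Y"
  using assms unfolding prod_gens_def by blast

lemma bilin_tensor:
  assumes "f \<in> reg X U" "g \<in> reg Y V"
  shows "(\<lambda>(x, y). f x * g y) \<in> bilin X Y U V"
  unfolding bilin_def using assms
  by (intro CollectI exI[of _ 1] exI[of _ "\<lambda>_. f"] exI[of _ "\<lambda>_. g"]) auto

lemma points_prod_space:
  assumes "fun_space X" "fun_space Y"
  shows "points (prod_space X Y) = points X \<times> points Y"
proof -
  interpret X: fun_space X by fact
  interpret Y: fun_space Y by fact
  show ?thesis unfolding prod_space_eq points_generated
  proof (intro equalityI subsetI)
    fix q assume "q \<in> \<Union> (fst ` prod_gens X Y)"
    then obtain D h where "(D, h) \<in> prod_gens X Y" "q \<in> D" by auto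
    then show "q \<in> points X \<times> points Y"
      by (elim prod_gensE) (auto dest: openin_subset)
  next
    fix q assume q: "q \<in> points X \<times> points Y"
    have b: "(\<lambda>(x, y). (\<lambda>x\<in>points X. 1) x * (\<lambda>x\<in>points Y. 1) y) \<in> bilin X Y (points X) (points Y)"
      by (intro bilin_tensor X.reg_const Y.reg_const) auto
    show "q \<in> \<Union> (fst ` prod_gens X Y)"
      by (rule UN_I[OF prod_gensI[OF _ _ b b]]) (use q in auto)
  qed
qed

text \<open>With \<open>y\<close> fixed, a sum of products \<open>f i x * g i y\<close> becomes a
  linear combination of the \<open>f i\<close>, and a fraction of two such sums is regular where its
  denominator does not vanish.\<close>

lemma fmorphism_slice1:
  assumes X: "fun_space X" and Y: "fun_space Y" and y: "y \<in> points Y"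
  shows "fmorphism X (prod_space X Y) (\<lambda>x. (x, y))"
proof -
  interpret X: fun_space X by fact
  have slice: "(\<lambda>x\<in>U. F (x, y)) \<in> reg X U" if "F \<in> bilin X Y U V" "openin (zariski X) U" for F U V
  proof -
    obtain k f g where F: "\<forall>i<k. f i \<in> reg X U \<and> g i \<in> reg Y V" "F = (\<lambda>(x, y). \<Sum>i<(k::nat). f i x * g i y)"
      using \<open>F \<in> bilin X Y U V\<close> unfolding bilin_def by blast
    have "(\<lambda>x\<in>U. \<Sum>i<k. g i y * f i x) \<in> reg X U"
      by (intro X.reg_sum X.reg_cmult that) (use F in auto)
    then show ?thesis unfolding F by (simp add: mult.commute)
  qed
  show ?thesis unfolding prod_space_eq
  proof (rule fmorphism_generatedI[OF X])
    show "(x, y) \<in> \<Union> (fst ` prod_gens X Y)" if "x \<in> points X" for x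
      using points_prod_space[OF X Y] that y unfolding prod_space_eq points_generated by simp
    fix D h assume "(D, h) \<in> prod_gens X Y"
    then obtain U V F G where D: "D = {p \<in> U \<times> V. G p \<noteq> 0}" "h = (\<lambda>p. F p / G p)"
     "openin (zariski X) U" "openin (zariski Y) V" "F \<in> bilin X Y U V" "G \<in> bilin X Y U V" by (rule prod_gensE)
    have "preim X (\<lambda>x. (x, y)) D = (if y \<in> V then {x \<in> U. (\<lambda>x\<in>U. G (x, y)) x \<noteq> 0} else {})"
      using openin_subset[OF D(3)] by (auto simp: D(1))
    then show o: "openin (zariski X) (preim X (\<lambda>x. (x, y)) D)"
      using X.open_nonzero[OF D(3) slice[OF D(6,3)]] by simp
    let ?E = "preim X (\<lambda>x. (x, y)) D"
    have s: "?E \<subseteq> U" by (auto simp: D(1))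
    have "(\<lambda>x\<in>?E. restrict (\<lambda>x\<in>U. F (x, y)) ?E x * (\<lambda>x\<in>?E. inverse (restrict (\<lambda>x\<in>U. G (x, y)) ?E x)) x) \<in> reg X ?E"
      by (intro X.reg_mult X.reg_inverse X.reg_restrict[OF D(3) o s] slice[OF D(5,3)] slice[OF D(6,3)] o)
        (auto simp: D(1))
    then show "(\<lambda>x\<in>?E. h (x, y)) \<in> reg X ?E"
      by (rule X.reg_cong[OF o]) (auto simp: D(1,2) field_simps)
  qed
qed

lemma fmorphism_slice2:
  assumes X: "fun_space X" and Y: "fun_space Y" and x: "x \<in> points X"
  shows "fmorphism Y (prod_space X Y) (\<lambda>y. (x, y))"
proof -
  interpret Y: fun_space Y by fact
  have slice: "(\<lambda>y\<in>V. F (x, y)) \<in> reg Y V" if "F \<in> bilin X Y U V" "openin (zariski Y) V" for F U V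
  proof -
    obtain k f g where F: "\<forall>i<k. f i \<in> reg X U \<and> g i \<in> reg Y V" "F = (\<lambda>(x, y). \<Sum>i<(k::nat). f i x * g i y)"
      using \<open>F \<in> bilin X Y U V\<close> unfolding bilin_def by blast
    have "(\<lambda>y\<in>V. \<Sum>i<k. f i x * g i y) \<in> reg Y V"
      by (intro Y.reg_sum Y.reg_cmult that) (use F in auto)
    then show ?thesis unfolding F by simp
  qed
  show ?thesis unfolding prod_space_eq
  proof (rule fmorphism_generatedI[OF Y])
    show "(x, y) \<in> \<Union> (fst ` prod_gens X Y)" if "y \<in> points Y" for y
      using points_prod_space[OF X Y] that x unfolding prod_space_eq points_generated by simp
    fix D h assume "(D, h) \<in> prod_gens X Y"
    then obtain U V F G where D: "D = {p \<in> U \<times> V. G p \<noteq> 0}" "h = (\<lambda>p. F p / G p)"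
     "openin (zariski X) U" "openin (zariski Y) V" "F \<in> bilin X Y U V" "G \<in> bilin X Y U V" by (rule prod_gensE)
    have "preim Y (\<lambda>y. (x, y)) D = (if x \<in> U then {y \<in> V. (\<lambda>y\<in>V. G (x, y)) y \<noteq> 0} else {})"
      using openin_subset[OF D(4)] by (auto simp: D(1))
    then show o: "openin (zariski Y) (preim Y (\<lambda>y. (x, y)) D)"
      using Y.open_nonzero[OF D(4) slice[OF D(6,4)]] by simp
    let ?E = "preim Y (\<lambda>y. (x, y)) D"
    have s: "?E \<subseteq> V" by (auto simp: D(1))
    have "(\<lambda>y\<in>?E. restrict (\<lambda>y\<in>V. F (x, y)) ?E y * (\<lambda>y\<in>?E. inverse (restrict (\<lambda>y\<in>V. G (x, y)) ?E y)) y) \<in> reg Y ?E"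
      by (intro Y.reg_mult Y.reg_inverse Y.reg_restrict[OF D(4) o s] slice[OF D(5,4)] slice[OF D(6,4)] o)
        (auto simp: D(1))
    then show "(\<lambda>y\<in>?E. h (x, y)) \<in> reg Y ?E"
      by (rule Y.reg_cong[OF o]) (auto simp: D(1,2) field_simps)
  qed
qed

section \<open>The multiplicative group\<close>

definition Gm_gens :: "(complex set \<times> (complex \<Rightarrow> complex)) set" where
  "Gm_gens = {({z. z \<noteq> 0 \<and> poly q z \<noteq> 0}, \<lambda>z. poly p z / poly q z) | p q. True}"

lemma Gm_eq: "Gm = generated_space Gm_gens"
  by (simp add: Gm_def Gm_gens_def)

lemma Gm_gensI: "({z. z \<noteq> 0 \<and> poly q z \<noteq> 0}, \<lambda>z. poly p z / poly q z) \<in> Gm_gens"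
  unfolding Gm_gens_def by blast

lemma Gm_gensE:
  assumes "(D, g) \<in> Gm_gens"
  obtains p q where "D = {z. z \<noteq> 0 \<and> poly q z \<noteq> 0}" "g = (\<lambda>z. poly p z / poly q z)"
  using assms unfolding Gm_gens_def by blast

lemma points_Gm: "points Gm = - {0}"
proof -
  have "x \<in> \<Union> (fst ` Gm_gens)" if "x \<noteq> 0" for x
    by (rule UN_I[OF Gm_gensI[of 1 1]]) (use that in simp)
  moreover have "x \<noteq> 0" if "x \<in> \<Union> (fst ` Gm_gens)" for x
    using that unfolding Gm_gens_def by auto
  ultimately show ?thesis unfolding Gm_eq points_generated by blast
qed

lemma fun_space_Gm: "fun_space Gm"
  unfolding Gm_eq
proof (rule fun_space_generated, goal_cases)
  case (1 x z)
  then show ?case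
    by (intro bexI[OF _ Gm_gensI[of 1 "[:z:]"]]) (auto simp: Gm_gens_def)
next
  case (2 D g D' g' x)
  obtain p q where e: "D = {z. z \<noteq> 0 \<and> poly q z \<noteq> 0}" "g = (\<lambda>z. poly p z / poly q z)"
    using Gm_gensE[OF 2(1)] .
  obtain p' q' where e': "D' = {z. z \<noteq> 0 \<and> poly q' z \<noteq> 0}" "g' = (\<lambda>z. poly p' z / poly q' z)"
    using Gm_gensE[OF 2(2)] .
  show ?case
    by (rule bexI[OF _ Gm_gensI[of "q * q'" "p * q' + p' * q"]])
      (use 2(3) in \<open>auto simp: field_simps e e'\<close>)
next
  case (3 D g D' g' x)
  obtain p q where e: "D = {z. z \<noteq> 0 \<and> poly q z \<noteq> 0}" "g = (\<lambda>z. poly p z / poly q z)"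
    using Gm_gensE[OF 3(1)] .
  obtain p' q' where e': "D' = {z. z \<noteq> 0 \<and> poly q' z \<noteq> 0}" "g' = (\<lambda>z. poly p' z / poly q' z)"
    using Gm_gensE[OF 3(2)] .
  show ?case
    by (rule bexI[OF _ Gm_gensI[of "q * q'" "p * p'"]])
      (use 3(3) in \<open>auto simp: field_simps e e'\<close>)
next
  case (4 D g x)
  obtain p q where e: "D = {z. z \<noteq> 0 \<and> poly q z \<noteq> 0}" "g = (\<lambda>z. poly p z / poly q z)" using Gm_gensE[OF 4(1)] .
  show ?case
    by (rule bexI[OF _ Gm_gensI[of "p * q" "q * q"]])
      (use 4(2,3) in \<open>auto simp: field_simps e\<close>)
qed

text \<open>A subbasic set omits only 0 and the finitely many roots of a polynomial, unless the
  polynomial is 0 and the set is empty. The alternative between empty and cofinite survives finite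
  intersections and arbitrary unions.\<close>

lemma open_Gm_cofinite:
  assumes "openin (zariski Gm) U" "U \<noteq> {}"
  shows "finite (- U)"
proof -
  have "generate_topology_on (fst ` Gm_gens) U"
    using assms(1) unfolding Gm_eq generated_space_def Let_def by (simp add: openin_topology_generated_by_iff)
  then have "U = {} \<or> finite (- U)"
  proof (induction rule: generate_topology_on.induct)
    case (Int a b)
    then show ?case by (auto simp: Compl_Int)
  next
    case (UN K)
    show ?case
    proof (cases "\<Union>K = {}")
      case False
      then obtain k where "k \<in> K" "k \<noteq> {}" by blast
      then have "finite (- k)" using UN by blast
      moreover have "- \<Union>K \<subseteq> - k" using \<open>k \<in> K\<close> by blast
      ultimately show ?thesis using finite_subset by blast
    qed simp
  next
    case (Basis s)
    then obtain q :: "complex poly" where q: "s = {z. z \<noteq> 0 \<and> poly q z \<noteq> 0}" unfolding Gm_gens_def by auto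
    show ?case
    proof (cases "q = 0")
      case False
      have "- s = insert 0 {z. poly q z = 0}" unfolding q by auto
      then show ?thesis using poly_roots_finite[OF False] by simp
    qed (simp add: q)
  qed simp
  then show ?thesis using assms by blast
qed

lemma irreducible_Gm: "irreducible_space (zariski Gm)"
  unfolding irreducible_space_def
proof (intro conjI allI impI)
  have "(1::complex) \<in> points Gm" by (simp add: points_Gm)
  then show "points Gm \<noteq> {}" by blast
  fix U V assume a: "openin (zariski Gm) U \<and> openin (zariski Gm) V \<and> U \<noteq> {} \<and> V \<noteq> {}"
  have "finite (- (U \<inter> V))" using open_Gm_cofinite[of U] open_Gm_cofinite[of V] a by (simp add: Compl_Int)
  then show "U \<inter> V \<noteq> {}" using infinite_UNIV_char_0[where 'a=complex] by (metis Compl_empty_eq)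
qed

lemma reg_Gm_local:
  assumes "f \<in> reg Gm U" "x \<in> U"
  shows "\<exists>p q W. openin (zariski Gm) W \<and> x \<in> W \<and> W \<subseteq> U \<and> (\<forall>z\<in>W. poly q z \<noteq> 0 \<and> f z = poly p z / poly q z)"
proof -
  obtain D g W where W: "(D, g) \<in> Gm_gens" "openin (zariski Gm) W" "x \<in> W" "W \<subseteq> U \<inter> D" "\<forall>y\<in>W. f y = g y"
    using assms unfolding Gm_eq reg_generated by blast
  obtain p q where e: "D = {z. z \<noteq> 0 \<and> poly q z \<noteq> 0}" "g = (\<lambda>z. poly p z / poly q z)" using Gm_gensE[OF W(1)] .
  show ?thesis by (rule exI[of _ p], rule exI[of _ q], rule exI[of _ W]) (use W e in auto)
qed

lemma reg_Gm_poly: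
  assumes U: "openin (zariski Gm) U"
  shows "(\<lambda>z\<in>U. poly p z) \<in> reg Gm U"
proof -
  have "\<exists>D g W. (D, g) \<in> Gm_gens \<and>
     openin (zariski Gm) W \<and> x \<in> W \<and> W \<subseteq> U \<inter> D \<and> (\<forall>y\<in>W. (\<lambda>z\<in>U. poly p z) y = g y)" if "x \<in> U" for x
    by (rule ex3I[of _ "{z. z \<noteq> 0 \<and> poly 1 z \<noteq> 0}" "\<lambda>z. poly p z / poly 1 z" U], intro conjI Gm_gensI U that)
      (use openin_subset[OF U] points_Gm in auto)
  then show ?thesis using Gm_eq reg_generated[of "\<lambda>z\<in>U. poly p z" Gm_gens U] by auto
qed

lemma reg_snd_Gm:
  assumes X: "fun_space X"
  shows "(\<lambda>q\<in>points (prod_space X Gm). snd q) \<in> reg (prod_space X Gm) (points (prod_space X Gm))"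
proof -
  interpret X: fun_space X by fact
  interpret Gm: fun_space Gm by (rule fun_space_Gm)
  note pp = points_prod_space[OF X fun_space_Gm]
  let ?T = "points X \<times> points Gm"
  define F where "F = (\<lambda>(x, y). (\<lambda>x\<in>points X. 1) x * (\<lambda>z\<in>points Gm. poly [:0, 1:] z) y :: complex)"
  define G where "G = (\<lambda>(x, y). (\<lambda>x\<in>points X. 1) x * (\<lambda>z\<in>points Gm. 1) y :: complex)"
  have 1: "F \<in> bilin X Gm (points X) (points Gm)" unfolding F_def
    by (intro bilin_tensor X.reg_const reg_Gm_poly) auto
  have 2: "G \<in> bilin X Gm (points X) (points Gm)" unfolding G_def
    by (intro bilin_tensor X.reg_const Gm.reg_const) auto
  have m: "({p \<in> ?T. G p \<noteq> 0}, \<lambda>p. F p / G p) \<in> prod_gens X Gm"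
    by (rule prod_gensI[OF _ _ 1 2]) auto
  have o: "openin (zariski (prod_space X Gm)) ?T" by (metis pp openin_topspace)
  have "\<exists>D g W. (D, g) \<in> prod_gens X Gm \<and> openin (zariski (prod_space X Gm)) W \<and> x \<in> W \<and> W \<subseteq> ?T \<inter> D \<and>
     (\<forall>y\<in>W. (\<lambda>q\<in>?T. snd q) y = g y)" if "x \<in> ?T" for x
    by (rule ex3I[of _ "{p \<in> ?T. G p \<noteq> 0}" "\<lambda>p. F p / G p" ?T], intro conjI m o that)
      (auto simp: F_def G_def split: if_splits)
  then have "(\<lambda>q\<in>?T. snd q) \<in> reg (prod_space X Gm) ?T"
    unfolding prod_space_eq by (subst reg_generated) auto
  then show ?thesis unfolding pp .
qed

section \<open>The function field\<close>

locale irr_space = fun_space +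
  assumes irr: "irreducible_space (zariski X)"
begin

abbreviation K where "K \<equiv> ratfuns X"

lemma nopen_Int: "nopen X U \<Longrightarrow> nopen X V \<Longrightarrow> nopen X (U \<inter> V)"
  using irr by (auto simp: nopen_def irreducible_space_def)

lemma nopen_points: "nopen X (points X)"
  using irr by (auto simp: nopen_def irreducible_space_def)

lemma nopenD: "nopen X U \<Longrightarrow> openin (zariski X) U" "nopen X U \<Longrightarrow> U \<subseteq> points X"
  by (auto simp: nopen_def dest: openin_subset)

lemma nopenI: "openin (zariski X) U \<Longrightarrow> x \<in> U \<Longrightarrow> nopen X U"
  by (auto simp: nopen_def)

text \<open>The nonvanishing locus of the difference is open; if it were nonempty, irreducibility
  would make it meet \<open>W\<close>. This identity principle is what spreads equations from one
  nonempty open set.\<close>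

lemma reg_eq_dense:
  assumes U: "openin (zariski X) U" and f: "f \<in> reg X U" and g: "g \<in> reg X U"
    and W: "nopen X W" "W \<subseteq> U" "\<And>y. y \<in> W \<Longrightarrow> f y = g y" and x: "x \<in> U"
  shows "f x = g x"
proof (rule ccontr)
  assume ne: "f x \<noteq> g x"
  define h where "h = (\<lambda>x\<in>U. f x + (\<lambda>x\<in>U. - 1 * g x) x)"
  have "h \<in> reg X U" unfolding h_def using reg_add[OF U f reg_cmult[OF U g]] .
  then have o: "openin (zariski X) {y \<in> U. h y \<noteq> 0}" using open_nonzero[OF U] by blast
  have "h x \<noteq> 0" using x ne by (simp add: h_def)
  then have "nopen X {y \<in> U. h y \<noteq> 0}" using nopenI[OF o, of x] x by blast
  from nopen_Int[OF this W(1)] have "{y \<in> U. h y \<noteq> 0} \<inter> W \<noteq> {}" by (simp add: nopen_def)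
  then obtain y where "y \<in> W" "y \<in> U" "h y \<noteq> 0" by blast
  then show False using W(3) by (simp add: h_def)
qed

lemma germ_mem_iff: "(V, g) \<in> germ X U f \<longleftrightarrow> nopen X V \<and> g \<in> reg X V \<and> (\<forall>x\<in>U \<inter> V. f x = g x)"
  by (simp add: germ_def)

text \<open>By the identity principle, agreement on any nonempty open set forces agreement on every
  overlap. This makes the relation between representatives transitive, so that a class is the same
  set whichever member it is formed from.\<close>

lemma germ_eqI:
  assumes U: "nopen X U" "f \<in> reg X U" and V: "nopen X V" "g \<in> reg X V"
    and W: "nopen X W" "W \<subseteq> U \<inter> V" "\<And>x. x \<in> W \<Longrightarrow> f x = g x"
  shows "germ X U f = germ X V g"
proof -
  have main: "germ X U f \<subseteq> germ X V g"
    if U: "nopen X U" "f \<in> reg X U" and V: "nopen X V" "g \<in> reg X V"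
    and W: "nopen X W" "W \<subseteq> U \<inter> V" "\<And>x. x \<in> W \<Longrightarrow> f x = g x" for U V W f g
  proof
    fix p assume "p \<in> germ X U f"
    then obtain T h where p: "p = (T, h)" and T: "nopen X T" "h \<in> reg X T" "\<forall>x\<in>U \<inter> T. f x = h x"
      by (cases p) (auto simp: germ_mem_iff)
    have o: "openin (zariski X) (V \<inter> T)" using V T nopenD by blast
    have "g x = h x" if x: "x \<in> V \<inter> T" for x
    proof -
      have "restrict g (V \<inter> T) x = restrict h (V \<inter> T) x"
      proof (rule reg_eq_dense[OF o _ _ _ _ _ x])
        show "restrict g (V \<inter> T) \<in> reg X (V \<inter> T)" "restrict h (V \<inter> T) \<in> reg X (V \<inter> T)"
          using reg_restrict[OF nopenD(1)[OF V(1)] o _ V(2)] reg_restrict[OF nopenD(1)[OF T(1)] o _ T(2)] by auto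
        show "nopen X (W \<inter> T)" using W T nopen_Int by blast
        fix y assume y: "y \<in> W \<inter> T"
        then have "f y = g y" "f y = h y" using W(2) W(3)[of y] T(3) by auto
        then show "restrict g (V \<inter> T) y = restrict h (V \<inter> T) y" using y W(2) by auto
      qed (use W in auto)
      then show ?thesis using x by simp
    qed
    then show "p \<in> germ X V g" unfolding p germ_mem_iff using T by blast
  qed
  show ?thesis
    using main[OF U V W] main[OF V U W(1)] W by (auto simp: Int_commute)
qed

lemma germ_self: "nopen X U \<Longrightarrow> f \<in> reg X U \<Longrightarrow> (U, f) \<in> germ X U f"
  by (simp add: germ_mem_iff)

lemma germ_restrict:
  assumes "nopen X U" "f \<in> reg X U" "nopen X V" "V \<subseteq> U"
  shows "germ X V (restrict f V) = germ X U f"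
  using assms(4) reg_restrict[OF nopenD(1)[OF assms(1)] nopenD(1)[OF assms(3)] assms(4,2)]
  by (intro germ_eqI[OF assms(3) _ assms(1,2) assms(3)]) auto

lemma carrier_iff: "k \<in> carrier K \<longleftrightarrow> (\<exists>U f. nopen X U \<and> f \<in> reg X U \<and> k = germ X U f)"
  by (auto simp: ratfuns_def)

lemma germ_carrier: "nopen X U \<Longrightarrow> f \<in> reg X U \<Longrightarrow> germ X U f \<in> carrier K"
  by (auto simp: carrier_iff)

lemma germ_eq_of_mem:
  assumes "nopen X U" "f \<in> reg X U" "(V, g) \<in> germ X U f"
  shows "germ X V g = germ X U f"
  using assms nopen_Int
  by (intro germ_eqI[where W = "U \<inter> V"]) (auto simp: germ_mem_iff)

lemma carrier_mem:
  assumes "k \<in> carrier K" "(V, g) \<in> k"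
  shows "nopen X V" "g \<in> reg X V" "k = germ X V g"
proof -
  obtain U f where u: "nopen X U" "f \<in> reg X U" "k = germ X U f" using assms(1) carrier_iff by blast
  show "nopen X V" "g \<in> reg X V" using assms(2) unfolding u germ_mem_iff by auto
  show "k = germ X V g" using germ_eq_of_mem[OF u(1,2)] assms(2) unfolding u by simp
qed

text \<open>The field operations are defined as unions over all pairs of representatives. All
  members of such a union are one and the same class, which is therefore the union.\<close>

lemma binop_germ:
  assumes U: "nopen X U" "f \<in> reg X U" and V: "nopen X V" "g \<in> reg X V"
    and op: "\<And>U f g. openin (zariski X) U \<Longrightarrow> f \<in> reg X U \<Longrightarrow> g \<in> reg X U \<Longrightarrow> (\<lambda>x\<in>U. op (f x) (g x)) \<in> reg X U"
  shows "(\<Union>(U', f')\<in>germ X U f. \<Union>(V', g')\<in>germ X V g. germ X (U' \<inter> V') (\<lambda>x\<in>U' \<inter> V'. op (f' x) (g' x)))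
     = germ X (U \<inter> V) (\<lambda>x\<in>U \<inter> V. op (f x) (g x))"
proof -
  have r: "(\<lambda>x\<in>U \<inter> V. op (f x) (g x)) \<in> reg X (U \<inter> V)"
    if "nopen X U" "f \<in> reg X U" "nopen X V" "g \<in> reg X V" for U V f g
  proof -
    have o: "openin (zariski X) (U \<inter> V)" using that nopenD by blast
    have "(\<lambda>x\<in>U \<inter> V. op (restrict f (U \<inter> V) x) (restrict g (U \<inter> V) x)) \<in> reg X (U \<inter> V)"
      using op[OF o reg_restrict[OF nopenD(1) o] reg_restrict[OF nopenD(1) o]] that by auto
    then show ?thesis by (rule reg_cong[OF o]) auto
  qed
  have "germ X (U' \<inter> V') (\<lambda>x\<in>U' \<inter> V'. op (f' x) (g' x)) = germ X (U \<inter> V) (\<lambda>x\<in>U \<inter> V. op (f x) (g x))"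
    if a: "(U', f') \<in> germ X U f" "(V', g') \<in> germ X V g" for U' V' f' g'
  proof (rule germ_eqI)
    show "nopen X ((U \<inter> V) \<inter> (U' \<inter> V'))" using that U V by (intro nopen_Int) (auto simp: germ_mem_iff)
  qed (use that U V in \<open>auto simp: germ_mem_iff intro!: r nopen_Int\<close>)
  then show ?thesis using germ_self[OF U] germ_self[OF V] by blast
qed

lemma mult_germ:
  assumes "nopen X U" "f \<in> reg X U" "nopen X V" "g \<in> reg X V"
  shows "germ X U f \<otimes>\<^bsub>K\<^esub> germ X V g = germ X (U \<inter> V) (\<lambda>x\<in>U \<inter> V. f x * g x)"
  using binop_germ[OF assms, of "(*)"] reg_mult by (simp add: ratfuns_def)

lemma add_germ:
  assumes "nopen X U" "f \<in> reg X U" "nopen X V" "g \<in> reg X V"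
  shows "germ X U f \<oplus>\<^bsub>K\<^esub> germ X V g = germ X (U \<inter> V) (\<lambda>x\<in>U \<inter> V. f x + g x)"
  using binop_germ[OF assms, of "(+)"] reg_add by (simp add: ratfuns_def)

lemma germ_common3:
  assumes "k \<in> carrier K" "l \<in> carrier K" "m \<in> carrier K"
  obtains U f g h where "nopen X U" "f \<in> reg X U" "g \<in> reg X U" "h \<in> reg X U"
    "k = germ X U f" "l = germ X U g" "m = germ X U h"
proof -
  obtain U1 f1 where 1: "nopen X U1" "f1 \<in> reg X U1" "k = germ X U1 f1" using assms carrier_iff by blast
  obtain U2 f2 where 2: "nopen X U2" "f2 \<in> reg X U2" "l = germ X U2 f2" using assms carrier_iff by blast
  obtain U3 f3 where 3: "nopen X U3" "f3 \<in> reg X U3" "m = germ X U3 f3" using assms carrier_iff by blast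
  let ?U = "U1 \<inter> U2 \<inter> U3"
  have o: "nopen X ?U" using 1 2 3 nopen_Int by blast
  have s: "?U \<subseteq> U1" "?U \<subseteq> U2" "?U \<subseteq> U3" by auto
  show thesis
  proof (rule that[OF o])
    show "restrict f1 ?U \<in> reg X ?U" using reg_restrict[OF nopenD(1)[OF 1(1)] nopenD(1)[OF o] s(1) 1(2)] .
    show "restrict f2 ?U \<in> reg X ?U" using reg_restrict[OF nopenD(1)[OF 2(1)] nopenD(1)[OF o] s(2) 2(2)] .
    show "restrict f3 ?U \<in> reg X ?U" using reg_restrict[OF nopenD(1)[OF 3(1)] nopenD(1)[OF o] s(3) 3(2)] .
    show "k = germ X ?U (restrict f1 ?U)" using germ_restrict[OF 1(1,2) o s(1)] 1(3) by simp
    show "l = germ X ?U (restrict f2 ?U)" using germ_restrict[OF 2(1,2) o s(2)] 2(3) by simp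
    show "m = germ X ?U (restrict f3 ?U)" using germ_restrict[OF 3(1,2) o s(3)] 3(3) by simp
  qed
qed

lemma const_germ:
  assumes "nopen X U"
  shows "const_rat X z = germ X U (\<lambda>x\<in>U. z)"
  unfolding const_rat_def
  by (rule germ_eqI[OF nopen_points _ assms _ assms]) (use assms nopenD reg_const in auto)

lemma one_germ: "nopen X U \<Longrightarrow> \<one>\<^bsub>K\<^esub> = germ X U (\<lambda>x\<in>U. 1)"
  using const_germ[of U 1] by (simp add: ratfuns_def)

lemma zero_germ: "nopen X U \<Longrightarrow> \<zero>\<^bsub>K\<^esub> = germ X U (\<lambda>x\<in>U. 0)"
  using const_germ[of U 0] by (simp add: ratfuns_def)

lemma reg_uminus: "openin (zariski X) U \<Longrightarrow> f \<in> reg X U \<Longrightarrow> (\<lambda>x\<in>U. - f x) \<in> reg X U"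
  using reg_cmult[of U f "-1"] by simp

text \<open>The ring laws are checked on a common domain. A nonzero class is nonzero at some point
  of its domain, so its nonvanishing locus is a nonempty open set on which the pointwise inverse is
  regular.\<close>

lemma field_K: "field K"
proof -
  have add_same: "germ X U f \<oplus>\<^bsub>K\<^esub> germ X U g = germ X U (\<lambda>x\<in>U. f x + g x)"
    if "nopen X U" "f \<in> reg X U" "g \<in> reg X U" for U f g
    using add_germ[OF that(1,2,1,3)] by simp
  have mult_same: "germ X U f \<otimes>\<^bsub>K\<^esub> germ X U g = germ X U (\<lambda>x\<in>U. f x * g x)"
    if "nopen X U" "f \<in> reg X U" "g \<in> reg X U" for U f g
    using mult_germ[OF that(1,2,1,3)] by simp
  have ra: "(\<lambda>x\<in>U. f x + g x) \<in> reg X U" if "nopen X U" "f \<in> reg X U" "g \<in> reg X U" for U f g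
    using reg_add that nopenD by blast
  have rm: "(\<lambda>x\<in>U. f x * g x) \<in> reg X U" if "nopen X U" "f \<in> reg X U" "g \<in> reg X U" for U f g
    using reg_mult that nopenD by blast
  have rc: "(\<lambda>x\<in>U. z) \<in> reg X U" if "nopen X U" for U z using reg_const that nopenD by blast
  have reqI: "germ X U f = germ X U g" if "\<And>x. x \<in> U \<Longrightarrow> f x = g x" for U f g
    using that by (auto simp: germ_def)
  have ab: "abelian_group K"
  proof (rule abelian_groupI)
    fix x y assume "x \<in> carrier K" "y \<in> carrier K"
    then obtain U f g h where u: "nopen X U" "f \<in> reg X U" "g \<in> reg X U" "x = germ X U f" "y = germ X U g"
      using germ_common3[of x y x] by metis
    show "x \<oplus>\<^bsub>K\<^esub> y \<in> carrier K" unfolding u add_same[OF u(1-3)] using germ_carrier u ra by blast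
    show "x \<oplus>\<^bsub>K\<^esub> y = y \<oplus>\<^bsub>K\<^esub> x" unfolding u add_same[OF u(1,2,3)] add_same[OF u(1,3,2)]
      by (rule reqI) auto
  next
    show "\<zero>\<^bsub>K\<^esub> \<in> carrier K" using zero_germ[OF nopen_points] germ_carrier rc nopen_points by metis
  next
    fix x y z assume "x \<in> carrier K" "y \<in> carrier K" "z \<in> carrier K"
    then obtain U f g h where u: "nopen X U" "f \<in> reg X U" "g \<in> reg X U" "h \<in> reg X U"
       "x = germ X U f" "y = germ X U g" "z = germ X U h"
      using germ_common3[of x y z] by metis
    show "x \<oplus>\<^bsub>K\<^esub> y \<oplus>\<^bsub>K\<^esub> z = x \<oplus>\<^bsub>K\<^esub> (y \<oplus>\<^bsub>K\<^esub> z)"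
      using u ra by (simp add: add_same del: restrict_apply, intro reqI, auto simp: algebra_simps)
  next
    fix x assume "x \<in> carrier K"
    then obtain U f where u: "nopen X U" "f \<in> reg X U" "x = germ X U f" using carrier_iff by blast
    show "\<zero>\<^bsub>K\<^esub> \<oplus>\<^bsub>K\<^esub> x = x" unfolding zero_germ[OF u(1)] u(3)
      using u rc by (simp add: add_same del: restrict_apply, intro reqI, auto simp: algebra_simps)
    have "germ X U (\<lambda>x\<in>U. - f x) \<oplus>\<^bsub>K\<^esub> x = \<zero>\<^bsub>K\<^esub>" unfolding zero_germ[OF u(1)] u(3)
      using u reg_uminus nopenD by (simp add: add_same del: restrict_apply, intro reqI, auto simp: algebra_simps)
    then show "\<exists>y\<in>carrier K. y \<oplus>\<^bsub>K\<^esub> x = \<zero>\<^bsub>K\<^esub>"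
      using germ_carrier[OF u(1)] reg_uminus[OF nopenD(1)[OF u(1)] u(2)] by blast
  qed
  have cm: "comm_monoid K"
  proof (rule comm_monoidI)
    fix x y assume "x \<in> carrier K" "y \<in> carrier K"
    then obtain U f g h where u: "nopen X U" "f \<in> reg X U" "g \<in> reg X U" "x = germ X U f" "y = germ X U g"
      using germ_common3[of x y x] by metis
    show "x \<otimes>\<^bsub>K\<^esub> y \<in> carrier K" unfolding u mult_same[OF u(1-3)] using germ_carrier u rm by blast
    show "x \<otimes>\<^bsub>K\<^esub> y = y \<otimes>\<^bsub>K\<^esub> x" unfolding u mult_same[OF u(1,2,3)] mult_same[OF u(1,3,2)]
      by (rule reqI) auto
  next
    show "\<one>\<^bsub>K\<^esub> \<in> carrier K" using one_germ[OF nopen_points] germ_carrier rc nopen_points by metis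
  next
    fix x y z assume "x \<in> carrier K" "y \<in> carrier K" "z \<in> carrier K"
    then obtain U f g h where u: "nopen X U" "f \<in> reg X U" "g \<in> reg X U" "h \<in> reg X U"
       "x = germ X U f" "y = germ X U g" "z = germ X U h"
      using germ_common3[of x y z] by metis
    show "x \<otimes>\<^bsub>K\<^esub> y \<otimes>\<^bsub>K\<^esub> z = x \<otimes>\<^bsub>K\<^esub> (y \<otimes>\<^bsub>K\<^esub> z)"
      using u rm by (simp add: mult_same del: restrict_apply, intro reqI, auto simp: algebra_simps)
  next
    fix x assume "x \<in> carrier K"
    then obtain U f where u: "nopen X U" "f \<in> reg X U" "x = germ X U f" using carrier_iff by blast
    show "\<one>\<^bsub>K\<^esub> \<otimes>\<^bsub>K\<^esub> x = x" unfolding one_germ[OF u(1)] u(3)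
      using u rc by (simp add: mult_same del: restrict_apply, intro reqI, auto simp: algebra_simps)
  qed
  have cring: "cring K"
  proof (rule cringI[OF ab cm])
    fix x y z assume "x \<in> carrier K" "y \<in> carrier K" "z \<in> carrier K"
    then obtain U f g h where u: "nopen X U" "f \<in> reg X U" "g \<in> reg X U" "h \<in> reg X U"
       "x = germ X U f" "y = germ X U g" "z = germ X U h"
      using germ_common3[of x y z] by metis
    show "(x \<oplus>\<^bsub>K\<^esub> y) \<otimes>\<^bsub>K\<^esub> z = x \<otimes>\<^bsub>K\<^esub> z \<oplus>\<^bsub>K\<^esub> y \<otimes>\<^bsub>K\<^esub> z"
      using u rm ra by (simp add: mult_same add_same del: restrict_apply, intro reqI, auto simp: algebra_simps)
  qed
  have ne: "\<one>\<^bsub>K\<^esub> \<noteq> \<zero>\<^bsub>K\<^esub>"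
  proof
    assume "\<one>\<^bsub>K\<^esub> = \<zero>\<^bsub>K\<^esub>"
    then have "(points X, \<lambda>x\<in>points X. 1) \<in> germ X (points X) (\<lambda>x\<in>points X. 0)"
      using one_germ[OF nopen_points] zero_germ[OF nopen_points] germ_self[OF nopen_points rc[OF nopen_points]] by metis
    then show False using nopen_points by (auto simp: germ_mem_iff nopen_def)
  qed
  show ?thesis
  proof (rule cring.cring_fieldI[OF cring])
    interpret cring K by (rule cring)
    show "Units K = carrier K - {\<zero>\<^bsub>K\<^esub>}"
    proof (intro equalityI subsetI)
      fix x assume x: "x \<in> Units K"
      then have "x \<noteq> \<zero>\<^bsub>K\<^esub>" using ne by (auto simp: Units_def)
      then show "x \<in> carrier K - {\<zero>\<^bsub>K\<^esub>}" using x by auto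
    next
      fix x assume x: "x \<in> carrier K - {\<zero>\<^bsub>K\<^esub>}"
      then obtain U f where u: "nopen X U" "f \<in> reg X U" "x = germ X U f" using carrier_iff by blast
      let ?V = "{y \<in> U. f y \<noteq> 0}"
      have o: "openin (zariski X) ?V" using open_nonzero[OF nopenD(1)[OF u(1)] u(2)] .
      have "?V \<noteq> {}"
      proof
        assume "?V = {}"
        then have "x = \<zero>\<^bsub>K\<^esub>" unfolding zero_germ[OF u(1)] u(3) by (intro reqI) auto
        with x show False by simp
      qed
      then have V: "nopen X ?V" using o by (simp add: nopen_def)
      have r: "restrict f ?V \<in> reg X ?V" using reg_restrict[OF nopenD(1)[OF u(1)] o _ u(2)] by auto
      have x': "x = germ X ?V (restrict f ?V)" using germ_restrict[OF u(1,2) V] u(3) by auto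
      have i: "(\<lambda>y\<in>?V. inverse (restrict f ?V y)) \<in> reg X ?V" by (rule reg_inverse[OF o r]) auto
      have "x \<otimes>\<^bsub>K\<^esub> germ X ?V (\<lambda>y\<in>?V. inverse (restrict f ?V y)) = \<one>\<^bsub>K\<^esub>"
        unfolding x' mult_same[OF V r i] one_germ[OF V] by (rule reqI) auto
      then show "x \<in> Units K"
        using x germ_carrier[OF V i] m_comm[of x "germ X ?V (\<lambda>y\<in>?V. inverse (restrict f ?V y))"]
        unfolding Units_def by auto
    qed
  qed
qed

end

sublocale irr_space \<subseteq> K: field K
  by (rule field_K)

context irr_space
begin

section \<open>Stalks and values\<close>

definition stalk :: "'a \<Rightarrow> 'a ratfun set" where
  "stalk c = {k \<in> carrier K. \<exists>V g. (V, g) \<in> k \<and> c \<in> V}"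

text \<open>Members of one class agree wherever both are defined, so for \<open>k\<close> in
  \<open>stalk c\<close> the choice does not matter. For other \<open>k\<close> the value is
  unspecified.\<close>

definition ev :: "'a \<Rightarrow> 'a ratfun \<Rightarrow> complex" where
  "ev c k = (SOME y. \<exists>V g. (V, g) \<in> k \<and> c \<in> V \<and> y = g c)"

lemma stalk_carrier [simp, intro]: "k \<in> stalk c \<Longrightarrow> k \<in> carrier K"
  by (simp add: stalk_def)

lemma stalk_germ:
  assumes "nopen X U" "f \<in> reg X U" "c \<in> U"
  shows "germ X U f \<in> stalk c"
  unfolding stalk_def using germ_carrier[OF assms(1,2)] germ_self[OF assms(1,2)] assms(3) by blast

lemma ev_germ:
  assumes "nopen X U" "f \<in> reg X U" "c \<in> U"
  shows "ev c (germ X U f) = f c"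
proof -
  have "\<exists>y V g. (V, g) \<in> germ X U f \<and> c \<in> V \<and> y = g c" using germ_self[OF assms(1,2)] assms(3) by blast
  then have "\<exists>V g. (V, g) \<in> germ X U f \<and> c \<in> V \<and> ev c (germ X U f) = g c"
    unfolding ev_def by (rule someI_ex)
  then show ?thesis using assms(3) by (auto simp: germ_mem_iff)
qed

lemma stalkE:
  assumes "k \<in> stalk c"
  obtains U f where "nopen X U" "c \<in> U" "f \<in> reg X U" "k = germ X U f"
proof -
  obtain V g where "(V, g) \<in> k" "c \<in> V" "k \<in> carrier K" using assms unfolding stalk_def by blast
  then show thesis using that carrier_mem[of k V g] by blast
qed

lemma stalk_points: "k \<in> stalk c \<Longrightarrow> c \<in> points X"
  by (elim stalkE) (use nopenD in blast)

lemma stalk_open: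
  assumes "k \<in> stalk c"
  obtains V where "openin (zariski X) V" "c \<in> V" "\<And>d. d \<in> V \<Longrightarrow> k \<in> stalk d"
proof -
  obtain U f where u: "nopen X U" "c \<in> U" "f \<in> reg X U" "k = germ X U f" using stalkE[OF assms] .
  show thesis by (rule that[of U]) (use u stalk_germ nopenD in auto)
qed

lemma stalk_generic:
  assumes "k \<in> carrier K"
  obtains U where "nopen X U" "\<And>c. c \<in> U \<Longrightarrow> k \<in> stalk c"
proof -
  obtain U f where u: "nopen X U" "f \<in> reg X U" "k = germ X U f" using assms carrier_iff by blast
  show thesis by (rule that[OF u(1)]) (use stalk_germ[OF u(1,2)] u(3) in simp)
qed

text \<open>Identities in the function field are verified through values. Unspecified values do no
  harm, because \<open>W\<close> can be intersected with a common domain of the two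
  functions.\<close>

lemma ev_eqI:
  assumes "k \<in> carrier K" "l \<in> carrier K" "nopen X W" "\<And>c. c \<in> W \<Longrightarrow> ev c k = ev c l"
  shows "k = l"
proof -
  obtain U f g where u: "nopen X U" "f \<in> reg X U" "g \<in> reg X U" "k = germ X U f" "l = germ X U g"
    using germ_common3[OF assms(1,2,2)] by metis
  show ?thesis unfolding u(4,5)
  proof (rule germ_eqI[OF u(1,2) u(1,3) nopen_Int[OF u(1) assms(3)]])
    fix x assume x: "x \<in> U \<inter> W"
    then show "f x = g x" using assms(4)[of x] ev_germ[OF u(1,2)] ev_germ[OF u(1,3)] u by auto
  qed auto
qed

lemma stalk_add:
  assumes "k \<in> stalk c" "l \<in> stalk c"
  shows "k \<oplus>\<^bsub>K\<^esub> l \<in> stalk c" "ev c (k \<oplus>\<^bsub>K\<^esub> l) = ev c k + ev c l"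
proof -
  obtain U f where u: "nopen X U" "c \<in> U" "f \<in> reg X U" "k = germ X U f" using stalkE[OF assms(1)] .
  obtain V g where v: "nopen X V" "c \<in> V" "g \<in> reg X V" "l = germ X V g" using stalkE[OF assms(2)] .
  have o: "nopen X (U \<inter> V)" using u v nopen_Int by blast
  have r: "restrict f (U \<inter> V) \<in> reg X (U \<inter> V)" "restrict g (U \<inter> V) \<in> reg X (U \<inter> V)"
    using reg_restrict[OF nopenD(1)[OF u(1)] nopenD(1)[OF o] _ u(3)] reg_restrict[OF nopenD(1)[OF v(1)] nopenD(1)[OF o] _ v(3)] by auto
  have "(\<lambda>x\<in>U \<inter> V. f x + g x) \<in> reg X (U \<inter> V)"
    by (rule reg_cong[OF nopenD(1)[OF o] reg_add[OF nopenD(1)[OF o] r]]) auto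
  then show "k \<oplus>\<^bsub>K\<^esub> l \<in> stalk c" "ev c (k \<oplus>\<^bsub>K\<^esub> l) = ev c k + ev c l"
    unfolding u(4) v(4) add_germ[OF u(1,3) v(1,3)]
    using stalk_germ[OF o] ev_germ[OF o] ev_germ[OF u(1,3)] ev_germ[OF v(1,3)] u(2) v(2) by auto
qed

lemma stalk_mult:
  assumes "k \<in> stalk c" "l \<in> stalk c"
  shows "k \<otimes>\<^bsub>K\<^esub> l \<in> stalk c" "ev c (k \<otimes>\<^bsub>K\<^esub> l) = ev c k * ev c l"
proof -
  obtain U f where u: "nopen X U" "c \<in> U" "f \<in> reg X U" "k = germ X U f" using stalkE[OF assms(1)] .
  obtain V g where v: "nopen X V" "c \<in> V" "g \<in> reg X V" "l = germ X V g" using stalkE[OF assms(2)] .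
  have o: "nopen X (U \<inter> V)" using u v nopen_Int by blast
  have r: "restrict f (U \<inter> V) \<in> reg X (U \<inter> V)" "restrict g (U \<inter> V) \<in> reg X (U \<inter> V)"
    using reg_restrict[OF nopenD(1)[OF u(1)] nopenD(1)[OF o] _ u(3)] reg_restrict[OF nopenD(1)[OF v(1)] nopenD(1)[OF o] _ v(3)] by auto
  have "(\<lambda>x\<in>U \<inter> V. f x * g x) \<in> reg X (U \<inter> V)"
    by (rule reg_cong[OF nopenD(1)[OF o] reg_mult[OF nopenD(1)[OF o] r]]) auto
  then show "k \<otimes>\<^bsub>K\<^esub> l \<in> stalk c" "ev c (k \<otimes>\<^bsub>K\<^esub> l) = ev c k * ev c l"
    unfolding u(4) v(4) mult_germ[OF u(1,3) v(1,3)]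
    using stalk_germ[OF o] ev_germ[OF o] ev_germ[OF u(1,3)] ev_germ[OF v(1,3)] u(2) v(2) by auto
qed

lemma stalk_const:
  assumes "c \<in> points X"
  shows "const_rat X z \<in> stalk c" "ev c (const_rat X z) = z"
  using stalk_germ[OF nopen_points reg_const assms, of z] ev_germ[OF nopen_points reg_const assms, of z] assms
  by (auto simp: const_rat_def)

lemma const_1: "const_rat X 1 = \<one>\<^bsub>K\<^esub>" and const_0: "const_rat X 0 = \<zero>\<^bsub>K\<^esub>"
  by (auto simp: ratfuns_def)

lemma const_carrier [simp, intro]: "const_rat X z \<in> carrier K"
  unfolding const_rat_def by (rule germ_carrier[OF nopen_points reg_const]) simp

lemma stalk_one: "c \<in> points X \<Longrightarrow> \<one>\<^bsub>K\<^esub> \<in> stalk c" "c \<in> points X \<Longrightarrow> ev c \<one>\<^bsub>K\<^esub> = 1"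
  using stalk_const[of c 1] by (auto simp: const_1)

lemma stalk_zero: "c \<in> points X \<Longrightarrow> \<zero>\<^bsub>K\<^esub> \<in> stalk c" "c \<in> points X \<Longrightarrow> ev c \<zero>\<^bsub>K\<^esub> = 0"
  using stalk_const[of c 0] by (auto simp: const_0)

lemma stalk_uminus:
  assumes "k \<in> stalk c"
  shows "\<ominus>\<^bsub>K\<^esub> k \<in> stalk c" "ev c (\<ominus>\<^bsub>K\<^esub> k) = - ev c k"
proof -
  note c = stalk_points[OF assms]
  have "const_rat X (-1) \<oplus>\<^bsub>K\<^esub> \<one>\<^bsub>K\<^esub> = \<zero>\<^bsub>K\<^esub>"
    by (rule ev_eqI[OF _ _ nopen_points]) (use stalk_add(2) stalk_const stalk_one stalk_zero in simp_all)
  then have "\<ominus>\<^bsub>K\<^esub> \<one>\<^bsub>K\<^esub> = const_rat X (-1)"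
    by (simp add: K.minus_equality)
  then have e: "\<ominus>\<^bsub>K\<^esub> k = const_rat X (-1) \<otimes>\<^bsub>K\<^esub> k"
    using K.l_minus[of "\<one>\<^bsub>K\<^esub>" k] assms by simp
  show "\<ominus>\<^bsub>K\<^esub> k \<in> stalk c" "ev c (\<ominus>\<^bsub>K\<^esub> k) = - ev c k"
    unfolding e using stalk_mult[OF stalk_const(1)[OF c] assms] stalk_const(2)[OF c] by auto
qed

lemma stalk_finsum:
  assumes "finite A" "c \<in> points X" "\<And>i. i \<in> A \<Longrightarrow> k i \<in> stalk c"
  shows "(\<Oplus>\<^bsub>K\<^esub>i\<in>A. k i) \<in> stalk c \<and> ev c (\<Oplus>\<^bsub>K\<^esub>i\<in>A. k i) = (\<Sum>i\<in>A. ev c (k i))"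
  using assms(1,3)
proof (induction A)
  case empty
  then show ?case using stalk_zero assms(2) by simp
next
  case (insert i A)
  have "(\<Oplus>\<^bsub>K\<^esub>i\<in>insert i A. k i) = k i \<oplus>\<^bsub>K\<^esub> (\<Oplus>\<^bsub>K\<^esub>i\<in>A. k i)"
    by (rule K.finsum_insert) (use insert in auto)
  then show ?case using insert stalk_add[of "k i" c "\<Oplus>\<^bsub>K\<^esub>i\<in>A. k i"] by simp
qed

text \<open>Representatives of \<open>k\<close> near the various points of \<open>U\<close> have the
  same values \<open>ev c k\<close>, so they glue. Regular functions on \<open>U\<close> thus form
  the intersection of the local rings at its points.\<close>

lemma reg_of_stalks:
  assumes U: "nopen X U" and k: "k \<in> carrier K" "\<And>c. c \<in> U \<Longrightarrow> k \<in> stalk c"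
  shows "(\<lambda>c\<in>U. ev c k) \<in> reg X U" "germ X U (\<lambda>c\<in>U. ev c k) = k"
proof -
  show r: "(\<lambda>c\<in>U. ev c k) \<in> reg X U"
  proof (rule reg_localI[OF nopenD(1)[OF U]])
    fix x assume "x \<in> U"
    then obtain V f where u: "nopen X V" "x \<in> V" "f \<in> reg X V" "k = germ X V f" using stalkE k(2) by metis
    show "\<exists>V g. openin (zariski X) V \<and> x \<in> V \<and> g \<in> reg X V \<and> (\<forall>y\<in>U \<inter> V. ev y k = g y)"
      using u nopenD ev_germ[OF u(1,3)] by (intro exI[of _ V] exI[of _ f]) auto
  qed
  show "germ X U (\<lambda>c\<in>U. ev c k) = k"
    by (rule ev_eqI[OF germ_carrier[OF U r] k(1) U]) (simp add: ev_germ[OF U r])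
qed

lemma structure_sheaf_iff:
  assumes "nopen X U"
  shows "k \<in> structure_sheaf X U \<longleftrightarrow> k \<in> carrier K \<and> (\<forall>c\<in>U. k \<in> stalk c)"
proof
  assume "k \<in> structure_sheaf X U"
  then show "k \<in> carrier K \<and> (\<forall>c\<in>U. k \<in> stalk c)"
    unfolding structure_sheaf_def using germ_carrier[OF assms] stalk_germ[OF assms] by blast
next
  assume "k \<in> carrier K \<and> (\<forall>c\<in>U. k \<in> stalk c)"
  then show "k \<in> structure_sheaf X U"
    unfolding structure_sheaf_def using reg_of_stalks[OF assms, of k] by (metis imageI)
qed

definition unit_stalk :: "'a \<Rightarrow> 'a ratfun set" where
  "unit_stalk c = {k \<in> stalk c. ev c k \<noteq> 0}"

lemma unit_stalkD: "k \<in> unit_stalk c \<Longrightarrow> k \<in> stalk c" "k \<in> unit_stalk c \<Longrightarrow> ev c k \<noteq> 0"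
  "k \<in> unit_stalk c \<Longrightarrow> k \<in> carrier K" "k \<in> unit_stalk c \<Longrightarrow> k \<noteq> \<zero>\<^bsub>K\<^esub>"
  using stalk_zero(2) stalk_points unfolding unit_stalk_def by auto

lemma K_inv:
  assumes "k \<in> carrier K" "k \<noteq> \<zero>\<^bsub>K\<^esub>"
  shows "inv\<^bsub>K\<^esub> k \<in> carrier K" "inv\<^bsub>K\<^esub> k \<noteq> \<zero>\<^bsub>K\<^esub>" "k \<otimes>\<^bsub>K\<^esub> inv\<^bsub>K\<^esub> k = \<one>\<^bsub>K\<^esub>" "inv\<^bsub>K\<^esub> k \<otimes>\<^bsub>K\<^esub> k = \<one>\<^bsub>K\<^esub>"
    "inv\<^bsub>K\<^esub> (inv\<^bsub>K\<^esub> k) = k"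
proof -
  have u: "k \<in> Units K" using assms K.field_Units by auto
  show "inv\<^bsub>K\<^esub> k \<in> carrier K" "inv\<^bsub>K\<^esub> k \<noteq> \<zero>\<^bsub>K\<^esub>" using K.Units_inv_Units[OF u] K.field_Units by auto
  show "k \<otimes>\<^bsub>K\<^esub> inv\<^bsub>K\<^esub> k = \<one>\<^bsub>K\<^esub>" "inv\<^bsub>K\<^esub> k \<otimes>\<^bsub>K\<^esub> k = \<one>\<^bsub>K\<^esub>" "inv\<^bsub>K\<^esub> (inv\<^bsub>K\<^esub> k) = k" using u by auto
qed

text \<open>A nonzero value at \<open>c\<close> persists on a neighbourhood, where the pointwise
  inverse represents the inverse class.\<close>

lemma unit_stalk_inv:
  assumes "k \<in> unit_stalk c"
  shows "inv\<^bsub>K\<^esub> k \<in> unit_stalk c" "ev c (inv\<^bsub>K\<^esub> k) = inverse (ev c k)"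
proof -
  note kk = unit_stalkD[OF assms]
  obtain U f where u: "nopen X U" "c \<in> U" "f \<in> reg X U" "k = germ X U f" using stalkE[OF kk(1)] .
  have fc: "f c \<noteq> 0" using kk(2) ev_germ[OF u(1,3,2)] u(4) by simp
  let ?V = "{y \<in> U. f y \<noteq> 0}"
  have o: "openin (zariski X) ?V" using open_nonzero[OF nopenD(1)[OF u(1)] u(3)] .
  have c: "c \<in> ?V" using u fc by simp
  have V: "nopen X ?V" using nopenI[OF o c] .
  have r: "restrict f ?V \<in> reg X ?V" using reg_restrict[OF nopenD(1)[OF u(1)] o _ u(3)] by auto
  have k: "k = germ X ?V (restrict f ?V)" using germ_restrict[OF u(1,3) V] u(4) by auto
  have i: "(\<lambda>y\<in>?V. inverse (restrict f ?V y)) \<in> reg X ?V" by (rule reg_inverse[OF o r]) auto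
  let ?l = "germ X ?V (\<lambda>y\<in>?V. inverse (restrict f ?V y))"
  have lc: "?l \<in> carrier K" using germ_carrier[OF V i] .
  have "?l \<otimes>\<^bsub>K\<^esub> k = \<one>\<^bsub>K\<^esub>" unfolding k mult_germ[OF V i V r] one_germ[OF V]
    unfolding germ_def by auto
  then have inv: "inv\<^bsub>K\<^esub> k = ?l" using K.comm_inv_char[of k ?l] lc kk(3) K.m_comm by simp
  have "ev c ?l = inverse (ev c k)" using ev_germ[OF V i c] ev_germ[OF u(1,3,2)] u(4) c by simp
  then show "inv\<^bsub>K\<^esub> k \<in> unit_stalk c" "ev c (inv\<^bsub>K\<^esub> k) = inverse (ev c k)"
    unfolding inv using stalk_germ[OF V i c] kk(2) by (auto simp: unit_stalk_def)
qed

lemma unit_stalk_mult: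
  "k \<in> unit_stalk c \<Longrightarrow> l \<in> unit_stalk c \<Longrightarrow> k \<otimes>\<^bsub>K\<^esub> l \<in> unit_stalk c"
  using stalk_mult by (auto simp: unit_stalk_def)

lemma unit_stalk_one: "c \<in> points X \<Longrightarrow> \<one>\<^bsub>K\<^esub> \<in> unit_stalk c"
  using stalk_one by (auto simp: unit_stalk_def)

section \<open>Powers in the function field\<close>

abbreviation Ks where "Ks \<equiv> carrier K - {\<zero>\<^bsub>K\<^esub>}"

lemma units_group: "comm_group (units_of K)" and carrier_units: "carrier (units_of K) = Ks"
  using K.units_comm_group K.field_Units by (auto simp: units_of_def)

lemma int_pow_neg_nat: "k [^]\<^bsub>K\<^esub> (- int n) = inv\<^bsub>K\<^esub> (k [^]\<^bsub>K\<^esub> n)"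
  unfolding int_pow_def2 by (cases "n = 0") simp_all

text \<open>The laws for integer exponents are laws of abelian groups; this identification carries
  them from the unit group over to the field.\<close>

lemma int_pow_units:
  assumes "k \<in> Ks"
  shows "k [^]\<^bsub>units_of K\<^esub> (m::int) = k [^]\<^bsub>K\<^esub> m"
proof -
  interpret U: comm_group "units_of K" by (rule units_group)
  have u: "k \<in> Units K" using assms K.field_Units by auto
  have p: "k [^]\<^bsub>units_of K\<^esub> n = k [^]\<^bsub>K\<^esub> (n::nat)" for n using K.units_of_pow[OF u] .
  have pu: "k [^]\<^bsub>K\<^esub> (n::nat) \<in> Units K" for n using u by (induction n) (simp_all add: K.Units_m_closed)
  have k: "k \<in> carrier (units_of K)" using u by (simp add: units_of_def)
  show ?thesis
  proof (cases m rule: int_cases2)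
    case (nonneg n)
    then show ?thesis by (simp add: int_pow_int p)
  next
    case (nonpos n)
    then show ?thesis
      using U.int_pow_neg_int[OF k, of n] int_pow_neg_nat[of k n] K.units_of_inv[OF pu[of n]] p[of n] by simp
  qed
qed

lemma Ks_mult: "k \<in> Ks \<Longrightarrow> l \<in> Ks \<Longrightarrow> k \<otimes>\<^bsub>K\<^esub> l \<in> Ks"
  by (simp add: K.integral_iff)

lemma Ks_inv: "k \<in> Ks \<Longrightarrow> inv\<^bsub>K\<^esub> k \<in> Ks"
  using K_inv by auto

lemma Ks_one: "\<one>\<^bsub>K\<^esub> \<in> Ks"
  by simp

lemma Ks_pow: "k \<in> Ks \<Longrightarrow> k [^]\<^bsub>K\<^esub> (m::int) \<in> Ks"
  using group.int_pow_closed[OF comm_group.axioms(2)[OF units_group], of k m]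
  by (simp add: carrier_units int_pow_units)

lemma Ks_inv_eq: "k \<in> Ks \<Longrightarrow> inv\<^bsub>units_of K\<^esub> k = inv\<^bsub>K\<^esub> k"
  using K.units_of_inv K.field_Units by auto

lemma Ks_pow_add: "k \<in> Ks \<Longrightarrow> k [^]\<^bsub>K\<^esub> (m + n :: int) = k [^]\<^bsub>K\<^esub> m \<otimes>\<^bsub>K\<^esub> k [^]\<^bsub>K\<^esub> n"
  using group.int_pow_mult[OF comm_group.axioms(2)[OF units_group], of k m n]
  by (simp add: carrier_units int_pow_units units_of_mult)

lemma Ks_pow_neg: "k \<in> Ks \<Longrightarrow> k [^]\<^bsub>K\<^esub> (- m :: int) = inv\<^bsub>K\<^esub> (k [^]\<^bsub>K\<^esub> m)"
  using group.int_pow_neg[OF comm_group.axioms(2)[OF units_group], of k m] Ks_pow[of k m]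
  by (simp add: carrier_units int_pow_units Ks_inv_eq)

lemma Ks_inv_pow: "k \<in> Ks \<Longrightarrow> (inv\<^bsub>K\<^esub> k) [^]\<^bsub>K\<^esub> (m :: int) = inv\<^bsub>K\<^esub> (k [^]\<^bsub>K\<^esub> m)"
  using group.int_pow_inv[OF comm_group.axioms(2)[OF units_group], of k m] Ks_pow[of k m] Ks_inv[of k]
  by (simp add: carrier_units int_pow_units Ks_inv_eq)

lemma Ks_mult_pow: "k \<in> Ks \<Longrightarrow> l \<in> Ks \<Longrightarrow> (k \<otimes>\<^bsub>K\<^esub> l) [^]\<^bsub>K\<^esub> (m :: int) = k [^]\<^bsub>K\<^esub> m \<otimes>\<^bsub>K\<^esub> l [^]\<^bsub>K\<^esub> m"
  using comm_group.int_pow_distrib[OF units_group, of k l m] Ks_mult[of k l]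
  by (simp add: carrier_units int_pow_units units_of_mult)

lemma Ks_inv_mult: "k \<in> Ks \<Longrightarrow> l \<in> Ks \<Longrightarrow> inv\<^bsub>K\<^esub> (k \<otimes>\<^bsub>K\<^esub> l) = inv\<^bsub>K\<^esub> k \<otimes>\<^bsub>K\<^esub> inv\<^bsub>K\<^esub> l"
  using comm_group.inv_mult[OF units_group, of k l] Ks_mult[of k l]
  by (simp add: carrier_units Ks_inv_eq units_of_mult)

lemma Ks_pow_1: "k \<in> carrier K \<Longrightarrow> k [^]\<^bsub>K\<^esub> (1::int) = k"
  by (simp add: int_pow_def2)

lemma Ks_cancel:
  "k \<in> Ks \<Longrightarrow> l \<in> carrier K \<Longrightarrow> k \<otimes>\<^bsub>K\<^esub> (inv\<^bsub>K\<^esub> k \<otimes>\<^bsub>K\<^esub> l) = l"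
  "k \<in> Ks \<Longrightarrow> l \<in> carrier K \<Longrightarrow> inv\<^bsub>K\<^esub> k \<otimes>\<^bsub>K\<^esub> (k \<otimes>\<^bsub>K\<^esub> l) = l"
  using K_inv[of k] by (auto simp: K.m_assoc[symmetric])

lemma unit_stalk_pow:
  assumes "k \<in> unit_stalk c"
  shows "k [^]\<^bsub>K\<^esub> (m::int) \<in> unit_stalk c" "ev c (k [^]\<^bsub>K\<^esub> m) = ev c k powi m"
proof -
  have n: "k [^]\<^bsub>K\<^esub> (n::nat) \<in> unit_stalk c \<and> ev c (k [^]\<^bsub>K\<^esub> n) = ev c k ^ n" for n
  proof (induction n)
    case 0
    then show ?case using unit_stalk_one stalk_one stalk_points unit_stalkD(1)[OF assms] by auto
  next
    case (Suc n)
    then show ?case using unit_stalk_mult[of "k [^]\<^bsub>K\<^esub> n" c k] stalk_mult(2)[of "k [^]\<^bsub>K\<^esub> n" c k] assms unit_stalkD(1)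
      by (simp add: mult.commute)
  qed
  show "k [^]\<^bsub>K\<^esub> m \<in> unit_stalk c" "ev c (k [^]\<^bsub>K\<^esub> m) = ev c k powi m"
    using n unit_stalk_inv by (cases m rule: int_cases2; simp add: int_pow_int int_pow_neg_nat power_int_minus)+
qed

end

section \<open>Conjugation of rational functions\<close>

locale real_irr_space = irr_space C for C :: "('a, 'm) real_space_scheme" +
  assumes conj_cont: "continuous_map (zariski C) (zariski C) (rconj C)"
    and conj_conj: "\<And>x. x \<in> points C \<Longrightarrow> rconj C (rconj C x) = x"
    and conj_reg: "\<And>U f. openin (zariski C) U \<Longrightarrow> f \<in> reg C U \<Longrightarrow>
        (\<lambda>x\<in>preim C (rconj C) U. cnj (f (rconj C x))) \<in> reg C (preim C (rconj C) U)"
begin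

lemma conj_points: "x \<in> points C \<Longrightarrow> rconj C x \<in> points C"
  using conj_cont by (auto simp: continuous_map_def)

lemma conj_image:
  assumes "U \<subseteq> points C"
  shows "rconj C ` U = preim C (rconj C) U"
proof (intro equalityI subsetI)
  fix x assume "x \<in> rconj C ` U"
  then show "x \<in> preim C (rconj C) U" using assms conj_conj conj_points by auto
next
  fix x assume "x \<in> preim C (rconj C) U"
  then show "x \<in> rconj C ` U" using conj_conj[of x] by (intro image_eqI[of _ _ "rconj C x"]) auto
qed

lemma conj_open: "openin (zariski C) U \<Longrightarrow> openin (zariski C) (preim C (rconj C) U)"
  using conj_cont by (simp add: continuous_map_def preim_def)

lemma conj_nopen: assumes "nopen C U" shows "nopen C (preim C (rconj C) U)"
  using assms conj_open conj_image[OF nopenD(2)[OF assms]] unfolding nopen_def by blast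

lemma rat_conj_germ:
  assumes U: "nopen C U" "f \<in> reg C U"
  shows "rat_conj C (germ C U f) = germ C (preim C (rconj C) U) (\<lambda>x\<in>preim C (rconj C) U. cnj (f (rconj C x)))"
proof -
  let ?g = "\<lambda>U f. germ C (preim C (rconj C) U) (\<lambda>x\<in>preim C (rconj C) U. cnj (f (rconj C x)))"
  have "?g V g = ?g U f" if "(V, g) \<in> germ C U f" for V g
  proof -
    have v: "nopen C V" "g \<in> reg C V" "\<forall>x\<in>U \<inter> V. f x = g x" using that by (auto simp: germ_mem_iff)
    show ?thesis
      by (rule germ_eqI[OF conj_nopen[OF v(1)] conj_reg[OF nopenD(1)[OF v(1)] v(2)]
            conj_nopen[OF U(1)] conj_reg[OF nopenD(1)[OF U(1)] U(2)] conj_nopen[OF nopen_Int[OF U(1) v(1)]]])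
        (use v(3) in auto)
  qed
  then show ?thesis unfolding rat_conj_def using germ_self[OF U] by blast
qed

lemma rat_conj_stalk:
  assumes c: "c \<in> points C" and k: "k \<in> stalk (rconj C c)"
  shows "rat_conj C k \<in> stalk c" "ev c (rat_conj C k) = cnj (ev (rconj C c) k)"
proof -
  obtain U f where u: "nopen C U" "rconj C c \<in> U" "f \<in> reg C U" "k = germ C U f" using stalkE[OF k] .
  have c': "c \<in> preim C (rconj C) U" using c u by simp
  note r = conj_reg[OF nopenD(1)[OF u(1)] u(3)]
  show "rat_conj C k \<in> stalk c" "ev c (rat_conj C k) = cnj (ev (rconj C c) k)"
    unfolding u(4) rat_conj_germ[OF u(1,3)]
    using stalk_germ[OF conj_nopen[OF u(1)] r c'] ev_germ[OF conj_nopen[OF u(1)] r c'] ev_germ[OF u(1,3,2)] c' by auto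
qed

lemma rat_conj_carrier [simp]:
  assumes "k \<in> carrier K"
  shows "rat_conj C k \<in> carrier K"
proof -
  obtain U f where u: "nopen C U" "f \<in> reg C U" "k = germ C U f" using assms carrier_iff by blast
  show ?thesis unfolding u(3) rat_conj_germ[OF u(1,2)]
    by (rule germ_carrier[OF conj_nopen[OF u(1)] conj_reg[OF nopenD(1)[OF u(1)] u(2)]])
qed

lemma rat_conj_conj: 
  assumes "k \<in> carrier K"
  shows "rat_conj C (rat_conj C k) = k"
proof -
  obtain U where U: "nopen C U" "\<And>c. c \<in> U \<Longrightarrow> k \<in> stalk c" using stalk_generic[OF assms] by metis
  show ?thesis
  proof (rule ev_eqI[OF _ assms U(1)])
    fix c assume c: "c \<in> U"
    then have p: "c \<in> points C" using nopenD U by blast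
    have "k \<in> stalk (rconj C (rconj C c))" using conj_conj[OF p] U(2)[OF c] by simp
    from rat_conj_stalk[OF conj_points[OF p] this] rat_conj_stalk[OF p]
    show "ev c (rat_conj C (rat_conj C k)) = ev c k" using conj_conj[OF p] by simp
  qed (use assms in simp)
qed

lemma rat_conj_stalk_iff:
  assumes c: "c \<in> points C" and k: "k \<in> carrier K"
  shows "rat_conj C k \<in> stalk c \<longleftrightarrow> k \<in> stalk (rconj C c)"
proof
  assume a: "rat_conj C k \<in> stalk c"
  show "k \<in> stalk (rconj C c)"
    using rat_conj_stalk(1)[OF conj_points[OF c], of "rat_conj C k"] a conj_conj[OF c] rat_conj_conj[OF k] by simp
qed (use rat_conj_stalk[OF c] in auto)

lemma rat_conj_mult:
  assumes "k \<in> carrier K" "l \<in> carrier K"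
  shows "rat_conj C (k \<otimes>\<^bsub>K\<^esub> l) = rat_conj C k \<otimes>\<^bsub>K\<^esub> rat_conj C l"
proof -
  obtain U where U: "nopen C U" "\<And>c. c \<in> U \<Longrightarrow> k \<in> stalk c" using stalk_generic[OF assms(1)] by metis
  obtain V where V: "nopen C V" "\<And>c. c \<in> V \<Longrightarrow> l \<in> stalk c" using stalk_generic[OF assms(2)] by metis
  show ?thesis
  proof (rule ev_eqI[OF _ _ conj_nopen[OF nopen_Int[OF U(1) V(1)]]])
    fix c assume "c \<in> preim C (rconj C) (U \<inter> V)"
    then have c: "c \<in> points C" "k \<in> stalk (rconj C c)" "l \<in> stalk (rconj C c)" using U V by auto
    show "ev c (rat_conj C (k \<otimes>\<^bsub>K\<^esub> l)) = ev c (rat_conj C k \<otimes>\<^bsub>K\<^esub> rat_conj C l)"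
      using rat_conj_stalk[OF c(1) stalk_mult(1)[OF c(2,3)]] stalk_mult(2)[OF c(2,3)]
        stalk_mult(2)[OF rat_conj_stalk(1)[OF c(1,2)] rat_conj_stalk(1)[OF c(1,3)]]
        rat_conj_stalk(2)[OF c(1,2)] rat_conj_stalk(2)[OF c(1,3)] by simp
  qed (use assms in auto)
qed

lemma rat_conj_one: "rat_conj C \<one>\<^bsub>K\<^esub> = \<one>\<^bsub>K\<^esub>"
  by (rule ev_eqI[OF _ _ nopen_points]) (use rat_conj_stalk(2) stalk_one conj_points in auto)

lemma rat_conj_zero: "rat_conj C \<zero>\<^bsub>K\<^esub> = \<zero>\<^bsub>K\<^esub>"
  by (rule ev_eqI[OF _ _ nopen_points]) (use rat_conj_stalk(2) stalk_zero conj_points in auto)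

lemma rat_conj_Ks: "k \<in> Ks \<Longrightarrow> rat_conj C k \<in> Ks"
  using rat_conj_conj[of k] rat_conj_zero by auto

lemma rat_conj_unit:
  assumes "c \<in> points C" "k \<in> unit_stalk (rconj C c)"
  shows "rat_conj C k \<in> unit_stalk c"
  using rat_conj_stalk[OF assms(1)] assms(2) by (auto simp: unit_stalk_def)

lemma rat_conj_inv: 
  assumes "k \<in> Ks"
  shows "rat_conj C (inv\<^bsub>K\<^esub> k) = inv\<^bsub>K\<^esub> (rat_conj C k)"
proof -
  have "rat_conj C (inv\<^bsub>K\<^esub> k) \<otimes>\<^bsub>K\<^esub> rat_conj C k = \<one>\<^bsub>K\<^esub>"
    using rat_conj_mult[of "inv\<^bsub>K\<^esub> k" k] K_inv[of k] assms rat_conj_one by simp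
  then show ?thesis
    using K.comm_inv_char[of "rat_conj C k" "rat_conj C (inv\<^bsub>K\<^esub> k)"] assms K_inv(1)[of k] by (simp add: K.m_comm)
qed

lemma rat_conj_pow:
  assumes "k \<in> Ks"
  shows "rat_conj C (k [^]\<^bsub>K\<^esub> (m::int)) = rat_conj C k [^]\<^bsub>K\<^esub> m"
proof -
  have n: "rat_conj C (k [^]\<^bsub>K\<^esub> (n::nat)) = rat_conj C k [^]\<^bsub>K\<^esub> n" for n
    by (induction n) (use assms in \<open>simp_all add: rat_conj_one rat_conj_mult\<close>)
  have "k [^]\<^bsub>K\<^esub> (n::nat) \<in> Ks" for n using Ks_pow[OF assms, of "int n"] by (simp add: int_pow_int)
  then show ?thesis using n rat_conj_inv
    by (cases m rule: int_cases2) (simp_all add: int_pow_int int_pow_neg_nat)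
qed

end

context irr_space
begin

section \<open>Invertible submodules as Cartier divisors\<close>

abbreviation quot (infixl "\<oslash>" 70) where "a \<oslash> b \<equiv> a \<otimes>\<^bsub>K\<^esub> inv\<^bsub>K\<^esub> b"

lemma quot_carrier: "a \<in> carrier K \<Longrightarrow> b \<in> Ks \<Longrightarrow> a \<oslash> b \<in> carrier K"
  using K_inv by simp

lemma quot_Ks: "a \<in> Ks \<Longrightarrow> b \<in> Ks \<Longrightarrow> a \<oslash> b \<in> Ks"
  using Ks_inv Ks_mult by blast

lemma quot_self: "a \<in> Ks \<Longrightarrow> a \<oslash> a = \<one>\<^bsub>K\<^esub>"
  using K_inv by simp

lemma quot_mult:
  assumes "a \<in> carrier K" "b \<in> carrier K" "c \<in> Ks" "d \<in> Ks"
  shows "(a \<otimes>\<^bsub>K\<^esub> b) \<oslash> (c \<otimes>\<^bsub>K\<^esub> d) = (a \<oslash> c) \<otimes>\<^bsub>K\<^esub> (b \<oslash> d)"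
  using assms K_inv(1)[of c] K_inv(1)[of d] Ks_inv_mult[OF assms(3,4)] by (simp add: K.m_ac)

lemma quot_trans:
  assumes "a \<in> carrier K" "b \<in> Ks" "c \<in> Ks"
  shows "a \<oslash> c = (a \<oslash> b) \<otimes>\<^bsub>K\<^esub> (b \<oslash> c)"
  using assms K_inv(1)[of c] K_inv(1)[of b] Ks_cancel(2)[of b] by (simp add: K.m_assoc)

lemma quot_inv:
  assumes "a \<in> Ks" "b \<in> Ks"
  shows "inv\<^bsub>K\<^esub> (a \<oslash> b) = b \<oslash> a" "inv\<^bsub>K\<^esub> a \<oslash> inv\<^bsub>K\<^esub> b = b \<oslash> a"
  using assms Ks_inv_mult[OF assms(1) Ks_inv[OF assms(2)]] K_inv[of b] K_inv[of a] by (simp_all add: K.m_comm)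

lemma quot_cancel:
  assumes "a \<in> carrier K" "b \<in> Ks"
  shows "(a \<oslash> b) \<otimes>\<^bsub>K\<^esub> b = a" "(a \<otimes>\<^bsub>K\<^esub> b) \<oslash> b = a" "b \<otimes>\<^bsub>K\<^esub> (a \<oslash> b) = a" 
  using assms K_inv[of b] by (simp_all add: K.m_assoc K.m_comm[of b] quot_carrier)

lemma quot_one: "a \<in> carrier K \<Longrightarrow> a \<oslash> \<one>\<^bsub>K\<^esub> = a"
  by simp

lemma quot_pow:
  assumes "a \<in> Ks" "b \<in> Ks"
  shows "(a \<oslash> b) [^]\<^bsub>K\<^esub> (m::int) = a [^]\<^bsub>K\<^esub> m \<oslash> b [^]\<^bsub>K\<^esub> m"
  using Ks_mult_pow[OF assms(1) Ks_inv[OF assms(2)]] Ks_inv_pow[OF assms(2)] by simp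

definition divisor :: "('a \<Rightarrow> 'a ratfun) \<Rightarrow> bool" where
  "divisor G \<longleftrightarrow> (\<forall>c\<in>points X. G c \<in> Ks \<and>
     (\<exists>V. openin (zariski X) V \<and> c \<in> V \<and> (\<forall>d\<in>V. G d \<oslash> G c \<in> unit_stalk d)))"

definition sections :: "('a \<Rightarrow> 'a ratfun) \<Rightarrow> 'a submod" where
  "sections G U = {k \<in> carrier K. \<forall>c\<in>U. k \<oslash> G c \<in> stalk c}"

definition represents :: "('a \<Rightarrow> 'a ratfun) \<Rightarrow> 'a submod \<Rightarrow> bool" where
  "represents G L \<longleftrightarrow> divisor G \<and> (\<forall>U. nopen X U \<longrightarrow> L U = sections G U)"

lemma divisor_Ks: "divisor G \<Longrightarrow> c \<in> points X \<Longrightarrow> G c \<in> Ks"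
  by (simp add: divisor_def)

lemma divisor_local:
  assumes "divisor G" "c \<in> points X"
  obtains V where "openin (zariski X) V" "c \<in> V" "\<And>d. d \<in> V \<Longrightarrow> G d \<oslash> G c \<in> unit_stalk d"
    "\<And>d. d \<in> V \<Longrightarrow> G c \<oslash> G d \<in> unit_stalk d"
proof -
  obtain V where V: "openin (zariski X) V" "c \<in> V" "\<forall>d\<in>V. G d \<oslash> G c \<in> unit_stalk d"
    using assms unfolding divisor_def by blast
  have "G c \<oslash> G d \<in> unit_stalk d" if "d \<in> V" for d
  proof -
    have d: "d \<in> points X" using openin_subset[OF V(1)] that by blast
    show ?thesis using unit_stalk_inv(1)[of "G d \<oslash> G c" d] V(3) that
        quot_inv(1)[OF divisor_Ks[OF assms(1) d] divisor_Ks[OF assms]] by simp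
  qed
  then show thesis using that V by blast
qed

lemma representsD: "represents G L \<Longrightarrow> divisor G" "represents G L \<Longrightarrow> nopen X U \<Longrightarrow> L U = sections G U"
  by (auto simp: represents_def)

lemma sections_cong:
  assumes "U \<subseteq> points X" "\<And>c. c \<in> U \<Longrightarrow> G c \<in> Ks" "\<And>c. c \<in> U \<Longrightarrow> H c \<in> Ks"
    and "\<And>c. c \<in> U \<Longrightarrow> G c \<oslash> H c \<in> unit_stalk c"
  shows "sections G U = sections H U"
proof -
  have 1: "k \<oslash> H c \<in> stalk c" if "c \<in> U" "k \<in> carrier K" "k \<oslash> G c \<in> stalk c" for k c
    using quot_trans[of k "G c" "H c"] assms that stalk_mult(1)[OF that(3)] unit_stalkD(1) by simp
  have 2: "k \<oslash> G c \<in> stalk c" if "c \<in> U" "k \<in> carrier K" "k \<oslash> H c \<in> stalk c" for k c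
  proof -
    have "H c \<oslash> G c \<in> unit_stalk c"
      using unit_stalk_inv(1)[OF assms(4)[OF that(1)]] quot_inv(1)[OF assms(2)[OF that(1)] assms(3)[OF that(1)]] by simp
    then show ?thesis
      using quot_trans[of k "H c" "G c"] assms that stalk_mult(1)[OF that(3)] unit_stalkD(1) by simp
  qed
  show ?thesis unfolding sections_def using 1 2 by blast
qed

lemma principal_submod_iff:
  assumes U: "nopen X U" and g: "g \<in> Ks"
  shows "principal_submod X g U = sections (\<lambda>_. g) U"
proof (intro equalityI subsetI)
  fix k assume "k \<in> principal_submod X g U"
  then obtain s where s: "s \<in> structure_sheaf X U" "k = g \<otimes>\<^bsub>K\<^esub> s" unfolding principal_submod_def by blast
  have s': "s \<in> carrier K" "\<forall>c\<in>U. s \<in> stalk c" using s(1) structure_sheaf_iff[OF U] by auto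
  have "k \<oslash> g = s" using quot_cancel(2)[OF s'(1) g] g s' by (simp add: s(2) K.m_comm)
  then show "k \<in> sections (\<lambda>_. g) U" unfolding sections_def using s' s(2) g by simp
next
  fix k assume k: "k \<in> sections (\<lambda>_. g) U"
  then have "k \<oslash> g \<in> structure_sheaf X U"
    using structure_sheaf_iff[OF U] quot_carrier[OF _ g] by (simp add: sections_def)
  moreover have "k = g \<otimes>\<^bsub>K\<^esub> (k \<oslash> g)" using quot_cancel(3)[OF _ g, of k] k by (simp add: sections_def)
  ultimately show "k \<in> principal_submod X g U" unfolding principal_submod_def by blast
qed

lemma divisor_const: "g \<in> Ks \<Longrightarrow> divisor (\<lambda>_. g)"
  unfolding divisor_def using quot_self unit_stalk_one openin_topspace by metis

lemma represents_principal: "g \<in> Ks \<Longrightarrow> represents (\<lambda>_. g) (principal_submod X g)"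
  unfolding represents_def using divisor_const principal_submod_iff by blast

lemma sections_mono: "V \<subseteq> U \<Longrightarrow> sections G U \<subseteq> sections G V"
  by (auto simp: sections_def)

lemma sections_sheaf: "\<U> \<noteq> {} \<Longrightarrow> (\<And>U. U \<in> \<U> \<Longrightarrow> k \<in> sections G U) \<Longrightarrow> k \<in> sections G (\<Union>\<U>)"
  by (auto simp: sections_def)

lemma sections_add:
  assumes "U \<subseteq> points X" "\<And>c. c \<in> U \<Longrightarrow> G c \<in> Ks" "k \<in> sections G U" "l \<in> sections G U"
  shows "k \<oplus>\<^bsub>K\<^esub> l \<in> sections G U"
proof -
  have "(k \<oplus>\<^bsub>K\<^esub> l) \<oslash> G c \<in> stalk c" if c: "c \<in> U" for c
    using stalk_add(1)[of "k \<oslash> G c" c "l \<oslash> G c"] assms c K_inv(1)[of "G c"]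
    by (simp add: sections_def K.l_distr)
  then show ?thesis using assms by (simp add: sections_def)
qed

lemma sections_smult:
  assumes "U \<subseteq> points X" "\<And>c. c \<in> U \<Longrightarrow> G c \<in> Ks" "k \<in> sections G U" "l \<in> carrier K" "\<And>c. c \<in> U \<Longrightarrow> l \<in> stalk c"
  shows "l \<otimes>\<^bsub>K\<^esub> k \<in> sections G U"
proof -
  have "(l \<otimes>\<^bsub>K\<^esub> k) \<oslash> G c \<in> stalk c" if c: "c \<in> U" for c
    using stalk_mult(1)[of l c "k \<oslash> G c"] assms c K_inv(1)[of "G c"]
    by (simp add: sections_def K.m_assoc)
  then show ?thesis using assms by (simp add: sections_def)
qed

lemma sections_zero:
  assumes "U \<subseteq> points X" "\<And>c. c \<in> U \<Longrightarrow> G c \<in> Ks"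
  shows "\<zero>\<^bsub>K\<^esub> \<in> sections G U"
proof -
  have "\<zero>\<^bsub>K\<^esub> \<oslash> G c \<in> stalk c" if "c \<in> U" for c
    using assms that stalk_zero(1)[of c] K_inv(1)[of "G c"] by (simp add: subset_iff)
  then show ?thesis by (simp add: sections_def)
qed

lemma sections_subgroup:
  assumes "U \<subseteq> points X" "\<And>c. c \<in> U \<Longrightarrow> G c \<in> Ks"
  shows "subgroup (sections G U) (add_monoid K)"
proof (rule subgroup.intro)
  show "sections G U \<subseteq> carrier (add_monoid K)" by (auto simp: sections_def)
  show "\<one>\<^bsub>add_monoid K\<^esub> \<in> sections G U" using sections_zero[OF assms] by simp
  show "x \<otimes>\<^bsub>add_monoid K\<^esub> y \<in> sections G U" if "x \<in> sections G U" "y \<in> sections G U" for x y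
    using sections_add[OF assms that] by simp
  show "inv\<^bsub>add_monoid K\<^esub> x \<in> sections G U" if x: "x \<in> sections G U" for x
  proof -
    have xc: "x \<in> carrier K" using x by (simp add: sections_def)
    have "(\<ominus>\<^bsub>K\<^esub> x) \<oslash> G c \<in> stalk c" if c: "c \<in> U" for c
      using stalk_uminus(1)[of "x \<oslash> G c" c] x c K_inv(1)[of "G c"] assms(2)[OF c] xc
      by (simp add: sections_def K.l_minus)
    then have "\<ominus>\<^bsub>K\<^esub> x \<in> sections G U" using xc by (simp add: sections_def)
    then show ?thesis by (simp add: a_inv_def)
  qed
qed

lemma invertible_sections:
  assumes "divisor G"
  shows "invertible_submod X (sections G)"
  unfolding invertible_submod_def
proof (intro conjI ballI)
  have g: "G c \<in> Ks" if "c \<in> U" "nopen X U" for c U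
    using divisor_Ks[OF assms] nopenD(2)[OF that(2)] that(1) by blast
  show "is_submod X (sections G)"
    unfolding is_submod_def
  proof (intro conjI allI impI ballI)
    fix U assume U: "nopen X U"
    show "subgroup (sections G U) (add_monoid K)" using sections_subgroup[OF nopenD(2)[OF U] g[OF _ U]] .
    fix s k assume "s \<in> structure_sheaf X U" "k \<in> sections G U"
    then show "s \<otimes>\<^bsub>K\<^esub> k \<in> sections G U"
      using structure_sheaf_iff[OF U] g[OF _ U] by (intro sections_smult[OF nopenD(2)[OF U]]) auto
  next
    fix U V k assume "nopen X U \<and> nopen X V \<and> V \<subseteq> U"
    then show "sections G U \<subseteq> sections G V" using sections_mono by blast
  next
    fix \<U> k assume a: "\<U> \<noteq> {} \<and> (\<forall>U\<in>\<U>. nopen X U \<and> k \<in> sections G U)"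
    show "k \<in> sections G (\<Union>\<U>)" by (rule sections_sheaf) (use a in auto)
  qed
  fix c assume c: "c \<in> points X"
  obtain V where V: "openin (zariski X) V" "c \<in> V" "\<And>d. d \<in> V \<Longrightarrow> G d \<oslash> G c \<in> unit_stalk d"
    using divisor_local[OF assms c] by metis
  have "sections G W = principal_submod X (G c) W" if W: "nopen X W \<and> W \<subseteq> V" for W
    unfolding principal_submod_iff[OF conjunct1[OF W] divisor_Ks[OF assms c]]
    by (rule sections_cong) (use W nopenD(2) divisor_Ks[OF assms] c V(3) in \<open>auto\<close>)
  then show "\<exists>U g. openin (zariski X) U \<and> c \<in> U \<and> g \<in> Ks \<and> (\<forall>V. nopen X V \<and> V \<subseteq> U \<longrightarrow> sections G V = principal_submod X g V)"
    using V divisor_Ks[OF assms c] by blast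
qed

text \<open>Let d lie in the neighbourhood \<open>U c\<close> on which \<open>G c\<close> generates.
  On the overlap with \<open>U d\<close> both \<open>G c\<close> and \<open>G d\<close> are
  generators, so each is a multiple of the other by an element of the local ring at d, and their
  quotient is a unit there. The equality with \<open>sections G\<close> uses restriction in one
  direction and gluing in the other.\<close>

lemma invertible_represents:
  assumes L: "invertible_submod X L"
  obtains G where "represents G L"
proof -
  have sub: "is_submod X L" using L by (simp add: invertible_submod_def)
  have "\<forall>c\<in>points X. \<exists>U g. openin (zariski X) U \<and> c \<in> U \<and> g \<in> Ks \<and>
    (\<forall>V. nopen X V \<and> V \<subseteq> U \<longrightarrow> L V = principal_submod X g V)" using L by (simp add: invertible_submod_def)
  then obtain U G where UG: "\<And>c. c \<in> points X \<Longrightarrow> openin (zariski X) (U c) \<and> c \<in> U c \<and> G c \<in> Ks \<and>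
    (\<forall>V. nopen X V \<and> V \<subseteq> U c \<longrightarrow> L V = principal_submod X (G c) V)" by metis
  have loc: "L V = sections (\<lambda>_. G c) V" if "c \<in> points X" "nopen X V" "V \<subseteq> U c" for c V
    using UG[OF that(1)] that principal_submod_iff[OF that(2)] by metis
  have quot: "G d \<oslash> G c \<in> stalk d" if c: "c \<in> points X" "d \<in> points X" "d \<in> U c" for c d
  proof -
    have W: "nopen X (U c \<inter> U d)" using UG[OF c(1)] UG[OF c(2)] c(3) nopenI[of "U c \<inter> U d" d] by auto
    have "G d \<in> sections (\<lambda>_. G d) (U c \<inter> U d)"
      unfolding sections_def using UG[OF c(2)] quot_self[of "G d"] stalk_one(1) nopenD(2)[OF W] by auto
    then have "G d \<in> sections (\<lambda>_. G c) (U c \<inter> U d)" using loc[OF c(1) W] loc[OF c(2) W] by auto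
    then show ?thesis using c UG[OF c(2)] by (simp add: sections_def)
  qed
  have quot': "G c \<oslash> G d \<in> stalk d" if c: "c \<in> points X" "d \<in> points X" "d \<in> U c" for c d
  proof -
    have W: "nopen X (U c \<inter> U d)" using UG[OF c(1)] UG[OF c(2)] c(3) nopenI[of "U c \<inter> U d" d] by auto
    have "G c \<in> sections (\<lambda>_. G c) (U c \<inter> U d)"
      unfolding sections_def using UG[OF c(1)] quot_self[of "G c"] stalk_one(1) nopenD(2)[OF W] by auto
    then have "G c \<in> sections (\<lambda>_. G d) (U c \<inter> U d)" using loc[OF c(1) W] loc[OF c(2) W] by auto
    then show ?thesis using c UG[OF c(2)] by (simp add: sections_def)
  qed
  have unit: "G d \<oslash> G c \<in> unit_stalk d" if c: "c \<in> points X" "d \<in> points X" "d \<in> U c" for c d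
  proof -
    have g: "G c \<in> Ks" "G d \<in> Ks" using UG c by blast+
    have "(G d \<oslash> G c) \<otimes>\<^bsub>K\<^esub> (G c \<oslash> G d) = \<one>\<^bsub>K\<^esub>"
      using quot_trans[of "G d" "G c" "G d"] g quot_self[OF g(2)] by simp
    then have "ev d (G d \<oslash> G c) * ev d (G c \<oslash> G d) = 1"
      using stalk_mult(2)[OF quot[OF c] quot'[OF c]] stalk_one(2)[OF c(2)] by simp
    then show ?thesis using quot[OF c] by (auto simp: unit_stalk_def)
  qed
  have div: "divisor G" unfolding divisor_def
  proof
    fix c assume c: "c \<in> points X"
    have "\<forall>d\<in>U c. G d \<oslash> G c \<in> unit_stalk d" using unit[OF c] UG[OF c] openin_subset by blast
    then show "G c \<in> Ks \<and> (\<exists>V. openin (zariski X) V \<and> c \<in> V \<and> (\<forall>d\<in>V. G d \<oslash> G c \<in> unit_stalk d))"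
      using UG[OF c] by blast
  qed
  have "L W = sections G W" if W: "nopen X W" for W
  proof (intro equalityI subsetI)
    fix k assume k: "k \<in> L W"
    have sg: "subgroup (L W) (add_monoid K)" using sub W by (simp add: is_submod_def)
    have kc: "k \<in> carrier K" using subgroup.subset[OF sg] k by auto
    have "k \<oslash> G c \<in> stalk c" if c: "c \<in> W" for c
    proof -
      have p: "c \<in> points X" using c nopenD(2)[OF W] by blast
      have W': "nopen X (W \<inter> U c)" using UG[OF p] c nopenD(1)[OF W] nopenI[of "W \<inter> U c" c] by auto
      have "k \<in> L (W \<inter> U c)" using sub k W W' unfolding is_submod_def by blast
      then show ?thesis using loc[OF p W'] c UG[OF p] by (simp add: sections_def)
    qed
    then show "k \<in> sections G W" using kc by (simp add: sections_def)
  next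
    fix k assume k: "k \<in> sections G W"
    then have kc: "k \<in> carrier K" by (simp add: sections_def)
    \<comment> \<open>All open subsets of \<open>W\<close> over which \<open>k\<close> is already
      known to be a section; they cover \<open>W\<close>, so the gluing axiom applies.\<close>
    let ?\<U> = "{V. nopen X V \<and> V \<subseteq> W \<and> k \<in> L V}"
    have cover: "\<exists>V\<in>?\<U>. c \<in> V" if c: "c \<in> W" for c
    proof -
      have p: "c \<in> points X" using c nopenD(2)[OF W] by blast
      have "k \<oslash> G c \<in> stalk c" using k c by (simp add: sections_def)
      then obtain V where V: "openin (zariski X) V" "c \<in> V" "\<And>d. d \<in> V \<Longrightarrow> k \<oslash> G c \<in> stalk d"
        using stalk_open by metis
      let ?V = "V \<inter> W \<inter> U c"
      have W': "nopen X ?V" using UG[OF p] c nopenD(1)[OF W] V nopenI[of ?V c] by auto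
      have "k \<in> sections (\<lambda>_. G c) ?V" using kc V by (simp add: sections_def)
      then have "k \<in> L ?V" using loc[OF p W'] by simp
      then show ?thesis using W' c V UG[OF p] by (intro bexI[of _ ?V]) auto
    qed
    then have "\<Union>?\<U> = W" by blast
    moreover have "?\<U> \<noteq> {}" using W cover unfolding nopen_def by blast
    moreover have "?\<U> \<noteq> {} \<and> (\<forall>U\<in>?\<U>. nopen X U \<and> k \<in> L U) \<longrightarrow> k \<in> L (\<Union>?\<U>)"
      using sub unfolding is_submod_def by (elim conjE) (rule spec, erule spec)
    ultimately show "k \<in> L W" by (simp del: Union_iff)
  qed
  then have "represents G L" using div unfolding represents_def by blast
  then show thesis by (rule that)
qed

lemma generator_mem:
  assumes "divisor G" "c \<in> points X"
  obtains V where "openin (zariski X) V" "c \<in> V" "\<And>W. W \<subseteq> V \<Longrightarrow> G c \<in> sections G W"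
proof -
  obtain V where V: "openin (zariski X) V" "c \<in> V" "\<And>d. d \<in> V \<Longrightarrow> G c \<oslash> G d \<in> unit_stalk d"
    using divisor_local[OF assms] by metis
  show thesis
    by (rule that[OF V(1,2)]) (use V(3) unit_stalkD(1) divisor_Ks[OF assms] in \<open>auto simp: sections_def\<close>)
qed

text \<open>If the submodules agree, each local generator is a section of the other module; the two
  quotients then lie in the stalk and are inverse to each other.\<close>

lemma represents_eq:
  assumes G: "represents G L" and H: "represents H M"
  shows "submod_eq X L M \<longleftrightarrow> (\<forall>c\<in>points X. G c \<oslash> H c \<in> unit_stalk c)"
proof
  assume eq: "submod_eq X L M"
  have half: "G c \<oslash> H c \<in> stalk c" if G: "represents G L" and H: "represents H M" and eq: "submod_eq X L M" and c: "c \<in> points X" for c G H L M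
  proof -
    obtain V where V: "openin (zariski X) V" "c \<in> V" "\<And>W. W \<subseteq> V \<Longrightarrow> G c \<in> sections G W"
      using generator_mem[OF representsD(1)[OF G] c] by metis
    have n: "nopen X V" using nopenI V by blast
    have "G c \<in> sections H V" using V(3)[of V] eq n representsD(2)[OF G n] representsD(2)[OF H n] by (simp add: submod_eq_def)
    then show ?thesis using V(2) by (simp add: sections_def)
  qed
  show "\<forall>c\<in>points X. G c \<oslash> H c \<in> unit_stalk c"
  proof
    fix c assume c: "c \<in> points X"
    have g: "G c \<in> Ks" "H c \<in> Ks" using divisor_Ks[OF representsD(1) c] G H by blast+
    have 1: "G c \<oslash> H c \<in> stalk c" using half[OF G H eq c] .
    have "submod_eq X M L" using eq by (simp add: submod_eq_def)
    then have 2: "H c \<oslash> G c \<in> stalk c" using half[OF H G _ c] by blast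
    have "ev c (G c \<oslash> H c) * ev c (H c \<oslash> G c) = 1"
      using stalk_mult(2)[OF 1 2] quot_trans[of "G c" "H c" "G c"] g quot_self[OF g(1)] stalk_one(2)[OF c] by simp
    then show "G c \<oslash> H c \<in> unit_stalk c" using 1 by (auto simp: unit_stalk_def)
  qed
next
  assume a: "\<forall>c\<in>points X. G c \<oslash> H c \<in> unit_stalk c"
  have "L U = M U" if U: "nopen X U" for U
    unfolding representsD(2)[OF G U] representsD(2)[OF H U]
    by (rule sections_cong[OF nopenD(2)[OF U]]) (use nopenD(2)[OF U] divisor_Ks[OF representsD(1)] G H a in blast)+
  then show "submod_eq X L M" by (simp add: submod_eq_def)
qed

lemma divisor_mult:
  assumes "divisor G" "divisor H"
  shows "divisor (\<lambda>c. G c \<otimes>\<^bsub>K\<^esub> H c)"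
  unfolding divisor_def
proof (intro ballI conjI)
  fix c assume c: "c \<in> points X"
  show "G c \<otimes>\<^bsub>K\<^esub> H c \<in> Ks" by (rule Ks_mult[OF divisor_Ks[OF assms(1) c] divisor_Ks[OF assms(2) c]])
  obtain V where V: "openin (zariski X) V" "c \<in> V" "\<And>d. d \<in> V \<Longrightarrow> G d \<oslash> G c \<in> unit_stalk d"
    using divisor_local[OF assms(1) c] by metis
  obtain W where W: "openin (zariski X) W" "c \<in> W" "\<And>d. d \<in> W \<Longrightarrow> H d \<oslash> H c \<in> unit_stalk d"
    using divisor_local[OF assms(2) c] by metis
  have "(G d \<otimes>\<^bsub>K\<^esub> H d) \<oslash> (G c \<otimes>\<^bsub>K\<^esub> H c) \<in> unit_stalk d" if d: "d \<in> V \<inter> W" for d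
  proof -
    have p: "d \<in> points X" using d openin_subset[OF V(1)] by blast
    show ?thesis
      using quot_mult[of "G d" "H d" "G c" "H c"] divisor_Ks[OF assms(1) c] divisor_Ks[OF assms(2) c]
       divisor_Ks[OF assms(1) p] divisor_Ks[OF assms(2) p] unit_stalk_mult[OF V(3) W(3)] d by auto
  qed
  then show "\<exists>V. openin (zariski X) V \<and> c \<in> V \<and> (\<forall>d\<in>V. (G d \<otimes>\<^bsub>K\<^esub> H d) \<oslash> (G c \<otimes>\<^bsub>K\<^esub> H c) \<in> unit_stalk d)"
    using V W by (intro exI[of _ "V \<inter> W"]) auto
qed

lemma divisor_inv:
  assumes "divisor G"
  shows "divisor (\<lambda>c. inv\<^bsub>K\<^esub> (G c))"
  unfolding divisor_def
proof (intro ballI conjI)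
  fix c assume c: "c \<in> points X"
  show "inv\<^bsub>K\<^esub> (G c) \<in> Ks" by (rule Ks_inv[OF divisor_Ks[OF assms c]])
  obtain V where V: "openin (zariski X) V" "c \<in> V" "\<And>d. d \<in> V \<Longrightarrow> G c \<oslash> G d \<in> unit_stalk d"
    using divisor_local[OF assms(1) c] by metis
  have "inv\<^bsub>K\<^esub> (G d) \<oslash> inv\<^bsub>K\<^esub> (G c) \<in> unit_stalk d" if d: "d \<in> V" for d
  proof -
    have p: "d \<in> points X" using d openin_subset[OF V(1)] by blast
    show ?thesis
      using quot_inv(2)[OF divisor_Ks[OF assms p] divisor_Ks[OF assms c]] V(3)[OF d] by simp
  qed
  then show "\<exists>V. openin (zariski X) V \<and> c \<in> V \<and> (\<forall>d\<in>V. inv\<^bsub>K\<^esub> (G d) \<oslash> inv\<^bsub>K\<^esub> (G c) \<in> unit_stalk d)"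
    using V by blast
qed

lemma sections_mult:
  assumes "U \<subseteq> points X" "divisor G" "divisor H" "k \<in> sections G U" "l \<in> sections H U"
  shows "k \<otimes>\<^bsub>K\<^esub> l \<in> sections (\<lambda>c. G c \<otimes>\<^bsub>K\<^esub> H c) U"
proof -
  have "(k \<otimes>\<^bsub>K\<^esub> l) \<oslash> (G c \<otimes>\<^bsub>K\<^esub> H c) \<in> stalk c" if c: "c \<in> U" for c
  proof -
    have p: "c \<in> points X" using c assms(1) by blast
    show ?thesis
      using quot_mult[of k l "G c" "H c"] divisor_Ks[OF assms(2) p] divisor_Ks[OF assms(3) p]
        stalk_mult(1)[of "k \<oslash> G c" c "l \<oslash> H c"] assms(4,5) c by (simp add: sections_def)
  qed
  then show ?thesis using assms by (simp add: sections_def)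
qed

text \<open>Sections of the product divisor form a subgroup, so they contain everything generated by
  products of sections. Conversely, near \<open>c\<close> a section \<open>k\<close> is one single
  product: the quotient \<open>k \<oslash> (G c \<otimes> H c)\<close> times \<open>G c\<close>,
  multiplied by \<open>H c\<close>.\<close>

lemma represents_tensor:
  assumes G: "represents G L" and H: "represents H M"
  shows "represents (\<lambda>c. G c \<otimes>\<^bsub>K\<^esub> H c) (tensor_submod X L M)"
  unfolding represents_def
proof (intro conjI allI impI)
  note dG = representsD(1)[OF G] and dH = representsD(1)[OF H]
  let ?GH = "\<lambda>c. G c \<otimes>\<^bsub>K\<^esub> H c"
  show dGH: "divisor ?GH" using divisor_mult[OF dG dH] .
  fix U assume U: "nopen X U"
  show "tensor_submod X L M U = sections ?GH U"
  proof (intro equalityI subsetI)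
    fix k assume k: "k \<in> tensor_submod X L M U"
    then have kc: "k \<in> carrier K" by (simp add: tensor_submod_def)
    have "k \<oslash> ?GH c \<in> stalk c" if c: "c \<in> U" for c
    proof -
      obtain V where V: "openin (zariski X) V" "c \<in> V" "V \<subseteq> U"
         "k \<in> generate (add_monoid K) {x \<otimes>\<^bsub>K\<^esub> y | x y. x \<in> L V \<and> y \<in> M V}"
        using k c unfolding tensor_submod_def by blast
      have n: "nopen X V" using nopenI V by blast
      have sub: "{x \<otimes>\<^bsub>K\<^esub> y | x y. x \<in> L V \<and> y \<in> M V} \<subseteq> sections ?GH V"
        using sections_mult[OF nopenD(2)[OF n] dG dH] representsD(2)[OF G n] representsD(2)[OF H n] by blast
      have "subgroup (sections ?GH V) (add_monoid K)"
        by (rule sections_subgroup[OF nopenD(2)[OF n]]) (use divisor_Ks[OF dGH] nopenD(2)[OF n] in blast)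
      then have "k \<in> sections ?GH V"
        using group.generate_subgroup_incl[OF K.a_group sub] V(4) by blast
      then show ?thesis using V(2) by (simp add: sections_def)
    qed
    then show "k \<in> sections ?GH U" using kc by (simp add: sections_def)
  next
    fix k assume k: "k \<in> sections ?GH U"
    then have kc: "k \<in> carrier K" by (simp add: sections_def)
    have "\<exists>V. openin (zariski X) V \<and> c \<in> V \<and> V \<subseteq> U \<and>
       k \<in> generate (add_monoid K) {x \<otimes>\<^bsub>K\<^esub> y | x y. x \<in> L V \<and> y \<in> M V}" if c: "c \<in> U" for c
    proof -
      have p: "c \<in> points X" using c nopenD(2)[OF U] by blast
      have g: "G c \<in> Ks" "H c \<in> Ks" using divisor_Ks p dG dH by blast+
      have "k \<oslash> ?GH c \<in> stalk c" using k c by (simp add: sections_def)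
      then obtain V1 where V1: "openin (zariski X) V1" "c \<in> V1" "\<And>d. d \<in> V1 \<Longrightarrow> k \<oslash> ?GH c \<in> stalk d"
        using stalk_open by metis
      obtain V2 where V2: "openin (zariski X) V2" "c \<in> V2" "\<And>W. W \<subseteq> V2 \<Longrightarrow> G c \<in> sections G W"
        using generator_mem[OF dG p] by metis
      obtain V3 where V3: "openin (zariski X) V3" "c \<in> V3" "\<And>W. W \<subseteq> V3 \<Longrightarrow> H c \<in> sections H W"
        using generator_mem[OF dH p] by metis
      let ?V = "U \<inter> V1 \<inter> V2 \<inter> V3"
      have o: "openin (zariski X) ?V" "c \<in> ?V" using nopenD(1)[OF U] V1 V2 V3 c by auto
      have n: "nopen X ?V" using nopenI o by blast
      have gs: "G c \<in> sections G ?V" "H c \<in> sections H ?V" by (rule V2(3), blast, rule V3(3), blast)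
      have s: "(k \<oslash> ?GH c) \<otimes>\<^bsub>K\<^esub> G c \<in> L ?V" unfolding representsD(2)[OF G n]
        by (rule sections_smult[OF nopenD(2)[OF n]])
          (use divisor_Ks[OF dG] nopenD(2)[OF n] gs(1) V1(3) quot_carrier[OF kc Ks_mult[OF g]] in auto)
      have t: "H c \<in> M ?V" unfolding representsD(2)[OF H n] by (rule gs(2))
      have "((k \<oslash> ?GH c) \<otimes>\<^bsub>K\<^esub> G c) \<otimes>\<^bsub>K\<^esub> H c = (k \<oslash> ?GH c) \<otimes>\<^bsub>K\<^esub> ?GH c"
        using g quot_carrier[OF kc Ks_mult[OF g]] by (simp add: K.m_assoc)
      also have "\<dots> = k" using quot_cancel(1)[OF kc Ks_mult[OF g]] .
      finally have e: "((k \<oslash> ?GH c) \<otimes>\<^bsub>K\<^esub> G c) \<otimes>\<^bsub>K\<^esub> H c = k" .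
      have "\<exists>x y. k = x \<otimes>\<^bsub>K\<^esub> y \<and> x \<in> L ?V \<and> y \<in> M ?V"
        by (rule exI[of _ "(k \<oslash> ?GH c) \<otimes>\<^bsub>K\<^esub> G c"], rule exI[of _ "H c"]) (use e s t in simp)
      then have "k \<in> {x \<otimes>\<^bsub>K\<^esub> y | x y. x \<in> L ?V \<and> y \<in> M ?V}" by simp
      then have "k \<in> generate (add_monoid K) {x \<otimes>\<^bsub>K\<^esub> y | x y. x \<in> L ?V \<and> y \<in> M ?V}" by (rule generate.incl)
      then show ?thesis using o by (intro exI[of _ ?V]) auto
    qed
    then show "k \<in> tensor_submod X L M U" using kc by (simp add: tensor_submod_def)
  qed
qed

text \<open>Testing \<open>k\<close> on the generator at \<open>c\<close> shows that
  \<open>k\<close> times \<open>G c\<close> is regular at \<open>c\<close>. Conversely, the product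
  of \<open>k\<close> with a section \<open>g\<close> is \<open>k\<close> times \<open>G c\<close>,
  multiplied by the regular quotient of \<open>g\<close> by \<open>G c\<close>.\<close>

lemma represents_dual:
  assumes G: "represents G L"
  shows "represents (\<lambda>c. inv\<^bsub>K\<^esub> (G c)) (dual_submod X L)"
  unfolding represents_def
proof (intro conjI allI impI)
  note dG = representsD(1)[OF G]
  show "divisor (\<lambda>c. inv\<^bsub>K\<^esub> (G c))" using divisor_inv[OF dG] .
  fix U assume U: "nopen X U"
  show "dual_submod X L U = sections (\<lambda>c. inv\<^bsub>K\<^esub> (G c)) U"
  proof (intro equalityI subsetI)
    fix k assume k: "k \<in> dual_submod X L U"
    then have kc: "k \<in> carrier K" by (simp add: dual_submod_def)
    have "k \<oslash> inv\<^bsub>K\<^esub> (G c) \<in> stalk c" if c: "c \<in> U" for c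
    proof -
      have p: "c \<in> points X" using c nopenD(2)[OF U] by blast
      obtain V where V: "openin (zariski X) V" "c \<in> V" "\<And>W. W \<subseteq> V \<Longrightarrow> G c \<in> sections G W"
        using generator_mem[OF dG p] by metis
      have n: "nopen X (U \<inter> V)" using nopenI[of "U \<inter> V" c] nopenD(1)[OF U] V c by auto
      have "G c \<in> L (U \<inter> V)" unfolding representsD(2)[OF G n] by (rule V(3)) blast
      then have "k \<otimes>\<^bsub>K\<^esub> G c \<in> structure_sheaf X (U \<inter> V)" using k n by (auto simp: dual_submod_def)
      then show ?thesis using structure_sheaf_iff[OF n] V(2) c K_inv(5)[of "G c"] divisor_Ks[OF dG p] by simp
    qed
    then show "k \<in> sections (\<lambda>c. inv\<^bsub>K\<^esub> (G c)) U" using kc by (simp add: sections_def)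
  next
    fix k assume k: "k \<in> sections (\<lambda>c. inv\<^bsub>K\<^esub> (G c)) U"
    then have kc: "k \<in> carrier K" by (simp add: sections_def)
    have "k \<otimes>\<^bsub>K\<^esub> g \<in> structure_sheaf X V" if V: "nopen X V" "V \<subseteq> U" and g: "g \<in> L V" for V g
    proof -
      have g': "g \<in> carrier K" "\<And>c. c \<in> V \<Longrightarrow> g \<oslash> G c \<in> stalk c" using g representsD(2)[OF G V(1)] by (auto simp: sections_def)
      have "k \<otimes>\<^bsub>K\<^esub> g \<in> stalk c" if c: "c \<in> V" for c
      proof -
        have p: "c \<in> points X" using c nopenD(2)[OF V(1)] by blast
        have gg: "G c \<in> Ks" using divisor_Ks[OF dG p] .
        have "k \<oslash> inv\<^bsub>K\<^esub> (G c) \<in> stalk c" using k c V(2) by (auto simp: sections_def)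
        then have "k \<otimes>\<^bsub>K\<^esub> G c \<in> stalk c" using K_inv(5)[of "G c"] gg by simp
        from stalk_mult(1)[OF this g'(2)[OF c]] have "(k \<otimes>\<^bsub>K\<^esub> G c) \<otimes>\<^bsub>K\<^esub> (g \<oslash> G c) \<in> stalk c" .
        moreover have "(k \<otimes>\<^bsub>K\<^esub> G c) \<otimes>\<^bsub>K\<^esub> (g \<oslash> G c) = k \<otimes>\<^bsub>K\<^esub> g"
          using kc gg quot_cancel(3)[OF g'(1) gg] quot_carrier[OF g'(1) gg] by (simp add: K.m_assoc)
        ultimately show ?thesis by simp
      qed
      then show ?thesis using structure_sheaf_iff[OF V(1)] kc g'(1) by simp
    qed
    then show "k \<in> dual_submod X L U" using kc by (simp add: dual_submod_def)
  qed
qed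

lemma represents_structure_sheaf: "represents (\<lambda>_. \<one>\<^bsub>K\<^esub>) (structure_sheaf X)"
  unfolding represents_def using divisor_const[OF Ks_one] structure_sheaf_iff
  by (auto simp: sections_def)

lemma represents_cong:
  assumes "represents G L" "\<And>c. c \<in> points X \<Longrightarrow> G c = H c"
  shows "represents H L"
proof -
  have s: "sections G U = sections H U" if "nopen X U" for U
    using assms(2) nopenD(2)[OF that] by (auto simp: sections_def subset_iff)
  have "divisor H" unfolding divisor_def
  proof
    fix c assume c: "c \<in> points X"
    obtain V where V: "openin (zariski X) V" "c \<in> V" "\<And>d. d \<in> V \<Longrightarrow> G d \<oslash> G c \<in> unit_stalk d"
      using divisor_local[OF representsD(1)[OF assms(1)] c] by metis
    have "\<forall>d\<in>V. H d \<oslash> H c \<in> unit_stalk d" using V(3) assms(2)[OF c] assms(2) openin_subset[OF V(1)] by (metis subsetD)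
    then show "H c \<in> Ks \<and> (\<exists>V. openin (zariski X) V \<and> c \<in> V \<and> (\<forall>d\<in>V. H d \<oslash> H c \<in> unit_stalk d))"
      using V divisor_Ks[OF representsD(1)[OF assms(1)] c] assms(2)[OF c] by auto
  qed
  then show ?thesis using assms(1) s by (simp add: represents_def)
qed

lemma represents_tensor_nat:
  assumes "represents G L"
  shows "represents (\<lambda>c. G c [^]\<^bsub>K\<^esub> (n::nat)) ((tensor_submod X L ^^ n) (structure_sheaf X))"
proof (induction n)
  case 0
  then show ?case using represents_structure_sheaf by simp
next
  case (Suc n)
  have "represents (\<lambda>c. G c \<otimes>\<^bsub>K\<^esub> G c [^]\<^bsub>K\<^esub> n) ((tensor_submod X L ^^ Suc n) (structure_sheaf X))"
    using represents_tensor[OF assms Suc.IH] by simp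
  then show ?case
    by (rule represents_cong) (use divisor_Ks[OF representsD(1)[OF assms]] in \<open>simp add: K.m_comm\<close>)
qed

lemma represents_tensor_pow:
  assumes "represents G L"
  shows "represents (\<lambda>c. G c [^]\<^bsub>K\<^esub> m) (tensor_pow X L m)"
proof (cases m rule: int_cases2)
  case (nonneg n)
  then show ?thesis using represents_tensor_nat[OF assms, of n] by (simp add: tensor_pow_def int_pow_int)
next
  case (nonpos n)
  show ?thesis
  proof (cases "n = 0")
    case True
    then show ?thesis using represents_structure_sheaf nonpos by (simp add: tensor_pow_def)
  next
    case False
    have eq: "tensor_pow X L m = (tensor_submod X (dual_submod X L) ^^ n) (structure_sheaf X)"
      using False nonpos by (simp add: tensor_pow_def)
    have pw: "inv\<^bsub>K\<^esub> (G c) [^]\<^bsub>K\<^esub> n = G c [^]\<^bsub>K\<^esub> m" if "c \<in> points X" for c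
      using Ks_inv_pow[OF divisor_Ks[OF representsD(1)[OF assms] that], of "int n"] nonpos
      by (simp add: int_pow_neg_nat int_pow_int)
    show ?thesis unfolding eq
      by (rule represents_cong[OF represents_tensor_nat[OF represents_dual[OF assms]] pw])
  qed
qed

text \<open>The condition at \<open>c\<close> spreads to a neighbourhood: near \<open>c\<close> the
  quotient of \<open>k\<close> by \<open>G c\<close> stays regular, and \<open>G c\<close> differs
  from the generator \<open>G d\<close> by a unit at d.\<close>

lemma represents_stalk:
  assumes G: "represents G L" and c: "c \<in> points X"
  shows "(\<Union>U\<in>{U. openin (zariski X) U \<and> c \<in> U}. L U) = {k \<in> carrier K. k \<oslash> G c \<in> stalk c}"
proof (intro equalityI subsetI)
  fix k assume "k \<in> (\<Union>U\<in>{U. openin (zariski X) U \<and> c \<in> U}. L U)"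
  then obtain U where U: "openin (zariski X) U" "c \<in> U" "k \<in> L U" by blast
  then show "k \<in> {k \<in> carrier K. k \<oslash> G c \<in> stalk c}"
    using representsD(2)[OF G nopenI[OF U(1,2)]] by (simp add: sections_def)
next
  fix k assume k: "k \<in> {k \<in> carrier K. k \<oslash> G c \<in> stalk c}"
  note dG = representsD(1)[OF G]
  obtain V where V: "openin (zariski X) V" "c \<in> V" "\<And>d. d \<in> V \<Longrightarrow> G c \<oslash> G d \<in> unit_stalk d"
    using divisor_local[OF dG c] by metis
  obtain W where W: "openin (zariski X) W" "c \<in> W" "\<And>d. d \<in> W \<Longrightarrow> k \<oslash> G c \<in> stalk d"
    using k stalk_open by (metis (no_types, lifting) mem_Collect_eq)
  have o: "openin (zariski X) (V \<inter> W)" using V W by auto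
  have n: "nopen X (V \<inter> W)" using nopenI[OF o] V W by blast
  have "k \<oslash> G d \<in> stalk d" if d: "d \<in> V \<inter> W" for d
  proof -
    have p: "d \<in> points X" using d openin_subset[OF o] by blast
    show ?thesis
      using quot_trans[OF _ divisor_Ks[OF dG c] divisor_Ks[OF dG p], of k] k stalk_mult(1)[OF W(3) unit_stalkD(1)[OF V(3)], of d] d by auto
  qed
  then have "k \<in> L (V \<inter> W)" using representsD(2)[OF G n] k by (simp add: sections_def)
  then show "k \<in> (\<Union>U\<in>{U. openin (zariski X) U \<and> c \<in> U}. L U)" using o V W by blast
qed

end

section \<open>Conjugate divisors and real pairs\<close>

context real_irr_space
begin

notation quot (infixl "\<oslash>" 70)

text \<open>Conjugation exchanges the stalks at \<open>c\<close> and at its conjugate point and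
  respects quotients. Hence the pull-back is generated at \<open>c\<close> by the conjugate of the
  generator at the conjugate point.\<close>

lemma represents_pullback:
  assumes G: "represents G L"
  shows "represents (\<lambda>c. rat_conj C (G (rconj C c))) (pullback_conj C L)"
  unfolding represents_def
proof (intro conjI allI impI)
  note dG = representsD(1)[OF G]
  show "divisor (\<lambda>c. rat_conj C (G (rconj C c)))" unfolding divisor_def
  proof (intro ballI conjI)
    fix c assume c: "c \<in> points C"
    note tc = conj_points[OF c]
    show "rat_conj C (G (rconj C c)) \<in> Ks" by (rule rat_conj_Ks[OF divisor_Ks[OF dG tc]])
    obtain V where V: "openin (zariski C) V" "rconj C c \<in> V" "\<And>d. d \<in> V \<Longrightarrow> G d \<oslash> G (rconj C c) \<in> unit_stalk d"
      using divisor_local[OF dG tc] by metis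
    have "rat_conj C (G (rconj C d)) \<oslash> rat_conj C (G (rconj C c)) \<in> unit_stalk d" if "d \<in> preim C (rconj C) V" for d
    proof -
      have d: "d \<in> points C" "rconj C d \<in> V" using that by auto
      have g: "G (rconj C d) \<in> Ks" "G (rconj C c) \<in> Ks" using divisor_Ks[OF dG conj_points] d c by blast+
      show ?thesis using rat_conj_unit[OF d(1) V(3)[OF d(2)]] g
          rat_conj_mult[of "G (rconj C d)" "inv\<^bsub>K\<^esub> (G (rconj C c))"] rat_conj_inv[OF g(2)] K_inv(1) by simp
    qed
    then show "\<exists>V. openin (zariski C) V \<and> c \<in> V \<and> (\<forall>d\<in>V. rat_conj C (G (rconj C d)) \<oslash> rat_conj C (G (rconj C c)) \<in> unit_stalk d)"
      using conj_open[OF V(1)] V(2) c by (intro exI[of _ "preim C (rconj C) V"]) auto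
  qed
  fix U assume U: "nopen C U"
  have eq: "rconj C ` U = preim C (rconj C) U" using conj_image[OF nopenD(2)[OF U]] .
  have L: "L (rconj C ` U) = sections G (preim C (rconj C) U)"
    unfolding eq using representsD(2)[OF G conj_nopen[OF U]] .
  have key: "rat_conj C k \<oslash> rat_conj C (G (rconj C c)) \<in> stalk c \<longleftrightarrow> k \<oslash> G (rconj C c) \<in> stalk (rconj C c)"
    if c: "c \<in> points C" and k: "k \<in> carrier K" for c k
  proof -
    have g: "G (rconj C c) \<in> Ks" using divisor_Ks[OF dG conj_points[OF c]] .
    have "rat_conj C (k \<oslash> G (rconj C c)) = rat_conj C k \<oslash> rat_conj C (G (rconj C c))"
      using rat_conj_mult[OF k, of "inv\<^bsub>K\<^esub> (G (rconj C c))"] rat_conj_inv[OF g] K_inv(1) g by simp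
    then show ?thesis using rat_conj_stalk_iff[OF c quot_carrier[OF k g]] by simp
  qed
  show "pullback_conj C L U = sections (\<lambda>c. rat_conj C (G (rconj C c))) U"
  proof (intro equalityI subsetI)
    fix l assume "l \<in> pullback_conj C L U"
    then obtain k where k: "k \<in> sections G (preim C (rconj C) U)" "l = rat_conj C k" unfolding pullback_conj_def L by blast
    have kc: "k \<in> carrier K" using k by (simp add: sections_def)
    have "l \<oslash> rat_conj C (G (rconj C c)) \<in> stalk c" if c: "c \<in> U" for c
    proof -
      have p: "c \<in> points C" using c nopenD(2)[OF U] by blast
      have "rconj C c \<in> preim C (rconj C) U" using conj_points[OF p] conj_conj[OF p] c by simp
      then show ?thesis unfolding k(2) key[OF p kc] using k(1) by (simp add: sections_def)
    qed
    then show "l \<in> sections (\<lambda>c. rat_conj C (G (rconj C c))) U" using kc k(2) by (simp add: sections_def)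
  next
    fix l assume l: "l \<in> sections (\<lambda>c. rat_conj C (G (rconj C c))) U"
    then have lc: "l \<in> carrier K" by (simp add: sections_def)
    let ?k = "rat_conj C l"
    have kc: "?k \<in> carrier K" using lc by simp
    have "?k \<oslash> G d \<in> stalk d" if d: "d \<in> preim C (rconj C) U" for d
    proof -
      have p: "d \<in> points C" "rconj C d \<in> U" using d by auto
      have "l \<oslash> rat_conj C (G (rconj C (rconj C d))) \<in> stalk (rconj C d)" using l p(2) by (simp add: sections_def)
      then show ?thesis using key[OF conj_points[OF p(1)] kc] rat_conj_conj[OF lc] conj_conj[OF p(1)] by simp
    qed
    then have "?k \<in> sections G (preim C (rconj C) U)" using kc by (simp add: sections_def)
    then show "l \<in> pullback_conj C L U" unfolding pullback_conj_def L
      using rat_conj_conj[OF lc] by (intro image_eqI[of _ _ ?k]) auto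
  qed
qed

text \<open>The last clause is the equation between \<open>L \<otimes> \<tau>\<close>-pull-back of
  \<open>L\<close> and the module generated by the inverse of \<open>h\<close>, read on generators:
  the quotient of the two generators at \<open>c\<close> is the displayed product.\<close>

definition real_pair :: "('a \<Rightarrow> 'a ratfun) \<Rightarrow> 'a ratfun \<Rightarrow> bool" where
  "real_pair G h \<longleftrightarrow> divisor G \<and> h \<in> Ks \<and> rat_conj C h = h \<and>
     (\<forall>c\<in>points C. (G c \<otimes>\<^bsub>K\<^esub> rat_conj C (G (rconj C c))) \<otimes>\<^bsub>K\<^esub> h \<in> unit_stalk c)"

lemma torsor_pair_iff:
  assumes G: "represents G L" and L: "invertible_submod C L"
  shows "torsor_pair C L h \<longleftrightarrow> real_pair G h"
proof (cases "h \<in> Ks")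
  case True
  have "submod_eq C (tensor_submod C L (pullback_conj C L)) (principal_submod C (inv\<^bsub>K\<^esub> h)) \<longleftrightarrow>
     (\<forall>c\<in>points C. (G c \<otimes>\<^bsub>K\<^esub> rat_conj C (G (rconj C c))) \<otimes>\<^bsub>K\<^esub> h \<in> unit_stalk c)"
    using represents_eq[OF represents_tensor[OF G represents_pullback[OF G]] represents_principal[OF Ks_inv[OF True]]]
      K_inv(5)[of h] True by simp
  then show ?thesis unfolding torsor_pair_def real_pair_def using L representsD(1)[OF G] True by blast
next
  case False
  then show ?thesis unfolding torsor_pair_def real_pair_def by blast
qed

end

context irr_space
begin

section \<open>Points of the relative spectrum\<close>

definition supp :: "(int \<Rightarrow> 'a ratfun) \<Rightarrow> int set" where
  "supp a = {m. a m \<noteq> \<zero>\<^bsub>K\<^esub>}"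

definition gmult :: "(int \<Rightarrow> 'a ratfun) \<Rightarrow> (int \<Rightarrow> 'a ratfun) \<Rightarrow> int \<Rightarrow> 'a ratfun" where
  "gmult a b = (\<lambda>m. \<Oplus>\<^bsub>K\<^esub>i\<in>supp a. a i \<otimes>\<^bsub>K\<^esub> b (m - i))"

definition gadd :: "(int \<Rightarrow> 'a ratfun) \<Rightarrow> (int \<Rightarrow> 'a ratfun) \<Rightarrow> int \<Rightarrow> 'a ratfun" where
  "gadd a b = (\<lambda>m. a m \<oplus>\<^bsub>K\<^esub> b m)"

lemma graded_ring_simps:
  "a \<in> carrier (graded_ring X A) \<longleftrightarrow> finite (supp a) \<and> (\<forall>m. a m \<in> A m)"
  "a \<otimes>\<^bsub>graded_ring X A\<^esub> b = gmult a b"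
  "a \<oplus>\<^bsub>graded_ring X A\<^esub> b = gadd a b"
  "\<one>\<^bsub>graded_ring X A\<^esub> = homog X 0 \<one>\<^bsub>K\<^esub>"
  by (simp_all add: graded_ring_def supp_def gmult_def gadd_def)

text \<open>For a generator \<open>g\<close> of \<open>L\<close> at \<open>c\<close>, \<open>laurent c g\<close> is the stalk at \<open>c\<close> of the direct sum of the
  powers of \<open>L\<close>, and \<open>spt c g z\<close> is its character with value \<open>z\<close> at \<open>g\<close>.\<close>

definition laurent :: "'a \<Rightarrow> 'a ratfun \<Rightarrow> (int \<Rightarrow> 'a ratfun) set" where
  "laurent c g = {a. finite (supp a) \<and> (\<forall>m. a m \<in> carrier K \<and> a m \<oslash> g [^]\<^bsub>K\<^esub> m \<in> stalk c)}"

definition gval :: "'a \<Rightarrow> 'a ratfun \<Rightarrow> complex \<Rightarrow> (int \<Rightarrow> 'a ratfun) \<Rightarrow> complex" where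
  "gval c g z a = (\<Sum>m\<in>supp a. ev c (a m \<oslash> g [^]\<^bsub>K\<^esub> m) * z powi m)"

definition spt :: "'a \<Rightarrow> 'a ratfun \<Rightarrow> complex \<Rightarrow> (int \<Rightarrow> 'a ratfun) \<Rightarrow> complex" where
  "spt c g z = restrict (gval c g z) (laurent c g)"

lemma ev_zero_quot:
  assumes "c \<in> points X" "g \<in> Ks"
  shows "ev c (\<zero>\<^bsub>K\<^esub> \<oslash> g [^]\<^bsub>K\<^esub> (m::int)) = 0" "\<zero>\<^bsub>K\<^esub> \<oslash> g [^]\<^bsub>K\<^esub> (m::int) = \<zero>\<^bsub>K\<^esub>"
  using Ks_inv[OF Ks_pow[OF assms(2), of m]] stalk_zero[OF assms(1)] by simp_all

lemma gval_superset:
  assumes "c \<in> points X" "g \<in> Ks" "finite S" "supp a \<subseteq> S"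
  shows "gval c g z a = (\<Sum>m\<in>S. ev c (a m \<oslash> g [^]\<^bsub>K\<^esub> m) * z powi m)"
  unfolding gval_def
  by (rule sum.mono_neutral_left[OF assms(3,4)]) (auto simp: supp_def ev_zero_quot[OF assms(1,2)] stalk_zero(2)[OF assms(1)])

lemma laurentD:
  assumes "a \<in> laurent c g"
  shows "finite (supp a)" "a m \<in> carrier K" "a m \<oslash> g [^]\<^bsub>K\<^esub> m \<in> stalk c"
  using assms by (auto simp: laurent_def)

lemma gadd_laurent:
  assumes c: "c \<in> points X" and g: "g \<in> Ks" and a: "a \<in> laurent c g" and b: "b \<in> laurent c g"
  shows "gadd a b \<in> laurent c g" "gval c g z (gadd a b) = gval c g z a + gval c g z b"
proof -
  have s: "supp (gadd a b) \<subseteq> supp a \<union> supp b"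
    using laurentD(2)[OF a] laurentD(2)[OF b] by (auto simp: supp_def gadd_def)
  have f: "finite (supp a \<union> supp b)" using laurentD(1) a b by blast
  have q: "(a m \<oplus>\<^bsub>K\<^esub> b m) \<oslash> g [^]\<^bsub>K\<^esub> m = (a m \<oslash> g [^]\<^bsub>K\<^esub> m) \<oplus>\<^bsub>K\<^esub> (b m \<oslash> g [^]\<^bsub>K\<^esub> m)" for m
    using laurentD(2)[OF a] laurentD(2)[OF b] Ks_inv[OF Ks_pow[OF g, of m]] by (simp add: K.l_distr)
  show "gadd a b \<in> laurent c g"
    unfolding laurent_def using finite_subset[OF s f] stalk_add(1)[OF laurentD(3)[OF a] laurentD(3)[OF b]]
      laurentD(2)[OF a] laurentD(2)[OF b] by (simp add: gadd_def q)
  show "gval c g z (gadd a b) = gval c g z a + gval c g z b"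
    unfolding gval_superset[OF c g f s] gval_superset[OF c g f Un_upper1] gval_superset[OF c g f Un_upper2]
    by (simp add: gadd_def q stalk_add(2)[OF laurentD(3)[OF a] laurentD(3)[OF b]] distrib_right sum.distrib)
qed

text \<open>Dividing degree m by the m-th power of \<open>g\<close> turns graded elements into
  Laurent polynomials over the local ring. After evaluation at \<open>c\<close> the second claim is
  the multiplicativity of the value of a Laurent polynomial at \<open>z\<close>.\<close>

lemma gmult_laurent:
  assumes c: "c \<in> points X" and g: "g \<in> Ks" and a: "a \<in> laurent c g" and b: "b \<in> laurent c g"
  shows "gmult a b \<in> laurent c g"
    and "z \<noteq> 0 \<Longrightarrow> gval c g z (gmult a b) = gval c g z a * gval c g z b"
proof -
  let ?S = "supp a" and ?T = "supp b"
  let ?M = "(\<lambda>(i, j). i + j) ` (?S \<times> ?T)"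
  define \<alpha> where "\<alpha> = (\<lambda>i. ev c (a i \<oslash> g [^]\<^bsub>K\<^esub> i))"
  define \<beta> where "\<beta> = (\<lambda>i. ev c (b i \<oslash> g [^]\<^bsub>K\<^esub> i))"
  have fS: "finite ?S" and "finite ?T" using laurentD(1) a b by blast+
  then have fM: "finite ?M" by simp
  have ac: "a i \<in> carrier K" and bc: "b i \<in> carrier K" for i using laurentD(2) a b by blast+
  have s: "supp (gmult a b) \<subseteq> ?M"
  proof
    fix m assume m: "m \<in> supp (gmult a b)"
    show "m \<in> ?M"
    proof (rule ccontr)
      assume n: "m \<notin> ?M"
      have "b (m - i) = \<zero>\<^bsub>K\<^esub>" if "i \<in> ?S" for i
      proof (rule ccontr)
        assume "b (m - i) \<noteq> \<zero>\<^bsub>K\<^esub>"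
        then have "(i, m - i) \<in> ?S \<times> ?T" using that by (simp add: supp_def)
        then have "m \<in> ?M" by force
        then show False using n by blast
      qed
      then have "gmult a b m = (\<Oplus>\<^bsub>K\<^esub>i\<in>?S. \<zero>\<^bsub>K\<^esub>)"
        unfolding gmult_def using ac by (intro K.finsum_cong') auto
      then show False using m by (simp add: supp_def)
    qed
  qed
  have q: "gmult a b m \<oslash> g [^]\<^bsub>K\<^esub> m = (\<Oplus>\<^bsub>K\<^esub>i\<in>?S. (a i \<oslash> g [^]\<^bsub>K\<^esub> i) \<otimes>\<^bsub>K\<^esub> (b (m - i) \<oslash> g [^]\<^bsub>K\<^esub> (m - i)))" for m
  proof -
    have gi: "inv\<^bsub>K\<^esub> (g [^]\<^bsub>K\<^esub> m) \<in> carrier K" using Ks_inv[OF Ks_pow[OF g, of m]] by simp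
    have "gmult a b m \<oslash> g [^]\<^bsub>K\<^esub> m = (\<Oplus>\<^bsub>K\<^esub>i\<in>?S. (a i \<otimes>\<^bsub>K\<^esub> b (m - i)) \<oslash> g [^]\<^bsub>K\<^esub> m)"
      unfolding gmult_def by (rule K.finsum_ldistr[OF fS gi]) (use ac bc in auto)
    also have "\<dots> = (\<Oplus>\<^bsub>K\<^esub>i\<in>?S. (a i \<oslash> g [^]\<^bsub>K\<^esub> i) \<otimes>\<^bsub>K\<^esub> (b (m - i) \<oslash> g [^]\<^bsub>K\<^esub> (m - i)))"
    proof (rule K.finsum_cong')
      fix i
      have "g [^]\<^bsub>K\<^esub> m = g [^]\<^bsub>K\<^esub> i \<otimes>\<^bsub>K\<^esub> g [^]\<^bsub>K\<^esub> (m - i)" using Ks_pow_add[OF g, of i "m - i"] by simp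
      then show "(a i \<otimes>\<^bsub>K\<^esub> b (m - i)) \<oslash> g [^]\<^bsub>K\<^esub> m = (a i \<oslash> g [^]\<^bsub>K\<^esub> i) \<otimes>\<^bsub>K\<^esub> (b (m - i) \<oslash> g [^]\<^bsub>K\<^esub> (m - i))"
        using quot_mult[OF ac bc Ks_pow[OF g] Ks_pow[OF g]] by simp
    qed (use ac bc quot_carrier[OF ac Ks_pow[OF g]] quot_carrier[OF bc Ks_pow[OF g]] in auto)
    finally show ?thesis .
  qed
  have st: "gmult a b m \<oslash> g [^]\<^bsub>K\<^esub> m \<in> stalk c \<and> ev c (gmult a b m \<oslash> g [^]\<^bsub>K\<^esub> m) = (\<Sum>i\<in>?S. \<alpha> i * \<beta> (m - i))" for m
    unfolding q \<alpha>_def \<beta>_def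
    using stalk_finsum[OF fS c, of "\<lambda>i. (a i \<oslash> g [^]\<^bsub>K\<^esub> i) \<otimes>\<^bsub>K\<^esub> (b (m - i) \<oslash> g [^]\<^bsub>K\<^esub> (m - i))"]
      stalk_mult[OF laurentD(3)[OF a] laurentD(3)[OF b]] by simp
  have gc: "gmult a b m \<in> carrier K" for m
    unfolding gmult_def by (rule K.finsum_closed) (use ac bc in auto)
  show "gmult a b \<in> laurent c g" unfolding laurent_def using finite_subset[OF s fM] st gc by simp
  assume z: "z \<noteq> 0"
  have b0: "\<beta> j = 0" if "j \<notin> ?T" for j
    using that ev_zero_quot[OF c g] by (simp add: \<beta>_def supp_def)
  \<comment> \<open>Shifting the set of possible exponents by \<open>i\<close> gives a set that
    contains the support of \<open>b\<close>, and \<beta> vanishes outside this support; so the sum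
    does not depend on \<open>i\<close>.\<close>
  have inner: "(\<Sum>m\<in>?M. \<beta> (m - i) * z powi (m - i)) = (\<Sum>j\<in>?T. \<beta> j * z powi j)" if i: "i \<in> ?S" for i
  proof -
    have inj: "inj_on (\<lambda>m. m - i) ?M" by (auto simp: inj_on_def)
    have "(\<Sum>m\<in>?M. \<beta> (m - i) * z powi (m - i)) = (\<Sum>j\<in>(\<lambda>m. m - i) ` ?M. \<beta> j * z powi j)"
      using sum.reindex[OF inj, of "\<lambda>j. \<beta> j * z powi j"] by (simp add: comp_def)
    also have "\<dots> = (\<Sum>j\<in>?T. \<beta> j * z powi j)"
    proof (rule sum.mono_neutral_right)
      show "?T \<subseteq> (\<lambda>m. m - i) ` ?M"
      proof
        fix j assume "j \<in> ?T"
        then have "i + j \<in> ?M" using i by force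
        then show "j \<in> (\<lambda>m. m - i) ` ?M" by force
      qed
    qed (use fM b0 in auto)
    finally show ?thesis .
  qed
  have "gval c g z (gmult a b) = (\<Sum>m\<in>?M. (\<Sum>i\<in>?S. \<alpha> i * \<beta> (m - i)) * z powi m)"
    unfolding gval_superset[OF c g fM s] using st by simp
  also have "\<dots> = (\<Sum>m\<in>?M. \<Sum>i\<in>?S. (\<alpha> i * z powi i) * (\<beta> (m - i) * z powi (m - i)))"
  proof (rule sum.cong[OF refl])
    fix m
    have "z powi m = z powi i * z powi (m - i)" for i using z power_int_add[of z i "m - i"] by simp
    then show "(\<Sum>i\<in>?S. \<alpha> i * \<beta> (m - i)) * z powi m = (\<Sum>i\<in>?S. (\<alpha> i * z powi i) * (\<beta> (m - i) * z powi (m - i)))"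
      unfolding sum_distrib_right by (intro sum.cong) (auto simp: mult.assoc mult.left_commute)
  qed
  also have "\<dots> = (\<Sum>i\<in>?S. (\<alpha> i * z powi i) * (\<Sum>m\<in>?M. \<beta> (m - i) * z powi (m - i)))"
    by (subst sum.swap) (simp add: sum_distrib_left)
  also have "\<dots> = (\<Sum>i\<in>?S. (\<alpha> i * z powi i) * (\<Sum>j\<in>?T. \<beta> j * z powi j))"
    using inner by (intro sum.cong) auto
  also have "\<dots> = gval c g z a * gval c g z b" unfolding gval_def \<alpha>_def \<beta>_def by (simp add: sum_distrib_right)
  finally show "gval c g z (gmult a b) = gval c g z a * gval c g z b" .
qed

lemma supp_homog: "supp (homog X m k) \<subseteq> {m}"
  by (auto simp: supp_def homog_def)

lemma homog_laurent:
  assumes c: "c \<in> points X" and g: "g \<in> Ks" and k: "k \<in> carrier K" "k \<oslash> g [^]\<^bsub>K\<^esub> m \<in> stalk c"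
  shows "homog X m k \<in> laurent c g" "gval c g z (homog X m k) = ev c (k \<oslash> g [^]\<^bsub>K\<^esub> m) * z powi m"
proof -
  show "homog X m k \<in> laurent c g"
    unfolding laurent_def using finite_subset[OF supp_homog] k stalk_zero(1)[OF c] ev_zero_quot(2)[OF c g]
    by (simp add: homog_def)
  show "gval c g z (homog X m k) = ev c (k \<oslash> g [^]\<^bsub>K\<^esub> m) * z powi m"
    unfolding gval_superset[OF c g _ supp_homog, simplified] by (simp add: homog_def)
qed

lemma homog_mult:
  assumes "k \<in> carrier K" "l \<in> carrier K"
  shows "gmult (homog X i k) (homog X j l) = homog X (i + j) (k \<otimes>\<^bsub>K\<^esub> l)"
proof
  fix m
  show "gmult (homog X i k) (homog X j l) m = homog X (i + j) (k \<otimes>\<^bsub>K\<^esub> l) m"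
  proof (cases "k = \<zero>\<^bsub>K\<^esub>")
    case True
    then have "supp (homog X i k) = {}" by (auto simp: supp_def homog_def)
    then show ?thesis unfolding gmult_def using assms True by (simp add: homog_def)
  next
    case False
    then have "supp (homog X i k) = {i}" by (auto simp: supp_def homog_def)
    then have "gmult (homog X i k) (homog X j l) m = (\<Oplus>\<^bsub>K\<^esub>n\<in>{i}. homog X i k n \<otimes>\<^bsub>K\<^esub> homog X j l (m - n))"
      by (simp add: gmult_def)
    also have "\<dots> = homog X i k i \<otimes>\<^bsub>K\<^esub> homog X j l (m - i)"
      using assms by (subst K.finsum_insert) (auto simp: homog_def)
    finally show ?thesis using assms by (auto simp: homog_def)
  qed
qed

text \<open>A character with value \<open>z\<close> at \<open>g\<close> has value
  \<open>z * ev c (g' \<oslash> g)\<close> at \<open>g'\<close>. This rule governs every change of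
  coordinates on a fibre.\<close>

lemma gval_change:
  assumes c: "c \<in> points X" and g: "g \<in> Ks" "g' \<in> Ks" and u: "g' \<oslash> g \<in> unit_stalk c"
  shows "laurent c g = laurent c g'"
    and "a \<in> laurent c g \<Longrightarrow> gval c g z a = gval c g' (z * ev c (g' \<oslash> g)) a"
proof -
  have e: "k \<oslash> h [^]\<^bsub>K\<^esub> (m::int) = (k \<oslash> h' [^]\<^bsub>K\<^esub> m) \<otimes>\<^bsub>K\<^esub> (h' \<oslash> h) [^]\<^bsub>K\<^esub> m" if "k \<in> carrier K" "h \<in> Ks" "h' \<in> Ks" for k m h h'
    using quot_trans[OF that(1) Ks_pow[OF that(3), of m] Ks_pow[OF that(2), of m]] quot_pow[OF that(3,2), of m] by simp
  have u': "g \<oslash> g' \<in> unit_stalk c" using unit_stalk_inv(1)[OF u] quot_inv(1)[OF g(2,1)] by simp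
  have "k \<oslash> g [^]\<^bsub>K\<^esub> (m::int) \<in> stalk c \<longleftrightarrow> k \<oslash> g' [^]\<^bsub>K\<^esub> m \<in> stalk c" if k: "k \<in> carrier K" for k m
    using e[OF k g(1,2), of m] e[OF k g(2,1), of m] stalk_mult(1) unit_stalkD(1)[OF unit_stalk_pow(1)[OF u, of m]]
      unit_stalkD(1)[OF unit_stalk_pow(1)[OF u', of m]] by metis
  then show l: "laurent c g = laurent c g'" unfolding laurent_def by blast
  assume a: "a \<in> laurent c g"
  have "ev c (a m \<oslash> g [^]\<^bsub>K\<^esub> m) * z powi m = ev c (a m \<oslash> g' [^]\<^bsub>K\<^esub> m) * (z * ev c (g' \<oslash> g)) powi m" for m
    unfolding e[OF laurentD(2)[OF a] g, of m m]
    using stalk_mult(2)[OF laurentD(3)[OF a[unfolded l], of m] unit_stalkD(1)[OF unit_stalk_pow(1)[OF u, of m]]] unit_stalk_pow(2)[OF u, of m]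
    by (simp add: power_int_mult_distrib)
  then show "gval c g z a = gval c g' (z * ev c (g' \<oslash> g)) a" unfolding gval_def by simp
qed

lemma power_stalk_simps:
  assumes G: "represents G L" and c: "c \<in> points X"
  shows "carrier (power_stalk X L c) = laurent c (G c)"
    "a \<otimes>\<^bsub>power_stalk X L c\<^esub> b = gmult a b"
    "a \<oplus>\<^bsub>power_stalk X L c\<^esub> b = gadd a b"
    "\<one>\<^bsub>power_stalk X L c\<^esub> = homog X 0 \<one>\<^bsub>K\<^esub>"
proof -
  have "(\<Union>U\<in>{U. openin (zariski X) U \<and> c \<in> U}. tensor_pow X L m U) = {k \<in> carrier K. k \<oslash> G c [^]\<^bsub>K\<^esub> m \<in> stalk c}" for m
    using represents_stalk[OF represents_tensor_pow[OF G] c] .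
  then show "carrier (power_stalk X L c) = laurent c (G c)"
    unfolding power_stalk_def by (auto simp: graded_ring_simps laurent_def)
qed (simp_all add: power_stalk_def graded_ring_simps)

lemma power_alg_carrier:
  assumes G: "represents G L" and U: "nopen X U"
  shows "a \<in> carrier (power_alg X L U) \<longleftrightarrow> (\<forall>c\<in>U. a \<in> laurent c (G c))"
proof -
  have "tensor_pow X L m U = sections (\<lambda>c. G c [^]\<^bsub>K\<^esub> m) U" for m
    using representsD(2)[OF represents_tensor_pow[OF G] U] .
  moreover have "U \<noteq> {}" using U by (simp add: nopen_def)
  ultimately show ?thesis
    unfolding power_alg_def graded_ring_simps laurent_def sections_def by auto
qed

lemma spt_homog:
  assumes "c \<in> points X" "g \<in> Ks"
  shows "spt c g z (homog X 1 g) = z" "homog X 1 g \<in> laurent c g"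
proof -
  have q: "g \<oslash> g [^]\<^bsub>K\<^esub> (1::int) = \<one>\<^bsub>K\<^esub>" using Ks_pow_1[of g] quot_self[of g] assms by simp
  have s: "g \<oslash> g [^]\<^bsub>K\<^esub> (1::int) \<in> stalk c" unfolding q by (rule stalk_one(1)[OF assms(1)])
  show "homog X 1 g \<in> laurent c g" by (rule homog_laurent(1)[OF assms _ s]) (use assms in simp)
  then show "spt c g z (homog X 1 g) = z"
    unfolding spt_def using homog_laurent(2)[OF assms _ s, of z] assms q stalk_one(2)[OF assms(1)] by simp
qed

lemma spec_pointI:
  assumes G: "represents G L" and c: "c \<in> points X" and z: "z \<noteq> 0"
  shows "(c, spt c (G c) z) \<in> spec_points X L"
proof -
  have g: "G c \<in> Ks" using divisor_Ks[OF representsD(1)[OF G] c] .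
  note ps = power_stalk_simps[OF G c]
  have one: "homog X 0 \<one>\<^bsub>K\<^esub> \<in> laurent c (G c)" "gval c (G c) z (homog X 0 \<one>\<^bsub>K\<^esub>) = 1"
    using homog_laurent(1)[OF c g, of "\<one>\<^bsub>K\<^esub>" 0] homog_laurent(2)[OF c g, of "\<one>\<^bsub>K\<^esub>" 0 z] stalk_one[OF c] by simp_all
  have "spt c (G c) z \<in> ring_hom (power_stalk X L c) complex_ring"
    by (rule ring_hom_memI)
      (simp_all add: ps complex_ring_def spt_def gmult_laurent[OF c g] gadd_laurent[OF c g] z one)
  moreover have "spt c (G c) z (homog X 0 (germ X U f)) = f c"
    if U: "openin (zariski X) U" "c \<in> U" "f \<in> reg X U" for U f
  proof -
    have n: "nopen X U" using nopenI U by blast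
    have s: "germ X U f \<in> stalk c" using stalk_germ[OF n U(3,2)] .
    then show ?thesis
      using homog_laurent(1)[OF c g, of "germ X U f" 0] homog_laurent(2)[OF c g, of "germ X U f" 0 z] ev_germ[OF n U(3,2)] by (simp add: spt_def)
  qed
  ultimately show ?thesis
    unfolding spec_points_def using c by (simp add: ps spt_def)
qed

text \<open>In degree 0 the character is evaluation at \<open>c\<close>, and an element
  \<open>k\<close> of degree m is a degree 0 element times the m-th power of the generator. So the
  character is determined by its value \<open>z\<close> at the generator.\<close>

lemma spec_pointE:
  assumes G: "represents G L" and p: "(c, \<psi>) \<in> spec_points X L"
  obtains z where "c \<in> points X" "z \<noteq> 0" "\<psi> = spt c (G c) z"
proof -
  have c: "c \<in> points X" using p by (simp add: spec_points_def)
  define g where "g = G c"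
  have g: "g \<in> Ks" unfolding g_def using divisor_Ks[OF representsD(1)[OF G] c] .
  note ps = power_stalk_simps[OF G c, folded g_def]
  have psi_ext: "\<psi> \<in> extensional (laurent c g)" and hom: "\<psi> \<in> ring_hom (power_stalk X L c) complex_ring"
    and deg0: "\<And>U f. openin (zariski X) U \<Longrightarrow> c \<in> U \<Longrightarrow> f \<in> reg X U \<Longrightarrow> \<psi> (homog X 0 (germ X U f)) = f c"
    using p by (simp_all add: spec_points_def ps)
  have mul: "\<psi> (gmult a b) = \<psi> a * \<psi> b" if "a \<in> laurent c g" "b \<in> laurent c g" for a b
    using ring_hom_mult[OF hom, of a b] that by (simp add: ps complex_ring_def)
  have add: "\<psi> (gadd a b) = \<psi> a + \<psi> b" if "a \<in> laurent c g" "b \<in> laurent c g" for a b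
    using ring_hom_add[OF hom, of a b] that by (simp add: ps complex_ring_def)
  have one: "\<psi> (homog X 0 \<one>\<^bsub>K\<^esub>) = 1"
    using ring_hom_one[OF hom] by (simp add: ps complex_ring_def)
  have h0: "\<psi> (homog X 0 k) = ev c k" if k: "k \<in> stalk c" for k
  proof -
    obtain U f where u: "nopen X U" "c \<in> U" "f \<in> reg X U" "k = germ X U f" using stalkE[OF k] .
    show ?thesis unfolding u(4) using deg0[OF nopenD(1)[OF u(1)] u(2,3)] ev_germ[OF u(1,3,2)] by simp
  qed
  have gl: "homog X m (g [^]\<^bsub>K\<^esub> m) \<in> laurent c g" for m
    by (rule homog_laurent(1)[OF c g]) (use Ks_pow[OF g, of m] quot_self[OF Ks_pow[OF g, of m]] stalk_one(1)[OF c] in simp_all)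
  define z where "z = \<psi> (homog X 1 g)"
  have pow_add: "\<psi> (homog X (i + j) (g [^]\<^bsub>K\<^esub> (i + j))) = \<psi> (homog X i (g [^]\<^bsub>K\<^esub> i)) * \<psi> (homog X j (g [^]\<^bsub>K\<^esub> j))" for i j
    using mul[OF gl[of i] gl[of j]] homog_mult[of "g [^]\<^bsub>K\<^esub> i" "g [^]\<^bsub>K\<^esub> j" i j] Ks_pow[OF g] Ks_pow_add[OF g, of i j] by simp
  have p1: "\<psi> (homog X 1 (g [^]\<^bsub>K\<^esub> (1::int))) = z" using Ks_pow_1[of g] g by (simp add: z_def)
  have p0: "\<psi> (homog X 0 (g [^]\<^bsub>K\<^esub> (0::int))) = 1" using one by simp
  \<comment> \<open>The inverse of \<open>g\<close> lies in degree -1 of the stalk algebra, and its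
    product with \<open>g\<close> is 1.\<close>
  have z: "z \<noteq> 0" using pow_add[of 1 "-1"] p1 p0 by auto
  have pn: "\<psi> (homog X (int n) (g [^]\<^bsub>K\<^esub> (int n))) = z ^ n" for n
  proof (induction n)
    case (Suc n)
    then show ?case using pow_add[of 1 "int n"] p1 by simp
  qed (use p0 in simp)
  have pm: "\<psi> (homog X m (g [^]\<^bsub>K\<^esub> m)) = z powi m" for m
  proof (cases m rule: int_cases2)
    case (nonneg n)
    then show ?thesis using pn by simp
  next
    case (nonpos n)
    have "z ^ n * \<psi> (homog X m (g [^]\<^bsub>K\<^esub> m)) = 1" using pow_add[of "int n" m] pn p0 nonpos by simp
    then show ?thesis using z nonpos by (simp add: power_int_minus field_simps)
  qed
  have ph: "\<psi> (homog X m k) = gval c g z (homog X m k)" if k: "k \<in> carrier K" "k \<oslash> g [^]\<^bsub>K\<^esub> m \<in> stalk c" for m k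
  proof -
    have s0: "homog X 0 (k \<oslash> g [^]\<^bsub>K\<^esub> m) \<in> laurent c g"
      by (rule homog_laurent(1)[OF c g]) (use k quot_carrier[OF k(1) Ks_pow[OF g]] in simp_all)
    have "gmult (homog X 0 (k \<oslash> g [^]\<^bsub>K\<^esub> m)) (homog X m (g [^]\<^bsub>K\<^esub> m)) = homog X m k"
      using homog_mult[of "k \<oslash> g [^]\<^bsub>K\<^esub> m" "g [^]\<^bsub>K\<^esub> m" 0 m] quot_carrier[OF k(1) Ks_pow[OF g]] Ks_pow[OF g] quot_cancel(1)[OF k(1) Ks_pow[OF g]]
      by simp
    then have "\<psi> (homog X m k) = ev c (k \<oslash> g [^]\<^bsub>K\<^esub> m) * z powi m"
      using mul[OF s0 gl[of m]] h0[OF k(2)] pm[of m] by simp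
    then show ?thesis using homog_laurent(2)[OF c g k] by simp
  qed
  have "\<psi> a = gval c g z a" if a: "a \<in> laurent c g" for a
  proof -
    \<comment> \<open>Induction over a finite set containing the support, splitting off one
      homogeneous component at a time.\<close>
    have "\<psi> b = gval c g z b" if "finite S" "b \<in> laurent c g" "supp b \<subseteq> S" for b S
      using that
    proof (induction S arbitrary: b rule: finite_induct)
      case empty
      then have "b = homog X 0 \<zero>\<^bsub>K\<^esub>" by (auto simp: supp_def homog_def)
      then show ?case using ph[of "\<zero>\<^bsub>K\<^esub>" 0] ev_zero_quot(2)[OF c g] stalk_zero(1)[OF c] by simp
    next
      case (insert m S)
      let ?b = "\<lambda>i. if i = m then \<zero>\<^bsub>K\<^esub> else b i"
      have sub: "supp ?b \<subseteq> supp b" by (auto simp: supp_def)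
      have b': "?b \<in> laurent c g"
        unfolding laurent_def using finite_subset[OF sub laurentD(1)[OF insert.prems(1)]] laurentD(2,3)[OF insert.prems(1)] stalk_zero(1)[OF c] ev_zero_quot(2)[OF c g]
        by simp
      have s': "supp ?b \<subseteq> S" using insert.prems(2) by (auto simp: supp_def)
      have hm: "homog X m (b m) \<in> laurent c g" using homog_laurent(1)[OF c g laurentD(2,3)[OF insert.prems(1)]] .
      have e: "b = gadd (homog X m (b m)) ?b"
        unfolding gadd_def homog_def using laurentD(2)[OF insert.prems(1)] by (intro ext) auto
      have "\<psi> b = \<psi> (homog X m (b m)) + \<psi> ?b" using add[OF hm b'] e by simp
      also have "\<dots> = gval c g z (homog X m (b m)) + gval c g z ?b"
        using ph[OF laurentD(2,3)[OF insert.prems(1)]] insert.IH[OF b' s'] by simp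
      also have "\<dots> = gval c g z b" using gadd_laurent(2)[OF c g hm b'] e by simp
      finally show ?case .
    qed
    then show ?thesis using laurentD(1)[OF a] a by blast
  qed
  then have "\<psi> = spt c g z" unfolding spt_def using psi_ext by (auto simp: extensional_def restrict_def)
  then show thesis using that[OF c z] by (simp add: g_def)
qed

definition spec_gens :: "'a submod \<Rightarrow> (('a \<times> ((int \<Rightarrow> 'a ratfun) \<Rightarrow> complex)) set \<times> ('a \<times> ((int \<Rightarrow> 'a ratfun) \<Rightarrow> complex) \<Rightarrow> complex)) set" where
  "spec_gens L = {({(c, \<psi>) \<in> spec_points X L. c \<in> U \<and> \<psi> b \<noteq> 0}, \<lambda>(c, \<psi>). \<psi> a / \<psi> b) | U a b.
        nopen X U \<and> a \<in> carrier (power_alg X L U) \<and> b \<in> carrier (power_alg X L U)}"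

lemma spec_space_eq: "spec_space X L = generated_space (spec_gens L)"
  by (simp add: spec_space_def spec_gens_def)

lemma spec_gensI:
  assumes "nopen X U" "a \<in> carrier (power_alg X L U)" "b \<in> carrier (power_alg X L U)"
  shows "({(c, \<psi>) \<in> spec_points X L. c \<in> U \<and> \<psi> b \<noteq> 0}, \<lambda>(c, \<psi>). \<psi> a / \<psi> b) \<in> spec_gens L"
  unfolding spec_gens_def by (rule CollectI, rule exI[of _ U], rule exI[of _ a], rule exI[of _ b]) (simp add: assms)

lemma spec_gensE:
  assumes "(D, h) \<in> spec_gens L"
  obtains U a b where "D = {(c, \<psi>) \<in> spec_points X L. c \<in> U \<and> \<psi> b \<noteq> 0}" "h = (\<lambda>(c, \<psi>). \<psi> a / \<psi> b)"
    "nopen X U" "a \<in> carrier (power_alg X L U)" "b \<in> carrier (power_alg X L U)"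
  using assms unfolding spec_gens_def by (elim CollectE exE conjE) simp

lemma one_power_alg:
  assumes "represents G L" "nopen X U"
  shows "homog X 0 \<one>\<^bsub>K\<^esub> \<in> carrier (power_alg X L U)"
  unfolding power_alg_carrier[OF assms]
proof
  fix c assume "c \<in> U"
  then have c: "c \<in> points X" using nopenD(2)[OF assms(2)] by blast
  show "homog X 0 \<one>\<^bsub>K\<^esub> \<in> laurent c (G c)"
    using homog_laurent(1)[OF c divisor_Ks[OF representsD(1)[OF assms(1)] c], of "\<one>\<^bsub>K\<^esub>" 0] stalk_one[OF c] by simp
qed

lemma spt_one:
  assumes "c \<in> points X" "g \<in> Ks"
  shows "spt c g z (homog X 0 \<one>\<^bsub>K\<^esub>) = 1"
  using homog_laurent(1)[OF assms, of "\<one>\<^bsub>K\<^esub>" 0] homog_laurent(2)[OF assms, of "\<one>\<^bsub>K\<^esub>" 0 z] stalk_one[OF assms(1)] by (simp add: spt_def)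

lemma spec_point_one:
  assumes G: "represents G L" and p: "(c, \<psi>) \<in> spec_points X L"
  shows "\<psi> (homog X 0 \<one>\<^bsub>K\<^esub>) = 1"
proof -
  obtain z where z: "c \<in> points X" "z \<noteq> 0" "\<psi> = spt c (G c) z" using spec_pointE[OF G p] .
  then show ?thesis using spt_one divisor_Ks[OF representsD(1)[OF G] z(1)] by simp
qed

lemma points_spec_space:
  assumes G: "represents G L"
  shows "points (spec_space X L) = spec_points X L"
  unfolding spec_space_eq points_generated
proof (intro equalityI subsetI)
  fix p assume "p \<in> \<Union> (fst ` spec_gens L)"
  then obtain D h where "(D, h) \<in> spec_gens L" "p \<in> D" by auto
  then show "p \<in> spec_points X L" by (elim spec_gensE) blast
next
  fix p assume p: "p \<in> spec_points X L"
  obtain c \<psi> where cp: "p = (c, \<psi>)" by (cases p)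
  have c: "c \<in> points X" using p cp by (simp add: spec_points_def)
  note o = one_power_alg[OF G nopen_points]
  show "p \<in> \<Union> (fst ` spec_gens L)"
    by (rule UN_I[OF spec_gensI[OF nopen_points o o]]) (use p cp c spec_point_one[OF G, of c \<psi>] in simp)
qed

end

text \<open>Here generators pull back to generators, so local agreement with a generator is
  inherited directly, without performing any ring operation on the source. Relative spectra are
  compared in this way.\<close>

lemma fmorphism_generated_generated:
  assumes pts: "\<And>x. x \<in> \<Union>(fst ` P) \<Longrightarrow> \<phi> x \<in> \<Union>(fst ` Q)"
    and gen: "\<And>D g. (D, g) \<in> Q \<Longrightarrow> \<exists>(E, k)\<in>P. preim (generated_space P) \<phi> D = E \<and> (\<forall>x\<in>E. g (\<phi> x) = k x)"
  shows "fmorphism (generated_space P) (generated_space Q) \<phi>"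
proof -
  let ?X = "generated_space P"
  have cm: "continuous_map (zariski ?X) (zariski (generated_space Q)) \<phi>"
    unfolding generated_space_def[of Q] Let_def fspace.select_convs
  proof (rule continuous_on_generated_topo)
    fix U assume "U \<in> fst ` Q"
    then obtain g where "(U, g) \<in> Q" by auto
    then obtain E k where E: "(E, k) \<in> P" "preim ?X \<phi> U = E" using gen by fast
    then show "openin (zariski ?X) (\<phi> -` U \<inter> points ?X)"
      using open_generated[OF E(1)] by (simp add: preim_def vimage_def Int_def conj_commute)
  next
    show "\<phi> ` points ?X \<subseteq> \<Union> (fst ` Q)" using pts unfolding points_generated by blast
  qed
  have "(\<lambda>x\<in>preim ?X \<phi> V. f (\<phi> x)) \<in> reg ?X (preim ?X \<phi> V)"
    if V: "openin (zariski (generated_space Q)) V" and f: "f \<in> reg (generated_space Q) V" for V f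
    unfolding reg_generated
  proof (intro conjI ballI)
    fix x assume x: "x \<in> preim ?X \<phi> V"
    then have "\<phi> x \<in> V" by simp
    then obtain D g W where W: "(D, g) \<in> Q" "openin (zariski (generated_space Q)) W" "\<phi> x \<in> W" "W \<subseteq> V \<inter> D" "\<forall>y\<in>W. f y = g y"
      using f unfolding reg_generated by blast
    obtain E k where E: "(E, k) \<in> P" "preim ?X \<phi> D = E" "\<forall>x\<in>E. g (\<phi> x) = k x" using gen[OF W(1)] by fast
    have oW: "openin (zariski ?X) (preim ?X \<phi> W)" using cm W by (simp add: continuous_map_def preim_def)
    have "preim ?X \<phi> W \<subseteq> preim ?X \<phi> V \<inter> E" using W E by auto
    moreover have "\<forall>y\<in>preim ?X \<phi> W. (\<lambda>x\<in>preim ?X \<phi> V. f (\<phi> x)) y = k y"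
      using W(4,5) E(2,3) by auto
    ultimately show "\<exists>D g W. (D, g) \<in> P \<and> openin (zariski ?X) W \<and> x \<in> W \<and> W \<subseteq> preim ?X \<phi> V \<inter> D \<and>
        (\<forall>y\<in>W. (\<lambda>x\<in>preim ?X \<phi> V. f (\<phi> x)) y = g y)"
      using E(1) oW x W(3) by (intro ex3I[of _ E k "preim ?X \<phi> W"]) auto
  qed auto
  then show ?thesis using cm by (simp add: fmorphism_def)
qed

section \<open>Isomorphisms of torsors associated with pairs\<close>

lemma pair_torsor_simps [simp]:
  "zariski (pair_torsor C L h) = zariski (spec_space C L)" "reg (pair_torsor C L h) = reg (spec_space C L)"
  "base (pair_torsor C L h) = fst"
  by (simp_all add: pair_torsor_def)

lemma points_circle: "points circle = - {0}"
  by (simp add: circle_def points_Gm)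

lemma cnj_power_int: "cnj (x powi n) = cnj x powi n"
  by (cases n rule: int_cases2) (simp_all add: power_int_minus)

lemma (in irr_space) supp_mult:
  assumes "\<And>m. k m \<in> carrier K"
  shows "supp (\<lambda>m. k m \<otimes>\<^bsub>K\<^esub> a m) \<subseteq> supp a"
proof
  fix m assume "m \<in> supp (\<lambda>m. k m \<otimes>\<^bsub>K\<^esub> a m)"
  then have "k m \<otimes>\<^bsub>K\<^esub> a m \<noteq> \<zero>\<^bsub>K\<^esub>" by (simp add: supp_def)
  moreover have "k m \<otimes>\<^bsub>K\<^esub> a m = \<zero>\<^bsub>K\<^esub>" if "a m = \<zero>\<^bsub>K\<^esub>"
    unfolding that by (rule K.r_null[OF assms])
  ultimately show "m \<in> supp a" unfolding supp_def by blast
qed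

context real_irr_space
begin

text \<open>Scaling the component of degree m by \<open>z powi m\<close> has the same effect on
  \<open>gval\<close> as scaling the coordinate by \<open>z\<close>.\<close>

lemma pair_torsor_act:
  assumes G: "represents G L" and c: "c \<in> points C"
  shows "act (pair_torsor C L h) z (c, spt c (G c) w) = (c, spt c (G c) (z * w))"
proof -
  have g: "G c \<in> Ks" using divisor_Ks[OF representsD(1)[OF G] c] .
  have key: "spt c (G c) w (\<lambda>m. const_rat C (z powi m) \<otimes>\<^bsub>K\<^esub> a m) = gval c (G c) (z * w) a" if a: "a \<in> laurent c (G c)" for a
  proof -
    let ?b = "\<lambda>m. const_rat C (z powi m) \<otimes>\<^bsub>K\<^esub> a m"
    have s: "supp ?b \<subseteq> supp a" by (rule supp_mult) simp
    have q: "?b m \<oslash> G c [^]\<^bsub>K\<^esub> m = const_rat C (z powi m) \<otimes>\<^bsub>K\<^esub> (a m \<oslash> G c [^]\<^bsub>K\<^esub> m)" for m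
      using laurentD(2)[OF a] Ks_inv[OF Ks_pow[OF g, of m]] by (simp add: K.m_assoc)
    have ev_q: "ev c (?b m \<oslash> G c [^]\<^bsub>K\<^esub> m) = z powi m * ev c (a m \<oslash> G c [^]\<^bsub>K\<^esub> m)" for m
      unfolding q using stalk_mult(2)[OF stalk_const(1)[OF c] laurentD(3)[OF a]] stalk_const(2)[OF c] by simp
    have b: "?b \<in> laurent c (G c)"
      unfolding laurent_def using finite_subset[OF s laurentD(1)[OF a]] laurentD(2)[OF a]
        stalk_mult(1)[OF stalk_const(1)[OF c] laurentD(3)[OF a]] by (simp add: q)
    have "gval c (G c) w ?b = gval c (G c) (z * w) a"
      unfolding gval_superset[OF c g laurentD(1)[OF a] s] ev_q
      by (simp add: gval_def power_int_mult_distrib mult_ac)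
    then show ?thesis using b by (simp add: spt_def)
  qed
  show ?thesis
    using key by (auto simp: pair_torsor_def power_stalk_simps(1)[OF G c] spt_def restrict_def)
qed

text \<open>The generator at the conjugate point, in degree 1, is sent to \<open>h\<close> times its
  conjugate in degree -1. Since \<open>e\<close> is the value of \<open>G c\<close> times this
  conjugate times \<open>h\<close>, the value of that section at the coordinate \<open>z\<close> is
  \<open>e / z\<close>; the coordinate of the image point is the complex conjugate.\<close>

lemma pair_torsor_rconj:
  assumes G: "represents G L" and h: "real_pair G h" and c: "c \<in> points C" and z: "z \<noteq> 0"
  defines "e \<equiv> ev c ((G c \<otimes>\<^bsub>K\<^esub> rat_conj C (G (rconj C c))) \<otimes>\<^bsub>K\<^esub> h)"
  shows "rconj (pair_torsor C L h) (c, spt c (G c) z) = (rconj C c, spt (rconj C c) (G (rconj C c)) (cnj (e / z)))"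
    "e \<noteq> 0"
proof -
  define g where "g = G c"
  define c' where "c' = rconj C c"
  define g' where "g' = G c'"
  have c': "c' \<in> points C" unfolding c'_def using conj_points[OF c] .
  have g: "g \<in> Ks" "g' \<in> Ks" unfolding g_def g'_def using divisor_Ks[OF representsD(1)[OF G]] c c' by blast+
  have hK: "h \<in> Ks" using h by (simp add: real_pair_def)
  define u where "u = (g \<otimes>\<^bsub>K\<^esub> rat_conj C g') \<otimes>\<^bsub>K\<^esub> h"
  have u: "u \<in> unit_stalk c" using h c by (simp add: real_pair_def u_def g_def g'_def c'_def)
  have e: "e = ev c u" by (simp add: e_def u_def g_def g'_def c'_def)
  show "e \<noteq> 0" using unit_stalkD(2)[OF u] e by simp
  have rg: "rat_conj C g' \<in> Ks" using rat_conj_Ks[OF g(2)] .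
  have key: "cnj (spt c g z (\<lambda>m. h [^]\<^bsub>K\<^esub> (- m) \<otimes>\<^bsub>K\<^esub> rat_conj C (a (- m)))) = gval c' g' (cnj (e / z)) a"
    if a: "a \<in> laurent c' g'" for a
  proof -
    let ?b = "\<lambda>m. h [^]\<^bsub>K\<^esub> (- m) \<otimes>\<^bsub>K\<^esub> rat_conj C (a (- m))"
    have ac: "a m \<in> carrier K" for m using laurentD(2)[OF a] .
    \<comment> \<open>The unit \<open>u\<close>, raised to the power -m, absorbs the powers of
      \<open>h\<close>, of \<open>g\<close> and of the conjugate of \<open>g'\<close>. What remains
      is the conjugate of the coefficient of \<open>a\<close> with respect to \<open>g'\<close>,
      which is known to be regular.\<close>
    have q: "?b m \<oslash> g [^]\<^bsub>K\<^esub> m = u [^]\<^bsub>K\<^esub> (- m) \<otimes>\<^bsub>K\<^esub> rat_conj C (a (- m) \<oslash> g' [^]\<^bsub>K\<^esub> (- m))" for m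
    proof -
      define R where "R = rat_conj C g' [^]\<^bsub>K\<^esub> (- m)"
      define H where "H = h [^]\<^bsub>K\<^esub> (- m)"
      define Q where "Q = g [^]\<^bsub>K\<^esub> (- m)"
      define x where "x = rat_conj C (a (- m))"
      have cl: "R \<in> Ks" "H \<in> Ks" "Q \<in> Ks" "x \<in> carrier K"
        using Ks_pow[OF rg] Ks_pow[OF hK] Ks_pow[OF g(1)] ac by (simp_all add: R_def H_def Q_def x_def)
      have iR: "inv\<^bsub>K\<^esub> R \<in> carrier K" using Ks_inv[OF cl(1)] by simp
      have 1: "u [^]\<^bsub>K\<^esub> (- m) = (Q \<otimes>\<^bsub>K\<^esub> R) \<otimes>\<^bsub>K\<^esub> H"
        unfolding u_def Q_def R_def H_def Ks_mult_pow[OF Ks_mult[OF g(1) rg] hK] Ks_mult_pow[OF g(1) rg] ..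
      have 2: "rat_conj C (a (- m) \<oslash> g' [^]\<^bsub>K\<^esub> (- m)) = x \<otimes>\<^bsub>K\<^esub> inv\<^bsub>K\<^esub> R"
        unfolding x_def R_def
        using rat_conj_mult[OF ac, of "inv\<^bsub>K\<^esub> (g' [^]\<^bsub>K\<^esub> (- m))" "- m"] Ks_inv[OF Ks_pow[OF g(2), of "- m"]]
          rat_conj_inv[OF Ks_pow[OF g(2), of "- m"]] rat_conj_pow[OF g(2), of "- m"] by simp
      have 3: "inv\<^bsub>K\<^esub> (g [^]\<^bsub>K\<^esub> m) = Q" unfolding Q_def using Ks_pow_neg[OF g(1), of m] by simp
      have "((Q \<otimes>\<^bsub>K\<^esub> R) \<otimes>\<^bsub>K\<^esub> H) \<otimes>\<^bsub>K\<^esub> (x \<otimes>\<^bsub>K\<^esub> inv\<^bsub>K\<^esub> R) = ((H \<otimes>\<^bsub>K\<^esub> x) \<otimes>\<^bsub>K\<^esub> Q) \<otimes>\<^bsub>K\<^esub> (R \<otimes>\<^bsub>K\<^esub> inv\<^bsub>K\<^esub> R)"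
        using cl iR by (simp add: K.m_ac)
      also have "\<dots> = (H \<otimes>\<^bsub>K\<^esub> x) \<otimes>\<^bsub>K\<^esub> Q" using cl quot_self[OF cl(1)] by simp
      finally show ?thesis unfolding 1 2 3 H_def x_def by simp
    qed
    have um: "u [^]\<^bsub>K\<^esub> (- m) \<in> unit_stalk c" "ev c (u [^]\<^bsub>K\<^esub> (- m)) = e powi (- m)" for m
      using unit_stalk_pow[OF u, of "- m"] e by simp_all
    have rs: "rat_conj C (a (- m) \<oslash> g' [^]\<^bsub>K\<^esub> (- m)) \<in> stalk c"
      "ev c (rat_conj C (a (- m) \<oslash> g' [^]\<^bsub>K\<^esub> (- m))) = cnj (ev c' (a (- m) \<oslash> g' [^]\<^bsub>K\<^esub> (- m)))" for m
      using rat_conj_stalk[OF c, of "a (- m) \<oslash> g' [^]\<^bsub>K\<^esub> (- m)"] laurentD(3)[OF a, of "- m"] by (simp_all add: c'_def)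
    have st: "?b m \<oslash> g [^]\<^bsub>K\<^esub> m \<in> stalk c"
      "ev c (?b m \<oslash> g [^]\<^bsub>K\<^esub> m) = e powi (- m) * cnj (ev c' (a (- m) \<oslash> g' [^]\<^bsub>K\<^esub> (- m)))" for m
      unfolding q using stalk_mult[OF unit_stalkD(1)[OF um(1)[of m]] rs(1)[of m]] um(2) rs(2) by simp_all
    have s: "supp ?b \<subseteq> uminus ` supp a"
    proof
      fix m assume "m \<in> supp ?b"
      then have "?b m \<noteq> \<zero>\<^bsub>K\<^esub>" by (simp add: supp_def)
      moreover have "?b m = \<zero>\<^bsub>K\<^esub>" if "a (- m) = \<zero>\<^bsub>K\<^esub>"
        unfolding that rat_conj_zero by (rule K.r_null) (use Ks_pow[OF hK, of "- m"] in simp)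
      ultimately have "a (- m) \<noteq> \<zero>\<^bsub>K\<^esub>" by blast
      then have "- m \<in> supp a" by (simp add: supp_def)
      then show "m \<in> uminus ` supp a" by force
    qed
    have fin: "finite (uminus ` supp a)" using laurentD(1)[OF a] by simp
    have bc: "?b m \<in> carrier K" for m using Ks_pow[OF hK, of "- m"] ac by simp
    have b: "?b \<in> laurent c g" unfolding laurent_def using finite_subset[OF s fin] st(1) bc by simp
    have "gval c g z ?b = (\<Sum>m\<in>uminus ` supp a. e powi (- m) * cnj (ev c' (a (- m) \<oslash> g' [^]\<^bsub>K\<^esub> (- m))) * z powi m)"
      unfolding gval_superset[OF c g(1) fin s] st(2) ..
    also have "\<dots> = (\<Sum>n\<in>supp a. e powi n * cnj (ev c' (a n \<oslash> g' [^]\<^bsub>K\<^esub> n)) * z powi (- n))"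
      by (subst sum.reindex) (auto simp: inj_on_def)
    finally have "cnj (gval c g z ?b) = (\<Sum>n\<in>supp a. cnj e powi n * ev c' (a n \<oslash> g' [^]\<^bsub>K\<^esub> n) * cnj z powi (- n))"
      by (simp add: cnj_power_int)
    also have "\<dots> = gval c' g' (cnj (e / z)) a"
      unfolding gval_def by (intro sum.cong refl) (simp add: power_int_mult_distrib power_int_inverse power_int_minus divide_inverse mult_ac)
    finally show ?thesis using b by (simp add: spt_def)
  qed
  have ps: "carrier (power_stalk C L c') = laurent c' g'" using power_stalk_simps(1)[OF G c'] by (simp add: g'_def)
  have "rconj (pair_torsor C L h) (c, spt c g z) = (c', spt c' g' (cnj (e / z)))"
    using key unfolding pair_torsor_def by (simp add: ps c'_def[symmetric]) (auto simp: spt_def restrict_def)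
  then show "rconj (pair_torsor C L h) (c, spt c (G c) z) = (rconj C c, spt (rconj C c) (G (rconj C c)) (cnj (e / z)))"
    by (simp add: g_def g'_def c'_def)
qed

text \<open>The value at \<open>homog C 1 (G1 c)\<close> is the coordinate of the point, and it is
  multiplied by the value of \<open>f \<otimes> (G2 c \<oslash> G1 c)\<close>. If this element is a
  unit at every point, \<open>f\<close> times \<open>G2 c\<close> generates \<open>L1\<close>, and
  the map is dual to multiplication by the m-th power of \<open>f\<close> from the m-th power of
  \<open>L2\<close> to that of \<open>L1\<close>.\<close>

definition transport :: "('a \<Rightarrow> 'a ratfun) \<Rightarrow> ('a \<Rightarrow> 'a ratfun) \<Rightarrow> 'a ratfun \<Rightarrow>
    'a \<times> ((int \<Rightarrow> 'a ratfun) \<Rightarrow> complex) \<Rightarrow> 'a \<times> ((int \<Rightarrow> 'a ratfun) \<Rightarrow> complex)" where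
  "transport G1 G2 f = (\<lambda>(c, \<psi>). (c, spt c (G2 c) (\<psi> (homog C 1 (G1 c)) * ev c (f \<otimes>\<^bsub>K\<^esub> (G2 c \<oslash> G1 c)))))"

lemma transport_spt:
  assumes "represents G1 L1" "c \<in> points C"
  shows "transport G1 G2 f (c, spt c (G1 c) z) = (c, spt c (G2 c) (z * ev c (f \<otimes>\<^bsub>K\<^esub> (G2 c \<oslash> G1 c))))"
  using spt_homog(1)[OF assms(2) divisor_Ks[OF representsD(1)[OF assms(1)] assms(2)], of z] by (simp add: transport_def)

lemma gval_transport:
  assumes c: "c \<in> points C" and g: "g1 \<in> Ks" "g2 \<in> Ks" and f: "f \<in> Ks" and u: "f \<otimes>\<^bsub>K\<^esub> (g2 \<oslash> g1) \<in> unit_stalk c"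
    and b: "b \<in> laurent c g2"
  defines "b' \<equiv> \<lambda>m. f [^]\<^bsub>K\<^esub> m \<otimes>\<^bsub>K\<^esub> b m"
  shows "b' \<in> laurent c g1" "gval c g1 z b' = gval c g2 (z * ev c (f \<otimes>\<^bsub>K\<^esub> (g2 \<oslash> g1))) b"
proof -
  let ?u = "f \<otimes>\<^bsub>K\<^esub> (g2 \<oslash> g1)"
  have bc: "b m \<in> carrier K" for m using laurentD(2)[OF b] .
  have q: "b' m \<oslash> g1 [^]\<^bsub>K\<^esub> m = (b m \<oslash> g2 [^]\<^bsub>K\<^esub> m) \<otimes>\<^bsub>K\<^esub> ?u [^]\<^bsub>K\<^esub> m" for m
  proof -
    define F where "F = f [^]\<^bsub>K\<^esub> m"
    define A where "A = b m \<oslash> g2 [^]\<^bsub>K\<^esub> m"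
    define B where "B = g2 [^]\<^bsub>K\<^esub> m \<oslash> g1 [^]\<^bsub>K\<^esub> m"
    have cl: "F \<in> carrier K" "A \<in> carrier K" "B \<in> carrier K" "inv\<^bsub>K\<^esub> (g1 [^]\<^bsub>K\<^esub> m) \<in> carrier K"
      using Ks_pow[OF f, of m] quot_carrier[OF bc Ks_pow[OF g(2)]] quot_Ks[OF Ks_pow[OF g(2), of m] Ks_pow[OF g(1), of m]]
        Ks_inv[OF Ks_pow[OF g(1), of m]] by (simp_all add: F_def A_def B_def)
    have "?u [^]\<^bsub>K\<^esub> m = F \<otimes>\<^bsub>K\<^esub> B"
      unfolding F_def B_def Ks_mult_pow[OF f quot_Ks[OF g(2,1)]] quot_pow[OF g(2,1)] ..
    then have "A \<otimes>\<^bsub>K\<^esub> ?u [^]\<^bsub>K\<^esub> m = F \<otimes>\<^bsub>K\<^esub> (A \<otimes>\<^bsub>K\<^esub> B)" using cl by (simp add: K.m_ac)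
    also have "A \<otimes>\<^bsub>K\<^esub> B = b m \<oslash> g1 [^]\<^bsub>K\<^esub> m"
      unfolding A_def B_def by (rule quot_trans[OF bc Ks_pow[OF g(2)] Ks_pow[OF g(1)], symmetric])
    finally show ?thesis unfolding A_def b'_def using cl bc by (simp add: F_def K.m_assoc)
  qed
  have st: "b' m \<oslash> g1 [^]\<^bsub>K\<^esub> m \<in> stalk c" "ev c (b' m \<oslash> g1 [^]\<^bsub>K\<^esub> m) = ev c (b m \<oslash> g2 [^]\<^bsub>K\<^esub> m) * ev c ?u powi m" for m
    unfolding q using stalk_mult[OF laurentD(3)[OF b, of m] unit_stalkD(1)[OF unit_stalk_pow(1)[OF u, of m]]] unit_stalk_pow(2)[OF u, of m] by simp_all
  have s: "supp b' \<subseteq> supp b" unfolding b'_def by (rule supp_mult) (use Ks_pow[OF f] in simp)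
  show "b' \<in> laurent c g1" unfolding laurent_def using finite_subset[OF s laurentD(1)[OF b]] st(1) Ks_pow[OF f] bc
    by (simp add: b'_def)
  show "gval c g1 z b' = gval c g2 (z * ev c ?u) b"
    unfolding gval_superset[OF c g(1) laurentD(1)[OF b] s] st(2)
    by (simp add: gval_def power_int_mult_distrib mult_ac)
qed

lemma transport_fmorphism:
  assumes G1: "represents G1 L1" and G2: "represents G2 L2" and f: "f \<in> Ks"
    and u: "\<And>c. c \<in> points C \<Longrightarrow> f \<otimes>\<^bsub>K\<^esub> (G2 c \<oslash> G1 c) \<in> unit_stalk c"
  shows "fmorphism (spec_space C L1) (spec_space C L2) (transport G1 G2 f)"
    and "p \<in> spec_points C L1 \<Longrightarrow> transport G1 G2 f p \<in> spec_points C L2"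
proof -
  have pts: "transport G1 G2 f p \<in> spec_points C L2" if pin: "p \<in> spec_points C L1" for p
  proof -
    obtain c \<psi> where p: "p = (c, \<psi>)" by (cases p)
    obtain z where z: "c \<in> points C" "z \<noteq> 0" "\<psi> = spt c (G1 c) z" using spec_pointE[OF G1] pin p by metis
    show ?thesis unfolding p z(3) transport_spt[OF G1 z(1)]
      using spec_pointI[OF G2 z(1)] z(2) unit_stalkD(2)[OF u[OF z(1)]] by simp
  qed
  then show "p \<in> spec_points C L1 \<Longrightarrow> transport G1 G2 f p \<in> spec_points C L2" .
  show "fmorphism (spec_space C L1) (spec_space C L2) (transport G1 G2 f)"
    unfolding spec_space_eq
  proof (rule fmorphism_generated_generated)
    show "transport G1 G2 f x \<in> \<Union> (fst ` spec_gens L2)" if "x \<in> \<Union> (fst ` spec_gens L1)" for x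
      using that pts[of x] points_spec_space[OF G1] points_spec_space[OF G2]
      unfolding spec_space_eq points_generated by simp
    fix D k assume "(D, k) \<in> spec_gens L2"
    then obtain U a b where U: "D = {(c, \<psi>) \<in> spec_points C L2. c \<in> U \<and> \<psi> b \<noteq> 0}" "k = (\<lambda>(c, \<psi>). \<psi> a / \<psi> b)"
      "nopen C U" "a \<in> carrier (power_alg C L2 U)" "b \<in> carrier (power_alg C L2 U)" by (rule spec_gensE)
    \<comment> \<open>The map on sections to which \<open>transport\<close> is dual. It turns
      numerators and denominators over the target into such over the source, so generators pull back
      to generators.\<close>
    define tw where "tw = (\<lambda>(a :: int \<Rightarrow> 'a ratfun) m. f [^]\<^bsub>K\<^esub> m \<otimes>\<^bsub>K\<^esub> a m)"
    have tw: "tw a \<in> carrier (power_alg C L1 U)" "\<And>c z. c \<in> U \<Longrightarrow> spt c (G2 c) (z * ev c (f \<otimes>\<^bsub>K\<^esub> (G2 c \<oslash> G1 c))) a = spt c (G1 c) z (tw a)"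
      if "a \<in> carrier (power_alg C L2 U)" for a
    proof -
      have l: "a \<in> laurent c (G2 c)" if "c \<in> U" for c using \<open>a \<in> carrier (power_alg C L2 U)\<close> power_alg_carrier[OF G2 U(3)] that by blast
      have p: "c \<in> points C" if "c \<in> U" for c using nopenD(2)[OF U(3)] that by blast
      have g: "G1 c \<in> Ks" "G2 c \<in> Ks" if "c \<in> U" for c using divisor_Ks representsD(1) G1 G2 p[OF that] by blast+
      have t: "tw a \<in> laurent c (G1 c)" "gval c (G1 c) z (tw a) = gval c (G2 c) (z * ev c (f \<otimes>\<^bsub>K\<^esub> (G2 c \<oslash> G1 c))) a" if "c \<in> U" for c z
        using gval_transport[OF p[OF that] g[OF that] f u[OF p[OF that]] l[OF that]] by (simp_all add: tw_def)
      show "tw a \<in> carrier (power_alg C L1 U)" using t(1) power_alg_carrier[OF G1 U(3)] by blast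
      show "spt c (G2 c) (z * ev c (f \<otimes>\<^bsub>K\<^esub> (G2 c \<oslash> G1 c))) a = spt c (G1 c) z (tw a)" if "c \<in> U" for c z
        using t[OF that] l[OF that] by (simp add: spt_def)
    qed
    let ?E = "{(c, \<psi>) \<in> spec_points C L1. c \<in> U \<and> \<psi> (tw b) \<noteq> 0}"
    have val: "fst (transport G1 G2 f (c, \<psi>)) = c"
      "a \<in> carrier (power_alg C L2 U) \<Longrightarrow> c \<in> U \<Longrightarrow> snd (transport G1 G2 f (c, \<psi>)) a = \<psi> (tw a)"
      if cp: "(c, \<psi>) \<in> spec_points C L1" for c \<psi> a
    proof -
      obtain z where z: "c \<in> points C" "z \<noteq> 0" "\<psi> = spt c (G1 c) z" using spec_pointE[OF G1 cp] .
      show "fst (transport G1 G2 f (c, \<psi>)) = c" by (simp add: transport_def)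
      assume "a \<in> carrier (power_alg C L2 U)" "c \<in> U"
      then show "snd (transport G1 G2 f (c, \<psi>)) a = \<psi> (tw a)"
        unfolding z(3) transport_spt[OF G1 z(1)] using tw(2) by simp
    qed
    have pre: "preim (generated_space (spec_gens L1)) (transport G1 G2 f) D = ?E"
    proof (rule Set.set_eqI)
      fix x :: "'a \<times> ((int \<Rightarrow> 'a ratfun) \<Rightarrow> complex)"
      obtain c \<psi> where x: "x = (c, \<psi>)" by (cases x)
      have px: "x \<in> points (generated_space (spec_gens L1)) \<longleftrightarrow> x \<in> spec_points C L1"
        using points_spec_space[OF G1] by (simp add: spec_space_eq)
      show "x \<in> preim (generated_space (spec_gens L1)) (transport G1 G2 f) D \<longleftrightarrow> x \<in> ?E"
      proof (cases "x \<in> spec_points C L1")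
        case True
        have t: "transport G1 G2 f x = (c, snd (transport G1 G2 f x))" using val(1)[of c \<psi>] True x by (metis prod.collapse)
        have "transport G1 G2 f x \<in> D \<longleftrightarrow> c \<in> U \<and> snd (transport G1 G2 f x) b \<noteq> 0"
          using pts[OF True] prod.case[of "\<lambda>c \<psi>. (c, \<psi>) \<in> spec_points C L2 \<and> c \<in> U \<and> \<psi> b \<noteq> 0" c "snd (transport G1 G2 f x)"]
          unfolding U(1) t[symmetric] by simp
        then show ?thesis using True px val(2)[of c \<psi> b] U(5) x by auto
      qed (use px x in auto)
    qed
    have kk: "\<forall>x\<in>?E. k (transport G1 G2 f x) = (\<lambda>(c, \<psi>). \<psi> (tw a) / \<psi> (tw b)) x"
    proof
      fix x assume "x \<in> ?E"
      then obtain c \<psi> where x: "x = (c, \<psi>)" "(c, \<psi>) \<in> spec_points C L1" "c \<in> U" by auto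
      have t: "transport G1 G2 f x = (c, snd (transport G1 G2 f x))" using val(1)[OF x(2)] x by (metis prod.collapse)
      show "k (transport G1 G2 f x) = (\<lambda>(c, \<psi>). \<psi> (tw a) / \<psi> (tw b)) x"
        unfolding U(2) by (subst t) (use val(2)[OF x(2) U(4) x(3)] val(2)[OF x(2) U(5) x(3)] x(1) in simp)
    qed
    show "\<exists>(E, l)\<in>spec_gens L1. preim (generated_space (spec_gens L1)) (transport G1 G2 f) D = E \<and>
       (\<forall>x\<in>E. k (transport G1 G2 f x) = l x)"
      by (rule bexI[OF _ spec_gensI[OF U(3) tw(1)[OF U(4)] tw(1)[OF U(5)]]]) (use pre kk in simp)
  qed
qed

text \<open>A rearrangement in which \<open>a\<close> and the conjugate of \<open>b\<close> cancel.
  It is used with \<open>a\<close>, \<open>b\<close> the generators of the first module at a point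
  and at its conjugate, \<open>x\<close>, \<open>y\<close> those of the second, and \<open>p\<close>
  the multiplier \<open>f\<close>.\<close>

lemma conj_weight_identity:
  assumes K: "a \<in> Ks" "b \<in> Ks" "x \<in> Ks" "y \<in> Ks" "p \<in> Ks" "h \<in> Ks"
  shows "(x \<otimes>\<^bsub>K\<^esub> rat_conj C y) \<otimes>\<^bsub>K\<^esub> ((p \<otimes>\<^bsub>K\<^esub> rat_conj C p) \<otimes>\<^bsub>K\<^esub> h) =
    (((a \<otimes>\<^bsub>K\<^esub> rat_conj C b) \<otimes>\<^bsub>K\<^esub> h) \<otimes>\<^bsub>K\<^esub> rat_conj C (p \<otimes>\<^bsub>K\<^esub> (y \<oslash> b))) \<otimes>\<^bsub>K\<^esub> (p \<otimes>\<^bsub>K\<^esub> (x \<oslash> a))"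
proof -
  define B where "B = rat_conj C b"
  define Y where "Y = rat_conj C y"
  define P where "P = rat_conj C p"
  have K': "B \<in> Ks" "Y \<in> Ks" "P \<in> Ks" using rat_conj_Ks K by (simp_all add: B_def Y_def P_def)
  have i: "inv\<^bsub>K\<^esub> a \<in> carrier K" "inv\<^bsub>K\<^esub> B \<in> carrier K" "inv\<^bsub>K\<^esub> b \<in> carrier K" using Ks_inv K K' by blast+
  have e: "rat_conj C (p \<otimes>\<^bsub>K\<^esub> (y \<oslash> b)) = P \<otimes>\<^bsub>K\<^esub> (Y \<otimes>\<^bsub>K\<^esub> inv\<^bsub>K\<^esub> B)"
    using K i rat_conj_inv[OF K(2)] by (simp add: rat_conj_mult P_def Y_def B_def)
  have "(((a \<otimes>\<^bsub>K\<^esub> B) \<otimes>\<^bsub>K\<^esub> h) \<otimes>\<^bsub>K\<^esub> (P \<otimes>\<^bsub>K\<^esub> (Y \<otimes>\<^bsub>K\<^esub> inv\<^bsub>K\<^esub> B))) \<otimes>\<^bsub>K\<^esub> (p \<otimes>\<^bsub>K\<^esub> (x \<otimes>\<^bsub>K\<^esub> inv\<^bsub>K\<^esub> a)) =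
     ((a \<otimes>\<^bsub>K\<^esub> inv\<^bsub>K\<^esub> a) \<otimes>\<^bsub>K\<^esub> (B \<otimes>\<^bsub>K\<^esub> inv\<^bsub>K\<^esub> B)) \<otimes>\<^bsub>K\<^esub> ((x \<otimes>\<^bsub>K\<^esub> Y) \<otimes>\<^bsub>K\<^esub> ((p \<otimes>\<^bsub>K\<^esub> P) \<otimes>\<^bsub>K\<^esub> h))"
    using K K' i by (simp add: K.m_ac)
  also have "\<dots> = (x \<otimes>\<^bsub>K\<^esub> Y) \<otimes>\<^bsub>K\<^esub> ((p \<otimes>\<^bsub>K\<^esub> P) \<otimes>\<^bsub>K\<^esub> h)"
    using K K' by (simp add: quot_self)
  finally show ?thesis unfolding e by (simp add: B_def Y_def P_def)
qed

text \<open>With weights \<open>e1\<close>, \<open>e2\<close> of the two pairs, the map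
  \<open>z \<mapsto> z * w c\<close> intertwines \<open>cnj (e1 / z)\<close> and
  \<open>cnj (e2 / z)\<close> exactly when \<open>e2\<close> is \<open>e1\<close> times
  \<open>w c\<close> times the conjugate of \<open>w\<close> at the conjugate point. The formula
  shows that the twisted function \<open>(f \<otimes> rat_conj C f) \<otimes> h1\<close> has this
  weight.\<close>

lemma transport_weight:
  assumes G2: "divisor G2" and h1: "real_pair G1 h1" and f: "f \<in> Ks"
    and u: "\<And>c. c \<in> points C \<Longrightarrow> f \<otimes>\<^bsub>K\<^esub> (G2 c \<oslash> G1 c) \<in> unit_stalk c" and c: "c \<in> points C"
  defines "x \<equiv> (G2 c \<otimes>\<^bsub>K\<^esub> rat_conj C (G2 (rconj C c))) \<otimes>\<^bsub>K\<^esub> ((f \<otimes>\<^bsub>K\<^esub> rat_conj C f) \<otimes>\<^bsub>K\<^esub> h1)"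
    and "w \<equiv> \<lambda>c. ev c (f \<otimes>\<^bsub>K\<^esub> (G2 c \<oslash> G1 c))"
  shows "x \<in> unit_stalk c"
    "ev c x = ev c ((G1 c \<otimes>\<^bsub>K\<^esub> rat_conj C (G1 (rconj C c))) \<otimes>\<^bsub>K\<^esub> h1) * cnj (w (rconj C c)) * w c"
proof -
  note c' = conj_points[OF c]
  have G1: "divisor G1" and h1K: "h1 \<in> Ks" using h1 by (simp_all add: real_pair_def)
  have s1: "(G1 c \<otimes>\<^bsub>K\<^esub> rat_conj C (G1 (rconj C c))) \<otimes>\<^bsub>K\<^esub> h1 \<in> unit_stalk c"
    using h1 c by (simp add: real_pair_def)
  have s2: "rat_conj C (f \<otimes>\<^bsub>K\<^esub> (G2 (rconj C c) \<oslash> G1 (rconj C c))) \<in> unit_stalk c"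
    "ev c (rat_conj C (f \<otimes>\<^bsub>K\<^esub> (G2 (rconj C c) \<oslash> G1 (rconj C c)))) = cnj (w (rconj C c))"
    using rat_conj_unit[OF c u[OF c']] rat_conj_stalk[OF c unit_stalkD(1)[OF u[OF c']]] by (simp_all add: w_def)
  note e = conj_weight_identity[OF divisor_Ks[OF G1 c] divisor_Ks[OF G1 c'] divisor_Ks[OF G2 c] divisor_Ks[OF G2 c'] f h1K]
  show "x \<in> unit_stalk c"
    unfolding x_def e by (rule unit_stalk_mult[OF unit_stalk_mult[OF s1 s2(1)] u[OF c]])
  show "ev c x = ev c ((G1 c \<otimes>\<^bsub>K\<^esub> rat_conj C (G1 (rconj C c))) \<otimes>\<^bsub>K\<^esub> h1) * cnj (w (rconj C c)) * w c"
    unfolding x_def e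
    using stalk_mult(2)[OF stalk_mult(1)[OF unit_stalkD(1)[OF s1] unit_stalkD(1)[OF s2(1)]] unit_stalkD(1)[OF u[OF c]]]
      stalk_mult(2)[OF unit_stalkD(1)[OF s1] unit_stalkD(1)[OF s2(1)]] s2(2)
    by (simp add: w_def)
qed

text \<open>In fibre coordinates the map is multiplication by the unit \<open>W c\<close>, which
  commutes with the action and is inverted by transport along the inverse of \<open>f\<close>. The
  equation for \<open>h2\<close> is used for the real structures only.\<close>

lemma pair_torsor_isomorphicI:
  assumes G1: "represents G1 L1" and G2: "represents G2 L2" and h1: "real_pair G1 h1" and h2: "real_pair G2 h2"
    and f: "f \<in> Ks" and u: "\<And>c. c \<in> points C \<Longrightarrow> f \<otimes>\<^bsub>K\<^esub> (G2 c \<oslash> G1 c) \<in> unit_stalk c"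
    and hh: "h2 = (f \<otimes>\<^bsub>K\<^esub> rat_conj C f) \<otimes>\<^bsub>K\<^esub> h1"
  shows "torsor_isomorphic (pair_torsor C L1 h1) (pair_torsor C L2 h2)"
proof -
  let ?\<phi> = "transport G1 G2 f" and ?\<psi> = "transport G2 G1 (inv\<^bsub>K\<^esub> f)"
  define W where "W = (\<lambda>c. ev c (f \<otimes>\<^bsub>K\<^esub> (G2 c \<oslash> G1 c)))"
  have W: "W c \<noteq> 0" if "c \<in> points C" for c using unit_stalkD(2)[OF u[OF that]] by (simp add: W_def)
  have g: "G1 c \<in> Ks" "G2 c \<in> Ks" if "c \<in> points C" for c using divisor_Ks representsD(1) G1 G2 that by blast+
  have inv: "inv\<^bsub>K\<^esub> f \<otimes>\<^bsub>K\<^esub> (G1 c \<oslash> G2 c) = inv\<^bsub>K\<^esub> (f \<otimes>\<^bsub>K\<^esub> (G2 c \<oslash> G1 c))" if "c \<in> points C" for c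
    using Ks_inv_mult[OF f quot_Ks[OF g(2)[OF that] g(1)[OF that]]] quot_inv(1)[OF g(2)[OF that] g(1)[OF that]] by simp
  have u': "inv\<^bsub>K\<^esub> f \<otimes>\<^bsub>K\<^esub> (G1 c \<oslash> G2 c) \<in> unit_stalk c" "ev c (inv\<^bsub>K\<^esub> f \<otimes>\<^bsub>K\<^esub> (G1 c \<oslash> G2 c)) = inverse (W c)" if "c \<in> points C" for c
    unfolding inv[OF that] W_def using unit_stalk_inv[OF u[OF that]] by simp_all
  have m1: "fmorphism (spec_space C L1) (spec_space C L2) ?\<phi>" "\<And>p. p \<in> spec_points C L1 \<Longrightarrow> ?\<phi> p \<in> spec_points C L2"
    using transport_fmorphism[OF G1 G2 f] u by simp_all
  have m2: "fmorphism (spec_space C L2) (spec_space C L1) ?\<psi>" "\<And>p. p \<in> spec_points C L2 \<Longrightarrow> ?\<psi> p \<in> spec_points C L1"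
    using transport_fmorphism[OF G2 G1 Ks_inv[OF f]] u'(1) by simp_all
  have \<phi>: "?\<phi> (c, spt c (G1 c) z) = (c, spt c (G2 c) (z * W c))" if "c \<in> points C" for c z
    using transport_spt[OF G1 that] by (simp add: W_def)
  have \<psi>: "?\<psi> (c, spt c (G2 c) z) = (c, spt c (G1 c) (z * inverse (W c)))" if "c \<in> points C" for c z
    using transport_spt[OF G2 that] u'(2)[OF that] by simp
  have \<psi>\<phi>: "?\<psi> (?\<phi> p) = p" if pin: "p \<in> spec_points C L1" for p
  proof -
    obtain c \<eta> where p: "p = (c, \<eta>)" by (cases p)
    obtain z where z: "c \<in> points C" "z \<noteq> 0" "\<eta> = spt c (G1 c) z" using spec_pointE[OF G1] pin p by metis
    show ?thesis unfolding p z(3) \<phi>[OF z(1)] \<psi>[OF z(1)] using W[OF z(1)] by (simp add: mult.assoc)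
  qed
  have \<phi>\<psi>: "?\<phi> (?\<psi> p) = p" if pin: "p \<in> spec_points C L2" for p
  proof -
    obtain c \<eta> where p: "p = (c, \<eta>)" by (cases p)
    obtain z where z: "c \<in> points C" "z \<noteq> 0" "\<eta> = spt c (G2 c) z" using spec_pointE[OF G2] pin p by metis
    show ?thesis unfolding p z(3) \<phi>[OF z(1)] \<psi>[OF z(1)] using W[OF z(1)] by (simp add: mult.assoc)
  qed
  have bij: "bij_betw ?\<phi> (spec_points C L1) (spec_points C L2)"
    by (rule bij_betw_byWitness[of _ ?\<psi>]) (use m1(2) m2(2) \<psi>\<phi> \<phi>\<psi> in blast)+
  have "inv_into (spec_points C L1) ?\<phi> p = ?\<psi> p" if pin: "p \<in> spec_points C L2" for p
    using bij_betw_inv_into_left[OF bij m2(2)[OF that]] \<phi>\<psi>[OF that] by simp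
  then have mi: "fmorphism (spec_space C L2) (spec_space C L1) (inv_into (spec_points C L1) ?\<phi>)"
    by (intro fmorphism_cong[OF m2(1)]) (simp add: points_spec_space[OF G2])
  have iso: "fiso (pair_torsor C L1 h1) (pair_torsor C L2 h2) ?\<phi>"
    unfolding fiso_def using bij m1(1) mi
    by (simp add: points_spec_space[OF G1] points_spec_space[OF G2] fmorphism_def preim_def)
  have weight: "ev c ((G2 c \<otimes>\<^bsub>K\<^esub> rat_conj C (G2 (rconj C c))) \<otimes>\<^bsub>K\<^esub> h2) =
     ev c ((G1 c \<otimes>\<^bsub>K\<^esub> rat_conj C (G1 (rconj C c))) \<otimes>\<^bsub>K\<^esub> h1) * cnj (W (rconj C c)) * W c" if c: "c \<in> points C" for c
    using transport_weight(2)[OF representsD(1)[OF G2] h1 f u c] by (simp add: W_def hh)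
  have real: "?\<phi> (rconj (pair_torsor C L1 h1) p) = rconj (pair_torsor C L2 h2) (?\<phi> p)" if pin: "p \<in> spec_points C L1" for p
  proof -
    obtain c \<eta> where p: "p = (c, \<eta>)" by (cases p)
    obtain z where z: "c \<in> points C" "z \<noteq> 0" "\<eta> = spt c (G1 c) z" using spec_pointE[OF G1] pin p by metis
    have zw: "z * W c \<noteq> 0" using z W by simp
    show ?thesis
      unfolding p z(3) pair_torsor_rconj(1)[OF G1 h1 z(1,2)] \<phi>[OF z(1)] \<phi>[OF conj_points[OF z(1)]]
        pair_torsor_rconj(1)[OF G2 h2 z(1) zw] weight[OF z(1)]
      using W[OF z(1)] z(2) by (simp add: field_simps)
  qed
  have equi: "?\<phi> (act (pair_torsor C L1 h1) t p) = act (pair_torsor C L2 h2) t (?\<phi> p)" if pin: "p \<in> spec_points C L1" for p t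
  proof -
    obtain c \<eta> where p: "p = (c, \<eta>)" by (cases p)
    obtain z where z: "c \<in> points C" "z \<noteq> 0" "\<eta> = spt c (G1 c) z" using spec_pointE[OF G1] pin p by metis
    show ?thesis unfolding p z(3) pair_torsor_act[OF G1 z(1)] \<phi>[OF z(1)] pair_torsor_act[OF G2 z(1)] by (simp add: mult.assoc)
  qed
  have b: "fst (?\<phi> p) = fst p" for p by (simp add: transport_def split: prod.splits)
  show ?thesis unfolding torsor_isomorphic_def real_morphism_def
    by (rule exI[of _ ?\<phi>]) (use iso real equi b in \<open>simp add: fiso_def points_spec_space[OF G1]\<close>)
qed

end

section \<open>Recovering the rational multiplier from an isomorphism\<close>

lemma generator_reg: "(D, g) \<in> Q \<Longrightarrow> restrict g D \<in> reg (generated_space Q) D"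
  unfolding reg_generated
  by (intro conjI ballI ex3I[of _ D g D]) (auto intro: open_generated)

context irr_space
begin

lemma gval_reg:
  assumes G: "represents G L" and g: "g \<in> Ks" and V: "\<And>d. d \<in> V \<Longrightarrow> G d \<oslash> g \<in> unit_stalk d"
    and U: "nopen X U" and a: "a \<in> carrier (power_alg X L U)" and W: "nopen X W" "W \<subseteq> U \<inter> V"
  shows "(\<lambda>d\<in>W. gval d g z a) \<in> reg X W"
proof -
  have l: "a \<in> laurent d g" if "d \<in> W" for d
  proof -
    have d: "d \<in> points X" using nopenD(2)[OF W(1)] that by blast
    have "a \<in> laurent d (G d)" using a power_alg_carrier[OF G U] that W by blast
    moreover have "G d \<oslash> g \<in> unit_stalk d" using that W V by blast
    ultimately show ?thesis using gval_change(1)[OF d g divisor_Ks[OF representsD(1)[OF G] d]] by blast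
  qed
  obtain d0 where "d0 \<in> W" using W(1) by (auto simp: nopen_def)
  then have fin: "finite (supp a)" using laurentD(1)[OF l] by blast
  note o = nopenD(1)[OF W(1)]
  have "(\<lambda>d\<in>W. \<Sum>m\<in>supp a. z powi m * (\<lambda>d\<in>W. ev d (a m \<oslash> g [^]\<^bsub>K\<^esub> m)) d) \<in> reg X W"
  proof (rule reg_sum[OF o fin])
    fix m
    have "a m \<in> carrier K" using laurentD(2)[OF l[OF \<open>d0 \<in> W\<close>]] .
    then have "(\<lambda>d\<in>W. ev d (a m \<oslash> g [^]\<^bsub>K\<^esub> m)) \<in> reg X W"
      by (intro reg_of_stalks(1)[OF W(1)] quot_carrier Ks_pow[OF g] laurentD(3)[OF l])
    then show "(\<lambda>d\<in>W. z powi m * (\<lambda>d\<in>W. ev d (a m \<oslash> g [^]\<^bsub>K\<^esub> m)) d) \<in> reg X W"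
      by (rule reg_cmult[OF o])
  qed
  then show ?thesis by (rule reg_cong[OF o]) (simp add: gval_def mult.commute)
qed

text \<open>The coordinate with respect to \<open>G d\<close> depends on the arbitrary choice of
  \<open>G d\<close> at each point. Normalizing by one fixed generator \<open>g\<close> gives a
  section along which graded sections have regular values, since all coefficients are then divided
  by powers of the same rational function.\<close>

lemma section_fmorphism:
  assumes G: "represents G L" and g: "g \<in> Ks" and V: "nopen X V" "\<And>d. d \<in> V \<Longrightarrow> G d \<oslash> g \<in> unit_stalk d"
  shows "fmorphism (subvariety X V) (spec_space X L) (\<lambda>d. (d, spt d g 1))"
    and "d \<in> V \<Longrightarrow> spt d g 1 = spt d (G d) (ev d (G d \<oslash> g))"
proof -
  have G': "G d \<in> Ks" if "d \<in> V" for d using divisor_Ks[OF representsD(1)[OF G]] nopenD(2)[OF V(1)] that by blast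
  have p: "d \<in> points X" if "d \<in> V" for d using nopenD(2)[OF V(1)] that by blast
  have ch: "laurent d g = laurent d (G d)" if "d \<in> V" for d
    using gval_change(1)[OF p[OF that] g G'[OF that] V(2)[OF that]] .
  have eq: "spt d g 1 = spt d (G d) (ev d (G d \<oslash> g))" if "d \<in> V" for d
    using ch[OF that] gval_change(2)[OF p[OF that] g G'[OF that] V(2)[OF that], of _ 1]
    by (auto simp: spt_def restrict_def)
  then show "d \<in> V \<Longrightarrow> spt d g 1 = spt d (G d) (ev d (G d \<oslash> g))" .
  have sp: "(d, spt d g 1) \<in> spec_points X L" if "d \<in> V" for d
    unfolding eq[OF that] by (rule spec_pointI[OF G p[OF that] unit_stalkD(2)[OF V(2)[OF that]]])
  have Vo: "openin (zariski X) V" using nopenD(1)[OF V(1)] .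
  interpret S: fun_space "subvariety X V" by (rule fun_space_subvariety) unfold_locales
  show "fmorphism (subvariety X V) (spec_space X L) (\<lambda>d. (d, spt d g 1))"
    unfolding spec_space_eq
  proof (rule fmorphism_generatedI[OF S.fun_space_axioms])
    show "(d, spt d g 1) \<in> \<Union> (fst ` spec_gens L)" if "d \<in> points (subvariety X V)" for d
      using sp[of d] that points_spec_space[OF G] unfolding spec_space_eq points_generated by simp
    fix D k assume "(D, k) \<in> spec_gens L"
    then obtain U a b where U: "D = {(c, \<psi>) \<in> spec_points X L. c \<in> U \<and> \<psi> b \<noteq> 0}" "k = (\<lambda>(c, \<psi>). \<psi> a / \<psi> b)"
      "nopen X U" "a \<in> carrier (power_alg X L U)" "b \<in> carrier (power_alg X L U)" by (rule spec_gensE)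
    let ?W = "U \<inter> V"
    have W: "nopen X ?W" using nopen_Int[OF U(3) V(1)] .
    have val: "spt d g 1 a = gval d g 1 a" if "a \<in> carrier (power_alg X L U)" "d \<in> ?W" for a d
      using that power_alg_carrier[OF G U(3)] ch by (simp add: spt_def)
    have ra: "(\<lambda>d\<in>?W. gval d g 1 a) \<in> reg X ?W" and rb: "(\<lambda>d\<in>?W. gval d g 1 b) \<in> reg X ?W"
      using gval_reg[OF G g V(2) U(3) _ W] U(4,5) by blast+
    let ?E = "preim (subvariety X V) (\<lambda>d. (d, spt d g 1)) D"
    have E: "?E = {d \<in> ?W. (\<lambda>d\<in>?W. gval d g 1 b) d \<noteq> 0}"
    proof (rule Set.set_eqI)
      fix d
      show "d \<in> ?E \<longleftrightarrow> d \<in> {d \<in> ?W. (\<lambda>d\<in>?W. gval d g 1 b) d \<noteq> 0}"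
        using p sp val[OF U(5), of d] unfolding U(1) by auto
    qed
    have oE: "openin (zariski X) ?E" unfolding E by (rule open_nonzero[OF nopenD(1)[OF W] rb])
    have EV: "?E \<subseteq> V" by auto
    show "openin (zariski (subvariety X V)) ?E" using oE EV openin_subvariety[OF Vo] by blast
    have s: "?E \<subseteq> ?W" unfolding E by blast
    have "(\<lambda>d\<in>?E. restrict (\<lambda>d\<in>?W. gval d g 1 a) ?E d * (\<lambda>d\<in>?E. inverse (restrict (\<lambda>d\<in>?W. gval d g 1 b) ?E d)) d) \<in> reg X ?E"
      by (intro reg_mult[OF oE] reg_inverse[OF oE] reg_restrict[OF nopenD(1)[OF W] oE s] ra rb)
        (use E in auto)
    then have "(\<lambda>d\<in>?E. k (d, spt d g 1)) \<in> reg X ?E"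
    proof (rule reg_cong[OF oE])
      fix d assume d: "d \<in> ?E"
      then have dW: "d \<in> ?W" using s by blast
      show "(\<lambda>d\<in>?E. restrict (\<lambda>d\<in>?W. gval d g 1 a) ?E d * (\<lambda>d\<in>?E. inverse (restrict (\<lambda>d\<in>?W. gval d g 1 b) ?E d)) d) d = k (d, spt d g 1)"
        unfolding U(2) using d dW val[OF U(4) dW] val[OF U(5) dW] by (simp del: preim_iff add: divide_inverse)
    qed
    then show "(\<lambda>d\<in>?E. k (d, spt d g 1)) \<in> reg (subvariety X V) ?E"
      using reg_open_subvariety[OF fun_space_axioms Vo oE EV] by simp
  qed
qed

end

context real_irr_space
begin

text \<open>Composing a local section of the first spectrum with \<phi> and with a coordinate
  function on the second gives a regular function on \<open>V\<close>, which is \<open>v\<close> up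
  to the change from the fixed generators to the pointwise ones. Correcting by the quotient of the
  fixed generators yields \<open>k\<close>.\<close>

lemma local_multiplier:
  assumes G1: "represents G1 L1" and G2: "represents G2 L2"
    and \<phi>: "fmorphism (spec_space C L1) (spec_space C L2) \<phi>"
    and v: "\<And>c z. c \<in> points C \<Longrightarrow> z \<noteq> 0 \<Longrightarrow> \<phi> (c, spt c (G1 c) z) = (c, spt c (G2 c) (z * v c))"
    and v0: "\<And>c. c \<in> points C \<Longrightarrow> v c \<noteq> 0"
    and c: "c \<in> points C"
  shows "\<exists>V k. openin (zariski C) V \<and> c \<in> V \<and> k \<in> Ks \<and>
    (\<forall>d\<in>V. k \<otimes>\<^bsub>K\<^esub> (G2 d \<oslash> G1 d) \<in> unit_stalk d \<and> ev d (k \<otimes>\<^bsub>K\<^esub> (G2 d \<oslash> G1 d)) = v d)"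
proof -
  note D1 = representsD(1)[OF G1] and D2 = representsD(1)[OF G2]
  define g1 where "g1 = G1 c"
  define g2 where "g2 = G2 c"
  have g: "g1 \<in> Ks" "g2 \<in> Ks" unfolding g1_def g2_def using divisor_Ks D1 D2 c by blast+
  obtain V1 where V1: "openin (zariski C) V1" "c \<in> V1" "\<And>d. d \<in> V1 \<Longrightarrow> G1 d \<oslash> g1 \<in> unit_stalk d"
    using divisor_local[OF D1 c] unfolding g1_def by metis
  obtain V2 where V2: "openin (zariski C) V2" "c \<in> V2" "\<And>d. d \<in> V2 \<Longrightarrow> G2 d \<oslash> g2 \<in> unit_stalk d"
    using divisor_local[OF D2 c] unfolding g2_def by metis
  define V where "V = V1 \<inter> V2"
  have Vo: "openin (zariski C) V" and cV: "c \<in> V" unfolding V_def using V1 V2 by auto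
  have Vn: "nopen C V" using nopenI[OF Vo cV] .
  have p: "d \<in> points C" if "d \<in> V" for d using nopenD(2)[OF Vn] that by blast
  have u1: "G1 d \<oslash> g1 \<in> unit_stalk d" and u2: "G2 d \<oslash> g2 \<in> unit_stalk d" if "d \<in> V" for d using V1 V2 that by (auto simp: V_def)
  have Gd: "G1 d \<in> Ks" "G2 d \<in> Ks" if "d \<in> V" for d using divisor_Ks D1 D2 p[OF that] by blast+
  have u2': "g2 \<oslash> G2 d \<in> unit_stalk d" "ev d (g2 \<oslash> G2 d) = inverse (ev d (G2 d \<oslash> g2))" if "d \<in> V" for d
    using unit_stalk_inv[OF u2[OF that]] quot_inv(1)[OF Gd(2)[OF that] g(2)] by simp_all
  have u1': "g1 \<oslash> G1 d \<in> unit_stalk d" "ev d (g1 \<oslash> G1 d) = inverse (ev d (G1 d \<oslash> g1))" if "d \<in> V" for d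
    using unit_stalk_inv[OF u1[OF that]] quot_inv(1)[OF Gd(1)[OF that] g(1)] by simp_all
  \<comment> \<open>The coordinate with respect to \<open>g2\<close>, written as a fraction with
    denominator 1 because functions on the spectrum are given as fractions of sections.\<close>
  let ?a = "homog C 1 g2" and ?b = "homog C 0 \<one>\<^bsub>K\<^esub>"
  have gs: "g2 \<oslash> G2 d [^]\<^bsub>K\<^esub> (1::int) \<in> stalk d" if "d \<in> V" for d
    using unit_stalkD(1)[OF u2'(1)[OF that]] Ks_pow_1[of "G2 d"] Gd(2)[OF that] by simp
  have al: "?a \<in> laurent d (G2 d)" "gval d (G2 d) z ?a = ev d (g2 \<oslash> G2 d) * z" if "d \<in> V" for d z
    using homog_laurent(1)[OF p[OF that] Gd(2)[OF that] _ gs[OF that]] homog_laurent(2)[OF p[OF that] Gd(2)[OF that] _ gs[OF that], of z]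
     Ks_pow_1[of "G2 d"] Gd(2)[OF that] g by simp_all
  have a: "?a \<in> carrier (power_alg C L2 V)" using power_alg_carrier[OF G2 Vn] al(1) by blast
  have b: "?b \<in> carrier (power_alg C L2 V)" using one_power_alg[OF G2 Vn] .
  define T where "T = {(c, \<psi>) \<in> spec_points C L2. c \<in> V \<and> \<psi> ?b \<noteq> 0}"
  define F :: "'a \<times> ((int \<Rightarrow> 'a ratfun) \<Rightarrow> complex) \<Rightarrow> complex" where "F = (\<lambda>(c, \<psi>). \<psi> ?a / \<psi> ?b)"
  have TF: "(T, F) \<in> spec_gens L2" unfolding T_def F_def by (rule spec_gensI[OF Vn a b])
  have oT: "openin (zariski (spec_space C L2)) T" and rF: "restrict F T \<in> reg (spec_space C L2) T"
    unfolding spec_space_eq by (rule open_generated[OF TF], rule generator_reg[OF TF])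
  define s where "s = (\<lambda>d. (d, spt d g1 1))"
  have ms: "fmorphism (subvariety C V) (spec_space C L1) s"
    unfolding s_def by (rule section_fmorphism(1)[OF G1 g(1) Vn u1])
  have seq: "s d = (d, spt d (G1 d) (ev d (G1 d \<oslash> g1)))" if "d \<in> V" for d
    unfolding s_def using section_fmorphism(2)[OF G1 g(1) Vn u1 that] by simp
  have \<phi>s: "\<phi> (s d) = (d, spt d (G2 d) (ev d (G1 d \<oslash> g1) * v d))" if "d \<in> V" for d
    unfolding seq[OF that] by (rule v[OF p[OF that] unit_stalkD(2)[OF u1[OF that]]])
  have nz: "ev d (G1 d \<oslash> g1) * v d \<noteq> 0" if "d \<in> V" for d
    using unit_stalkD(2)[OF u1[OF that]] v0[OF p[OF that]] by simp
  have inT: "\<phi> (s d) \<in> T" if "d \<in> V" for d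
    unfolding T_def \<phi>s[OF that] using spec_pointI[OF G2 p[OF that] nz[OF that]] that spt_one[OF p[OF that] Gd(2)[OF that]] by simp
  \<comment> \<open>The value at \<phi> (s d) of the coordinate with respect to \<open>g2\<close>:
    \<open>s d\<close> has coordinate \<open>ev d (G1 d \<oslash> g1)\<close>, \<phi> multiplies it
    by \<open>v d\<close>, and the last factor passes from \<open>G2 d\<close> to
    \<open>g2\<close>.\<close>
  define w where "w = (\<lambda>d\<in>V. ev d (g2 \<oslash> G2 d) * (ev d (G1 d \<oslash> g1) * v d))"
  note comp = fmorphism_comp[OF ms \<phi>]
  have pre: "preim (subvariety C V) (\<lambda>x. \<phi> (s x)) T = V"
    using inT p by auto
  have "(\<lambda>d\<in>V. restrict F T (\<phi> (s d))) \<in> reg (subvariety C V) V"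
    using fmorphism_reg[OF comp oT rF] unfolding pre .
  then have "(\<lambda>d\<in>V. restrict F T (\<phi> (s d))) \<in> reg C V"
    using reg_open_subvariety[OF fun_space_axioms Vo Vo] by simp
  moreover have "(\<lambda>d\<in>V. restrict F T (\<phi> (s d))) = w"
    unfolding w_def
  proof (rule restrict_ext)
    fix d assume d: "d \<in> V"
    show "restrict F T (\<phi> (s d)) = ev d (g2 \<oslash> G2 d) * (ev d (G1 d \<oslash> g1) * v d)"
      using inT[OF d] unfolding \<phi>s[OF d]
      by (simp add: F_def spt_one[OF p[OF d] Gd(2)[OF d]]) (simp add: spt_def al[OF d])
  qed
  ultimately have wr: "w \<in> reg C V" by simp
  have w0: "w d \<noteq> 0" if "d \<in> V" for d
    using nz[OF that] unit_stalkD(2)[OF u2'(1)[OF that]] that by (simp add: w_def)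
  define r where "r = germ C V w"
  have r: "r \<in> unit_stalk d" "ev d r = w d" if "d \<in> V" for d
    using stalk_germ[OF Vn wr that] ev_germ[OF Vn wr that] w0[OF that] by (simp_all add: r_def unit_stalk_def)
  have rK: "r \<in> Ks" using unit_stalkD(3,4)[OF r(1)[OF cV]] by simp
  \<comment> \<open>The factor \<open>g1 \<oslash> g2\<close> undoes the passage to fixed
    generators: in the product with \<open>G2 d \<oslash> G1 d\<close> only units at d remain, and
    their values cancel those in \<open>w d\<close> except for \<open>v d\<close>.\<close>
  define k where "k = r \<otimes>\<^bsub>K\<^esub> (g1 \<oslash> g2)"
  have kK: "k \<in> Ks" unfolding k_def by (rule Ks_mult[OF rK quot_Ks[OF g]])
  have "k \<otimes>\<^bsub>K\<^esub> (G2 d \<oslash> G1 d) \<in> unit_stalk d \<and> ev d (k \<otimes>\<^bsub>K\<^esub> (G2 d \<oslash> G1 d)) = v d" if d: "d \<in> V" for d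
  proof -
    have i: "inv\<^bsub>K\<^esub> g2 \<in> carrier K" "inv\<^bsub>K\<^esub> (G1 d) \<in> carrier K" using Ks_inv g Gd[OF d] by blast+
    have "k \<otimes>\<^bsub>K\<^esub> (G2 d \<oslash> G1 d) = r \<otimes>\<^bsub>K\<^esub> ((g1 \<oslash> G1 d) \<otimes>\<^bsub>K\<^esub> (G2 d \<oslash> g2))"
      unfolding k_def using rK g Gd[OF d] i by (simp add: K.m_ac)
    moreover have "r \<otimes>\<^bsub>K\<^esub> ((g1 \<oslash> G1 d) \<otimes>\<^bsub>K\<^esub> (G2 d \<oslash> g2)) \<in> unit_stalk d"
      by (intro unit_stalk_mult r(1) u1'(1) u2 d)
    moreover have "ev d (r \<otimes>\<^bsub>K\<^esub> ((g1 \<oslash> G1 d) \<otimes>\<^bsub>K\<^esub> (G2 d \<oslash> g2))) = w d * (ev d (g1 \<oslash> G1 d) * ev d (G2 d \<oslash> g2))"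
      using stalk_mult[OF unit_stalkD(1)[OF u1'(1)[OF d]] unit_stalkD(1)[OF u2[OF d]]] stalk_mult(2)[OF unit_stalkD(1)[OF r(1)[OF d]], of "(g1 \<oslash> G1 d) \<otimes>\<^bsub>K\<^esub> (G2 d \<oslash> g2)"]
        r(2)[OF d] by simp
    moreover have "w d * (ev d (g1 \<oslash> G1 d) * ev d (G2 d \<oslash> g2)) = v d"
      using d unit_stalkD(2)[OF u1[OF d]] unit_stalkD(2)[OF u2[OF d]]
      by (simp add: w_def u1'(2)[OF d] u2'(2)[OF d] field_simps)
    ultimately show ?thesis by simp
  qed
  then show ?thesis using Vo cV kK by blast
qed

lemma eq_of_ev_quot:
  assumes "k \<in> Ks" "l \<in> Ks" "nopen C W" "\<And>d. d \<in> W \<Longrightarrow> ev d (k \<oslash> l) = 1"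
  shows "k = l"
proof -
  have "k \<oslash> l = \<one>\<^bsub>K\<^esub>"
    by (rule ev_eqI[OF _ _ assms(3)])
      (use assms quot_Ks[OF assms(1,2)] stalk_one(2) nopenD(2)[OF assms(3)] in \<open>simp_all add: subset_iff\<close>)
  then show ?thesis using quot_cancel(1)[of k l] assms by simp
qed

lemma unit_quot_ev:
  assumes "x \<in> Ks" "k \<in> Ks" "l \<in> Ks" "x \<otimes>\<^bsub>K\<^esub> k \<in> unit_stalk d" "x \<otimes>\<^bsub>K\<^esub> l \<in> unit_stalk d"
    and "ev d (x \<otimes>\<^bsub>K\<^esub> k) = ev d (x \<otimes>\<^bsub>K\<^esub> l)"
  shows "ev d (k \<oslash> l) = 1"
proof -
  have "k \<oslash> l = (x \<otimes>\<^bsub>K\<^esub> k) \<oslash> (x \<otimes>\<^bsub>K\<^esub> l)"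
    using quot_mult[of x k x l] quot_self[of x] quot_carrier[of k l] assms by simp
  then show ?thesis
    using stalk_mult(2)[OF unit_stalkD(1)[OF assms(4)] unit_stalkD(1)[OF unit_stalk_inv(1)[OF assms(5)]]]
      unit_stalk_inv(2)[OF assms(5)] unit_stalkD(2)[OF assms(5)] assms(6) by simp
qed

text \<open>Equivariance makes the isomorphism a multiplication on each fibre, its regularity makes
  the factor rational near each point, irreducibility makes the local rational functions equal, and
  compatibility with the real structures gives the equation for \<open>h2\<close>.\<close>

lemma pair_torsor_isomorphicD:
  assumes G1: "represents G1 L1" and G2: "represents G2 L2" and h1: "real_pair G1 h1" and h2: "real_pair G2 h2"
    and iso: "torsor_isomorphic (pair_torsor C L1 h1) (pair_torsor C L2 h2)"
  obtains f where "f \<in> Ks" "\<And>c. c \<in> points C \<Longrightarrow> f \<otimes>\<^bsub>K\<^esub> (G2 c \<oslash> G1 c) \<in> unit_stalk c"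
    "h2 = (f \<otimes>\<^bsub>K\<^esub> rat_conj C f) \<otimes>\<^bsub>K\<^esub> h1"
proof -
  note D1 = representsD(1)[OF G1] and D2 = representsD(1)[OF G2]
  have g: "G1 c \<in> Ks" "G2 c \<in> Ks" if "c \<in> points C" for c using divisor_Ks D1 D2 that by blast+
  obtain \<phi> where m: "fmorphism (pair_torsor C L1 h1) (pair_torsor C L2 h2) \<phi>"
    and re: "\<And>p. p \<in> spec_points C L1 \<Longrightarrow> \<phi> (rconj (pair_torsor C L1 h1) p) = rconj (pair_torsor C L2 h2) (\<phi> p)"
    and ba: "\<And>p. p \<in> spec_points C L1 \<Longrightarrow> fst (\<phi> p) = fst p"
    and eq: "\<And>z p. z \<noteq> 0 \<Longrightarrow> p \<in> spec_points C L1 \<Longrightarrow> \<phi> (act (pair_torsor C L1 h1) z p) = act (pair_torsor C L2 h2) z (\<phi> p)"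
    using iso unfolding torsor_isomorphic_def real_morphism_def
    by (auto simp: points_spec_space[OF G1] points_circle)
  have \<phi>: "fmorphism (spec_space C L1) (spec_space C L2) \<phi>"
    using m by (simp add: fmorphism_def preim_def)
  \<comment> \<open>The image of the point with coordinate 1 determines the map on the whole fibre
    by equivariance.\<close>
  have "\<exists>v. v \<noteq> 0 \<and> \<phi> (c, spt c (G1 c) 1) = (c, spt c (G2 c) v)" if c: "c \<in> points C" for c
  proof -
    have p: "(c, spt c (G1 c) 1) \<in> spec_points C L1" by (rule spec_pointI[OF G1 c]) simp
    then have "\<phi> (c, spt c (G1 c) 1) \<in> spec_points C L2"
      using fmorphism_points[OF \<phi>] points_spec_space[OF G1] points_spec_space[OF G2] by blast
    moreover obtain \<eta> where e: "\<phi> (c, spt c (G1 c) 1) = (c, \<eta>)" using ba[OF p] by (metis fst_conv prod.collapse)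
    ultimately have "(c, \<eta>) \<in> spec_points C L2" by simp
    then obtain v where "v \<noteq> 0" "\<eta> = spt c (G2 c) v" using spec_pointE[OF G2] by metis
    then show ?thesis using e by blast
  qed
  then obtain v where v: "\<And>c. c \<in> points C \<Longrightarrow> v c \<noteq> 0"
     "\<And>c. c \<in> points C \<Longrightarrow> \<phi> (c, spt c (G1 c) 1) = (c, spt c (G2 c) (v c))" by metis
  have \<phi>v: "\<phi> (c, spt c (G1 c) z) = (c, spt c (G2 c) (z * v c))" if c: "c \<in> points C" and z: "z \<noteq> 0" for c z
    using eq[OF z spec_pointI[OF G1 c, of 1]] pair_torsor_act[OF G1 c, of h1 z 1] pair_torsor_act[OF G2 c, of h2 z "v c"] v(2)[OF c]
    by simp
  have loc: "\<exists>V k. openin (zariski C) V \<and> c \<in> V \<and> k \<in> Ks \<and>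
    (\<forall>d\<in>V. k \<otimes>\<^bsub>K\<^esub> (G2 d \<oslash> G1 d) \<in> unit_stalk d \<and> ev d (k \<otimes>\<^bsub>K\<^esub> (G2 d \<oslash> G1 d)) = v d)" if "c \<in> points C" for c
    by (rule local_multiplier[OF G1 G2 \<phi> \<phi>v v(1) that])
  obtain c0 where c0: "c0 \<in> points C" using nopen_points unfolding nopen_def by blast
  obtain V0 f where V0: "openin (zariski C) V0" "c0 \<in> V0" "f \<in> Ks"
    "\<And>d. d \<in> V0 \<Longrightarrow> f \<otimes>\<^bsub>K\<^esub> (G2 d \<oslash> G1 d) \<in> unit_stalk d \<and> ev d (f \<otimes>\<^bsub>K\<^esub> (G2 d \<oslash> G1 d)) = v d"
    using loc[OF c0] by blast
  \<comment> \<open>Two local multipliers take the same values against \<open>v\<close> on the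
    overlap of their domains, which is nonempty; so they are equal, and the multiplier found near
    \<open>c0\<close> serves at every point.\<close>
  have f: "f \<otimes>\<^bsub>K\<^esub> (G2 c \<oslash> G1 c) \<in> unit_stalk c \<and> ev c (f \<otimes>\<^bsub>K\<^esub> (G2 c \<oslash> G1 c)) = v c" if c: "c \<in> points C" for c
  proof -
    obtain V k where V: "openin (zariski C) V" "c \<in> V" "k \<in> Ks"
      "\<And>d. d \<in> V \<Longrightarrow> k \<otimes>\<^bsub>K\<^esub> (G2 d \<oslash> G1 d) \<in> unit_stalk d \<and> ev d (k \<otimes>\<^bsub>K\<^esub> (G2 d \<oslash> G1 d)) = v d"
      using loc[OF c] by blast
    have n: "nopen C (V \<inter> V0)" using nopen_Int[OF nopenI[OF V(1,2)] nopenI[OF V0(1,2)]] .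
    have "k = f"
    proof (rule eq_of_ev_quot[OF V(3) V0(3) n])
      fix d assume d: "d \<in> V \<inter> V0"
      then have p: "d \<in> points C" using nopenD(2)[OF n] by blast
      show "ev d (k \<oslash> f) = 1"
        by (rule unit_quot_ev[OF quot_Ks[OF g(2)[OF p] g(1)[OF p]] V(3) V0(3)])
          (use V(4)[of d] V0(4)[of d] d K.m_comm[of "G2 d \<oslash> G1 d"] V(3) V0(3) quot_Ks[OF g(2)[OF p] g(1)[OF p]] in simp_all)
    qed
    then show ?thesis using V(4)[OF V(2)] by simp
  qed
  have hK: "h1 \<in> Ks" "h2 \<in> Ks" using h1 h2 by (simp_all add: real_pair_def)
  define y where "y = (f \<otimes>\<^bsub>K\<^esub> rat_conj C f) \<otimes>\<^bsub>K\<^esub> h1"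
  have yK: "y \<in> Ks" unfolding y_def by (intro Ks_mult V0(3) rat_conj_Ks hK)
  have "h2 = y"
  proof (rule eq_of_ev_quot[OF hK(2) yK nopen_points])
    fix c assume c: "c \<in> points C"
    note c' = conj_points[OF c]
    let ?x = "G2 c \<otimes>\<^bsub>K\<^esub> rat_conj C (G2 (rconj C c))"
    define e1 where "e1 = ev c ((G1 c \<otimes>\<^bsub>K\<^esub> rat_conj C (G1 (rconj C c))) \<otimes>\<^bsub>K\<^esub> h1)"
    define e2 where "e2 = ev c (?x \<otimes>\<^bsub>K\<^esub> h2)"
    have xK: "?x \<in> Ks" by (rule Ks_mult[OF g(2)[OF c] rat_conj_Ks[OF g(2)[OF c']]])
    have e1: "e1 \<noteq> 0" unfolding e1_def using pair_torsor_rconj(2)[OF G1 h1 c, of 1] by simp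
    have vc: "v c \<noteq> 0" using v(1)[OF c] .
    \<comment> \<open>Compatibility with the real structures, tested at the point over
      \<open>c\<close> with coordinate 1. Comparing the two expressions for the image gives the
      relation between the weights \<open>e1\<close> and \<open>e2\<close>.\<close>
    have "\<phi> (rconj C c, spt (rconj C c) (G1 (rconj C c)) (cnj e1)) = (rconj C c, spt (rconj C c) (G2 (rconj C c)) (cnj (e2 / v c)))"
      using re[OF spec_pointI[OF G1 c, of 1]] pair_torsor_rconj(1)[OF G1 h1 c, of 1] pair_torsor_rconj(1)[OF G2 h2 c vc] v(2)[OF c]
      by (simp add: e1_def e2_def)
    then have sp: "spt (rconj C c) (G2 (rconj C c)) (cnj e1 * v (rconj C c)) = spt (rconj C c) (G2 (rconj C c)) (cnj (e2 / v c))"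
      using \<phi>v[OF c', of "cnj e1"] e1 by simp
    have "cnj e1 * v (rconj C c) = cnj (e2 / v c)"
      using fun_cong[OF sp, of "homog C 1 (G2 (rconj C c))"] spt_homog(1)[OF c' g(2)[OF c']] by simp
    then have "cnj (cnj e1 * v (rconj C c)) = e2 / v c" by simp
    then have e: "e2 = e1 * cnj (v (rconj C c)) * v c" using vc by (simp add: field_simps)
    have fu: "f \<otimes>\<^bsub>K\<^esub> (G2 d \<oslash> G1 d) \<in> unit_stalk d" if "d \<in> points C" for d using f[OF that] by blast
    note tw = transport_weight[OF D2 h1 V0(3) fu c]
    have "ev c (?x \<otimes>\<^bsub>K\<^esub> y) = e2" unfolding e y_def using tw(2) f[OF c] f[OF c'] by (simp add: e1_def)
    moreover have "?x \<otimes>\<^bsub>K\<^esub> y \<in> unit_stalk c" unfolding y_def by (rule tw(1))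
    moreover have "?x \<otimes>\<^bsub>K\<^esub> h2 \<in> unit_stalk c" using h2 c by (simp add: real_pair_def)
    ultimately show "ev c (h2 \<oslash> y) = 1"
      by (intro unit_quot_ev[OF xK hK(2) yK]) (simp_all add: e2_def)
  qed
  then show thesis using that[OF V0(3)] f unfolding y_def by blast
qed

lemma torsor_pairE:
  assumes "torsor_pair C L h"
  obtains G where "represents G L" "real_pair G h"
proof -
  have i: "invertible_submod C L" using assms by (simp add: torsor_pair_def)
  obtain G where "represents G L" using invertible_represents[OF i] by metis
  then show thesis using that torsor_pair_iff[OF _ i] assms by blast
qed

theorem pair_torsor_isomorphic_iff:
  assumes P1: "torsor_pair C L1 h1" and P2: "torsor_pair C L2 h2"
  shows "torsor_isomorphic (pair_torsor C L1 h1) (pair_torsor C L2 h2) \<longleftrightarrow>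
             (\<exists>f \<in> Ks. submod_eq C (tensor_submod C (dual_submod C L1) L2) (principal_submod C (inv\<^bsub>K\<^esub> f)) \<and>
                h2 = (f \<otimes>\<^bsub>K\<^esub> rat_conj C f) \<otimes>\<^bsub>K\<^esub> h1)"
proof -
  obtain G1 where G1: "represents G1 L1" "real_pair G1 h1" using torsor_pairE[OF P1] by metis
  obtain G2 where G2: "represents G2 L2" "real_pair G2 h2" using torsor_pairE[OF P2] by metis
  \<comment> \<open>At \<open>c\<close> the dual of \<open>L1\<close> tensored with
    \<open>L2\<close> is generated by the inverse of \<open>G1 c\<close> times \<open>G2 c\<close>;
    dividing by the inverse of \<open>f\<close> gives the element on the right.\<close>
  have eq: "submod_eq C (tensor_submod C (dual_submod C L1) L2) (principal_submod C (inv\<^bsub>K\<^esub> f)) \<longleftrightarrow>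
     (\<forall>c\<in>points C. f \<otimes>\<^bsub>K\<^esub> (G2 c \<oslash> G1 c) \<in> unit_stalk c)" if f: "f \<in> Ks" for f
  proof -
    have "(inv\<^bsub>K\<^esub> (G1 c) \<otimes>\<^bsub>K\<^esub> G2 c) \<oslash> inv\<^bsub>K\<^esub> f = f \<otimes>\<^bsub>K\<^esub> (G2 c \<oslash> G1 c)" if c: "c \<in> points C" for c
    proof -
      have "G1 c \<in> Ks" "G2 c \<in> Ks" using divisor_Ks representsD(1) G1 G2 c by blast+
      then show ?thesis using f Ks_inv[of "G1 c"] K_inv(5)[of f] by (simp add: K.m_ac)
    qed
    then show ?thesis
      using represents_eq[OF represents_tensor[OF represents_dual[OF G1(1)] G2(1)] represents_principal[OF Ks_inv[OF f]]] by simp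
  qed
  show ?thesis
  proof
    assume "torsor_isomorphic (pair_torsor C L1 h1) (pair_torsor C L2 h2)"
    then obtain f where f: "f \<in> Ks" "\<And>c. c \<in> points C \<Longrightarrow> f \<otimes>\<^bsub>K\<^esub> (G2 c \<oslash> G1 c) \<in> unit_stalk c"
      "h2 = (f \<otimes>\<^bsub>K\<^esub> rat_conj C f) \<otimes>\<^bsub>K\<^esub> h1"
      using pair_torsor_isomorphicD[OF G1(1) G2(1) G1(2) G2(2)] by metis
    then show "\<exists>f \<in> Ks. submod_eq C (tensor_submod C (dual_submod C L1) L2) (principal_submod C (inv\<^bsub>K\<^esub> f)) \<and>
                h2 = (f \<otimes>\<^bsub>K\<^esub> rat_conj C f) \<otimes>\<^bsub>K\<^esub> h1"
      using eq[OF f(1)] by blast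
  next
    assume "\<exists>f \<in> Ks. submod_eq C (tensor_submod C (dual_submod C L1) L2) (principal_submod C (inv\<^bsub>K\<^esub> f)) \<and>
                h2 = (f \<otimes>\<^bsub>K\<^esub> rat_conj C f) \<otimes>\<^bsub>K\<^esub> h1"
    then obtain f where f: "f \<in> Ks" "submod_eq C (tensor_submod C (dual_submod C L1) L2) (principal_submod C (inv\<^bsub>K\<^esub> f))"
       "h2 = (f \<otimes>\<^bsub>K\<^esub> rat_conj C f) \<otimes>\<^bsub>K\<^esub> h1" by blast
    show "torsor_isomorphic (pair_torsor C L1 h1) (pair_torsor C L2 h2)"
      by (rule pair_torsor_isomorphicI[OF G1(1) G2(1) G1(2) G2(2) f(1) _ f(3)]) (use eq[OF f(1)] f(2) in blast)
  qed
qed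

end

lemma real_variety_real_irr_space:
  assumes "real_variety C"
  shows "real_irr_space C"
proof -
  interpret fun_space C by (rule variety_fun_space) (use assms in \<open>simp add: real_variety_def\<close>)
  show ?thesis
    by unfold_locales (use assms in \<open>auto simp: real_variety_def variety_def\<close>)
qed

section \<open>Laurent polynomials\<close>

lemma irr_space_Gm: "irr_space Gm"
  using fun_space_Gm irreducible_Gm by (simp add: irr_space_def irr_space_axioms_def)

lemma root_of_unity_ne_1:
  assumes "0 < n" "n < K"
  shows "cis (2 * pi / real K) ^ n \<noteq> 1"
proof
  assume "cis (2 * pi / real K) ^ n = 1"
  then have "cos (real n * (2 * pi / real K)) = 1"
    unfolding Complex.DeMoivre by (metis cis.simps(1) one_complex.simps(1))
  then obtain k :: int where k: "real n * (2 * pi / real K) = of_int k * 2 * pi"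
    using cos_one_2pi_int by blast
  have "real n = of_int k * real K" using k assms by (simp add: field_simps)
  then have "int n = k * int K" by (metis of_int_eq_iff of_int_mult of_int_of_nat_eq)
  then have "int K dvd int n" by simp
  then show False using assms by (simp add: nat_dvd_not_less)
qed

text \<open>A geometric series whose ratio has K-th power 1; the bound on \<open>n\<close> ensures
  that this ratio differs from 1 unless \<open>n\<close> is 0.\<close>

lemma root_of_unity_sum:
  fixes n :: int
  assumes "\<bar>n\<bar> < int K"
  shows "(\<Sum>j<K. (cis (2 * pi / real K) ^ j) powi n) = (if n = 0 then of_nat K else 0)"
proof (cases "n = 0")
  case False
  let ?w = "cis (2 * pi / real K)"
  have w0: "?w \<noteq> 0" by simp
  have K: "0 < K" using assms by auto
  have wK: "?w ^ K = 1" using K by (simp add: Complex.DeMoivre)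
  have ne: "?w powi n \<noteq> 1"
  proof (cases n rule: int_cases2)
    case (nonneg k)
    then show ?thesis using root_of_unity_ne_1[of k K] assms False by simp
  next
    case (nonpos k)
    then show ?thesis using root_of_unity_ne_1[of k K] assms False by (simp add: power_int_minus)
  qed
  have e: "(?w ^ j) powi n = (?w powi n) ^ j" for j
    by (metis power_int_mult power_int_of_nat mult.commute)
  have "(\<Sum>j<K. (?w ^ j) powi n) = ((?w powi n) ^ K - 1) / (?w powi n - 1)"
    unfolding e by (rule geometric_sum[OF ne])
  also have "(?w powi n) ^ K = 1" using e[of K] wK by simp
  finally show ?thesis using False by simp
qed simp

text \<open>The discrete Fourier coefficient over the roots of unity of order 2N + 1, the number of
  exponents between -N and N. It uses finitely many values of \<open>f\<close>; applied to a
  function along an orbit it is a finite combination of translates, and this is what makes the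
  coefficients regular.\<close>

definition dft :: "nat \<Rightarrow> int \<Rightarrow> (complex \<Rightarrow> complex) \<Rightarrow> complex" where
  "dft N m f = (\<Sum>j<2 * N + 1. inverse (of_nat (2 * N + 1)) * (cis (2 * pi / real (2 * N + 1)) ^ j) powi (- m)
      * f (cis (2 * pi / real (2 * N + 1)) ^ j))"

lemma dft_laurent:
  assumes f: "\<And>z. z \<noteq> 0 \<Longrightarrow> f z = (\<Sum>m\<in>{- int N..int N}. c m * z powi m)" and m: "m \<in> {- int N..int N}"
  shows "dft N m f = c m"
proof -
  let ?K = "2 * N + 1"
  let ?w = "cis (2 * pi / real ?K)"
  let ?I = "{- int N..int N}"
  have w: "?w ^ j \<noteq> 0" for j by simp
  have "dft N m f = (\<Sum>j<?K. \<Sum>k\<in>?I. inverse (of_nat ?K) * c k * (?w ^ j) powi (k - m))"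
    unfolding dft_def
  proof (rule sum.cong[OF refl])
    fix j
    have p: "(?w ^ j) powi (- m) * (?w ^ j) powi k = (?w ^ j) powi (k - m)" for k
      using power_int_add[of "?w ^ j" "- m" k] w by simp
    have "inverse (of_nat ?K) * (?w ^ j) powi (- m) * f (?w ^ j) =
      (\<Sum>k\<in>?I. inverse (of_nat ?K) * c k * ((?w ^ j) powi (- m) * (?w ^ j) powi k))"
      unfolding f[OF w] sum_distrib_left by (intro sum.cong) (auto simp: mult_ac)
    then show "inverse (of_nat ?K) * (?w ^ j) powi (- m) * f (?w ^ j) =
      (\<Sum>k\<in>?I. inverse (of_nat ?K) * c k * (?w ^ j) powi (k - m))" unfolding p .
  qed
  also have "\<dots> = (\<Sum>k\<in>?I. inverse (of_nat ?K) * c k * (\<Sum>j<?K. (?w ^ j) powi (k - m)))"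
    by (subst sum.swap) (simp only: sum_distrib_left)
  also have "\<dots> = (\<Sum>k\<in>?I. inverse (of_nat ?K) * c k * (if k - m = 0 then of_nat ?K else 0))"
  proof (rule sum.cong[OF refl])
    fix k assume "k \<in> ?I"
    then have "\<bar>k - m\<bar> < int ?K" using m by auto
    then show "inverse (of_nat ?K) * c k * (\<Sum>j<?K. (?w ^ j) powi (k - m)) =
      inverse (of_nat ?K) * c k * (if k - m = 0 then of_nat ?K else 0)" by (simp only: root_of_unity_sum)
  qed
  also have "\<dots> = (\<Sum>k\<in>?I. if k = m then c m else 0)"
  proof (rule sum.cong[OF refl])
    fix k
    have "(of_nat ?K :: complex) \<noteq> 0" by (simp only: of_nat_eq_0_iff)
    then show "inverse (of_nat ?K) * c k * (if k - m = 0 then of_nat ?K else 0) = (if k = m then c m else 0)"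
      by (auto simp del: of_nat_add of_nat_mult)
  qed
  also have "\<dots> = c m" using m by simp
  finally show ?thesis .
qed

text \<open>The coefficients are read off by the transform, and the transform of the zero function
  is 0.\<close>

lemma laurent_zero:
  fixes c :: "int \<Rightarrow> complex"
  assumes S: "finite S" and z: "\<And>z. z \<noteq> 0 \<Longrightarrow> (\<Sum>m\<in>S. c m * z powi m) = 0" and m: "m \<in> S"
  shows "c m = 0"
proof -
  define N where "N = nat (Max ((\<lambda>m. \<bar>m\<bar>) ` S))"
  have N: "S \<subseteq> {- int N..int N}"
  proof
    fix k assume "k \<in> S"
    then have "\<bar>k\<bar> \<le> Max ((\<lambda>m. \<bar>m\<bar>) ` S)" using S by simp
    then show "k \<in> {- int N..int N}" unfolding N_def by auto
  qed
  define d where "d = (\<lambda>k. if k \<in> S then c k else 0)"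
  have "(0 :: complex) = (\<Sum>k\<in>{- int N..int N}. d k * z powi k)" if "z \<noteq> 0" for z
  proof -
    have "(\<Sum>k\<in>{- int N..int N}. d k * z powi k) = (\<Sum>k\<in>S. c k * z powi k)"
      by (rule sum.mono_neutral_cong_right) (use N in \<open>auto simp: d_def\<close>)
    then show ?thesis using z[OF that] by simp
  qed
  from dft_laurent[where f = "\<lambda>_. 0" and N = N and c = d and m = m, OF this] show ?thesis
    using m N by (auto simp: d_def dft_def)
qed

text \<open>The linear factors of the denominator are removed one by one. At a nonzero root the
  function is defined, so the numerator vanishes there too and the factor cancels. A root at 0 is
  outside the group and cannot be cancelled; it is absorbed by replacing \<open>f\<close> with
  \<open>z * f z\<close>, which raises the exponent \<open>k\<close> by one.\<close>

lemma reg_Gm_cancel: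
  assumes f: "(\<lambda>z\<in>- {0}. f z) \<in> reg Gm (- {0})" and b: "b \<noteq> 0"
    and eq: "\<And>z. z \<noteq> 0 \<Longrightarrow> poly b z * f z = poly a z" and d: "degree a \<le> N"
  shows "\<exists>p k. degree p \<le> N \<and> k \<le> degree b \<and> (\<forall>z. z \<noteq> 0 \<longrightarrow> f z * z ^ k = poly p z)"
  using assms
proof (induction "degree b" arbitrary: b a f)
  case 0
  then obtain c where c: "b = [:c:]" "c \<noteq> 0" by (metis degree_eq_zeroE pCons_0_0)
  have "f z = poly (smult (inverse c) a) z" if "z \<noteq> 0" for z
    using 0(4)[OF that] c by (simp add: field_simps)
  then show ?case using 0(5) by (intro exI[of _ "smult (inverse c) a"] exI[of _ 0]) auto
next
  case (Suc n)
  interpret Gm: irr_space Gm by (rule irr_space_Gm)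
  have o: "openin (zariski Gm) (- {0})" using points_Gm by (metis openin_topspace)
  have "\<not> constant (poly b)" using Suc.hyps(2) constant_degree[of b] by simp
  then obtain x where x: "poly b x = 0" using fundamental_theorem_of_algebra by blast
  then obtain b' where b': "b = [:- x, 1:] * b'" using poly_eq_0_iff_dvd by (metis dvdE)
  have b'0: "b' \<noteq> 0" using Suc.prems(2) b' by auto
  have db: "degree b = Suc (degree b')" unfolding b' using b'0 by (subst degree_mult_eq) auto
  then have n: "n = degree b'" using Suc.hyps(2) by simp
  show ?case
  proof (cases "x = 0")
    case True
    have "(\<lambda>z\<in>- {0}. (\<lambda>z\<in>- {0}. poly [:0, 1:] z) z * (\<lambda>z\<in>- {0}. f z) z) \<in> reg Gm (- {0})"
      by (intro Gm.reg_mult o reg_Gm_poly Suc.prems(1))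
    then have r: "(\<lambda>z\<in>- {0}. z * f z) \<in> reg Gm (- {0})"
      by (rule Gm.reg_cong[OF o]) auto
    have "poly b' z * (z * f z) = poly a z" if "z \<noteq> 0" for z
      using Suc.prems(3)[OF that] unfolding b' True by (simp add: mult_ac)
    from Suc.hyps(1)[OF n r b'0 this Suc.prems(4)] obtain p k where
      "degree p \<le> N" "k \<le> degree b'" "\<forall>z. z \<noteq> 0 \<longrightarrow> z * f z * z ^ k = poly p z" by blast
    then show ?thesis using db by (intro exI[of _ p] exI[of _ "Suc k"]) (simp add: mult_ac)
  next
    case False
    have "poly a x = 0" using Suc.prems(3)[OF False] x by simp
    then obtain a' where a': "a = [:- x, 1:] * a'" using poly_eq_0_iff_dvd by (metis dvdE)
    have da: "degree a' \<le> N"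
    proof (cases "a' = 0")
      case False
      then have "degree a = Suc (degree a')" unfolding a' by (subst degree_mult_eq) auto
      then show ?thesis using Suc.prems(4) by simp
    qed simp
    have e: "poly b' z * f z = poly a' z" if "z \<noteq> 0" "z \<noteq> x" for z
    proof -
      have "(z - x) * (poly b' z * f z) = (z - x) * poly a' z"
        using Suc.prems(3)[OF that(1)] unfolding a' b' by (simp add: algebra_simps)
      then show ?thesis using that(2) by simp
    qed
    let ?W = "{z. z \<noteq> 0 \<and> poly [:- x, 1:] z \<noteq> 0}"
    have oW: "openin (zariski Gm) ?W" unfolding Gm_eq by (rule open_generated[OF Gm_gensI[of _ 1]])
    \<comment> \<open>A witness that the group without \<open>x\<close> is nonempty.\<close>
    have "2 * x \<in> ?W" using False by simp
    then have W: "nopen Gm ?W" using Gm.nopenI[OF oW] by blast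
    \<comment> \<open>Dividing by \<open>z - x\<close> gives the identity away from \<open>x\<close>
      only; it extends to \<open>x\<close> by density.\<close>
    have "poly b' z * f z = poly a' z" if z: "z \<noteq> 0" for z
    proof -
      have "(\<lambda>z\<in>- {0}. (\<lambda>z\<in>- {0}. poly b' z) z * (\<lambda>z\<in>- {0}. f z) z) z = (\<lambda>z\<in>- {0}. poly a' z) z"
      proof (rule Gm.reg_eq_dense[OF o Gm.reg_mult[OF o reg_Gm_poly[OF o] Suc.prems(1)] reg_Gm_poly[OF o] W])
        show "?W \<subseteq> - {0}" by auto
        show "(\<lambda>z\<in>- {0}. (\<lambda>z\<in>- {0}. poly b' z) z * (\<lambda>z\<in>- {0}. f z) z) y = (\<lambda>z\<in>- {0}. poly a' z) y" if "y \<in> ?W" for y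
          using e[of y] that by simp
      qed (use z in simp)
      then show ?thesis using z by simp
    qed
    from Suc.hyps(1)[OF n Suc.prems(1) b'0 this da] obtain p k where
      "degree p \<le> N" "k \<le> degree b'" "\<forall>z. z \<noteq> 0 \<longrightarrow> f z * z ^ k = poly p z" by blast
    then show ?thesis using db by (intro exI[of _ p] exI[of _ k]) simp
  qed
qed

text \<open>The relation on \<open>S\<close> spreads to the whole group, and all denominators cancel
  except a power of \<open>z\<close> of exponent at most \<open>degree b\<close>. So the exponents
  are bounded by the degrees alone, which allows one Fourier transform for a whole family of
  orbits.\<close>

lemma reg_Gm_laurent:
  assumes f: "(\<lambda>z\<in>- {0}. f z) \<in> reg Gm (- {0})" and b: "b \<noteq> 0" "degree b \<le> N" "degree a \<le> N"
    and S: "openin (zariski Gm) S" "x \<in> S" and eq: "\<And>z. z \<in> S \<Longrightarrow> poly b z * f z = poly a z"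
  shows "\<exists>c. \<forall>z. z \<noteq> 0 \<longrightarrow> f z = (\<Sum>m\<in>{- int N..int N}. c m * z powi m)"
proof -
  interpret Gm: irr_space Gm by (rule irr_space_Gm)
  have o: "openin (zariski Gm) (- {0})" using points_Gm by (metis openin_topspace)
  have sub: "S \<subseteq> - {0}" using openin_subset[OF S(1)] points_Gm by simp
  have "poly b z * f z = poly a z" if z: "z \<noteq> 0" for z
  proof -
    have "(\<lambda>z\<in>- {0}. (\<lambda>z\<in>- {0}. poly b z) z * (\<lambda>z\<in>- {0}. f z) z) z = (\<lambda>z\<in>- {0}. poly a z) z"
      by (rule Gm.reg_eq_dense[OF o Gm.reg_mult[OF o reg_Gm_poly[OF o] f] reg_Gm_poly[OF o] Gm.nopenI[OF S] sub])
        (use eq z sub in auto)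
    then show ?thesis using z by simp
  qed
  from reg_Gm_cancel[OF f b(1) this b(3)] obtain p k where p: "degree p \<le> N" "k \<le> degree b"
    "\<And>z. z \<noteq> 0 \<Longrightarrow> f z * z ^ k = poly p z" by blast
  \<comment> \<open>Division by \<open>z ^ k\<close> moves the coefficient of index i to the
    exponent i - k; below -k there is nothing, whence the default 0.\<close>
  define c where "c = (\<lambda>m. if m + int k \<ge> 0 then coeff p (nat (m + int k)) else 0)"
  have "f z = (\<Sum>m\<in>{- int N..int N}. c m * z powi m)" if z: "z \<noteq> 0" for z
  proof -
    have "f z = poly p z / z ^ k" using p(3)[OF z] z by (simp add: field_simps)
    also have "poly p z = (\<Sum>i\<le>N. coeff p i * z ^ i)"
    proof -
      have "(\<Sum>i\<le>degree p. coeff p i * z ^ i) = (\<Sum>i\<le>N. coeff p i * z ^ i)"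
        by (rule sum.mono_neutral_left) (use p(1) in \<open>auto intro: le_degree\<close>)
      then show ?thesis by (simp add: poly_altdef)
    qed
    also have "\<dots> / z ^ k = (\<Sum>i\<le>N. c (int i - int k) * z powi (int i - int k))"
      unfolding sum_divide_distrib using z
      by (intro sum.cong) (auto simp: c_def power_int_diff)
    also have "\<dots> = (\<Sum>m\<in>(\<lambda>i. int i - int k) ` {..N}. c m * z powi m)"
      by (subst sum.reindex) (auto simp: inj_on_def)
    also have "\<dots> = (\<Sum>m\<in>{- int N..int N}. c m * z powi m)"
    proof (rule sum.mono_neutral_left)
      show "(\<lambda>i. int i - int k) ` {..N} \<subseteq> {- int N..int N}" using p(2) b(2) by auto
      show "\<forall>m\<in>{- int N..int N} - (\<lambda>i. int i - int k) ` {..N}. c m * z powi m = 0"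
      proof
        fix m assume m: "m \<in> {- int N..int N} - (\<lambda>i. int i - int k) ` {..N}"
        have "c m = 0"
        proof (cases "m + int k \<ge> 0")
          case True
          have "\<not> nat (m + int k) \<le> N"
          proof
            assume "nat (m + int k) \<le> N"
            then have "m \<in> (\<lambda>i. int i - int k) ` {..N}" using True
              by (intro image_eqI[of _ _ "nat (m + int k)"]) auto
            then show False using m by blast
          qed
          then show ?thesis using p(1) by (simp add: c_def coeff_eq_0)
        qed (simp add: c_def)
        then show "c m * z powi m = 0" by simp
      qed
    qed simp
    finally show ?thesis .
  qed
  then show ?thesis by blast
qed

text \<open>Local denominators are multiplied together one function at a time. The polynomials
  depend on the functions alone; applied to the group-variable factors of a sum of products, they do
  not depend on the point of the torsor.\<close>

lemma common_denominator:
  assumes "openin (zariski Gm) U" "x \<in> U" "\<And>i. i < k \<Longrightarrow> f i \<in> reg Gm U"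
  shows "\<exists>q p S. openin (zariski Gm) S \<and> x \<in> S \<and> S \<subseteq> U \<and>
    (\<forall>z\<in>S. poly q z \<noteq> 0 \<and> (\<forall>i<(k::nat). f i z = poly (p i) z / poly q z))"
  using assms(3)
proof (induction k)
  case 0
  show ?case
    by (rule exI[of _ 1], rule exI[of _ "\<lambda>_. 0"], rule exI[of _ U]) (use assms in auto)
next
  case (Suc k)
  have "\<exists>q p S. openin (zariski Gm) S \<and> x \<in> S \<and> S \<subseteq> U \<and>
    (\<forall>z\<in>S. poly q z \<noteq> 0 \<and> (\<forall>i<k. f i z = poly (p i) z / poly q z))"
    by (rule Suc.IH) (use Suc.prems in simp)
  then obtain q p S where S: "openin (zariski Gm) S" "x \<in> S" "S \<subseteq> U"
    "\<forall>z\<in>S. poly q z \<noteq> 0 \<and> (\<forall>i<k. f i z = poly (p i) z / poly q z)" by blast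
  have 1: "\<And>z. z \<in> S \<Longrightarrow> poly q z \<noteq> 0" "\<And>z i. z \<in> S \<Longrightarrow> i < k \<Longrightarrow> f i z = poly (p i) z / poly q z"
    using S(4) by simp_all
  obtain a b W where 2: "openin (zariski Gm) W" "x \<in> W" "W \<subseteq> U"
    "\<And>z. z \<in> W \<Longrightarrow> poly b z \<noteq> 0 \<and> f k z = poly a z / poly b z"
    using reg_Gm_local[OF Suc.prems[of k] assms(2)] by (metis lessI)
  show ?case
  proof (rule exI[of _ "q * b"], rule exI[of _ "\<lambda>i. if i = k then a * q else p i * b"], rule exI[of _ "S \<inter> W"], intro conjI ballI allI impI)
    show "openin (zariski Gm) (S \<inter> W)" "x \<in> S \<inter> W" "S \<inter> W \<subseteq> U" using S 2 by auto
    fix z assume z: "z \<in> S \<inter> W"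
    then have zS: "z \<in> S" and zW: "z \<in> W" by auto
    show "poly (q * b) z \<noteq> 0" using 1(1)[OF zS] 2(4)[OF zW] by simp
    fix i assume "i < Suc k"
    then show "f i z = poly (if i = k then a * q else p i * b) z / poly (q * b) z"
      using 1(1)[OF zS] 2(4)[OF zW] 1(2)[OF zS, of i] \<open>i < Suc k\<close> by (cases "i = k") (auto simp: field_simps)
  qed
qed

section \<open>Torsors\<close>

lemma fun_space_circle: "fun_space circle"
  using fun_space_Gm by (simp add: fun_space_def circle_def)

lemma zariski_circle: "zariski circle = zariski Gm" and reg_circle: "reg circle = reg Gm"
  by (simp_all add: circle_def)

lemma rconj_circle: "rconj circle z = 1 / cnj z"
  by (simp add: circle_def)

lemma fmorphism_inclusion:
  assumes X: "fun_space X" and S: "openin (zariski X) S"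
  shows "fmorphism (subvariety X S) X (\<lambda>x. x)"
proof -
  interpret fun_space X by fact
  have eq: "preim (subvariety X S) (\<lambda>x. x) V = S \<inter> V" if "openin (zariski X) V" for V
    using openin_subset[OF that] by auto
  have "(\<lambda>x\<in>S \<inter> V. f x) \<in> reg (subvariety X S) (S \<inter> V)" if V: "openin (zariski X) V" "f \<in> reg X V" for V f
  proof -
    have o: "openin (zariski X) (S \<inter> V)" using S V by auto
    show ?thesis unfolding reg_open_subvariety[OF X S o Int_lower1]
      using reg_restrict[OF V(1) o _ V(2)] by simp
  qed
  moreover have "continuous_map (zariski (subvariety X S)) (zariski X) (\<lambda>x. x)"
    by simp
  ultimately show ?thesis unfolding fmorphism_def using eq by simp
qed

locale torsor_space = real_irr_space C + P: real_irr_space P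
  for C :: "('a, 'm) real_space_scheme" and P :: "('b, 'a, 'n) torsor_scheme" +
  assumes S1: "S1_torsor C P"
begin

notation quot (infixl "\<oslash>" 70)

abbreviation over :: "'a set \<Rightarrow> 'b set" where "over U \<equiv> preim P (base P) U"

lemma base_mor: "fmorphism P C (base P)"
  and base_conj: "p \<in> points P \<Longrightarrow> base P (rconj P p) = rconj C (base P p)"
  and act_mor: "fmorphism (prod_space circle P) P (\<lambda>(z, p). act P z p)"
  and act_one: "p \<in> points P \<Longrightarrow> act P 1 p = p"
  and act_act: "z \<noteq> 0 \<Longrightarrow> w \<noteq> 0 \<Longrightarrow> p \<in> points P \<Longrightarrow> act P (z * w) p = act P z (act P w p)"
  and act_conj: "z \<noteq> 0 \<Longrightarrow> p \<in> points P \<Longrightarrow> rconj P (act P z p) = act P (1 / cnj z) (rconj P p)"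
  and base_act: "z \<noteq> 0 \<Longrightarrow> p \<in> points P \<Longrightarrow> base P (act P z p) = base P p"
  using S1 unfolding S1_torsor_def real_morphism_def by (simp_all add: points_circle rconj_circle)

lemma base_points: "p \<in> points P \<Longrightarrow> base P p \<in> points C"
  using fmorphism_points[OF base_mor] .

lemma act_points:
  assumes "z \<noteq> 0" "p \<in> points P"
  shows "act P z p \<in> points P"
  using fmorphism_points[OF act_mor, of "(z, p)"] assms
  by (simp add: points_prod_space[OF fun_space_circle P.fun_space_axioms] points_circle)

lemma over_open: "openin (zariski C) U \<Longrightarrow> openin (zariski P) (over U)"
  using fmorphism_open[OF base_mor] .

lemma act_over: "z \<noteq> 0 \<Longrightarrow> p \<in> over U \<Longrightarrow> act P z p \<in> over U"
  using act_points base_act by simp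

lemma pull_reg: "openin (zariski C) U \<Longrightarrow> f \<in> reg C U \<Longrightarrow> (\<lambda>p\<in>over U. f (base P p)) \<in> reg P (over U)"
  using fmorphism_reg[OF base_mor] .

text \<open>The second component of a trivializing isomorphism is a nowhere vanishing function
  \<open>u\<close> of weight 1, and the preimages of the points (d, 1) form a section
  \<open>s\<close>. In this form charts are functions on \<open>P\<close>, which can be multiplied,
  divided and conjugated.\<close>

lemma trivialization:
  assumes c: "c \<in> points C"
  obtains U u s where "openin (zariski C) U" "c \<in> U" "u \<in> reg P (over U)"
    "\<And>p. p \<in> over U \<Longrightarrow> u p \<noteq> 0"
    "\<And>z p. z \<noteq> 0 \<Longrightarrow> p \<in> over U \<Longrightarrow> u (act P z p) = z * u p"
    "fmorphism (subvariety C U) P s"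
    "\<And>d. d \<in> U \<Longrightarrow> s d \<in> points P \<and> base P (s d) = d \<and> u (s d) = 1"
    "\<And>p. p \<in> over U \<Longrightarrow> p = act P (u p) (s (base P p))"
proof -
  have "\<forall>c\<in>points C. \<exists>U \<phi>. openin (zariski C) U \<and> c \<in> U \<and>
        fiso (subvariety P (over U)) (prod_space (subvariety C U) Gm) \<phi> \<and>
        (\<forall>p\<in>over U. fst (\<phi> p) = base P p \<and>
           (\<forall>z\<in>points Gm. \<phi> (act P z p) = (base P p, z * snd (\<phi> p))))"
    using S1 unfolding S1_torsor_def by (elim conjE)
  from bspec[OF this c] obtain U \<phi> where U: "openin (zariski C) U" "c \<in> U"
    and iso: "fiso (subvariety P (over U)) (prod_space (subvariety C U) Gm) \<phi>"
    and all: "\<forall>p\<in>over U. fst (\<phi> p) = base P p \<and>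
           (\<forall>z\<in>points Gm. \<phi> (act P z p) = (base P p, z * snd (\<phi> p)))" by (elim exE conjE) (rule that)
  have \<phi>: "fst (\<phi> p) = base P p" "z \<noteq> 0 \<Longrightarrow> \<phi> (act P z p) = (base P p, z * snd (\<phi> p))"
    if "p \<in> over U" for p z
    using bspec[OF all that] by (simp_all add: points_Gm)
  have US: "U \<subseteq> points C" using openin_subset[OF U(1)] .
  note oW = over_open[OF U(1)]
  have fC: "fun_space (subvariety C U)" by (rule fun_space_subvariety) unfold_locales
  have pW: "points (subvariety P (over U)) = over U" by auto
  have pp: "points (prod_space (subvariety C U) Gm) = U \<times> - {0}"
    unfolding points_prod_space[OF fC fun_space_Gm] points_Gm using US by auto
  have bij: "bij_betw \<phi> (over U) (U \<times> - {0})" and m: "fmorphism (subvariety P (over U)) (prod_space (subvariety C U) Gm) \<phi>"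
    and mi: "fmorphism (prod_space (subvariety C U) Gm) (subvariety P (over U)) (inv_into (over U) \<phi>)"
    using iso unfolding fiso_def pW pp by simp_all
  define u where "u = (\<lambda>p\<in>over U. snd (\<phi> p))"
  define s where "s = (\<lambda>d. inv_into (over U) \<phi> (d, 1))"
  have \<phi>in: "\<phi> p \<in> U \<times> - {0}" if "p \<in> over U" for p using bij that by (meson bij_betwE)
  have \<phi>eq: "\<phi> p = (base P p, u p)" if "p \<in> over U" for p
    using \<phi>(1)[OF that] that by (simp add: u_def prod_eq_iff)
  have pre: "preim (subvariety P (over U)) \<phi> (U \<times> - {0}) = over U" using \<phi>in by auto
  have "(\<lambda>p\<in>over U. (\<lambda>q\<in>U \<times> - {0}. snd q) (\<phi> p)) \<in> reg (subvariety P (over U)) (over U)"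
    using fmorphism_reg[OF m _ reg_snd_Gm[OF fC]] unfolding pp pre by (metis openin_topspace pp)
  moreover have "(\<lambda>p\<in>over U. (\<lambda>q\<in>U \<times> - {0}. snd q) (\<phi> p)) = u"
    unfolding u_def by (rule restrict_ext) (use \<phi>in in auto)
  ultimately have ur: "u \<in> reg P (over U)"
    using reg_open_subvariety[OF P.fun_space_axioms oW oW] by simp
  have u0: "u p \<noteq> 0" if "p \<in> over U" for p using \<phi>in[OF that] \<phi>eq[OF that] by simp
  have ua: "u (act P z p) = z * u p" if "z \<noteq> 0" "p \<in> over U" for z p
    using \<phi>(2)[OF that(2,1)] act_over[OF that] that(2) by (simp add: u_def)
  have one: "(1::complex) \<in> points Gm" by (simp add: points_Gm)
  have "fmorphism (subvariety C U) (subvariety P (over U)) s"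
    unfolding s_def using fmorphism_comp[OF fmorphism_slice1[OF fC fun_space_Gm one] mi] .
  from fmorphism_comp[OF this fmorphism_inclusion[OF P.fun_space_axioms oW]]
  have ms: "fmorphism (subvariety C U) P s" .
  have sW: "s d \<in> over U" and \<phi>s: "\<phi> (s d) = (d, 1)" if "d \<in> U" for d
  proof -
    have "(d, 1) \<in> \<phi> ` over U" using bij that by (simp add: bij_betw_def)
    then show "s d \<in> over U" "\<phi> (s d) = (d, 1)" unfolding s_def by (rule inv_into_into, rule f_inv_into_f)
  qed
  have s: "s d \<in> points P \<and> base P (s d) = d \<and> u (s d) = 1" if "d \<in> U" for d
    using sW[OF that] \<phi>s[OF that] \<phi>eq[OF sW[OF that]] by simp
  have "p = act P (u p) (s (base P p))" if p: "p \<in> over U" for p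
  proof -
    have b: "base P p \<in> U" using p by simp
    have "\<phi> (act P (u p) (s (base P p))) = (base P (s (base P p)), u p * snd (\<phi> (s (base P p))))"
      by (rule \<phi>(2)[OF sW[OF b] u0[OF p]])
    also have "\<dots> = \<phi> p" using s[OF b] \<phi>s[OF b] \<phi>eq[OF p] by simp
    finally show ?thesis using bij act_over[OF u0[OF p] sW[OF b]] p by (metis bij_betw_def inj_onD)
  qed
  then show thesis using that[OF U ur u0 ua ms s] by blast
qed

lemma over_nonempty:
  assumes "c \<in> points C"
  obtains p where "p \<in> points P" "base P p = c"
  by (rule trivialization[OF assms]) (use that in blast)

lemma over_nopen:
  assumes "nopen C U"
  shows "nopen P (over U)"
proof -
  obtain c where c: "c \<in> U" using assms by (auto simp: nopen_def)
  then have "c \<in> points C" using nopenD(2)[OF assms] by blast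
  then obtain p where "p \<in> points P" "base P p = c" using over_nonempty by metis
  then show ?thesis using over_open[OF nopenD(1)[OF assms]] c by (intro P.nopenI[of _ p]) simp_all
qed

text \<open>Each fibre is a single orbit, so \<open>F\<close> is constant on it. Near a point of the
  base the resulting function is \<open>F\<close> composed with a local section, hence
  regular.\<close>

lemma descent:
  assumes V: "openin (zariski C) V" and F: "F \<in> reg P (over V)"
    and inv: "\<And>z p. z \<noteq> 0 \<Longrightarrow> p \<in> over V \<Longrightarrow> F (act P z p) = F p"
  obtains f where "f \<in> reg C V" "\<And>p. p \<in> over V \<Longrightarrow> F p = f (base P p)"
proof -
  have "\<exists>x. \<forall>p\<in>points P. base P p = c \<longrightarrow> F p = x" if c: "c \<in> V" for c
  proof -
    have cp: "c \<in> points C" using openin_subset[OF V] c by blast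
    obtain U u s where "c \<in> U" "\<And>p. p \<in> over U \<Longrightarrow> u p \<noteq> 0"
      "\<And>d. d \<in> U \<Longrightarrow> s d \<in> points P \<and> base P (s d) = d \<and> u (s d) = (1::complex)"
      "\<And>p. p \<in> over U \<Longrightarrow> p = act P (u p) (s (base P p))"
      by (rule trivialization[OF cp]) blast
    note u = this
    have "F p = F (s c)" if "p \<in> points P" "base P p = c" for p
      using u(4)[of p] u(2)[of p] u(3)[OF u(1)] inv[of "u p" "s c"] that u(1) c by simp
    then show ?thesis by blast
  qed
  then obtain f where f: "\<And>c p. c \<in> V \<Longrightarrow> p \<in> points P \<Longrightarrow> base P p = c \<Longrightarrow> F p = f c" by metis
  have "restrict f V \<in> reg C V"
  proof (rule reg_localI[OF V])
    fix c assume c: "c \<in> V"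
    have cp: "c \<in> points C" using openin_subset[OF V] c by blast
    obtain U u s where U: "openin (zariski C) U" "c \<in> U" and m: "fmorphism (subvariety C U) P s"
      and s: "\<And>d. d \<in> U \<Longrightarrow> s d \<in> points P \<and> base P (s d) = d \<and> u (s d) = (1::complex)"
      by (rule trivialization[OF cp]) blast
    have US: "U \<subseteq> points C" using openin_subset[OF U(1)] .
    have o: "openin (zariski C) (U \<inter> V)" using U V by auto
    have pre: "preim (subvariety C U) s (over V) = U \<inter> V" using s US by auto
    have "(\<lambda>d\<in>U \<inter> V. F (s d)) \<in> reg (subvariety C U) (U \<inter> V)"
      using fmorphism_reg[OF m over_open[OF V] F] unfolding pre .
    then have "(\<lambda>d\<in>U \<inter> V. F (s d)) \<in> reg C (U \<inter> V)"
      unfolding reg_open_subvariety[OF fun_space_axioms U(1) o Int_lower1] .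
    moreover have "\<forall>d\<in>V \<inter> (U \<inter> V). f d = (\<lambda>d\<in>U \<inter> V. F (s d)) d" using f s by auto
    ultimately show "\<exists>W g. openin (zariski C) W \<and> c \<in> W \<and> g \<in> reg C W \<and> (\<forall>y\<in>V \<inter> W. f y = g y)"
      using o U(2) c by blast
  qed
  then show thesis by (rule that) (use f in simp)
qed

section \<open>Decomposition into semi-invariants\<close>

definition wt :: "int \<Rightarrow> 'a set \<Rightarrow> ('b \<Rightarrow> complex) \<Rightarrow> bool" where
  "wt m U F \<longleftrightarrow> F \<in> reg P (over U) \<and> semi_invariant P (over U) m F"

lemma wtD: "wt m U F \<Longrightarrow> F \<in> reg P (over U)" "wt m U F \<Longrightarrow> z \<noteq> 0 \<Longrightarrow> p \<in> over U \<Longrightarrow> F (act P z p) = z powi m * F p"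
  by (simp_all add: wt_def semi_invariant_def points_circle)

lemma translate_reg:
  assumes z: "z \<noteq> 0" and U: "openin (zariski C) U" and F: "F \<in> reg P (over U)"
  shows "(\<lambda>p\<in>over U. F (act P z p)) \<in> reg P (over U)"
proof -
  have zc: "z \<in> points circle" using z by (simp add: points_circle)
  have m: "fmorphism P P (\<lambda>p. act P z p)"
    using fmorphism_comp[OF fmorphism_slice2[OF fun_space_circle P.fun_space_axioms zc] act_mor] by simp
  have "preim P (\<lambda>p. act P z p) (over U) = over U"
    using act_points[OF z] base_act[OF z] by auto
  then show ?thesis using fmorphism_reg[OF m over_open[OF U] F] by simp
qed

lemma orbit_reg:
  assumes U: "openin (zariski C) U" and F: "F \<in> reg P (over U)" and p: "p \<in> over U"
  shows "(\<lambda>z\<in>- {0}. F (act P z p)) \<in> reg Gm (- {0})"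
proof -
  have m: "fmorphism circle P (\<lambda>z. act P z p)"
    using fmorphism_comp[OF fmorphism_slice1[OF fun_space_circle P.fun_space_axioms] act_mor] p by simp
  have "z \<in> preim circle (\<lambda>z. act P z p) (over U) \<longleftrightarrow> z \<in> - {0}" for z
    using act_over[of z p U] p by (auto simp: points_circle)
  then have "preim circle (\<lambda>z. act P z p) (over U) = - {0}" by blast
  then show ?thesis using fmorphism_reg[OF m over_open[OF U] F] by (simp add: reg_circle)
qed

text \<open>Near (1, p0) the function \<open>F (act P z p)\<close> is one quotient
  \<open>A / B\<close> of sums of products. For fixed \<open>p\<close> these are linear combinations
  of the functions \<open>f i\<close> and \<open>f' i\<close> of \<open>z\<close>, whose numerators
  and denominators do not involve \<open>p\<close>; only the combining coefficients do. Hence the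
  bound on degrees is uniform.\<close>

lemma orbit_rational:
  assumes U: "nopen C U" and F: "F \<in> reg P (over U)"
  obtains V N where "nopen P V" "V \<subseteq> over U"
    "\<And>p. p \<in> V \<Longrightarrow> \<exists>a b S. b \<noteq> 0 \<and> degree b \<le> N \<and> degree a \<le> N \<and> openin (zariski Gm) S \<and> 1 \<in> S \<and>
        (\<forall>z\<in>S. poly b z * F (act P z p) = poly a z)"
proof -
  note oW = over_open[OF nopenD(1)[OF U]]
  let ?X = "prod_space circle P"
  let ?A = "\<lambda>(z, p). act P z p"
  have pX: "points ?X = (- {0}) \<times> points P"
    unfolding points_prod_space[OF fun_space_circle P.fun_space_axioms] points_circle ..
  let ?H = "\<lambda>q\<in>preim ?X ?A (over U). F (?A q)"
  have H: "?H \<in> reg ?X (preim ?X ?A (over U))" using fmorphism_reg[OF act_mor oW F] .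
  obtain p0 where p0: "p0 \<in> over U" using over_nopen[OF U] unfolding nopen_def by blast
  have "(1, p0) \<in> preim ?X ?A (over U)" using p0 act_one[of p0] by (simp add: pX)
  then obtain D h T where T: "(D, h) \<in> prod_gens circle P" "openin (zariski ?X) T" "(1, p0) \<in> T"
    "T \<subseteq> preim ?X ?A (over U) \<inter> D" "\<forall>q\<in>T. ?H q = h q"
    using H unfolding prod_space_eq reg_generated by meson
  obtain U' V' A B where D: "D = {q \<in> U' \<times> V'. B q \<noteq> 0}" "h = (\<lambda>q. A q / B q)"
    "openin (zariski circle) U'" "openin (zariski P) V'" "A \<in> bilin circle P U' V'" "B \<in> bilin circle P U' V'"
    using T(1) by (rule prod_gensE)
  have U'Gm: "openin (zariski Gm) U'" using D(3) by (simp add: zariski_circle)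
  have q0: "(1, p0) \<in> D" using T by blast
  then have one: "1 \<in> U'" by (simp add: D(1))
  obtain k f g where A: "\<And>i. i < k \<Longrightarrow> f i \<in> reg Gm U'" "A = (\<lambda>(x, y). \<Sum>i<(k::nat). f i x * g i y)"
    using D(5) unfolding bilin_def reg_circle by blast
  obtain l f' g' where B: "\<And>i. i < l \<Longrightarrow> f' i \<in> reg Gm U'" "B = (\<lambda>(x, y). \<Sum>i<(l::nat). f' i x * g' i y)"
    using D(6) unfolding bilin_def reg_circle by blast
  have "\<exists>q p S. openin (zariski Gm) S \<and> 1 \<in> S \<and> S \<subseteq> U' \<and>
    (\<forall>z\<in>S. poly q z \<noteq> 0 \<and> (\<forall>i<k. f i z = poly (p i) z / poly q z))"
    by (rule common_denominator[OF U'Gm one A(1)])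
  then obtain q a S where S: "openin (zariski Gm) S" "1 \<in> S" "\<And>z. z \<in> S \<Longrightarrow> poly q z \<noteq> 0"
    "\<And>z i. z \<in> S \<Longrightarrow> i < k \<Longrightarrow> f i z = poly (a i) z / poly q z" by blast
  have "\<exists>q p S. openin (zariski Gm) S \<and> 1 \<in> S \<and> S \<subseteq> U' \<and>
    (\<forall>z\<in>S. poly q z \<noteq> 0 \<and> (\<forall>i<l. f' i z = poly (p i) z / poly q z))"
    by (rule common_denominator[OF U'Gm one B(1)])
  then obtain q' b S' where S': "openin (zariski Gm) S'" "1 \<in> S'" "\<And>z. z \<in> S' \<Longrightarrow> poly q' z \<noteq> 0"
    "\<And>z i. z \<in> S' \<Longrightarrow> i < l \<Longrightarrow> f' i z = poly (b i) z / poly q' z" by blast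
  \<comment> \<open>The numerator of the final fraction is a combination of the \<open>a i\<close>
    times \<open>q'\<close>, its denominator a combination of the \<open>b i\<close> times
    \<open>q\<close>. Sums of degrees dominate the degrees of all such combinations, whatever the
    coefficients.\<close>
  define N where "N = (\<Sum>i<k. degree (a i)) + degree q' + ((\<Sum>i<l. degree (b i)) + degree q)"
  have dsum: "degree (\<Sum>i<n. smult (x i) (r i)) \<le> (\<Sum>i<n. degree (r i))" for n and x :: "nat \<Rightarrow> complex" and r
  proof (rule degree_sum_le)
    fix i assume "i \<in> {..<n}"
    then have "degree (r i) \<le> (\<Sum>i<n. degree (r i))" by (intro member_le_sum) auto
    then show "degree (smult (x i) (r i)) \<le> (\<Sum>i<n. degree (r i))"
      using degree_smult_le[of "x i" "r i"] by linarith
  qed simp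
  \<comment> \<open>The slice of \<open>T\<close> at the neutral element: for \<open>p\<close> in
    it, the quotient describes the orbit function on a neighbourhood of 1 in the group.\<close>
  define V where "V = preim P (\<lambda>p. (1, p)) T"
  have onec: "(1::complex) \<in> points circle" by (simp add: points_circle)
  have oV: "openin (zariski P) V"
    unfolding V_def by (rule fmorphism_open[OF fmorphism_slice2[OF fun_space_circle P.fun_space_axioms onec] T(2)])
  have "p0 \<in> V" using T(3) p0 by (simp add: V_def)
  then have V: "nopen P V" using P.nopenI[OF oV] by blast
  have VU: "V \<subseteq> over U"
  proof
    fix p assume "p \<in> V"
    then have p: "p \<in> points P" "(1, p) \<in> T" by (simp_all add: V_def)
    then have "?A (1, p) \<in> over U" using T(4) by auto
    then show "p \<in> over U" using act_one[OF p(1)] by simp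
  qed
  have "\<exists>a b S. b \<noteq> 0 \<and> degree b \<le> N \<and> degree a \<le> N \<and> openin (zariski Gm) S \<and> 1 \<in> S \<and>
        (\<forall>z\<in>S. poly b z * F (act P z p) = poly a z)" if pV: "p \<in> V" for p
  proof -
    have p: "p \<in> points P" "(1, p) \<in> T" using pV by (simp_all add: V_def)
    let ?a = "\<Sum>i<k. smult (g i p) (a i)" and ?b = "\<Sum>i<l. smult (g' i p) (b i)"
    let ?S = "preim circle (\<lambda>z. (z, p)) T \<inter> S \<inter> S'"
    have "openin (zariski circle) (preim circle (\<lambda>z. (z, p)) T)"
      by (rule fmorphism_open[OF fmorphism_slice1[OF fun_space_circle P.fun_space_axioms p(1)] T(2)])
    then have oS: "openin (zariski Gm) ?S" using S(1) S'(1) by (auto simp: zariski_circle)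
    have 1: "1 \<in> ?S" using p S(2) S'(2) by (simp add: points_circle)
    have Aq: "A (z, p) = poly ?a z / poly q z" if "z \<in> S" for z
      unfolding A(2) using S(4)[OF that] by (simp add: poly_sum sum_divide_distrib mult.commute)
    have Bq: "B (z, p) = poly ?b z / poly q' z" if "z \<in> S'" for z
      unfolding B(2) using S'(4)[OF that] by (simp add: poly_sum sum_divide_distrib mult.commute)
    have B0: "B (z, p) \<noteq> 0" if "z \<in> ?S" for z using that T(4) D(1) by auto
    have main: "poly (?b * q) z * F (act P z p) = poly (?a * q') z" if z: "z \<in> ?S" for z
    proof -
      have zT: "(z, p) \<in> T" using z by simp
      have "(z, p) \<in> preim ?X ?A (over U)" using zT T(4) by blast
      then have "?H (z, p) = F (act P z p)" by (simp del: preim_iff)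
      moreover have "?H (z, p) = A (z, p) / B (z, p)" using T(5) zT unfolding D(2) by blast
      ultimately have "F (act P z p) = A (z, p) / B (z, p)" by simp
      moreover have "poly ?a z = A (z, p) * poly q z" using Aq[of z] S(3)[of z] z by simp
      moreover have "poly ?b z = B (z, p) * poly q' z" using Bq[of z] S'(3)[of z] z by simp
      ultimately show ?thesis unfolding poly_mult using B0[OF z] by (simp del: preim_iff)
    qed
    have "poly ?b 1 \<noteq> 0" "poly q 1 \<noteq> 0" using B0[OF 1] Bq[OF S'(2)] S(3)[OF S(2)] by auto
    then have "poly (?b * q) 1 \<noteq> 0" by simp
    then have bq0: "?b * q \<noteq> 0" by fastforce
    have "degree (?b * q) \<le> N" "degree (?a * q') \<le> N"
      using degree_mult_le[of ?b q] degree_mult_le[of ?a q'] dsum[where n=l and x="\<lambda>i. g' i p" and r=b]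
        dsum[where n=k and x="\<lambda>i. g i p" and r=a] unfolding N_def by linarith+
    then show ?thesis using bq0 oS 1 main by blast
  qed
  then show thesis using that[OF V VU] by blast
qed

lemma weight_decomposition:
  assumes U: "nopen C U" and F: "F \<in> reg P (over U)"
  obtains N Fm where "\<And>m. wt m U (Fm m)"
    "\<And>p. p \<in> over U \<Longrightarrow> F p = (\<Sum>m\<in>{- int N..int N}. Fm m p)"
proof -
  note oU = nopenD(1)[OF U] and oW = over_open[OF nopenD(1)[OF U]]
  obtain V N where V: "nopen P V" "V \<subseteq> over U"
    and rat: "\<And>p. p \<in> V \<Longrightarrow> \<exists>a b S. b \<noteq> 0 \<and> degree b \<le> N \<and> degree a \<le> N \<and> openin (zariski Gm) S \<and> 1 \<in> S \<and>
        (\<forall>z\<in>S. poly b z * F (act P z p) = poly a z)"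
    using orbit_rational[OF U F] by metis
  let ?I = "{- int N..int N}"
  let ?w = "cis (2 * pi / real (2 * N + 1))"
  \<comment> \<open>Defined and regular on all of \<open>over U\<close>, including points where the
    orbit function is not yet known to have its exponents in \<open>?I\<close>.\<close>
  define Fm where "Fm = (\<lambda>m. \<lambda>p\<in>over U. if m \<in> ?I then dft N m (\<lambda>z. F (act P z p)) else 0)"
  have w0: "?w ^ j \<noteq> 0" for j by simp
  have reg: "Fm m \<in> reg P (over U)" for m
  proof (cases "m \<in> ?I")
    case True
    have "(\<lambda>p\<in>over U. \<Sum>j<2 * N + 1. (\<lambda>p\<in>over U. (inverse (of_nat (2 * N + 1)) * (?w ^ j) powi (- m)) *
       (\<lambda>p\<in>over U. F (act P (?w ^ j) p)) p) p) \<in> reg P (over U)"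
      by (rule P.reg_sum[OF oW]) (simp_all only: finite_lessThan restrict_apply' cong: restrict_cong,
          rule P.reg_cong[OF oW P.reg_cmult[OF oW translate_reg[OF w0 oU F]]], simp)
    then show ?thesis unfolding Fm_def
      by (rule P.reg_cong[OF oW]) (use True in \<open>simp add: dft_def\<close>)
  next
    case False
    then have "Fm m = (\<lambda>p\<in>over U. 0)" unfolding Fm_def by (intro restrict_ext) auto
    then show ?thesis using P.reg_const[OF oW, of 0] by simp
  qed
  have expV: "F (act P z p) = (\<Sum>m\<in>?I. Fm m p * z powi m)" if p: "p \<in> V" and z: "z \<noteq> 0" for p z
  proof -
    have pU: "p \<in> over U" using V p by blast
    obtain a b S where "b \<noteq> 0" "degree b \<le> N" "degree a \<le> N" "openin (zariski Gm) S" "1 \<in> S"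
       "\<And>z. z \<in> S \<Longrightarrow> poly b z * F (act P z p) = poly a z" using rat[OF p] by blast
    from reg_Gm_laurent[OF orbit_reg[OF oU F pU] this] obtain c
      where c: "\<And>z. z \<noteq> 0 \<Longrightarrow> F (act P z p) = (\<Sum>m\<in>?I. c m * z powi m)" by blast
    have "Fm m p = c m" if "m \<in> ?I" for m
      using dft_laurent[where f = "\<lambda>z. F (act P z p)" and N = N and c = c and m = m, OF c that] that pU by (simp add: Fm_def del: preim_iff)
    then show ?thesis using c[OF z] by simp
  qed
  \<comment> \<open>For fixed \<open>z\<close> both sides are regular in \<open>p\<close> on
    \<open>over U\<close>, the right one being built from translates of \<open>F\<close>. So
    agreement on the open set \<open>V\<close> is enough.\<close>
  have expW: "F (act P z p) = (\<Sum>m\<in>?I. Fm m p * z powi m)" if p: "p \<in> over U" and z: "z \<noteq> 0" for p z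
  proof -
    have r: "(\<lambda>p\<in>over U. \<Sum>m\<in>?I. (\<lambda>p\<in>over U. z powi m * Fm m p) p) \<in> reg P (over U)"
      by (rule P.reg_sum[OF oW]) (simp, simp only: restrict_restrict Int_absorb, rule P.reg_cmult[OF oW reg])
    have "(\<lambda>p\<in>over U. F (act P z p)) p = (\<lambda>p\<in>over U. \<Sum>m\<in>?I. (\<lambda>p\<in>over U. z powi m * Fm m p) p) p"
    proof (rule P.reg_eq_dense[OF oW translate_reg[OF z oU F] r V _ p])
      fix y assume y: "y \<in> V"
      then have "y \<in> over U" using V by blast
      then show "(\<lambda>p\<in>over U. F (act P z p)) y = (\<lambda>p\<in>over U. \<Sum>m\<in>?I. (\<lambda>p\<in>over U. z powi m * Fm m p) p) y"
        using expV[OF y z] by (simp del: preim_iff add: mult.commute)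
    qed
    then show ?thesis using p by (simp del: preim_iff add: mult.commute)
  qed
  have "wt m U (Fm m)" for m
    unfolding wt_def semi_invariant_def points_circle
  proof (intro conjI ballI reg)
    fix t p assume t: "t \<in> - {0 :: complex}" and p: "p \<in> over U"
    then have t0: "t \<noteq> 0" by simp
    have tp: "act P t p \<in> over U" using act_over[OF t0 p] .
    show "Fm m (act P t p) = t powi m * Fm m p"
    proof (cases "m \<in> ?I")
      case True
      \<comment> \<open>Translating by \<open>z * t\<close> and expanding at \<open>p\<close> gives
        the expansion at \<open>act P t p\<close>, with coefficients scaled by powers of
        \<open>t\<close>. The transform recovers them, which is the weight property.\<close>
      have "F (act P z (act P t p)) = (\<Sum>m\<in>?I. (t powi m * Fm m p) * z powi m)" if z: "z \<noteq> 0" for z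
      proof -
        have "F (act P z (act P t p)) = F (act P (z * t) p)" using act_act[OF z t0] p by simp
        also have "\<dots> = (\<Sum>m\<in>?I. Fm m p * (z * t) powi m)" using expW[OF p, of "z * t"] z t0 by simp
        finally show ?thesis by (simp add: power_int_mult_distrib mult_ac)
      qed
      from dft_laurent[where f = "\<lambda>z. F (act P z (act P t p))" and N = N and c = "\<lambda>m. t powi m * Fm m p" and m = m, OF this True]
      show ?thesis using True tp by (simp add: Fm_def del: preim_iff)
    next
      case False
      then have "Fm m q = 0" if "q \<in> over U" for q using that unfolding Fm_def by (simp only: restrict_apply' if_False)
      then show ?thesis using tp p by (simp del: preim_iff)
    qed
  qed
  moreover have "F p = (\<Sum>m\<in>?I. Fm m p)" if p: "p \<in> over U" for p
    using expW[OF p, of 1] act_one[of p] p by simp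
  ultimately show thesis using that by blast
qed

end

context torsor_space
begin

section \<open>The pair of a torsor\<close>

definition frame :: "'a set \<Rightarrow> ('b \<Rightarrow> complex) \<Rightarrow> bool" where
  "frame U u \<longleftrightarrow> nopen C U \<and> wt 1 U u \<and> (\<forall>p\<in>over U. u p \<noteq> 0)"

lemma frameD:
  assumes "frame U u"
  shows "nopen C U" "u \<in> reg P (over U)" "p \<in> over U \<Longrightarrow> u p \<noteq> 0"
    "z \<noteq> 0 \<Longrightarrow> p \<in> over U \<Longrightarrow> u (act P z p) = z * u p"
  using assms wtD[of 1 U u] by (simp_all add: frame_def)

lemma frame_exists:
  assumes "c \<in> points C"
  shows "\<exists>x. frame (fst x) (snd x) \<and> c \<in> fst x"
proof -
  obtain U u where U: "openin (zariski C) U" "c \<in> U" "u \<in> reg P (over U)"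
    "\<And>p. p \<in> over U \<Longrightarrow> u p \<noteq> 0" "\<And>z p. z \<noteq> 0 \<Longrightarrow> p \<in> over U \<Longrightarrow> u (act P z p) = z * u p"
    by (rule trivialization[OF assms]) blast
  have "frame U u" unfolding frame_def wt_def semi_invariant_def points_circle
    using U nopenI[OF U(1,2)] by simp
  then show ?thesis using U(2) by (intro exI[of _ "(U, u)"]) simp
qed

definition chart :: "'a \<Rightarrow> 'a set \<times> ('b \<Rightarrow> complex)" where
  "chart c = (SOME x. frame (fst x) (snd x) \<and> c \<in> fst x)"

abbreviation cdom where "cdom c \<equiv> fst (chart c)"
abbreviation coord where "coord c \<equiv> snd (chart c)"

lemma chart: "c \<in> points C \<Longrightarrow> frame (cdom c) (coord c)" "c \<in> points C \<Longrightarrow> c \<in> cdom c"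
  using someI_ex[OF frame_exists[of c]] unfolding chart_def by auto

text \<open>Any point will do: its chart provides the reference trivialization \<open>u0\<close>,
  and thereby the embedding of \<open>L\<close> into the function field.\<close>

definition origin :: 'a where "origin = (SOME c. c \<in> points C)"

lemma origin: "origin \<in> points C"
  unfolding origin_def using nopen_points unfolding nopen_def by (meson equals0I someI_ex)

abbreviation U0 where "U0 \<equiv> cdom origin"
abbreviation u0 where "u0 \<equiv> coord origin"

lemma frame0: "frame U0 u0"
  using chart origin by blast

lemma over_mono: "U \<subseteq> V \<Longrightarrow> over U \<subseteq> over V"
  by auto

text \<open>The product of \<open>F\<close> with the power -m of \<open>u\<close> has weight 0 and
  descends to the base.\<close>

lemma wt_coeff:
  assumes V: "nopen C V" and F: "wt m V F" and u: "frame U u"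
  shows "\<exists>k. k \<in> carrier K \<and> (\<forall>p\<in>over (V \<inter> U). k \<in> stalk (base P p) \<and> F p = ev (base P p) k * u p powi m)"
proof -
  let ?X = "V \<inter> U"
  have X: "nopen C ?X" using nopen_Int[OF V frameD(1)[OF u]] .
  note oX = over_open[OF nopenD(1)[OF X]]
  have FX: "restrict F (over ?X) \<in> reg P (over ?X)"
    using P.reg_restrict[OF over_open[OF nopenD(1)[OF V]] oX over_mono[OF Int_lower1] wtD(1)[OF F]] .
  have uX: "restrict u (over ?X) \<in> reg P (over ?X)"
    using P.reg_restrict[OF over_open[OF nopenD(1)[OF frameD(1)[OF u]]] oX over_mono[OF Int_lower2] frameD(2)[OF u]] .
  have u0: "restrict u (over ?X) p \<noteq> 0" if "p \<in> over ?X" for p using that frameD(3)[OF u, of p] by simp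
  define H where "H = (\<lambda>p\<in>over ?X. restrict F (over ?X) p * (\<lambda>p\<in>over ?X. restrict u (over ?X) p powi (- m)) p)"
  have r: "H \<in> reg P (over ?X)" unfolding H_def by (rule P.reg_mult[OF oX FX P.reg_powi[OF oX uX u0]])
  have Fe: "H p = F p * u p powi (- m)" if "p \<in> over ?X" for p using that by (simp add: H_def)
  have inv: "H (act P z p) = H p" if z: "z \<noteq> 0" and p: "p \<in> over ?X" for z p
  proof -
    have pp: "p \<in> over V" "p \<in> over U" using p by auto
    show ?thesis
      unfolding Fe[OF p] Fe[OF act_over[OF z p]] wtD(2)[OF F z pp(1)] frameD(4)[OF u z pp(2)]
      using z by (simp add: power_int_mult_distrib power_int_minus)
  qed
  obtain f where f: "f \<in> reg C ?X" "\<And>p. p \<in> over ?X \<Longrightarrow> H p = f (base P p)"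
    using descent[OF nopenD(1)[OF X] r inv] by metis
  have "germ C ?X f \<in> stalk (base P p) \<and> F p = ev (base P p) (germ C ?X f) * u p powi m" if p: "p \<in> over ?X" for p
  proof -
    have b: "base P p \<in> ?X" using p by simp
    have "ev (base P p) (germ C ?X f) = F p * u p powi (- m)"
      using ev_germ[OF X f(1) b] f(2)[OF p] Fe[OF p] by simp
    then show ?thesis using stalk_germ[OF X f(1) b] frameD(3)[OF u, of p] p by (simp add: power_int_minus)
  qed
  then show ?thesis using germ_carrier[OF X f(1)] by blast
qed

text \<open>The quotient of \<open>coord c\<close> by \<open>u0\<close>, as a rational function on
  the base; it generates the line bundle at \<open>c\<close>.\<close>

definition cocycle :: "'a \<Rightarrow> 'a ratfun" where
  "cocycle c = (SOME k. k \<in> carrier K \<and> (\<forall>p\<in>over (cdom c \<inter> U0). k \<in> stalk (base P p) \<and> coord c p = ev (base P p) k * u0 p powi 1))"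

lemma cocycle:
  assumes c: "c \<in> points C"
  shows "p \<in> over (cdom c \<inter> U0) \<Longrightarrow> coord c p = ev (base P p) (cocycle c) * u0 p"
    "d \<in> cdom c \<inter> U0 \<Longrightarrow> cocycle c \<in> unit_stalk d"
    "cocycle c \<in> Ks"
proof -
  note fr = chart(1)[OF c]
  have "wt 1 (cdom c) (coord c)" using fr by (simp add: frame_def)
  note ex = wt_coeff[OF frameD(1)[OF fr] this frame0]
  have k: "\<forall>p\<in>over (cdom c \<inter> U0). cocycle c \<in> stalk (base P p) \<and> coord c p = ev (base P p) (cocycle c) * u0 p"
    using someI_ex[OF ex] unfolding cocycle_def[symmetric] by simp
  then show "p \<in> over (cdom c \<inter> U0) \<Longrightarrow> coord c p = ev (base P p) (cocycle c) * u0 p" by blast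
  have n: "nopen C (cdom c \<inter> U0)" using nopen_Int[OF frameD(1)[OF fr] frameD(1)[OF frame0]] .
  show u: "cocycle c \<in> unit_stalk d" if d: "d \<in> cdom c \<inter> U0" for d
  proof -
    have "d \<in> points C" using nopenD(2)[OF n] d by blast
    then obtain p where p: "p \<in> points P" "base P p = d" using over_nonempty by metis
    then have "p \<in> over (cdom c \<inter> U0)" using d by simp
    then show ?thesis using k frameD(3)[OF fr, of p] p d by (auto simp: unit_stalk_def)
  qed
  obtain d where "d \<in> cdom c \<inter> U0" using n unfolding nopen_def by blast
  from u[OF this] show "cocycle c \<in> Ks" using unit_stalkD(3,4) by blast
qed

text \<open>Coefficients with respect to \<open>u0\<close> and to \<open>coord c\<close> differ by
  the m-th power of the quotient of these charts. The comparison is made on a triple overlap and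
  holds everywhere by density; it shows that the coefficient \<open>k\<close> belongs to the m-th
  power of \<open>L\<close> at every point where \<open>F\<close> is defined.\<close>

lemma coeff_change:
  assumes V: "nopen C V" and F: "wt m V F" and k: "k \<in> carrier K"
    "\<And>p. p \<in> over (V \<inter> U0) \<Longrightarrow> F p = ev (base P p) k * u0 p powi m"
    and c: "c \<in> points C" and p: "p \<in> over (V \<inter> cdom c)"
  shows "k \<oslash> cocycle c [^]\<^bsub>K\<^esub> m \<in> stalk (base P p)"
    "F p = ev (base P p) (k \<oslash> cocycle c [^]\<^bsub>K\<^esub> m) * coord c p powi m"
proof -
  note fr = chart(1)[OF c]
  note gc = cocycle(3)[OF c]
  obtain l where l: "l \<in> carrier K" "\<And>p. p \<in> over (V \<inter> cdom c) \<Longrightarrow> l \<in> stalk (base P p) \<and> F p = ev (base P p) l * coord c p powi m"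
    using wt_coeff[OF V F fr] by blast
  let ?W = "V \<inter> cdom c \<inter> U0"
  have W: "nopen C ?W" using nopen_Int[OF nopen_Int[OF V frameD(1)[OF fr]] frameD(1)[OF frame0]] .
  have "k = l \<otimes>\<^bsub>K\<^esub> cocycle c [^]\<^bsub>K\<^esub> m"
  proof (rule ev_eqI[OF k(1) _ W])
    show "l \<otimes>\<^bsub>K\<^esub> cocycle c [^]\<^bsub>K\<^esub> m \<in> carrier K" using l(1) Ks_pow[OF gc, of m] by simp
    fix d assume d: "d \<in> ?W"
    have "d \<in> points C" using nopenD(2)[OF W] d by blast
    then obtain q where q: "q \<in> points P" "base P q = d" using over_nonempty by metis
    have in1: "q \<in> over (V \<inter> U0)" "q \<in> over (V \<inter> cdom c)" "q \<in> over (cdom c \<inter> U0)" "q \<in> over U0" using q d by simp_all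
    have u: "cocycle c \<in> unit_stalk d" using cocycle(2)[OF c] d by blast
    have ls: "l \<in> stalk d" and Fl: "F q = ev d l * coord c q powi m" using l(2)[OF in1(2)] q by auto
    have "ev d (l \<otimes>\<^bsub>K\<^esub> cocycle c [^]\<^bsub>K\<^esub> m) = ev d l * ev d (cocycle c) powi m"
      using stalk_mult(2)[OF ls unit_stalkD(1)[OF unit_stalk_pow(1)[OF u]]] unit_stalk_pow(2)[OF u] by simp
    moreover have "ev d k * u0 q powi m = ev d l * ev d (cocycle c) powi m * u0 q powi m"
      using k(2)[OF in1(1)] Fl cocycle(1)[OF c in1(3)] q by (auto simp: power_int_mult_distrib)
    ultimately show "ev d k = ev d (l \<otimes>\<^bsub>K\<^esub> cocycle c [^]\<^bsub>K\<^esub> m)"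
      using frameD(3)[OF frame0 in1(4)] by simp
  qed
  then have "k \<oslash> cocycle c [^]\<^bsub>K\<^esub> m = l" using quot_cancel(2)[OF l(1) Ks_pow[OF gc]] by simp
  then show "k \<oslash> cocycle c [^]\<^bsub>K\<^esub> m \<in> stalk (base P p)"
    "F p = ev (base P p) (k \<oslash> cocycle c [^]\<^bsub>K\<^esub> m) * coord c p powi m" using l(2)[OF p] by simp_all
qed

text \<open>The chart \<open>coord d\<close> is itself a function of weight 1 with coefficient
  \<open>cocycle d\<close>, so this is the change of coefficients in degree 1.\<close>

lemma cocycle_quot:
  assumes c: "c \<in> points C" and d: "d \<in> points C" "d \<in> cdom c"
  shows "cocycle d \<oslash> cocycle c \<in> unit_stalk d"
    "p \<in> points P \<Longrightarrow> base P p = d \<Longrightarrow> coord d p = ev d (cocycle d \<oslash> cocycle c) * coord c p"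
proof -
  note fr = chart(1)[OF d(1)]
  have w: "wt 1 (cdom d) (coord d)" using fr by (simp add: frame_def)
  have k: "cocycle d \<in> carrier K" using cocycle(3)[OF d(1)] by simp
  have e: "cocycle d \<oslash> cocycle c [^]\<^bsub>K\<^esub> (1::int) = cocycle d \<oslash> cocycle c"
    using Ks_pow_1[of "cocycle c"] cocycle(3)[OF c] by simp
  have main: "cocycle d \<oslash> cocycle c \<in> stalk d \<and> coord d p = ev d (cocycle d \<oslash> cocycle c) * coord c p"
    if p: "p \<in> points P" "base P p = d" for p
  proof -
    have pin: "p \<in> over (cdom d \<inter> cdom c)" using p d chart(2)[OF d(1)] by simp
    show ?thesis
      using coeff_change[OF frameD(1)[OF fr] w k _ c pin] cocycle(1)[OF d(1)] p unfolding e by simp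
  qed
  then show "p \<in> points P \<Longrightarrow> base P p = d \<Longrightarrow> coord d p = ev d (cocycle d \<oslash> cocycle c) * coord c p" by blast
  obtain p where p: "p \<in> points P" "base P p = d" using over_nonempty[OF d(1)] by metis
  have "coord d p \<noteq> 0" using frameD(3)[OF fr, of p] p chart(2)[OF d(1)] by simp
  then show "cocycle d \<oslash> cocycle c \<in> unit_stalk d" using main[OF p] by (auto simp: unit_stalk_def)
qed

lemma divisor_cocycle: "divisor cocycle"
  unfolding divisor_def
proof (intro ballI conjI)
  fix c assume c: "c \<in> points C"
  show "cocycle c \<in> Ks" using cocycle(3)[OF c] .
  have o: "openin (zariski C) (cdom c)" using nopenD(1)[OF frameD(1)[OF chart(1)[OF c]]] .
  have "cocycle d \<oslash> cocycle c \<in> unit_stalk d" if "d \<in> cdom c" for d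
    using cocycle_quot(1)[OF c _ that] openin_subset[OF o] that by blast
  then show "\<exists>V. openin (zariski C) V \<and> c \<in> V \<and> (\<forall>d\<in>V. cocycle d \<oslash> cocycle c \<in> unit_stalk d)"
    using o chart(2)[OF c] by blast
qed

lemma represents_cocycle: "represents cocycle (sections cocycle)"
  by (simp add: represents_def divisor_cocycle)

text \<open>The real structure turns the action of \<open>z\<close> into that of
  \<open>1 / cnj z\<close>, so the conjugate of a function of weight 1 has weight -1. Its product
  with \<open>u\<close> is invariant and descends to a unit.\<close>

lemma conj_pairing:
  assumes u: "frame U u" and v: "frame V v"
  defines "X \<equiv> U \<inter> preim C (rconj C) V"
  shows "nopen C X" "\<exists>k. k \<in> carrier K \<and> (\<forall>d\<in>X. k \<in> unit_stalk d) \<and>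
    (\<forall>p\<in>over X. ev (base P p) k = u p * cnj (v (rconj P p)))"
proof -
  have X: "nopen C X" unfolding X_def using nopen_Int[OF frameD(1)[OF u] conj_nopen[OF frameD(1)[OF v]]] .
  then show "nopen C X" .
  note oX = over_open[OF nopenD(1)[OF X]]
  let ?V = "preim C (rconj C) V"
  have ov: "preim P (rconj P) (over V) = over ?V"
    using base_conj base_points P.conj_points by auto
  have vr: "(\<lambda>p\<in>over ?V. cnj (v (rconj P p))) \<in> reg P (over ?V)"
    using P.conj_reg[OF over_open[OF nopenD(1)[OF frameD(1)[OF v]]] frameD(2)[OF v]] unfolding ov .
  have oV: "openin (zariski P) (over ?V)" using over_open[OF conj_open[OF nopenD(1)[OF frameD(1)[OF v]]]] .
  have s: "over X \<subseteq> over U" "over X \<subseteq> over ?V" unfolding X_def by auto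
  define H where "H = (\<lambda>p\<in>over X. restrict u (over X) p * restrict (\<lambda>p\<in>over ?V. cnj (v (rconj P p))) (over X) p)"
  have r: "H \<in> reg P (over X)"
    unfolding H_def using P.reg_mult[OF oX P.reg_restrict[OF over_open[OF nopenD(1)[OF frameD(1)[OF u]]] oX s(1) frameD(2)[OF u]]
      P.reg_restrict[OF oV oX s(2) vr]] .
  have Fe: "H p = u p * cnj (v (rconj P p))" if "p \<in> over X" for p
    using that subsetD[OF s(2) that] by (simp add: H_def del: preim_iff)
  have cV: "rconj P p \<in> over V" if "p \<in> over X" for p
    using that P.conj_points base_conj by (simp add: X_def)
  have inv: "H (act P z p) = H p" if z: "z \<noteq> 0" and p: "p \<in> over X" for z p
  proof -
    have pU: "p \<in> over U" using s p by blast
    have z': "1 / cnj z \<noteq> 0" using z by simp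
    have "rconj P (act P z p) = act P (1 / cnj z) (rconj P p)" using act_conj[OF z] p by simp
    then show ?thesis
      unfolding Fe[OF p] Fe[OF act_over[OF z p]] frameD(4)[OF u z pU] using frameD(4)[OF v z' cV[OF p]] z by simp
  qed
  obtain f where f: "f \<in> reg C X" "\<And>p. p \<in> over X \<Longrightarrow> H p = f (base P p)"
    using descent[OF nopenD(1)[OF X] r inv] by metis
  have val: "ev (base P p) (germ C X f) = u p * cnj (v (rconj P p))" if p: "p \<in> over X" for p
    using ev_germ[OF X f(1), of "base P p"] f(2)[OF p] Fe[OF p] p by simp
  have "germ C X f \<in> unit_stalk d" if d: "d \<in> X" for d
  proof -
    have "d \<in> points C" using nopenD(2)[OF X] d by blast
    then obtain p where p: "p \<in> points P" "base P p = d" using over_nonempty by metis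
    have pX: "p \<in> over X" using p d by simp
    have "ev d (germ C X f) \<noteq> 0"
      using val[OF pX] frameD(3)[OF u subsetD[OF s(1) pX]] frameD(3)[OF v cV[OF pX]] p by simp
    then show ?thesis using stalk_germ[OF X f(1) d] by (simp add: unit_stalk_def)
  qed
  then show "\<exists>k. k \<in> carrier K \<and> (\<forall>d\<in>X. k \<in> unit_stalk d) \<and>
    (\<forall>p\<in>over X. ev (base P p) k = u p * cnj (v (rconj P p)))"
    using germ_carrier[OF X f(1)] val by blast
qed

definition norm0 :: "'a ratfun" where
  "norm0 = (SOME k. k \<in> carrier K \<and> (\<forall>d\<in>U0 \<inter> preim C (rconj C) U0. k \<in> unit_stalk d) \<and>
    (\<forall>p\<in>over (U0 \<inter> preim C (rconj C) U0). ev (base P p) k = u0 p * cnj (u0 (rconj P p))))"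

text \<open>Multiplying \<open>norm0\<close> by \<open>cocycle c\<close> and by the conjugate of the
  generator at the conjugate point replaces both factors \<open>u0\<close> by charts around these
  points. The product is then defined and nonzero at \<open>c\<close> itself, although
  \<open>norm0\<close> need not be. Reality follows by evaluating \<open>norm0\<close> at
  \<open>p\<close> and at its conjugate.\<close>

lemma real_pair_cocycle: "real_pair cocycle norm0"
proof -
  let ?X = "U0 \<inter> preim C (rconj C) U0"
  note X = conj_pairing(1)[OF frame0 frame0]
  have h: "norm0 \<in> carrier K" "\<And>d. d \<in> ?X \<Longrightarrow> norm0 \<in> unit_stalk d"
    "\<And>p. p \<in> over ?X \<Longrightarrow> ev (base P p) norm0 = u0 p * cnj (u0 (rconj P p))"
    using someI_ex[OF conj_pairing(2)[OF frame0 frame0]] unfolding norm0_def[symmetric] by blast+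
  obtain d where "d \<in> ?X" using X unfolding nopen_def by blast
  then have hK: "norm0 \<in> Ks" using unit_stalkD(3,4)[OF h(2)] by blast
  have hc: "rat_conj C norm0 = norm0"
  proof (rule ev_eqI[OF _ h(1) X])
    show "rat_conj C norm0 \<in> carrier K" using h(1) by simp
    fix d assume d: "d \<in> ?X"
    have dp: "d \<in> points C" using nopenD(2)[OF X] d by blast
    have d': "rconj C d \<in> ?X" using d dp conj_conj[OF dp] conj_points[OF dp] by simp
    obtain p where p: "p \<in> points P" "base P p = d" using over_nonempty[OF dp] by metis
    have pX: "p \<in> over ?X" using p d by simp
    have p': "rconj P p \<in> over ?X" using P.conj_points[OF p(1)] base_conj[OF p(1)] p d' by simp
    have "ev d (rat_conj C norm0) = cnj (ev (rconj C d) norm0)"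
      using rat_conj_stalk(2)[OF dp unit_stalkD(1)[OF h(2)[OF d']]] .
    also have "ev (rconj C d) norm0 = u0 (rconj P p) * cnj (u0 p)"
      using h(3)[OF p'] base_conj[OF p(1)] p P.conj_conj[OF p(1)] by simp
    also have "cnj \<dots> = ev d norm0" using h(3)[OF pX] p by simp
    finally show "ev d (rat_conj C norm0) = ev d norm0" .
  qed
  have "(cocycle c \<otimes>\<^bsub>K\<^esub> rat_conj C (cocycle (rconj C c))) \<otimes>\<^bsub>K\<^esub> norm0 \<in> unit_stalk c" if c: "c \<in> points C" for c
  proof -
    define c' where "c' = rconj C c"
    have c': "c' \<in> points C" unfolding c'_def by (rule conj_points[OF c])
    let ?Y = "cdom c \<inter> preim C (rconj C) (cdom c')"
    note Y = conj_pairing(1)[OF chart(1)[OF c] chart(1)[OF c']]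
    obtain k where k: "k \<in> carrier K" "\<And>d. d \<in> ?Y \<Longrightarrow> k \<in> unit_stalk d"
      "\<And>p. p \<in> over ?Y \<Longrightarrow> ev (base P p) k = coord c p * cnj (coord c' (rconj P p))"
      using conj_pairing(2)[OF chart(1)[OF c] chart(1)[OF c']] by blast
    have gK: "cocycle c \<in> Ks" "rat_conj C (cocycle c') \<in> Ks" using cocycle(3)[OF c] rat_conj_Ks[OF cocycle(3)[OF c']] by blast+
    have "(cocycle c \<otimes>\<^bsub>K\<^esub> rat_conj C (cocycle c')) \<otimes>\<^bsub>K\<^esub> norm0 = k"
    proof (rule ev_eqI[OF _ k(1) nopen_Int[OF X Y]])
      show "(cocycle c \<otimes>\<^bsub>K\<^esub> rat_conj C (cocycle c')) \<otimes>\<^bsub>K\<^esub> norm0 \<in> carrier K" using gK h(1) by simp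
      fix d assume d: "d \<in> ?X \<inter> ?Y"
      have dp: "d \<in> points C" using nopenD(2)[OF X] d by blast
      obtain p where p: "p \<in> points P" "base P p = d" using over_nonempty[OF dp] by metis
      have in1: "p \<in> over ?X" "p \<in> over ?Y" "p \<in> over (cdom c \<inter> U0)" using p d by simp_all
      have in2: "rconj P p \<in> over (cdom c' \<inter> U0)" using P.conj_points[OF p(1)] base_conj[OF p(1)] p d by simp
      have u: "cocycle c \<in> unit_stalk d" "cocycle c' \<in> unit_stalk (rconj C d)" using cocycle(2)[OF c] cocycle(2)[OF c'] d by simp_all
      have 1: "coord c p = ev d (cocycle c) * u0 p" using cocycle(1)[OF c in1(3)] p by simp
      have 2: "coord c' (rconj P p) = ev (rconj C d) (cocycle c') * u0 (rconj P p)"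
        using cocycle(1)[OF c' in2] base_conj[OF p(1)] p by simp
      have 3: "ev d norm0 = u0 p * cnj (u0 (rconj P p))" using h(3)[OF in1(1)] p by simp
      have 4: "ev d k = coord c p * cnj (coord c' (rconj P p))" using k(3)[OF in1(2)] p by simp
      have s: "cocycle c \<in> stalk d" "rat_conj C (cocycle c') \<in> stalk d" "norm0 \<in> stalk d"
        using unit_stalkD(1)[OF u(1)] rat_conj_stalk(1)[OF dp unit_stalkD(1)[OF u(2)]] unit_stalkD(1)[OF h(2)] d by blast+
      have "ev d ((cocycle c \<otimes>\<^bsub>K\<^esub> rat_conj C (cocycle c')) \<otimes>\<^bsub>K\<^esub> norm0) = ev d (cocycle c) * cnj (ev (rconj C d) (cocycle c')) * ev d norm0"
        using stalk_mult(2)[OF stalk_mult(1)[OF s(1,2)] s(3)] stalk_mult(2)[OF s(1,2)] rat_conj_stalk(2)[OF dp unit_stalkD(1)[OF u(2)]] by simp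
      then show "ev d ((cocycle c \<otimes>\<^bsub>K\<^esub> rat_conj C (cocycle c')) \<otimes>\<^bsub>K\<^esub> norm0) = ev d k"
        unfolding 3 4 1 2 by simp
    qed
    moreover have "c \<in> ?Y" using c chart(2)[OF c] chart(2)[OF c'] by (simp add: c'_def)
    ultimately show ?thesis using k(2) unfolding c'_def by simp
  qed
  then show ?thesis unfolding real_pair_def using divisor_cocycle hK hc by blast
qed

section \<open>The direct image of the structure sheaf\<close>

abbreviation L0 where "L0 \<equiv> sections cocycle"

text \<open>Over \<open>U0\<close> every function is a Laurent polynomial in \<open>u0\<close> with
  rational coefficients, and \<open>\<one>\<close> serves as generator there. Since
  \<open>over (U \<inter> U0)\<close> is dense, the identity determines a regular \<open>F\<close>
  on all of \<open>over U\<close>; what happens at the other points is encoded in the membership of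
  \<open>a\<close>.\<close>

definition expansion :: "'a set \<Rightarrow> ('b \<Rightarrow> complex) \<Rightarrow> (int \<Rightarrow> 'a ratfun) \<Rightarrow> bool" where
  "expansion U F a \<longleftrightarrow> a \<in> carrier (power_alg C L0 U) \<and>
     (\<forall>p\<in>over (U \<inter> U0). F p = gval (base P p) \<one>\<^bsub>K\<^esub> (u0 p) a)"

lemma one_int_pow: "\<one>\<^bsub>K\<^esub> [^]\<^bsub>K\<^esub> (m::int) = \<one>\<^bsub>K\<^esub>"
  by (cases m rule: int_cases2) (simp_all add: int_pow_int int_pow_neg_nat)

lemma quot_one_pow: "k \<in> carrier K \<Longrightarrow> k \<oslash> \<one>\<^bsub>K\<^esub> [^]\<^bsub>K\<^esub> (m::int) = k"
  by (simp add: one_int_pow)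

lemma power_alg_L0: "nopen C U \<Longrightarrow> a \<in> carrier (power_alg C L0 U) \<longleftrightarrow> (\<forall>c\<in>U. a \<in> laurent c (cocycle c))"
  by (rule power_alg_carrier[OF represents_cocycle])

text \<open>At a point \<open>c\<close> of \<open>U0\<close> the function \<open>cocycle c\<close>
  is a unit, so \<open>\<one>\<close> generates \<open>L\<close> there as well.\<close>

lemma laurent_one:
  assumes c: "c \<in> U0"
  shows "laurent c \<one>\<^bsub>K\<^esub> = laurent c (cocycle c)"
    "a \<in> laurent c \<one>\<^bsub>K\<^esub> \<Longrightarrow> gval c \<one>\<^bsub>K\<^esub> z a = gval c (cocycle c) (z * ev c (cocycle c)) a"
proof -
  have cp: "c \<in> points C" using nopenD(2)[OF frameD(1)[OF frame0]] c by blast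
  have u: "cocycle c \<in> unit_stalk c" using cocycle(2)[OF cp] chart(2)[OF cp] c by blast
  have e: "cocycle c \<oslash> \<one>\<^bsub>K\<^esub> = cocycle c" using unit_stalkD(3)[OF u] by (rule quot_one)
  show "laurent c \<one>\<^bsub>K\<^esub> = laurent c (cocycle c)"
    "a \<in> laurent c \<one>\<^bsub>K\<^esub> \<Longrightarrow> gval c \<one>\<^bsub>K\<^esub> z a = gval c (cocycle c) (z * ev c (cocycle c)) a"
    using gval_change[OF cp Ks_one cocycle(3)[OF cp], unfolded e, OF u] by blast+
qed

lemma expansionD:
  assumes U: "nopen C U" and r: "expansion U F a"
  shows "c \<in> U \<inter> U0 \<Longrightarrow> a \<in> laurent c \<one>\<^bsub>K\<^esub>" "c \<in> U \<Longrightarrow> a \<in> laurent c (cocycle c)"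
    "p \<in> over (U \<inter> U0) \<Longrightarrow> F p = gval (base P p) \<one>\<^bsub>K\<^esub> (u0 p) a"
  using r power_alg_L0[OF U] laurent_one(1) unfolding expansion_def by (blast+)

lemma over_facts:
  assumes "nopen C U" "p \<in> over (U \<inter> U0)"
  shows "base P p \<in> points C" "base P p \<in> U \<inter> U0" "u0 p \<noteq> 0" "p \<in> over U"
  using assms base_points frameD(3)[OF frame0, of p] by simp_all

lemma expansion_add:
  assumes U: "nopen C U" and F: "expansion U F a" and H: "expansion U H b"
  shows "expansion U (\<lambda>p\<in>over U. F p + H p) (gadd a b)"
  unfolding expansion_def power_alg_L0[OF U]
proof (intro conjI ballI)
  fix c assume c: "c \<in> U"
  have "c \<in> points C" using nopenD(2)[OF U] c by blast
  then show "gadd a b \<in> laurent c (cocycle c)"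
    using gadd_laurent(1)[OF _ cocycle(3) expansionD(2)[OF U F c] expansionD(2)[OF U H c]] by blast
next
  fix p assume p: "p \<in> over (U \<inter> U0)"
  note o = over_facts[OF U p]
  show "(\<lambda>p\<in>over U. F p + H p) p = gval (base P p) \<one>\<^bsub>K\<^esub> (u0 p) (gadd a b)"
    using gadd_laurent(2)[OF o(1) Ks_one expansionD(1)[OF U F o(2)] expansionD(1)[OF U H o(2)]] expansionD(3)[OF U F p] expansionD(3)[OF U H p] o(4)
    by (simp del: preim_iff)
qed

lemma expansion_mult:
  assumes U: "nopen C U" and F: "expansion U F a" and H: "expansion U H b"
  shows "expansion U (\<lambda>p\<in>over U. F p * H p) (gmult a b)"
  unfolding expansion_def power_alg_L0[OF U]
proof (intro conjI ballI)
  fix c assume c: "c \<in> U"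
  have "c \<in> points C" using nopenD(2)[OF U] c by blast
  then show "gmult a b \<in> laurent c (cocycle c)"
    using gmult_laurent(1)[OF _ cocycle(3) expansionD(2)[OF U F c] expansionD(2)[OF U H c]] by blast
next
  fix p assume p: "p \<in> over (U \<inter> U0)"
  note o = over_facts[OF U p]
  show "(\<lambda>p\<in>over U. F p * H p) p = gval (base P p) \<one>\<^bsub>K\<^esub> (u0 p) (gmult a b)"
    using gmult_laurent(2)[OF o(1) Ks_one expansionD(1)[OF U F o(2)] expansionD(1)[OF U H o(2)] o(3)] expansionD(3)[OF U F p] expansionD(3)[OF U H p] o(4)
    by (simp del: preim_iff)
qed

lemma expansion_homogI:
  assumes U: "nopen C U" and k: "k \<in> carrier K" "\<And>c. c \<in> U \<Longrightarrow> k \<oslash> cocycle c [^]\<^bsub>K\<^esub> m \<in> stalk c"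
    and F: "\<And>p. p \<in> over (U \<inter> U0) \<Longrightarrow> k \<in> stalk (base P p) \<and> F p = ev (base P p) k * u0 p powi m"
  shows "expansion U F (homog C m k)"
  unfolding expansion_def power_alg_L0[OF U]
proof (intro conjI ballI)
  fix c assume c: "c \<in> U"
  have "c \<in> points C" using nopenD(2)[OF U] c by blast
  then show "homog C m k \<in> laurent c (cocycle c)"
    using homog_laurent(1)[OF _ cocycle(3) k(1) k(2)[OF c]] by blast
next
  fix p assume p: "p \<in> over (U \<inter> U0)"
  note o = over_facts[OF U p]
  have q: "k \<oslash> \<one>\<^bsub>K\<^esub> [^]\<^bsub>K\<^esub> m = k" by (rule quot_one_pow[OF k(1)])
  show "F p = gval (base P p) \<one>\<^bsub>K\<^esub> (u0 p) (homog C m k)"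
    using homog_laurent(2)[OF o(1) Ks_one k(1), of m "u0 p", unfolded q] F[OF p] by simp
qed

text \<open>The coefficient with respect to \<open>u0\<close> exists by descent; expressing it in
  the chart at each point of \<open>U\<close> shows that it is a section of the m-th power of
  \<open>L\<close>, also outside \<open>U0\<close>.\<close>

lemma expansion_homog:
  assumes U: "nopen C U" and F: "wt m U F"
  shows "\<exists>k. expansion U F (homog C m k)"
proof -
  obtain k where k: "k \<in> carrier K" "\<And>p. p \<in> over (U \<inter> U0) \<Longrightarrow> k \<in> stalk (base P p) \<and> F p = ev (base P p) k * u0 p powi m"
    using wt_coeff[OF U F frame0] by blast
  have "k \<oslash> cocycle c [^]\<^bsub>K\<^esub> m \<in> stalk c" if c: "c \<in> U" for c
  proof -
    have cp: "c \<in> points C" using nopenD(2)[OF U] c by blast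
    obtain p where p: "p \<in> points P" "base P p = c" using over_nonempty[OF cp] by metis
    have "p \<in> over (U \<inter> cdom c)" using p c chart(2)[OF cp] by simp
    from coeff_change(1)[OF U F k(1) conjunct2[OF k(2)] cp this] show ?thesis using p by simp
  qed
  then show ?thesis using expansion_homogI[OF U k(1) _ k(2)] by blast
qed

text \<open>On a fibre over \<open>U \<inter> U0\<close> the chart \<open>u0\<close> takes all
  nonzero values, so two expansions give the same Laurent polynomial there and their coefficients
  have equal values.\<close>

lemma expansion_unique:
  assumes U: "nopen C U" and a: "expansion U F a" and b: "expansion U F b"
  shows "a = b"
proof
  fix m
  let ?W = "U \<inter> U0"
  have W: "nopen C ?W" using nopen_Int[OF U frameD(1)[OF frame0]] .
  have lc: "a \<in> laurent c \<one>\<^bsub>K\<^esub>" "b \<in> laurent c \<one>\<^bsub>K\<^esub>" if "c \<in> ?W" for c using expansionD(1)[OF U a that] expansionD(1)[OF U b that] .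
  obtain d where "d \<in> ?W" using W unfolding nopen_def by blast
  note ab = lc[OF this]
  have ac: "a n \<in> carrier K" "b n \<in> carrier K" for n using laurentD(2) ab by blast+
  show "a m = b m"
  proof (rule ev_eqI[OF ac W])
    fix c assume c: "c \<in> ?W"
    have cp: "c \<in> points C" using nopenD(2)[OF W] c by blast
    let ?S = "insert m (supp a \<union> supp b)"
    have fS: "finite ?S" using laurentD(1)[OF ab(1)] laurentD(1)[OF ab(2)] by simp
    have "(\<Sum>n\<in>?S. (ev c (a n) - ev c (b n)) * z powi n) = 0" if z: "z \<noteq> 0" for z
    proof -
      obtain p where p: "p \<in> points P" "base P p = c" using over_nonempty[OF cp] by metis
      have pW: "p \<in> over ?W" using p c by simp
      note o = over_facts[OF U pW]
      have t: "z / u0 p \<noteq> 0" using z o(3) by simp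
      \<comment> \<open>The point of the orbit of \<open>p\<close> at which \<open>u0\<close> has
        the prescribed value \<open>z\<close>.\<close>
      define q where "q = act P (z / u0 p) p"
      have qW: "q \<in> over ?W" unfolding q_def by (rule act_over[OF t pW])
      have qc: "base P q = c" unfolding q_def using base_act[OF t p(1)] p by simp
      have pU0: "p \<in> over U0" using pW by simp
      have uq: "u0 q = z" unfolding q_def using frameD(4)[OF frame0 t pU0] o(3) by simp
      have "gval c \<one>\<^bsub>K\<^esub> z a = gval c \<one>\<^bsub>K\<^esub> z b" using expansionD(3)[OF U a qW] expansionD(3)[OF U b qW] qc uq by simp
      moreover have "gval c \<one>\<^bsub>K\<^esub> z a = (\<Sum>n\<in>?S. ev c (a n) * z powi n)"
        using gval_superset[OF cp Ks_one fS, of a z] quot_one_pow[OF ac(1)] by (simp add: subset_insertI2)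
      moreover have "gval c \<one>\<^bsub>K\<^esub> z b = (\<Sum>n\<in>?S. ev c (b n) * z powi n)"
        using gval_superset[OF cp Ks_one fS, of b z] quot_one_pow[OF ac(2)] by (simp add: subset_insertI2)
      ultimately show ?thesis by (simp only: left_diff_distrib sum_subtractf diff_self)
    qed
    from laurent_zero[OF fS this, of m] show "ev c (a m) = ev c (b m)" by simp
  qed
qed

lemma expansion_unique':
  assumes U: "nopen C U" and F: "F \<in> reg P (over U)" "expansion U F a" and H: "H \<in> reg P (over U)" "expansion U H a"
  shows "F = H"
proof -
  note o = over_open[OF nopenD(1)[OF U]]
  have W: "nopen P (over (U \<inter> U0))" using over_nopen[OF nopen_Int[OF U frameD(1)[OF frame0]]] .
  show ?thesis
  proof (rule P.reg_eqI[OF o F(1) H(1)])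
    fix p assume "p \<in> over U"
    then show "F p = H p"
      by (rule P.reg_eq_dense[OF o F(1) H(1) W over_mono[OF Int_lower1], rotated])
        (use expansionD(3)[OF U F(2)] expansionD(3)[OF U H(2)] in simp)
  qed
qed

lemma expansion_zero: "nopen C U \<Longrightarrow> expansion U (\<lambda>p\<in>over U. 0) (homog C 0 \<zero>\<^bsub>K\<^esub>)"
proof (rule expansion_homogI)
  fix c assume "nopen C U" "c \<in> U"
  then have c: "c \<in> points C" using nopenD(2) by blast
  show "\<zero>\<^bsub>K\<^esub> \<oslash> cocycle c [^]\<^bsub>K\<^esub> (0::int) \<in> stalk c"
    using ev_zero_quot(2)[OF c cocycle(3)[OF c], of 0] stalk_zero(1)[OF c] by simp
qed (use base_points stalk_zero in simp_all)

lemma expansion_exists: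
  assumes U: "nopen C U" and F: "F \<in> reg P (over U)"
  shows "\<exists>a. expansion U F a"
proof -
  note oU = nopenD(1)[OF U]
  obtain N Fm where Fm: "\<And>m. wt m U (Fm m)" "\<And>p. p \<in> over U \<Longrightarrow> F p = (\<Sum>m\<in>{- int N..int N}. Fm m p)"
    using weight_decomposition[OF U F] by metis
  have "\<exists>a. expansion U (\<lambda>p\<in>over U. \<Sum>m\<in>S. Fm m p) a" if "finite S" for S
    using that
  proof (induction S)
    case empty
    show ?case unfolding sum.empty by (rule exI[of _ "homog C 0 \<zero>\<^bsub>K\<^esub>"], rule expansion_zero[OF U])
  next
    case (insert m S)
    then obtain a where a: "expansion U (\<lambda>p\<in>over U. \<Sum>m\<in>S. Fm m p) a" by blast
    obtain k where k: "expansion U (Fm m) (homog C m k)" using expansion_homog[OF U Fm(1)] by blast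
    have e: "(\<lambda>p\<in>over U. Fm m p + (\<lambda>p\<in>over U. \<Sum>m\<in>S. Fm m p) p) = (\<lambda>p\<in>over U. \<Sum>m\<in>insert m S. Fm m p)"
      by (rule restrict_ext) (use insert.hyps in simp)
    show ?case by (rule exI[of _ "gadd (homog C m k) a"], rule expansion_add[OF U k a, unfolded e])
  qed
  then obtain a where a: "expansion U (\<lambda>p\<in>over U. \<Sum>m\<in>{- int N..int N}. Fm m p) a" by blast
  have "expansion U F a" using a Fm(2) unfolding expansion_def by simp
  then show ?thesis by blast
qed

text \<open>The value at \<open>p\<close> is computed in the chart attached to its own base point,
  so the chart varies with \<open>p\<close>. A fixed chart gives the same value near any point, and
  in it the function is a finite sum of pulled back regular functions times powers of a
  unit.\<close>

lemma expansion_surj: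
  assumes U: "nopen C U" and a: "a \<in> carrier (power_alg C L0 U)"
  shows "\<exists>F\<in>reg P (over U). expansion U F a"
proof -
  note oU = nopenD(1)[OF U] and oW = over_open[OF nopenD(1)[OF U]]
  have al: "a \<in> laurent c (cocycle c)" if "c \<in> U" for c using a power_alg_L0[OF U] that by blast
  define F where "F = (\<lambda>p\<in>over U. gval (base P p) (cocycle (base P p)) (coord (base P p) p) a)"
  \<comment> \<open>Passing from the chart at the base point to the chart at \<open>c\<close>
    rescales generator and coordinate by the same unit, which leaves \<open>gval\<close>
    unchanged.\<close>
  have loc: "F p = gval (base P p) (cocycle c) (coord c p) a \<and> a \<in> laurent (base P p) (cocycle c)"
    if c: "c \<in> points C" and p: "p \<in> over (U \<inter> cdom c)" for c p
  proof -
    let ?d = "base P p"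
    have d: "?d \<in> points C" "?d \<in> cdom c" "?d \<in> U" and pp: "p \<in> points P" using p base_points by auto
    note q = cocycle_quot[OF c d(1,2)]
    note ch = gval_change[OF d(1) cocycle(3)[OF c] cocycle(3)[OF d(1)] q(1)]
    have l: "a \<in> laurent ?d (cocycle c)" using al[OF d(3)] ch(1) by simp
    show ?thesis using ch(2)[OF l, of "coord c p"] q(2)[OF pp refl] l p by (simp add: F_def mult.commute)
  qed
  have "restrict F (over U) \<in> reg P (over U)"
  proof (rule P.reg_localI[OF oW])
    fix p0 assume p0: "p0 \<in> over U"
    define c where "c = base P p0"
    have c: "c \<in> points C" "c \<in> U" using p0 base_points by (auto simp: c_def)
    let ?V = "U \<inter> cdom c"
    note fr = chart(1)[OF c(1)]
    have V: "nopen C ?V" using nopen_Int[OF U frameD(1)[OF fr]] .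
    note oV = over_open[OF nopenD(1)[OF V]]
    have gl: "a \<in> laurent d (cocycle c)" if "d \<in> ?V" for d
    proof -
      have dp: "d \<in> points C" using nopenD(2)[OF V] that by blast
      obtain p where p: "p \<in> points P" "base P p = d" using over_nonempty[OF dp] by metis
      then show ?thesis using loc[OF c(1), of p] that by auto
    qed
    have fin: "finite (supp a)" using laurentD(1)[OF al[OF c(2)]] .
    have ur: "restrict (coord c) (over ?V) \<in> reg P (over ?V)"
      using P.reg_restrict[OF over_open[OF nopenD(1)[OF frameD(1)[OF fr]]] oV over_mono[OF Int_lower2] frameD(2)[OF fr]] .
    have un: "restrict (coord c) (over ?V) p \<noteq> 0" if "p \<in> over ?V" for p using that frameD(3)[OF fr, of p] by simp
    have ar: "(\<lambda>d\<in>?V. ev d (a m \<oslash> cocycle c [^]\<^bsub>K\<^esub> m)) \<in> reg C ?V" for m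
    proof (rule reg_of_stalks(1)[OF V])
      show "a m \<oslash> cocycle c [^]\<^bsub>K\<^esub> m \<in> carrier K"
        using quot_carrier[OF laurentD(2)[OF al[OF c(2)]] Ks_pow[OF cocycle(3)[OF c(1)]]] .
      show "a m \<oslash> cocycle c [^]\<^bsub>K\<^esub> m \<in> stalk d" if "d \<in> ?V" for d using laurentD(3)[OF gl[OF that]] .
    qed
    let ?t = "\<lambda>m p. (\<lambda>p\<in>over ?V. (\<lambda>d\<in>?V. ev d (a m \<oslash> cocycle c [^]\<^bsub>K\<^esub> m)) (base P p)) p *
        (\<lambda>p\<in>over ?V. restrict (coord c) (over ?V) p powi m) p"
    have "(\<lambda>p\<in>over ?V. \<Sum>m\<in>supp a. ?t m p) \<in> reg P (over ?V)"
      by (rule P.reg_sum[OF oV fin P.reg_mult[OF oV pull_reg[OF nopenD(1)[OF V] ar] P.reg_powi[OF oV ur un]]])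
    moreover have "F p = (\<lambda>p\<in>over ?V. \<Sum>m\<in>supp a. ?t m p) p" if p: "p \<in> over U \<inter> over ?V" for p
      using loc[OF c(1), of p] p by (simp add: gval_def)
    ultimately show "\<exists>W g. openin (zariski P) W \<and> p0 \<in> W \<and> g \<in> reg P W \<and> (\<forall>y\<in>over U \<inter> W. F y = g y)"
      using oV p0 c chart(2)[OF c(1)] by (intro exI[of _ "over ?V"] exI[of _ "\<lambda>p\<in>over ?V. \<Sum>m\<in>supp a. ?t m p"] conjI ballI) (auto simp: c_def)
  qed
  then have Fr: "F \<in> reg P (over U)" by (simp add: F_def)
  have "F p = gval (base P p) \<one>\<^bsub>K\<^esub> (u0 p) a" if p: "p \<in> over (U \<inter> U0)" for p
  proof -
    note o = over_facts[OF U p]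
    have d: "base P p \<in> U" "base P p \<in> U0" using o(2) by blast+
    have pin: "p \<in> over (cdom (base P p) \<inter> U0)" using p chart(2)[OF o(1)] by simp
    have l: "a \<in> laurent (base P p) \<one>\<^bsub>K\<^esub>" using al[OF d(1)] laurent_one(1)[OF d(2)] by simp
    show ?thesis
      using laurent_one(2)[OF d(2) l, of "u0 p"] cocycle(1)[OF o(1) pin] o(4) by (simp add: F_def mult.commute del: preim_iff)
  qed
  then have "expansion U F a" unfolding expansion_def using a by blast
  then show ?thesis using Fr by blast
qed

lemma expansion_pull:
  assumes U: "nopen C U" and f: "f \<in> reg C U"
  shows "expansion U (\<lambda>p\<in>over U. f (base P p)) (homog C 0 (germ C U f))"
proof (rule expansion_homogI[OF U germ_carrier[OF U f]])
  show "germ C U f \<oslash> cocycle c [^]\<^bsub>K\<^esub> (0::int) \<in> stalk c" if "c \<in> U" for c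
    using stalk_germ[OF U f that] by simp
  show "germ C U f \<in> stalk (base P p) \<and> (\<lambda>p\<in>over U. f (base P p)) p = ev (base P p) (germ C U f) * u0 p powi 0"
    if p: "p \<in> over (U \<inter> U0)" for p
    using stalk_germ[OF U f, of "base P p"] ev_germ[OF U f, of "base P p"] p by simp
qed

text \<open>Over \<open>U0\<close> only the term of degree \<open>m\<close> is present, so the
  weight is visible there; both sides are regular on \<open>over U\<close>, and density gives the
  rest.\<close>

lemma expansion_semi_invariant:
  assumes U: "nopen C U" and F: "F \<in> reg P (over U)" "expansion U F (homog C m k)"
  shows "semi_invariant P (over U) m F"
  unfolding semi_invariant_def points_circle
proof (intro ballI)
  fix z p assume "z \<in> - {0 :: complex}" and p: "p \<in> over U"
  then have z: "z \<noteq> 0" by simp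
  note oW = over_open[OF nopenD(1)[OF U]]
  have W: "nopen P (over (U \<inter> U0))" using over_nopen[OF nopen_Int[OF U frameD(1)[OF frame0]]] .
  have val: "F q = ev (base P q) (homog C m k m \<oslash> \<one>\<^bsub>K\<^esub> [^]\<^bsub>K\<^esub> m) * u0 q powi m" if q: "q \<in> over (U \<inter> U0)" for q
    using expansionD(3)[OF U F(2) q] gval_superset[OF over_facts(1)[OF U q] Ks_one _ supp_homog, of m "u0 q" k] by simp
  have "(\<lambda>p\<in>over U. F (act P z p)) p = (\<lambda>p\<in>over U. z powi m * F p) p"
  proof (rule P.reg_eq_dense[OF oW translate_reg[OF z nopenD(1)[OF U] F(1)] P.reg_cmult[OF oW F(1)] W over_mono[OF Int_lower1] _ p])
    fix q assume q: "q \<in> over (U \<inter> U0)"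
    have q0: "q \<in> over U0" "q \<in> points P" using q by simp_all
    show "(\<lambda>p\<in>over U. F (act P z p)) q = (\<lambda>p\<in>over U. z powi m * F p) q"
      using val[OF q] val[OF act_over[OF z q]] base_act[OF z q0(2)] frameD(4)[OF frame0 z q0(1)] over_facts(4)[OF U q]
      by (simp add: power_int_mult_distrib del: preim_iff)
  qed
  then show "F (act P z p) = z powi m * F p" using p by (simp del: preim_iff)
qed

lemma expansion_restrict:
  assumes U: "nopen C U" and V: "nopen C V" "V \<subseteq> U" and F: "expansion U F a"
  shows "expansion V (restrict F (over V)) a"
  using F V(2) unfolding expansion_def power_alg_L0[OF U] power_alg_L0[OF V(1)] by auto

text \<open>Existence and uniqueness of expansions define the isomorphism. Each compatibility then
  amounts to exhibiting one expansion, of a product, a sum, a pull-back or a restriction, and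
  identifying it by uniqueness.\<close>

lemma direct_image_power_alg: "direct_image_is_power_alg C P L0"
proof -
  define \<Phi> where "\<Phi> = (\<lambda>U F. THE a. expansion U F a)"
  have \<Phi>I: "\<Phi> U F = a" if "nopen C U" "expansion U F a" for U F a
    unfolding \<Phi>_def using that expansion_unique by blast
  have \<Phi>: "expansion U F (\<Phi> U F)" if "nopen C U" "F \<in> reg P (over U)" for U F
    using expansion_exists[OF that] \<Phi>I[OF that(1)] by metis
  have iso: "\<Phi> U \<in> ring_iso (reg_ring P (over U)) (power_alg C L0 U)" if U: "nopen C U" for U
    unfolding ring_iso_def
  proof (intro CollectI conjI)
    let ?R = "reg_ring P (over U)"
    have R: "carrier ?R = reg P (over U)" "\<And>F H. F \<otimes>\<^bsub>?R\<^esub> H = (\<lambda>p\<in>over U. F p * H p)"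
      "\<And>F H. F \<oplus>\<^bsub>?R\<^esub> H = (\<lambda>p\<in>over U. F p + H p)" "\<one>\<^bsub>?R\<^esub> = (\<lambda>p\<in>over U. 1)"
      by (simp_all add: reg_ring_def)
    have A: "\<And>a b. a \<otimes>\<^bsub>power_alg C L0 U\<^esub> b = gmult a b" "\<And>a b. a \<oplus>\<^bsub>power_alg C L0 U\<^esub> b = gadd a b"
      "\<one>\<^bsub>power_alg C L0 U\<^esub> = homog C 0 \<one>\<^bsub>K\<^esub>"
      by (simp_all add: power_alg_def graded_ring_simps)
    have one: "expansion U (\<lambda>p\<in>over U. 1) (homog C 0 \<one>\<^bsub>K\<^esub>)"
    proof (rule expansion_homogI[OF U])
      show "\<one>\<^bsub>K\<^esub> \<oslash> cocycle c [^]\<^bsub>K\<^esub> (0::int) \<in> stalk c" if "c \<in> U" for c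
        using stalk_one(1)[of c] nopenD(2)[OF U] that by auto
    qed (use base_points stalk_one in simp_all)
    show "\<Phi> U \<in> ring_hom ?R (power_alg C L0 U)"
    proof (rule ring_hom_memI)
      fix F assume "F \<in> carrier ?R"
      then show "\<Phi> U F \<in> carrier (power_alg C L0 U)" using \<Phi>[OF U] unfolding R expansion_def by blast
    next
      fix F H assume "F \<in> carrier ?R" "H \<in> carrier ?R"
      then have r: "expansion U F (\<Phi> U F)" "expansion U H (\<Phi> U H)" using \<Phi>[OF U] unfolding R by blast+
      show "\<Phi> U (F \<otimes>\<^bsub>?R\<^esub> H) = \<Phi> U F \<otimes>\<^bsub>power_alg C L0 U\<^esub> \<Phi> U H"
        unfolding R A by (rule \<Phi>I[OF U expansion_mult[OF U r]])
      show "\<Phi> U (F \<oplus>\<^bsub>?R\<^esub> H) = \<Phi> U F \<oplus>\<^bsub>power_alg C L0 U\<^esub> \<Phi> U H"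
        unfolding R A by (rule \<Phi>I[OF U expansion_add[OF U r]])
    next
      show "\<Phi> U \<one>\<^bsub>?R\<^esub> = \<one>\<^bsub>power_alg C L0 U\<^esub>" unfolding R A by (rule \<Phi>I[OF U one])
    qed
    show "bij_betw (\<Phi> U) (carrier ?R) (carrier (power_alg C L0 U))"
      unfolding R(1) bij_betw_def
    proof (intro conjI equalityI subsetI)
      show "inj_on (\<Phi> U) (reg P (over U))"
      proof (rule inj_onI)
        fix F H assume a: "F \<in> reg P (over U)" "H \<in> reg P (over U)" "\<Phi> U F = \<Phi> U H"
        then show "F = H" using expansion_unique'[OF U a(1) \<Phi>[OF U a(1)] a(2)] \<Phi>[OF U a(2)] by simp
      qed
      show "a \<in> carrier (power_alg C L0 U)" if "a \<in> \<Phi> U ` reg P (over U)" for a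
        using that \<Phi>[OF U] unfolding expansion_def by blast
      show "a \<in> \<Phi> U ` reg P (over U)" if a: "a \<in> carrier (power_alg C L0 U)" for a
        using expansion_surj[OF U a] \<Phi>I[OF U] by (metis imageI)
    qed
  qed
  have semi: "semi_invariant P (over U) m F \<longleftrightarrow> (\<exists>k. \<Phi> U F = homog C m k)"
    if U: "nopen C U" and F: "F \<in> reg P (over U)" for U F m
  proof
    assume "semi_invariant P (over U) m F"
    then obtain k where "expansion U F (homog C m k)" using expansion_homog[OF U, of m F] F by (auto simp: wt_def)
    then show "\<exists>k. \<Phi> U F = homog C m k" using \<Phi>I[OF U] by blast
  next
    assume "\<exists>k. \<Phi> U F = homog C m k"
    then show "semi_invariant P (over U) m F" using expansion_semi_invariant[OF U F] \<Phi>[OF U F] by metis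
  qed
  have res: "\<Phi> V (restrict F (over V)) = \<Phi> U F" if "nopen C U" "nopen C V" "V \<subseteq> U" "F \<in> reg P (over U)" for U V F
    by (rule \<Phi>I[OF that(2) expansion_restrict[OF that(1-3) \<Phi>[OF that(1,4)]]])
  show ?thesis
    unfolding direct_image_is_power_alg_def Let_def
  proof (rule exI[of _ \<Phi>], intro allI impI)
    fix U assume U: "nopen C U"
    show "\<Phi> U \<in> ring_iso (reg_ring P (over U)) (power_alg C L0 U) \<and>
      (\<forall>f\<in>reg C U. \<Phi> U (\<lambda>p\<in>over U. f (base P p)) = homog C 0 (germ C U f)) \<and>
      (\<forall>m. \<forall>F\<in>reg P (over U). semi_invariant P (over U) m F = (\<exists>k. \<Phi> U F = homog C m k)) \<and>
      (\<forall>V. nopen C V \<and> V \<subseteq> U \<longrightarrow> (\<forall>F\<in>reg P (over U). \<Phi> V (restrict F (over V)) = \<Phi> U F))"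
      using iso[OF U] \<Phi>I[OF U expansion_pull[OF U]] semi[OF U] res[OF U] by blast
  qed
qed

lemma torsor_pair_exists: "torsor_pair C L0 norm0"
  using torsor_pair_iff[OF represents_cocycle invertible_sections[OF divisor_cocycle]] real_pair_cocycle by blast

end

theorem lemma10:
  fixes C :: "'a real_space"
  assumes "real_variety C"
  shows "(\<forall>P :: ('b, 'a) torsor. S1_torsor C P \<longrightarrow>
            (\<exists>L h. torsor_pair C L h \<and> direct_image_is_power_alg C P L)) \<and>
         (\<forall>L1 h1 L2 h2. torsor_pair C L1 h1 \<and> torsor_pair C L2 h2 \<longrightarrow>
            (torsor_isomorphic (pair_torsor C L1 h1) (pair_torsor C L2 h2) \<longleftrightarrow>
             (\<exists>f \<in> carrier (ratfuns C) - {\<zero>\<^bsub>ratfuns C\<^esub>}.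
                submod_eq C (tensor_submod C (dual_submod C L1) L2) (principal_submod C (inv\<^bsub>ratfuns C\<^esub> f)) \<and>
                h2 = (f \<otimes>\<^bsub>ratfuns C\<^esub> rat_conj C f) \<otimes>\<^bsub>ratfuns C\<^esub> h1)))"
proof (intro conjI allI impI)
  interpret C: real_irr_space C using real_variety_real_irr_space[OF assms] .
  fix P :: "('b, 'a) torsor" assume P: "S1_torsor C P"
  then have "real_irr_space P" using real_variety_real_irr_space by (auto simp: S1_torsor_def)
  then interpret torsor_space C P
    using P C.real_irr_space_axioms by (simp add: torsor_space_def torsor_space_axioms_def)
  show "\<exists>L h. torsor_pair C L h \<and> direct_image_is_power_alg C P L"
    using torsor_pair_exists direct_image_power_alg by blast
next
  interpret C: real_irr_space C using real_variety_real_irr_space[OF assms] .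
  fix L1 h1 L2 h2 assume "torsor_pair C L1 h1 \<and> torsor_pair C L2 h2"
  then show "torsor_isomorphic (pair_torsor C L1 h1) (pair_torsor C L2 h2) \<longleftrightarrow>
             (\<exists>f \<in> carrier (ratfuns C) - {\<zero>\<^bsub>ratfuns C\<^esub>}.
                submod_eq C (tensor_submod C (dual_submod C L1) L2) (principal_submod C (inv\<^bsub>ratfuns C\<^esub> f)) \<and>
                h2 = (f \<otimes>\<^bsub>ratfuns C\<^esub> rat_conj C f) \<otimes>\<^bsub>ratfuns C\<^esub> h1)"
    using C.pair_torsor_isomorphic_iff by blast
qed

end
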